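(* Let $(\mathcal G, \mathcal L)$ be a twisted étale groupoid and let $\pi \colon \Gamma_c(\mathcal G, \mathcal L) \to \mathcal B(\mathcal H)$ be a $*$-representation which weakly contains the regular representation $\lambda$. Every $\mathcal G$-invariant real (resp. positive) Radon measure $\mu$ on $\mathcal G^0$ induces a self-adjoint (resp. positive) continuous trace $\tau_\mu$ on $\mathrm{Ped}(C^*_\pi(\mathcal G, \mathcal L))$ which is uniquely determined by $$\tau_\mu(f) = \int_{\mathcal G^0} f|_{\mathcal G^0} \, \mathrm d \mu, \qquad \text{for } f\in \Gamma_c(\mathcal G, \mathcal L).$$ Moreover, if $\mathcal G$ is principal then every self-adjoint (resp. positive) continuous trace on $\mathrm{Ped}(C^*_\pi(\mathcal G, \mathcal L))$ is of this form.
   Context: An étale groupoid $\mathcal G$ is a topological groupoid whose range map $r$ (hence also source map $s$) is a local homeomorphism; its unit space $\mathcal G^0$ is assumed locally compact Hausdorff ($\mathcal G$ itself need not be Hausdorff). It is principal if $g\mapsto (r(g),s(g))$ is injective. An open bisection is an open $U\subseteq\mathcal G$ on which $r$ and $s$ are injective. A twisted étale groupoid $(\mathcal G,\mathcal L)$ is an étale groupoid with a Fell line bundle $\mathcal L\to\mathcal G$ (a Fell bundle with one-dimensional fibres). For an open bisection $U$, $\Gamma_c(U,\mathcal L)$ is the space of compactly supported continuous sections $U\to\mathcal L$, extended by $0$ to $\mathcal G$; $\Gamma_c(\mathcal G,\mathcal L)$ is the linear span of these over all open bisections. It is a $*$-algebra with $(f*h)(g)=\sum_{g=g_1g_2} f(g_1)h(g_2)$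 and $f^*(g)=f(g^{-1})^*$. The restriction of $\mathcal L$ to $\mathcal G^0$ is the trivial bundle with fibres $\mathbb C$, so $\Gamma_c(\mathcal G^0,\mathcal L)=C_c(\mathcal G^0)$ and $f|_{\mathcal G^0}$ is a complex function. The regular representation $\lambda$ is the (faithful) representation of $\Gamma_c(\mathcal G,\mathcal L)$ on $\bigoplus_{x\in\mathcal G^0}\ell^2(\mathcal G_x,\mathcal L)$, $\mathcal G_x=s^{-1}(x)$, acting by the convolution formula. $\pi$ weakly contains $\lambda$ if $\|\lambda(f)\|\le\|\pi(f)\|$ for all $f\in\Gamma_c(\mathcal G,\mathcal L)$; $C^*_\pi(\mathcal G,\mathcal L)$ is the completion of $\Gamma_c(\mathcal G,\mathcal L)$ in the norm $\|f\|_\pi=\|\pi(f)\|$, and $\Gamma_c(\mathcal G,\mathcal L)\subseteq\mathrm{Ped}(C^*_\pi(\mathcal G,\mathcal L))$. A real Radon measure on a locally compact Hausdorff space $X$ is a self-adjoint linear functional on $C_c(X)$ continuous for the locally convex inductive limit topology (equivalently, a difference of positive Radon measures as functionals on $C_c(X)$). A real Radon measure $\mu$ on $\mathcal G^0$ is $\mathcal G$-invariant if for every open bisection $U$ and $f\in C_c(r(U))$, $\int_{r(U)} f\,\mathrm d\mu=\int_{s(U)} f\circ\alpha_U\,\mathrm d\mu$, where $\alpha_U\colon s(U)\to r(U)$ is the homeomorphism $s(g)\mapsto r(g)$, $g\in U$. For a $C^*$-algebra $A$, $\mathrm{Ped}(A)$ is the Pedersen ideal (the unique minimal norm-dense two-sided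 ideal). It has the locally convex direct limit topology of its $C^*$-subalgebras: a linear functional on $\mathrm{Ped}(A)$ is continuous iff it is bounded on every $C^*$-subalgebra $D$ of $A$ contained in $\mathrm{Ped}(A)$. A trace on $\mathrm{Ped}(A)$ is a linear functional with $\tau(xy)=\tau(yx)$; it is self-adjoint if $\tau(x^* )=\overline{\tau(x)}$ and positive if $\tau(a)\ge0$ for $a\in\mathrm{Ped}(A)\cap A_+$. *)

theory Defs
  imports
    "HOL-Analysis.Analysis"
    "HOL-Library.Nonpos_Ints"
    "HOL-Algebra.Module"
begin

section \<open>Complex Banach spaces, Hilbert spaces and C*-algebras\<close>

class complex_banach = banach +
  fixes scaleC :: "complex \<Rightarrow> 'a \<Rightarrow> 'a" (infixr \<open>*\<^sub>C\<close> 75)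
  assumes scaleR_scaleC: "scaleR t x = of_real t *\<^sub>C x"
    and scaleC_add_right: "c *\<^sub>C (x + y) = c *\<^sub>C x + c *\<^sub>C y"
    and scaleC_add_left: "(c + d) *\<^sub>C x = c *\<^sub>C x + d *\<^sub>C x"
    and scaleC_scaleC: "c *\<^sub>C d *\<^sub>C x = (c * d) *\<^sub>C x"
    and norm_scaleC: "norm (c *\<^sub>C x) = cmod c * norm x"

text \<open>The inner product is linear in the second argument.\<close>

class complex_hilbert = complex_banach +
  fixes cinner :: "'a \<Rightarrow> 'a \<Rightarrow> complex"
  assumes cinner_commute: "cinner x y = cnj (cinner y x)"
    and cinner_add_right: "cinner x (y + z) = cinner x y + cinner x z"
    and cinner_scaleC_right: "cinner x (c *\<^sub>C y) = c * cinner x y"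
    and cinner_self: "cinner x x = of_real ((norm x)\<^sup>2)"

text \<open>C*-algebras are not assumed to be unital.\<close>

class cstar_algebra = complex_banach + real_normed_algebra +
  fixes star :: "'a \<Rightarrow> 'a"
  assumes mult_scaleC_left: "(c *\<^sub>C x) * y = c *\<^sub>C (x * y)"
    and mult_scaleC_right: "x * (c *\<^sub>C y) = c *\<^sub>C (x * y)"
    and star_add: "star (x + y) = star x + star y"
    and star_scaleC: "star (c *\<^sub>C x) = cnj c *\<^sub>C star x"
    and star_mult: "star (x * y) = star y * star x"
    and star_star: "star (star x) = x"
    and cstar_identity: "norm (star x * x) = (norm x)\<^sup>2"

definition bounded_clinear :: "('h::complex_banach \<Rightarrow> 'h) \<Rightarrow> bool" where
  "bounded_clinear T \<longleftrightarrow> bounded_linear T \<and> (\<forall>c v. T (c *\<^sub>C v) = c *\<^sub>C T v)"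

definition csubspace :: "'a::complex_banach set \<Rightarrow> bool" where
  "csubspace S \<longleftrightarrow>
     0 \<in> S \<and> (\<forall>x\<in>S. \<forall>y\<in>S. x + y \<in> S) \<and> (\<forall>c. \<forall>x\<in>S. c *\<^sub>C x \<in> S)"

definition positive_elements :: "'a::cstar_algebra set" where
  "positive_elements = {star x * x | x. True}"

definition two_sided_ideal :: "'a::cstar_algebra set \<Rightarrow> bool" where
  "two_sided_ideal I \<longleftrightarrow> csubspace I \<and> (\<forall>x\<in>I. \<forall>a. a * x \<in> I \<and> x * a \<in> I)"

definition cstar_subalgebra :: "'a::cstar_algebra set \<Rightarrow> bool" where
  "cstar_subalgebra D \<longleftrightarrow>
     csubspace D \<and> (\<forall>x\<in>D. \<forall>y\<in>D. x * y \<in> D) \<and> (\<forall>x\<in>D. star x \<in> D) \<and> closed D"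

text \<open>By Pedersen's theorem the intersection of all dense two-sided ideals is again dense,
  i.e. it is the unique minimal one.  Ideals need not be closed.\<close>

definition pedersen_ideal :: "'a::cstar_algebra set" where
  "pedersen_ideal = \<Inter>{I. two_sided_ideal I \<and> closure I = UNIV}"

text \<open>Functionals on the Pedersen ideal are total functions whose values outside the ideal are
  irrelevant.\<close>

definition continuous_trace :: "('a::cstar_algebra \<Rightarrow> complex) \<Rightarrow> bool" where
  "continuous_trace \<tau> \<longleftrightarrow>
     (\<forall>x\<in>pedersen_ideal. \<forall>y\<in>pedersen_ideal. \<tau> (x + y) = \<tau> x + \<tau> y) \<and>
     (\<forall>c. \<forall>x\<in>pedersen_ideal. \<tau> (c *\<^sub>C x) = c * \<tau> x) \<and>
     (\<forall>x\<in>pedersen_ideal. \<forall>y\<in>pedersen_ideal. \<tau> (x * y) = \<tau> (y * x)) \<and>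
     (\<forall>D. cstar_subalgebra D \<and> D \<subseteq> pedersen_ideal \<longrightarrow>
        (\<exists>C. \<forall>x\<in>D. cmod (\<tau> x) \<le> C * norm x))"

definition selfadjoint_on_pedersen :: "('a::cstar_algebra \<Rightarrow> complex) \<Rightarrow> bool" where
  "selfadjoint_on_pedersen \<tau> \<longleftrightarrow> (\<forall>x\<in>pedersen_ideal. \<tau> (star x) = cnj (\<tau> x))"

definition positive_on_pedersen :: "('a::cstar_algebra \<Rightarrow> complex) \<Rightarrow> bool" where
  "positive_on_pedersen \<tau> \<longleftrightarrow>
     (\<forall>x \<in> pedersen_ideal \<inter> positive_elements. \<tau> x \<in> \<real>\<^sub>\<ge>\<^sub>0)"


section \<open>Real Radon measures\<close>

text \<open>Functions in \<open>C\<^sub>c(X)\<close> are extended by \<open>0\<close> to the whole type, so that \<open>C\<^sub>c(V)\<close> is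
  literally a subset of \<open>C\<^sub>c(X)\<close> for open \<open>V\<close> in a Hausdorff space \<open>X\<close>.\<close>

definition Cc :: "'x topology \<Rightarrow> ('x \<Rightarrow> complex) set" where
  "Cc X = {f. continuous_map X euclidean f \<and> (\<exists>K. compactin X K \<and> (\<forall>x. x \<notin> K \<longrightarrow> f x = 0))}"

text \<open>The last condition is continuity for the inductive limit topology of the Banach spaces
  of continuous functions supported in a fixed compact set.\<close>

definition real_radon :: "'x topology \<Rightarrow> (('x \<Rightarrow> complex) \<Rightarrow> complex) \<Rightarrow> bool" where
  "real_radon X \<mu> \<longleftrightarrow>
     (\<forall>f\<in>Cc X. \<forall>h\<in>Cc X. \<mu> (\<lambda>x. f x + h x) = \<mu> f + \<mu> h) \<and>
     (\<forall>c. \<forall>f\<in>Cc X. \<mu> (\<lambda>x. c * f x) = c * \<mu> f) \<and>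
     (\<forall>f\<in>Cc X. \<mu> (\<lambda>x. cnj (f x)) = cnj (\<mu> f)) \<and>
     (\<forall>K. compactin X K \<longrightarrow>
        (\<exists>C. \<forall>f\<in>Cc X. (\<forall>x. x \<notin> K \<longrightarrow> f x = 0) \<longrightarrow> cmod (\<mu> f) \<le> C * (SUP x. cmod (f x))))"

definition positive_radon :: "'x topology \<Rightarrow> (('x \<Rightarrow> complex) \<Rightarrow> complex) \<Rightarrow> bool" where
  "positive_radon X \<mu> \<longleftrightarrow>
     real_radon X \<mu> \<and> (\<forall>f\<in>Cc X. (\<forall>x. f x \<in> \<real>\<^sub>\<ge>\<^sub>0) \<longrightarrow> \<mu> f \<in> \<real>\<^sub>\<ge>\<^sub>0)"

definition radon_borel_measure :: "'x topology \<Rightarrow> 'x measure \<Rightarrow> bool" where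
  "radon_borel_measure X M \<longleftrightarrow>
     space M = topspace X \<and> sets M = sigma_sets (topspace X) {U. openin X U} \<and>
     (\<forall>K. compactin X K \<longrightarrow> emeasure M K < \<infinity>) \<and>
     (\<forall>B\<in>sets M. emeasure M B = (INF U \<in> {U. openin X U \<and> B \<subseteq> U}. emeasure M U)) \<and>
     (\<forall>U. openin X U \<longrightarrow> emeasure M U = (SUP K \<in> {K. compactin X K \<and> K \<subseteq> U}. emeasure M K))"

text \<open>On a non-Hausdorff groupoid the restriction of a section to the unit space need not be
  continuous, it is only a bounded Borel function vanishing outside a compact set.  Its integral
  against the functional \<open>\<mu>\<close> is therefore taken by writing \<open>\<mu>\<close> as a difference of positive Radon
  measures; the value does not depend on the decomposition.\<close>

definition has_radon_integral ::
  "'x topology \<Rightarrow> (('x \<Rightarrow> complex) \<Rightarrow> complex) \<Rightarrow> ('x \<Rightarrow> complex) \<Rightarrow> complex \<Rightarrow> bool" where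
  "has_radon_integral X \<mu> f c \<longleftrightarrow>
     (\<exists>M N. radon_borel_measure X M \<and> radon_borel_measure X N \<and>
        (\<forall>h\<in>Cc X. \<mu> h = (\<integral>x. h x \<partial>M) - (\<integral>x. h x \<partial>N)) \<and>
        integrable M f \<and> integrable N f \<and>
        c = (\<integral>x. f x \<partial>M) - (\<integral>x. f x \<partial>N))"


section \<open>Etale groupoids\<close>

record 'g groupoid =
  gtop :: "'g topology"
  rng :: "'g \<Rightarrow> 'g"
  src :: "'g \<Rightarrow> 'g"
  gmult :: "'g \<Rightarrow> 'g \<Rightarrow> 'g"
  ginv :: "'g \<Rightarrow> 'g"

abbreviation arrows :: "'g groupoid \<Rightarrow> 'g set" where
  "arrows G \<equiv> topspace (gtop G)"

definition units :: "'g groupoid \<Rightarrow> 'g set" where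
  "units G = rng G ` arrows G"

definition unit_space :: "'g groupoid \<Rightarrow> 'g topology" where
  "unit_space G = subtopology (gtop G) (units G)"

definition local_homeomorphism :: "'x topology \<Rightarrow> 'y topology \<Rightarrow> ('x \<Rightarrow> 'y) \<Rightarrow> bool" where
  "local_homeomorphism X Y f \<longleftrightarrow>
     (\<forall>x\<in>topspace X. \<exists>U. openin X U \<and> x \<in> U \<and> openin Y (f ` U) \<and>
        homeomorphic_map (subtopology X U) (subtopology Y (f ` U)) f)"

locale topological_groupoid =
  fixes G :: "'g groupoid"
  assumes rng_closed: "g \<in> arrows G \<Longrightarrow> rng G g \<in> arrows G"
    and src_closed: "g \<in> arrows G \<Longrightarrow> src G g \<in> arrows G"
    and rng_rng: "g \<in> arrows G \<Longrightarrow> rng G (rng G g) = rng G g"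
    and src_rng: "g \<in> arrows G \<Longrightarrow> src G (rng G g) = rng G g"
    and rng_src: "g \<in> arrows G \<Longrightarrow> rng G (src G g) = src G g"
    and src_src: "g \<in> arrows G \<Longrightarrow> src G (src G g) = src G g"
    and gmult_closed: "\<lbrakk>g \<in> arrows G; h \<in> arrows G; src G g = rng G h\<rbrakk> \<Longrightarrow> gmult G g h \<in> arrows G"
    and rng_gmult: "\<lbrakk>g \<in> arrows G; h \<in> arrows G; src G g = rng G h\<rbrakk> \<Longrightarrow> rng G (gmult G g h) = rng G g"
    and src_gmult: "\<lbrakk>g \<in> arrows G; h \<in> arrows G; src G g = rng G h\<rbrakk> \<Longrightarrow> src G (gmult G g h) = src G h"
    and gmult_assoc: "\<lbrakk>g \<in> arrows G; h \<in> arrows G; k \<in> arrows G; src G g = rng G h; src G h = rng G k\<rbrakk>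
          \<Longrightarrow> gmult G (gmult G g h) k = gmult G g (gmult G h k)"
    and gmult_rng: "g \<in> arrows G \<Longrightarrow> gmult G (rng G g) g = g"
    and gmult_src: "g \<in> arrows G \<Longrightarrow> gmult G g (src G g) = g"
    and ginv_closed: "g \<in> arrows G \<Longrightarrow> ginv G g \<in> arrows G"
    and rng_ginv: "g \<in> arrows G \<Longrightarrow> rng G (ginv G g) = src G g"
    and src_ginv: "g \<in> arrows G \<Longrightarrow> src G (ginv G g) = rng G g"
    and gmult_ginv_right: "g \<in> arrows G \<Longrightarrow> gmult G g (ginv G g) = rng G g"
    and gmult_ginv_left: "g \<in> arrows G \<Longrightarrow> gmult G (ginv G g) g = src G g"
    and continuous_gmult:
      "continuous_map
         (subtopology (prod_topology (gtop G) (gtop G)) {(g, h). src G g = rng G h})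
         (gtop G) (\<lambda>(g, h). gmult G g h)"
    and continuous_ginv: "continuous_map (gtop G) (gtop G) (ginv G)"

text \<open>The topology of the groupoid itself is not required to be Hausdorff.\<close>

locale etale_groupoid = topological_groupoid +
  assumes local_homeomorphism_rng: "local_homeomorphism (gtop G) (unit_space G) (rng G)"
    and locally_compact_unit_space: "locally_compact_space (unit_space G)"
    and Hausdorff_unit_space: "Hausdorff_space (unit_space G)"

definition principal :: "'g groupoid \<Rightarrow> bool" where
  "principal G \<longleftrightarrow> inj_on (\<lambda>g. (rng G g, src G g)) (arrows G)"

definition open_bisection :: "'g groupoid \<Rightarrow> 'g set \<Rightarrow> bool" where
  "open_bisection G U \<longleftrightarrow> openin (gtop G) U \<and> inj_on (rng G) U \<and> inj_on (src G) U"

definition bisection_map :: "'g groupoid \<Rightarrow> 'g set \<Rightarrow> 'g \<Rightarrow> 'g" where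
  "bisection_map G U x = rng G (inv_into U (src G) x)"

definition invariant_radon :: "'g groupoid \<Rightarrow> (('g \<Rightarrow> complex) \<Rightarrow> complex) \<Rightarrow> bool" where
  "invariant_radon G \<mu> \<longleftrightarrow>
     (\<forall>U. open_bisection G U \<longrightarrow>
        (\<forall>f \<in> Cc (subtopology (unit_space G) (rng G ` U)).
           \<mu> f = \<mu> (\<lambda>x. if x \<in> src G ` U then f (bisection_map G U x) else 0)))"


section \<open>Fell line bundles\<close>

record ('g, 'l) fell_bundle =
  total :: "'l topology"
  proj :: "'l \<Rightarrow> 'g"
  lzero :: "'g \<Rightarrow> 'l"
  ladd :: "'l \<Rightarrow> 'l \<Rightarrow> 'l"
  lscale :: "complex \<Rightarrow> 'l \<Rightarrow> 'l"
  lnorm :: "'l \<Rightarrow> real"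
  lmult :: "'l \<Rightarrow> 'l \<Rightarrow> 'l"
  lstar :: "'l \<Rightarrow> 'l"

definition fibre :: "('g, 'l) fell_bundle \<Rightarrow> 'g \<Rightarrow> 'l set" where
  "fibre L g = {a \<in> topspace (total L). proj L a = g}"

definition complex_field :: "complex ring" where
  "complex_field = \<lparr>carrier = UNIV, mult = (*), one = 1, zero = 0, add = (+)\<rparr>"

text \<open>The module record of the algebra library extends that of rings; its multiplicative
  components play no role for modules.\<close>

definition fibre_space :: "('g, 'l) fell_bundle \<Rightarrow> 'g \<Rightarrow> (complex, 'l) module" where
  "fibre_space L g =
     \<lparr>carrier = fibre L g, mult = undefined, one = undefined,
      zero = lzero L g, add = ladd L, smult = lscale L\<rparr>"

text \<open>A Banach bundle in the sense of Fell with one-dimensional fibres.  The existence of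
  continuous local sections through every point is automatic when the base is covered by open
  locally compact Hausdorff sets (Douady and dal Soglio-Herault); it is included in the
  definition, as is customary.\<close>

locale banach_line_bundle =
  fixes X :: "'g topology" and L :: "('g, 'l) fell_bundle"
  assumes fibre_module: "g \<in> topspace X \<Longrightarrow> Module.module complex_field (fibre_space L g)"
    and fibre_one_dimensional:
      "g \<in> topspace X \<Longrightarrow>
         \<exists>e \<in> fibre L g. e \<noteq> lzero L g \<and> (\<forall>a \<in> fibre L g. \<exists>c. a = lscale L c e)"
    and lnorm_nonneg: "a \<in> topspace (total L) \<Longrightarrow> 0 \<le> lnorm L a"
    and lnorm_eq_0_iff: "a \<in> topspace (total L) \<Longrightarrow> lnorm L a = 0 \<longleftrightarrow> a = lzero L (proj L a)"
    and lnorm_triangle: "\<lbrakk>a \<in> fibre L g; b \<in> fibre L g\<rbrakk> \<Longrightarrow> lnorm L (ladd L a b) \<le> lnorm L a + lnorm L b"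
    and lnorm_lscale: "a \<in> topspace (total L) \<Longrightarrow> lnorm L (lscale L c a) = cmod c * lnorm L a"
    and continuous_proj: "continuous_map (total L) X (proj L)"
    and open_proj: "open_map (total L) X (proj L)"
    and continuous_ladd:
      "continuous_map
         (subtopology (prod_topology (total L) (total L)) {(a, b). proj L a = proj L b})
         (total L) (\<lambda>(a, b). ladd L a b)"
    and continuous_lscale:
      "continuous_map (prod_topology euclidean (total L)) (total L) (\<lambda>(c, a). lscale L c a)"
    and continuous_lnorm: "continuous_map (total L) euclidean (lnorm L)"
    and lzero_neighbourhoods:
      "\<lbrakk>g \<in> topspace X; openin (total L) W; lzero L g \<in> W\<rbrakk> \<Longrightarrow>
         \<exists>V \<epsilon>. openin X V \<and> g \<in> V \<and> \<epsilon> > 0 \<and>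
           {a \<in> topspace (total L). proj L a \<in> V \<and> lnorm L a < \<epsilon>} \<subseteq> W"
    and local_sections:
      "a \<in> topspace (total L) \<Longrightarrow>
         \<exists>V f. openin X V \<and> proj L a \<in> V \<and> continuous_map (subtopology X V) (total L) f \<and>
           (\<forall>g\<in>V. proj L (f g) = g) \<and> f (proj L a) = a"

locale twisted_etale_groupoid = etale_groupoid G + banach_line_bundle "gtop G" L
  for G :: "'g groupoid" and L :: "('g, 'l) fell_bundle" +
  assumes lmult_closed:
      "\<lbrakk>g \<in> arrows G; h \<in> arrows G; src G g = rng G h; a \<in> fibre L g; b \<in> fibre L h\<rbrakk>
         \<Longrightarrow> lmult L a b \<in> fibre L (gmult G g h)"
    and lmult_ladd_left:
      "\<lbrakk>g \<in> arrows G; h \<in> arrows G; src G g = rng G h; a \<in> fibre L g; a' \<in> fibre L g; b \<in> fibre L h\<rbrakk>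
         \<Longrightarrow> lmult L (ladd L a a') b = ladd L (lmult L a b) (lmult L a' b)"
    and lmult_ladd_right:
      "\<lbrakk>g \<in> arrows G; h \<in> arrows G; src G g = rng G h; a \<in> fibre L g; b \<in> fibre L h; b' \<in> fibre L h\<rbrakk>
         \<Longrightarrow> lmult L a (ladd L b b') = ladd L (lmult L a b) (lmult L a b')"
    and lmult_lscale_left:
      "\<lbrakk>g \<in> arrows G; h \<in> arrows G; src G g = rng G h; a \<in> fibre L g; b \<in> fibre L h\<rbrakk>
         \<Longrightarrow> lmult L (lscale L c a) b = lscale L c (lmult L a b)"
    and lmult_lscale_right:
      "\<lbrakk>g \<in> arrows G; h \<in> arrows G; src G g = rng G h; a \<in> fibre L g; b \<in> fibre L h\<rbrakk>
         \<Longrightarrow> lmult L a (lscale L c b) = lscale L c (lmult L a b)"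
    and lmult_assoc:
      "\<lbrakk>g \<in> arrows G; h \<in> arrows G; k \<in> arrows G; src G g = rng G h; src G h = rng G k;
        a \<in> fibre L g; b \<in> fibre L h; d \<in> fibre L k\<rbrakk>
         \<Longrightarrow> lmult L (lmult L a b) d = lmult L a (lmult L b d)"
    and lnorm_lmult:
      "\<lbrakk>g \<in> arrows G; h \<in> arrows G; src G g = rng G h; a \<in> fibre L g; b \<in> fibre L h\<rbrakk>
         \<Longrightarrow> lnorm L (lmult L a b) \<le> lnorm L a * lnorm L b"
    and continuous_lmult:
      "continuous_map
         (subtopology (prod_topology (total L) (total L))
            {(a, b). src G (proj L a) = rng G (proj L b)})
         (total L) (\<lambda>(a, b). lmult L a b)"
    and lstar_closed:
      "\<lbrakk>g \<in> arrows G; a \<in> fibre L g\<rbrakk> \<Longrightarrow> lstar L a \<in> fibre L (ginv G g)"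
    and lstar_ladd:
      "\<lbrakk>g \<in> arrows G; a \<in> fibre L g; b \<in> fibre L g\<rbrakk>
         \<Longrightarrow> lstar L (ladd L a b) = ladd L (lstar L a) (lstar L b)"
    and lstar_lscale:
      "\<lbrakk>g \<in> arrows G; a \<in> fibre L g\<rbrakk> \<Longrightarrow> lstar L (lscale L c a) = lscale L (cnj c) (lstar L a)"
    and lstar_lstar: "\<lbrakk>g \<in> arrows G; a \<in> fibre L g\<rbrakk> \<Longrightarrow> lstar L (lstar L a) = a"
    and lstar_lmult:
      "\<lbrakk>g \<in> arrows G; h \<in> arrows G; src G g = rng G h; a \<in> fibre L g; b \<in> fibre L h\<rbrakk>
         \<Longrightarrow> lstar L (lmult L a b) = lmult L (lstar L b) (lstar L a)"
    and continuous_lstar: "continuous_map (total L) (total L) (lstar L)"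
    and lnorm_lstar_lmult:
      "\<lbrakk>g \<in> arrows G; a \<in> fibre L g\<rbrakk> \<Longrightarrow> lnorm L (lmult L (lstar L a) a) = (lnorm L a)\<^sup>2"
    and lstar_lmult_positive:
      "\<lbrakk>g \<in> arrows G; a \<in> fibre L g\<rbrakk>
         \<Longrightarrow> \<exists>b \<in> fibre L (src G g). lmult L (lstar L a) a = lmult L (lstar L b) b"

text \<open>Over a unit \<open>x\<close> the fibre is a one-dimensional C*-algebra, canonically identified with
  the complex numbers through its identity element.\<close>

definition fibre_unit :: "('g, 'l) fell_bundle \<Rightarrow> 'g \<Rightarrow> 'l" where
  "fibre_unit L x =
     (THE e. e \<in> fibre L x \<and> (\<forall>a \<in> fibre L x. lmult L e a = a \<and> lmult L a e = a))"

definition restrict_units ::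
  "'g groupoid \<Rightarrow> ('g, 'l) fell_bundle \<Rightarrow> ('g \<Rightarrow> 'l) \<Rightarrow> 'g \<Rightarrow> complex" where
  "restrict_units G L f =
     (\<lambda>x. if x \<in> units G then (THE c. f x = lscale L c (fibre_unit L x)) else 0)"


section \<open>The convolution algebra and its representations\<close>

text \<open>Sections are extensional functions on the set of arrows.\<close>

definition sections :: "'g groupoid \<Rightarrow> ('g, 'l) fell_bundle \<Rightarrow> ('g \<Rightarrow> 'l) set" where
  "sections G L = (\<Pi>\<^sub>E g \<in> arrows G. fibre L g)"

definition sec_add ::
  "'g groupoid \<Rightarrow> ('g, 'l) fell_bundle \<Rightarrow> ('g \<Rightarrow> 'l) \<Rightarrow> ('g \<Rightarrow> 'l) \<Rightarrow> 'g \<Rightarrow> 'l" where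
  "sec_add G L f h = (\<lambda>g \<in> arrows G. ladd L (f g) (h g))"

definition sec_scale ::
  "'g groupoid \<Rightarrow> ('g, 'l) fell_bundle \<Rightarrow> complex \<Rightarrow> ('g \<Rightarrow> 'l) \<Rightarrow> 'g \<Rightarrow> 'l" where
  "sec_scale G L c f = (\<lambda>g \<in> arrows G. lscale L c (f g))"

definition sec_star ::
  "'g groupoid \<Rightarrow> ('g, 'l) fell_bundle \<Rightarrow> ('g \<Rightarrow> 'l) \<Rightarrow> 'g \<Rightarrow> 'l" where
  "sec_star G L f = (\<lambda>g \<in> arrows G. lstar L (f (ginv G g)))"

text \<open>The sum is restricted to the nonzero terms: sums over infinite index sets are zero by
  convention in the library.\<close>

definition conv ::
  "'g groupoid \<Rightarrow> ('g, 'l) fell_bundle \<Rightarrow> ('g \<Rightarrow> 'l) \<Rightarrow> ('g \<Rightarrow> 'l) \<Rightarrow> 'g \<Rightarrow> 'l" where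
  "conv G L f h =
     (\<lambda>g \<in> arrows G.
        finsum (fibre_space L g) (\<lambda>(g1, g2). lmult L (f g1) (h g2))
          {(g1, g2). g1 \<in> arrows G \<and> g2 \<in> arrows G \<and> src G g1 = rng G g2 \<and> gmult G g1 g2 = g \<and>
             f g1 \<noteq> lzero L g1 \<and> h g2 \<noteq> lzero L g2})"

definition Gamma_c_on ::
  "'g groupoid \<Rightarrow> ('g, 'l) fell_bundle \<Rightarrow> 'g set \<Rightarrow> ('g \<Rightarrow> 'l) set" where
  "Gamma_c_on G L U =
     {f \<in> sections G L. continuous_map (subtopology (gtop G) U) (total L) f \<and>
        (\<exists>K \<subseteq> U. compactin (gtop G) K \<and> (\<forall>g \<in> arrows G - K. f g = lzero L g))}"

inductive_set Gamma_c :: "'g groupoid \<Rightarrow> ('g, 'l) fell_bundle \<Rightarrow> ('g \<Rightarrow> 'l) set"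
  for G :: "'g groupoid" and L :: "('g, 'l) fell_bundle" where
  base: "\<lbrakk>open_bisection G U; f \<in> Gamma_c_on G L U\<rbrakk> \<Longrightarrow> f \<in> Gamma_c G L"
| add: "\<lbrakk>f \<in> Gamma_c G L; h \<in> Gamma_c G L\<rbrakk> \<Longrightarrow> sec_add G L f h \<in> Gamma_c G L"
| scale: "f \<in> Gamma_c G L \<Longrightarrow> sec_scale G L c f \<in> Gamma_c G L"

text \<open>The arrows are the disjoint union of the source fibres, so the direct sum of the spaces
  of square-summable sections over the source fibres is the space of square-summable sections
  over all arrows.\<close>

definition l2_sections :: "'g groupoid \<Rightarrow> ('g, 'l) fell_bundle \<Rightarrow> ('g \<Rightarrow> 'l) set" where
  "l2_sections G L =
     {\<xi> \<in> sections G L. (\<lambda>g. (lnorm L (\<xi> g))\<^sup>2) summable_on arrows G}"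

definition l2_norm :: "'g groupoid \<Rightarrow> ('g, 'l) fell_bundle \<Rightarrow> ('g \<Rightarrow> 'l) \<Rightarrow> real" where
  "l2_norm G L \<xi> = sqrt (\<Sum>\<^sub>\<infinity>g \<in> arrows G. (lnorm L (\<xi> g))\<^sup>2)"

definition regular_rep ::
  "'g groupoid \<Rightarrow> ('g, 'l) fell_bundle \<Rightarrow> ('g \<Rightarrow> 'l) \<Rightarrow> ('g \<Rightarrow> 'l) \<Rightarrow> 'g \<Rightarrow> 'l" where
  "regular_rep G L f = (\<lambda>\<xi>. conv G L f \<xi>)"

definition regular_norm :: "'g groupoid \<Rightarrow> ('g, 'l) fell_bundle \<Rightarrow> ('g \<Rightarrow> 'l) \<Rightarrow> real" where
  "regular_norm G L f =
     (SUP \<xi> \<in> {\<xi> \<in> l2_sections G L. l2_norm G L \<xi> \<le> 1}. l2_norm G L (regular_rep G L f \<xi>))"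

definition star_representation ::
  "'g groupoid \<Rightarrow> ('g, 'l) fell_bundle \<Rightarrow> (('g \<Rightarrow> 'l) \<Rightarrow> 'h::complex_hilbert \<Rightarrow> 'h) \<Rightarrow> bool" where
  "star_representation G L \<pi> \<longleftrightarrow>
     (\<forall>f \<in> Gamma_c G L. bounded_clinear (\<pi> f)) \<and>
     (\<forall>f \<in> Gamma_c G L. \<forall>h \<in> Gamma_c G L. \<forall>v. \<pi> (sec_add G L f h) v = \<pi> f v + \<pi> h v) \<and>
     (\<forall>c. \<forall>f \<in> Gamma_c G L. \<forall>v. \<pi> (sec_scale G L c f) v = c *\<^sub>C \<pi> f v) \<and>
     (\<forall>f \<in> Gamma_c G L. \<forall>h \<in> Gamma_c G L. \<forall>v. \<pi> (conv G L f h) v = \<pi> f (\<pi> h v)) \<and>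
     (\<forall>f \<in> Gamma_c G L. \<forall>v w. cinner (\<pi> (sec_star G L f) v) w = cinner v (\<pi> f w))"

definition weakly_contains_regular ::
  "'g groupoid \<Rightarrow> ('g, 'l) fell_bundle \<Rightarrow> (('g \<Rightarrow> 'l) \<Rightarrow> 'h::complex_hilbert \<Rightarrow> 'h) \<Rightarrow> bool" where
  "weakly_contains_regular G L \<pi> \<longleftrightarrow> (\<forall>f \<in> Gamma_c G L. regular_norm G L f \<le> onorm (\<pi> f))"

text \<open>The C*-algebra \<open>'a\<close>, together with the canonical map \<open>\<iota>\<close>, is the completion of the
  convolution algebra in the norm \<open>\<parallel>\<pi>(f)\<parallel>\<close>.  This determines it up to a unique isometric
  *-isomorphism compatible with the canonical maps.\<close>

definition cstar_completion ::
  "'g groupoid \<Rightarrow> ('g, 'l) fell_bundle \<Rightarrow> (('g \<Rightarrow> 'l) \<Rightarrow> 'h::complex_hilbert \<Rightarrow> 'h) \<Rightarrow>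
     (('g \<Rightarrow> 'l) \<Rightarrow> 'a::cstar_algebra) \<Rightarrow> bool" where
  "cstar_completion G L \<pi> \<iota> \<longleftrightarrow>
     (\<forall>f \<in> Gamma_c G L. \<forall>h \<in> Gamma_c G L. \<iota> (sec_add G L f h) = \<iota> f + \<iota> h) \<and>
     (\<forall>c. \<forall>f \<in> Gamma_c G L. \<iota> (sec_scale G L c f) = c *\<^sub>C \<iota> f) \<and>
     (\<forall>f \<in> Gamma_c G L. \<forall>h \<in> Gamma_c G L. \<iota> (conv G L f h) = \<iota> f * \<iota> h) \<and>
     (\<forall>f \<in> Gamma_c G L. \<iota> (sec_star G L f) = star (\<iota> f)) \<and>
     (\<forall>f \<in> Gamma_c G L. norm (\<iota> f) = onorm (\<pi> f)) \<and>
     closure (\<iota> ` Gamma_c G L) = UNIV"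

definition trace_induced_by ::
  "'g groupoid \<Rightarrow> ('g, 'l) fell_bundle \<Rightarrow> (('g \<Rightarrow> 'l) \<Rightarrow> 'a::cstar_algebra) \<Rightarrow>
     (('g \<Rightarrow> complex) \<Rightarrow> complex) \<Rightarrow> ('a \<Rightarrow> complex) \<Rightarrow> bool" where
  "trace_induced_by G L \<iota> \<mu> \<tau> \<longleftrightarrow>
     (\<forall>f \<in> Gamma_c G L.
        has_radon_integral (unit_space G) \<mu> (restrict_units G L f) (\<tau> (\<iota> f)))"

end

theory Submission
  imports Defs
begin

text \<open>
  Write \<open>j : C\<^sub>c(\<G>\<^sup>0) \<rightarrow> A\<close> for the inclusion into the completion \<open>A\<close>.  An element \<open>f\<close> with \<open>f h = f\<close>
  for some \<open>h\<close> lies in every dense ideal (Neumann series), so the Pedersen ideal is exactly the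
  span of \<open>A j(C\<^sub>c(\<G>\<^sup>0)) A\<close>.  For \<open>e \<in> C\<^sub>c(\<G>\<^sup>0)\<close> the functional \<open>f \<mapsto> \<integral> e f|\<^bsub>\<G>\<^sup>0\<^esub> d\<mu>\<close> is bounded by the
  regular norm and extends to \<open>\<phi>\<^sub>e : A \<rightarrow> \<complex>\<close>.  Invariance of \<open>\<mu>\<close> gives
  \<open>\<phi>\<^sub>e(a j(f) b) = \<phi>\<^sub>f(b j(e) a)\<close>; letting \<open>e\<close> run through an approximate unit, \<open>\<tau>\<^sub>\<mu>(x) = lim \<phi>\<^sub>e(x)\<close>
  exists on the Pedersen ideal and satisfies \<open>\<tau>\<^sub>\<mu>(a j(f) b) = \<phi>\<^sub>f(b a)\<close>, whence the trace property.
  As a pointwise limit of pointwise bounded functionals, \<open>\<tau>\<^sub>\<mu>\<close> is bounded on every closed subspace of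
  the Pedersen ideal by the uniform boundedness principle.  A continuous trace is
  determined on \<open>a j(f) b\<close> by its values on the corner of \<open>b a\<close> cut out by \<open>f\<close>, hence by its values
  on the convolution algebra.  If the groupoid is principal, its units are closed, and a section
  supported on a small bisection \<open>V\<close> with \<open>r(V) \<inter> s(V) = \<emptyset>\<close> has trace zero, so every continuous trace is
  given by its restriction to \<open>C\<^sub>c(\<G>\<^sup>0)\<close>.
\<close>

section \<open>Functions with compact support on locally compact Hausdorff spaces\<close>

text \<open>A non-Hausdorff \<open>G\<close> shapes most of the work. The restriction of a section
  to the units may jump, so \<open>\<mu>\<close>, given only on \<open>Cc\<close>, is first turned
  into Borel measures by a Riesz theorem; identities known on \<open>Cc\<close> then pass to
  restrictions by multiplying with cutoffs carried inside the open set where the restriction is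
  continuous. A sum of such pieces need not be a piece, hence the constant induction over
  \<open>Gamma_c\<close> from single bisections. The bundle is handled through a coordinate that may
  be discontinuous from fibre to fibre: algebra is checked on coordinates, continuity separately by
  local sections of norm one. Norm estimates rest on two elementary devices instead of spectral
  theory: the C*-identity applied to repeated squares, and writing \<open>k^2 - |h|^2\<close> as a
  square of a function. Invariance of the functional that a trace induces on \<open>Cc\<close> holds
  for every continuous trace; principality serves to split off the part of a section away from the
  units and to see that its trace vanishes.\<close>

definition csupp :: "'x topology \<Rightarrow> 'x set \<Rightarrow> ('x \<Rightarrow> 'b::zero) \<Rightarrow> bool" where
  "csupp X U f \<longleftrightarrow> (\<exists>K. compactin X K \<and> K \<subseteq> U \<and> (\<forall>x. x \<notin> K \<longrightarrow> f x = 0))"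

text \<open>Like \<open>Cc\<close>, this consists of total functions. A compact carrier lies inside
  the space, so every member vanishes off \<open>topspace X\<close>, and pointwise hypotheses may
  range over all points of the type.\<close>

definition Cp :: "'x topology \<Rightarrow> ('x \<Rightarrow> real) set" where
  "Cp X = {f. continuous_map X euclideanreal f \<and> (\<forall>x. 0 \<le> f x) \<and> csupp X UNIV f}"

lemma csuppI: "compactin X K \<Longrightarrow> K \<subseteq> U \<Longrightarrow> (\<And>x. x \<notin> K \<Longrightarrow> f x = 0) \<Longrightarrow> csupp X U f"
  by (auto simp: csupp_def)

lemma csupp_mono: "csupp X U f \<Longrightarrow> U \<subseteq> V \<Longrightarrow> csupp X V f"
  by (meson csupp_def order_trans)

lemma csupp_weaken:
  "csupp X U f \<Longrightarrow> (\<And>x. f x = 0 \<Longrightarrow> g x = 0) \<Longrightarrow> csupp X U g"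
  by (meson csupp_def)

lemma csupp_combine:
  assumes "csupp X U f" "csupp X U g" "\<And>x. f x = 0 \<Longrightarrow> g x = 0 \<Longrightarrow> h x = 0"
  shows "csupp X U h"
proof -
  obtain K L where "compactin X K" "K \<subseteq> U" "\<And>x. x \<notin> K \<Longrightarrow> f x = 0"
    "compactin X L" "L \<subseteq> U" "\<And>x. x \<notin> L \<Longrightarrow> g x = 0"
    using assms(1,2) by (auto simp: csupp_def)
  then show ?thesis
    using assms(3) by (intro csuppI[of X "K \<union> L"]) (auto intro: compactin_Un)
qed

lemma csupp_0: "csupp X U (\<lambda>x. 0)"
  by (intro csuppI[of X "{}"]) auto

lemma Cc_iff: "f \<in> Cc X \<longleftrightarrow> continuous_map X euclidean f \<and> csupp X UNIV f"
  by (auto simp: Cc_def csupp_def)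

lemma continuous_map_compose_continuous_on:
  assumes "continuous_map X euclidean f" "continuous_on UNIV g"
  shows "continuous_map X euclidean (\<lambda>x. g (f x))"
  using continuous_map_compose[of X euclidean f euclidean g] assms by (simp add: o_def)

lemma continuous_map_times:
  fixes f g :: "'x \<Rightarrow> 'b::real_normed_algebra"
  shows "continuous_map X euclidean f \<Longrightarrow> continuous_map X euclidean g
    \<Longrightarrow> continuous_map X euclidean (\<lambda>x. f x * g x)"
  by (simp add: continuous_map_atin tendsto_mult)

text \<open>Functions given on part of the space become global this way. The Hausdorff condition
  makes the carrier \<open>K\<close> closed, so a preimage is an open part of \<open>U\<close>,
  joined with the complement of \<open>K\<close> when the target set contains 0.\<close>

lemma continuous_map_extend_zero:
  fixes f :: "'x \<Rightarrow> 'b::{topological_space, zero}"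
  assumes "Hausdorff_space X" and U: "openin X U"
    and f: "continuous_map (subtopology X U) euclidean f" and "csupp X U f"
  shows "continuous_map X euclidean f"
proof -
  obtain K where K: "compactin X K" "K \<subseteq> U" "\<And>x. x \<notin> K \<Longrightarrow> f x = 0"
    using assms(4) unfolding csupp_def by blast
  have UX: "U \<subseteq> topspace X" using U by (rule openin_subset)
  have cK: "closedin X K" using K(1) assms(1) compactin_imp_closedin by blast
  have "openin X {x \<in> topspace X. f x \<in> W}" if "open W" for W
  proof -
    have "openin (subtopology X U) {x \<in> topspace (subtopology X U). f x \<in> W}"
      using f that by (auto simp: continuous_map_def)
    then have 1: "openin X {x \<in> U. f x \<in> W}"
      using U UX by (simp add: openin_open_subtopology Int_absorb1)
    have "{x \<in> topspace X. f x \<in> W} =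
        {x \<in> U. f x \<in> W} \<union> (if 0 \<in> W then topspace X - K else {})"
      using K UX by (auto split: if_splits) (metis subsetD)+
    then show ?thesis using 1 cK by auto
  qed
  then show ?thesis by (auto simp: continuous_map_def)
qed

lemma Cp_D:
  assumes "f \<in> Cp X"
  shows "continuous_map X euclideanreal f" "0 \<le> f x" "csupp X UNIV f"
  using assms by (auto simp: Cp_def)

lemma Cp_0: "(\<lambda>x. 0) \<in> Cp X"
  by (auto simp: Cp_def csupp_0)

lemma Cp_add: "f \<in> Cp X \<Longrightarrow> g \<in> Cp X \<Longrightarrow> (\<lambda>x. f x + g x) \<in> Cp X"
  unfolding Cp_def by (auto intro!: continuous_map_add intro: csupp_combine)

lemma Cp_diff:
  "f \<in> Cp X \<Longrightarrow> g \<in> Cp X \<Longrightarrow> (\<And>x. g x \<le> f x) \<Longrightarrow> (\<lambda>x. f x - g x) \<in> Cp X"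
  unfolding Cp_def by (auto intro!: continuous_map_diff intro: csupp_combine)

lemma Cp_scale: "f \<in> Cp X \<Longrightarrow> 0 \<le> c \<Longrightarrow> (\<lambda>x. c * f x) \<in> Cp X"
  unfolding Cp_def by (auto intro!: continuous_map_real_mult_left intro: csupp_weaken)

lemma Cp_mult:
  "f \<in> Cp X \<Longrightarrow> continuous_map X euclideanreal g \<Longrightarrow> (\<And>x. 0 \<le> g x) \<Longrightarrow> (\<lambda>x. f x * g x) \<in> Cp X"
  unfolding Cp_def by (auto intro!: continuous_map_real_mult intro: csupp_weaken)

lemma Cp_min:
  "f \<in> Cp X \<Longrightarrow> continuous_map X euclideanreal g \<Longrightarrow> (\<And>x. 0 \<le> g x) \<Longrightarrow> (\<lambda>x. min (f x) (g x)) \<in> Cp X"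
  unfolding Cp_def
  by (auto intro!: continuous_map_real_min intro: csupp_weaken simp: min_absorb1)

lemma bounded_csupp:
  fixes f :: "'x \<Rightarrow> 'b::real_normed_vector"
  assumes "continuous_map X euclidean f" "csupp X U f"
  shows "\<exists>c>0. \<forall>x. norm (f x) \<le> c"
proof -
  obtain K where K: "compactin X K" "\<And>x. x \<notin> K \<Longrightarrow> f x = 0"
    using assms(2) unfolding csupp_def by blast
  have "compact (f ` K)"
    using image_compactin[OF K(1) assms(1)] by simp
  then obtain c where c: "c > 0" "\<And>y. y \<in> f ` K \<Longrightarrow> norm y \<le> c"
    using compact_imp_bounded bounded_pos by (metis)
  have "norm (f x) \<le> c" for x
    using c K(2)[of x] by (cases "x \<in> K") auto
  then show ?thesis using c(1) by blast
qed

section \<open>Cutoff functions and splitting along open covers\<close>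

locale locally_compact_Hausdorff =
  fixes X :: "'x topology"
  assumes locally_compact: "locally_compact_space X" and Hausdorff: "Hausdorff_space X"
begin

lemma compact_closed: "compactin X K \<Longrightarrow> closedin X K"
  using Hausdorff compactin_imp_closedin by blast

lemma compact_neighbourhood:
  assumes "compactin X K" "openin X U" "K \<subseteq> U"
  shows "\<exists>V C. openin X V \<and> compactin X C \<and> K \<subseteq> V \<and> V \<subseteq> C \<and> C \<subseteq> U"
proof -
  have "locally_compact_space (subtopology X U)"
    using locally_compact_space_open_subset Hausdorff locally_compact assms(2) by blast
  moreover have "Hausdorff_space (subtopology X U)"
    by (simp add: Hausdorff Hausdorff_space_subtopology)
  moreover have "compactin (subtopology X U) K"
    using assms by (simp add: compactin_subtopology)
  ultimately obtain V L where "openin (subtopology X U) V" "compactin (subtopology X U) L" "K \<subseteq> V" "V \<subseteq> L"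
    by (metis locally_compact_space_compact_closed_compact)
  then show ?thesis
    using assms(2) by (auto simp: compactin_subtopology openin_open_subtopology)
qed

text \<open>Two nested neighbourhoods are taken: the inner one makes the function equal to 1 on an
  open set around \<open>K\<close>, which is what comparison with open neighbourhoods of
  \<open>K\<close> requires, and the compact hull of the outer one carries it inside
  \<open>U\<close>.\<close>

lemma bump:
  assumes "compactin X K" "openin X U" "K \<subseteq> U"
  shows "\<exists>\<theta>\<in>Cp X. (\<forall>x. \<theta> x \<le> 1) \<and> csupp X U \<theta> \<and> (\<exists>V. openin X V \<and> K \<subseteq> V \<and> (\<forall>x\<in>V. \<theta> x = 1))"
proof -
  obtain V C where V: "openin X V" "compactin X C" "K \<subseteq> V" "V \<subseteq> C" "C \<subseteq> U"
    using compact_neighbourhood[OF assms] by blast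
  obtain V2 C2 where V2: "openin X V2" "compactin X C2" "K \<subseteq> V2" "V2 \<subseteq> C2" "C2 \<subseteq> V"
    using compact_neighbourhood[OF assms(1) V(1,3)] by blast
  have "completely_regular_space X"
    using locally_compact_regular_imp_completely_regular_space locally_compact Hausdorff by blast
  moreover have "closedin X (topspace X - V)" using V(1) by blast
  moreover have "disjnt C2 (topspace X - V)" using V2(5) by (auto simp: disjnt_def)
  ultimately obtain f where f: "continuous_map X (top_of_set {0..1::real}) f"
    "f ` (topspace X - V) \<subseteq> {0}" "f ` C2 \<subseteq> {1}"
    using Urysohn_completely_regular_compact_closed[of 0 1 X C2 "topspace X - V"] V2(2) by auto
  define \<theta> where "\<theta> x = (if x \<in> V then f x else 0)" for x
  have eq: "\<theta> x = f x" if "x \<in> topspace X" for x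
    using that f(2) by (auto simp: \<theta>_def)
  have VX: "V \<subseteq> topspace X" using V(1) openin_subset by blast
  have fc: "continuous_map X euclideanreal f" "\<And>x. x \<in> topspace X \<Longrightarrow> 0 \<le> f x \<and> f x \<le> 1"
    using f(1) by (auto simp: continuous_map_in_subtopology)
  have c: "continuous_map X euclideanreal \<theta>"
    using continuous_map_eq[OF fc(1)] eq by metis
  have s: "csupp X U \<theta>"
    using V by (intro csuppI[of X C]) (auto simp: \<theta>_def)
  have "\<theta> \<in> Cp X"
    using c csupp_mono[OF s] fc(2) VX by (auto simp: Cp_def \<theta>_def)
  moreover have "\<forall>x. \<theta> x \<le> 1" using fc(2) VX by (auto simp: \<theta>_def)
  moreover have "\<forall>x\<in>V2. \<theta> x = 1" using f(3) V2 by (auto simp: \<theta>_def)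
  ultimately show ?thesis using s V2 by blast
qed

text \<open>A partition of unity for two sets: a function carried by \<open>K\<close> is cut by
  \<open>\<theta>\<close> into a part carried in \<open>U\<close> and, with the factor
  \<open>1 - \<theta>\<close>, a part carried by the compact \<open>L\<close> inside
  \<open>V\<close>. Induction on this handles finite covers.\<close>

lemma split_cover:
  assumes "compactin X K" "openin X U" "openin X V" "K \<subseteq> U \<union> V"
  shows "\<exists>\<theta>\<in>Cp X. (\<forall>x. \<theta> x \<le> 1) \<and> csupp X U \<theta> \<and> 
    (\<exists>L. compactin X L \<and> L \<subseteq> V \<and> (\<forall>x\<in>K-L. \<theta> x = 1))"
proof -
  have "compactin X (K \<inter> (topspace X - V))"
    by (intro closed_Int_compactin[OF _ assms(1), of "topspace X - _", simplified Int_commute]) (use assms(3) in blast)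
  moreover have "K \<inter> (topspace X - V) \<subseteq> U" using assms(4) by blast
  ultimately obtain \<theta> W where \<theta>: "\<theta>\<in>Cp X" "\<forall>x. \<theta> x \<le> 1" "csupp X U \<theta>" "openin X W"
    "K \<inter> (topspace X - V) \<subseteq> W" "\<forall>x\<in>W. \<theta> x = 1"
    using bump assms(2) by meson
  have "compactin X (K \<inter> (topspace X - W))"
    by (intro closed_Int_compactin[OF _ assms(1), of "topspace X - _", simplified Int_commute]) (use \<theta>(4) in blast)
  moreover have "K \<inter> (topspace X - W) \<subseteq> V"
    using \<theta>(5) by blast
  moreover have "\<forall>x\<in>K - (K \<inter> (topspace X - W)). \<theta> x = 1"
    using \<theta>(6) compactin_subset_topspace[OF assms(1)] by blast
  ultimately show ?thesis using \<theta> by blast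
qed

end

section \<open>The Riesz--Markov theorem\<close>

text \<open>Only the cone of nonnegative functions is involved, so that the upper variation of a
  real functional, a supremum defined on that cone, is itself an instance.\<close>

locale positive_functional = locally_compact_Hausdorff X for X :: "'x topology" +
  fixes \<Phi> :: "('x \<Rightarrow> real) \<Rightarrow> real"
  assumes Phi_add: "f \<in> Cp X \<Longrightarrow> g \<in> Cp X \<Longrightarrow> \<Phi> (\<lambda>x. f x + g x) = \<Phi> f + \<Phi> g"
    and Phi_scale: "f \<in> Cp X \<Longrightarrow> 0 \<le> c \<Longrightarrow> \<Phi> (\<lambda>x. c * f x) = c * \<Phi> f"
    and Phi_nonneg: "f \<in> Cp X \<Longrightarrow> 0 \<le> \<Phi> f"
begin

lemma Phi_mono: "f \<in> Cp X \<Longrightarrow> g \<in> Cp X \<Longrightarrow> (\<And>x. g x \<le> f x) \<Longrightarrow> \<Phi> g \<le> \<Phi> f"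
  using Phi_add[of g "\<lambda>x. f x - g x"] Cp_diff[of f X g] Phi_nonneg[of "\<lambda>x. f x - g x"] by simp

lemma Phi_0: "\<Phi> (\<lambda>x. 0) = 0"
  using Phi_scale[OF Cp_0, of 0] by simp

definition test_functions :: "'x set \<Rightarrow> ('x \<Rightarrow> real) set" where
  "test_functions U = {f \<in> Cp X. (\<forall>x. f x \<le> 1) \<and> csupp X U f}"

text \<open>The intended measure of an open set; \<open>outer\<close> extends it to all sets by
  outer regularity, and Caratheodory's theorem is applied to \<open>outer\<close>.\<close>

definition content :: "'x set \<Rightarrow> ennreal" where
  "content U = (SUP f\<in>test_functions U. ennreal (\<Phi> f))"

definition outer :: "'x set \<Rightarrow> ennreal" where
  "outer B = (INF U\<in>{U. openin X U \<and> B \<subseteq> U}. content U)"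

lemma zero_test: "(\<lambda>x. 0) \<in> test_functions U"
  by (auto simp: test_functions_def Cp_0 csupp_0)

lemma content_mono: "U \<subseteq> V \<Longrightarrow> content U \<le> content V"
  unfolding content_def test_functions_def
  by (rule SUP_subset_mono) (auto intro: csupp_mono)

lemma content_upper: "f \<in> test_functions U \<Longrightarrow> ennreal (\<Phi> f) \<le> content U"
  unfolding content_def by (rule SUP_upper)

text \<open>Stated for one test function, so that \<open>split_cover\<close> can peel off the last
  set: the factor \<open>\<theta>\<close> leaves a test function for the first \<open>n\<close>
  sets, the factor \<open>1 - \<theta>\<close> one for \<open>U n\<close>.\<close>

lemma content_finite_subadditive:
  assumes "\<And>i::nat. openin X (U i)" "f \<in> test_functions (\<Union>i<n. U i)"
  shows "ennreal (\<Phi> f) \<le> (\<Sum>i<n. content (U i))"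
  using assms(2)
proof (induction n arbitrary: f)
  case 0
  then have "f = (\<lambda>x. 0)" by (auto simp: test_functions_def csupp_def)
  then show ?case by (simp add: Phi_0)
next
  case (Suc n)
  then have f: "f \<in> Cp X" "\<And>x. f x \<le> 1" and "csupp X (\<Union>i<Suc n. U i) f"
    by (auto simp: test_functions_def)
  then obtain K where K: "compactin X K" "K \<subseteq> (\<Union>i<Suc n. U i)" "\<And>x. x \<notin> K \<Longrightarrow> f x = 0"
    unfolding csupp_def by blast
  have "K \<subseteq> (\<Union>i<n. U i) \<union> U n" using K(2) by (auto simp: lessThan_Suc)
  then obtain \<theta> L where \<theta>: "\<theta> \<in> Cp X" "\<forall>x. \<theta> x \<le> 1" "csupp X (\<Union>i<n. U i) \<theta>"
      and L: "compactin X L" "L \<subseteq> U n" "\<forall>x\<in>K-L. \<theta> x = 1"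
    using split_cover[OF K(1), of "\<Union>i<n. U i" "U n"] assms(1) by blast
  have c: "continuous_map X euclideanreal \<theta>" "\<And>x. 0 \<le> \<theta> x" using \<theta>(1) by (auto simp: Cp_def)
  have 1: "(\<lambda>x. f x * \<theta> x) \<in> test_functions (\<Union>i<n. U i)"
    unfolding test_functions_def using f c \<theta> Cp_mult[OF f(1) c] Cp_D(2)[OF f(1)]
    by (auto intro: mult_le_one csupp_weaken)
  have 2: "(\<lambda>x. f x * (1 - \<theta> x)) \<in> Cp X"
    using \<theta>(2) by (intro Cp_mult[OF f(1)] continuous_map_diff c) auto
  have 3: "(\<lambda>x. f x * (1 - \<theta> x)) \<in> test_functions (U n)"
  proof -
    have "f x * (1 - \<theta> x) = 0" if "x \<notin> L" for x
      using that L(3) K(3)[of x] by (cases "x \<in> K") auto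
    then show ?thesis
      unfolding test_functions_def using 2 f c(2) \<theta> L(1,2) Cp_D(2)[OF f(1)]
      by (auto intro!: mult_le_one csuppI[of X L] simp del: mult_eq_0_iff)
  qed
  have "f = (\<lambda>x. f x * \<theta> x + f x * (1 - \<theta> x))" by (auto simp: algebra_simps)
  then have "\<Phi> f = \<Phi> (\<lambda>x. f x * \<theta> x) + \<Phi> (\<lambda>x. f x * (1 - \<theta> x))"
    using Phi_add[OF _ 2, of "\<lambda>x. f x * \<theta> x"] 1 by (simp add: test_functions_def)
  then have "ennreal (\<Phi> f) = ennreal (\<Phi> (\<lambda>x. f x * \<theta> x)) + ennreal (\<Phi> (\<lambda>x. f x * (1 - \<theta> x)))"
    using Phi_nonneg[OF 2] 1 by (simp add: test_functions_def Phi_nonneg ennreal_plus)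
  also have "\<dots> \<le> (\<Sum>i<n. content (U i)) + content (U n)"
    using Suc.IH[OF 1] content_upper[OF 3] by (rule add_mono)
  finally show ?case by simp
qed

text \<open>A test function of the union has a compact carrier, which finitely many of the sets
  already cover.\<close>

lemma content_countably_subadditive:
  assumes "\<And>i::nat. openin X (U i)"
  shows "content (\<Union>i. U i) \<le> (\<Sum>i. content (U i))"
  unfolding content_def[of "\<Union>i. U i"]
proof (rule SUP_least)
  fix f assume f: "f \<in> test_functions (\<Union>i. U i)"
  then obtain K where K: "compactin X K" "K \<subseteq> (\<Union>i. U i)" "\<And>x. x \<notin> K \<Longrightarrow> f x = 0"
    unfolding csupp_def test_functions_def by blast
  obtain F where F: "finite F" "F \<subseteq> range U" "K \<subseteq> \<Union>F"
    using compactinD[OF K(1), of "range U"] assms K(2) by blast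
  then obtain I where I: "finite I" "F = U ` I" by (metis finite_subset_image)
  obtain n where n: "\<forall>i\<in>I. i < n" using I(1) by (metis finite_nat_set_iff_bounded)
  have "K \<subseteq> (\<Union>i<n. U i)" using F(3) n unfolding I(2) by blast
  then have "f \<in> test_functions (\<Union>i<n. U i)"
    using f K by (auto simp: test_functions_def intro!: csuppI[of X K])
  from content_finite_subadditive[OF assms this]
  show "ennreal (\<Phi> f) \<le> (\<Sum>i. content (U i))"
    by (rule order_trans) (auto intro: sum_le_suminf)
qed

lemma outer_open: "openin X U \<Longrightarrow> outer U = content U"
  unfolding outer_def by (rule antisym) (auto intro!: INF_lower INF_greatest content_mono)

lemma outer_mono: "A \<subseteq> B \<Longrightarrow> outer A \<le> outer B"
  unfolding outer_def by (rule INF_superset_mono) auto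

lemma outer_empty: "outer {} = 0"
proof -
  have "test_functions {} = {\<lambda>x. 0}"
    using zero_test by (auto simp: test_functions_def csupp_def)
  then show ?thesis by (simp add: outer_open content_def Phi_0)
qed

lemma outer_countably_subadditive:
  assumes "\<And>i::nat. A i \<subseteq> topspace X"
  shows "outer (\<Union>i. A i) \<le> (\<Sum>i. outer (A i))"
proof (rule ennreal_le_epsilon)
  fix e :: real assume "0 < e" "(\<Sum>i. outer (A i)) < top_class.top"
  then have *: "\<And>n. outer (A n) < outer (A n) + e * (1/2)^Suc n"
    by (auto simp add: less_top dest!: ennreal_suminf_lessD)
  have "\<exists>U. openin X U \<and> A n \<subseteq> U \<and> content U \<le> outer (A n) + e * (1/2)^Suc n" for n
    using *[of n] unfolding outer_def INF_less_iff by (auto intro: less_imp_le)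
  then obtain U where U: "\<And>n. openin X (U n)" "\<And>n. A n \<subseteq> U n"
      "\<And>n. content (U n) \<le> outer (A n) + e * (1/2)^Suc n"
    by metis
  have "outer (\<Union>i. A i) \<le> outer (\<Union>i. U i)" using U(2) by (intro outer_mono) blast
  also have "\<dots> = content (\<Union>i. U i)" using U(1) by (intro outer_open) auto
  also have "\<dots> \<le> (\<Sum>i. content (U i))" by (rule content_countably_subadditive[OF U(1)])
  also have "\<dots> \<le> (\<Sum>n. outer (A n) + e * (1/2) ^ Suc n)"
    by (intro suminf_le allI U) auto
  also have "... = (\<Sum>n. outer (A n)) + (\<Sum>n. ennreal e * ennreal ((1/2) ^ Suc n))"
    using \<open>0 < e\<close> by (subst suminf_add[symmetric])
      (auto simp del: ennreal_suminf_cmult simp add: ennreal_mult[symmetric])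
  also have "\<dots> = (\<Sum>n. outer (A n)) + e"
    unfolding ennreal_suminf_cmult
    by (subst suminf_ennreal_eq[OF zero_le_power power_half_series]) auto
  finally show "outer (\<Union>i. A i) \<le> (\<Sum>i. outer (A i)) + e" .
qed

lemma outer_measure_space_outer: "outer_measure_space (Pow (topspace X)) outer"
  unfolding outer_measure_space_def
proof (intro conjI)
  show "positive (Pow (topspace X)) outer" by (simp add: positive_def outer_empty)
  show "increasing (Pow (topspace X)) outer" by (simp add: increasing_def outer_mono)
  show "countably_subadditive (Pow (topspace X)) outer"
    unfolding countably_subadditive_def
    by (intro allI impI outer_countably_subadditive) auto
qed

lemma outer_subadditive: 
  assumes "A \<subseteq> topspace X" "B \<subseteq> topspace X"
  shows "outer (A \<union> B) \<le> outer A + outer B"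
proof -
  have "outer (\<Union>i. binaryset A B i) \<le> (\<Sum>i. outer (binaryset A B i))"
    using assms by (intro outer_countably_subadditive) (auto simp: binaryset_def)
  then show ?thesis
    by (simp add: UN_binaryset_eq suminf_binaryset_eq outer_empty)
qed

text \<open>The Caratheodory inequality for open sets. If \<open>f\<close> is a test function of
  \<open>E \<inter> U\<close> with carrier \<open>K\<close> and \<open>g\<close> one of
  \<open>E - K\<close>, the two are never nonzero together, so \<open>f + g\<close> is still a test
  function of \<open>E\<close>; moreover \<open>E - U\<close> lies in \<open>E - K\<close>. Suprema
  over \<open>g\<close>, then over \<open>f\<close>, finish.\<close>

lemma content_split:
  assumes U: "openin X U" and E: "openin X E"
  shows "content (E \<inter> U) + outer (E - U) \<le> content E"
proof -
  have "ennreal (\<Phi> f) + outer (E - U) \<le> content E" if f: "f \<in> test_functions (E \<inter> U)" for f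
  proof -
    obtain K where K: "compactin X K" "K \<subseteq> E \<inter> U" "\<And>x. x \<notin> K \<Longrightarrow> f x = 0"
      using f unfolding csupp_def test_functions_def by blast
    have V: "openin X (E - K)" using E compact_closed[OF K(1)] by (rule openin_diff)
    have "ennreal (\<Phi> f) + ennreal (\<Phi> g) \<le> content E" if g: "g \<in> test_functions (E - K)" for g
    proof -
      have fg: "f \<in> Cp X" "g \<in> Cp X" "\<And>x. f x \<le> 1" "\<And>x. g x \<le> 1"
        using f g by (auto simp: test_functions_def)
      have "g x = 0" if "x \<in> K" for x
        using g that by (auto simp: test_functions_def csupp_def)
      then have "f x + g x \<le> 1" for x
        using fg(3,4)[of x] K(3)[of x] by (cases "x \<in> K") auto
      moreover have "csupp X E f" "csupp X E g" using f g
        by (auto simp: test_functions_def intro: csupp_mono)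
      then have "csupp X E (\<lambda>x. f x + g x)"
        by (rule csupp_combine) auto
      ultimately have "(\<lambda>x. f x + g x) \<in> test_functions E"
        using Cp_add[OF fg(1,2)] by (auto simp: test_functions_def)
      from content_upper[OF this] show ?thesis
        by (simp add: Phi_add fg Phi_nonneg ennreal_plus)
    qed
    then have "(SUP g\<in>test_functions (E - K). ennreal (\<Phi> f) + ennreal (\<Phi> g)) \<le> content E"
      by (rule SUP_least)
    also have "(SUP g\<in>test_functions (E - K). ennreal (\<Phi> f) + ennreal (\<Phi> g)) =
        ennreal (\<Phi> f) + content (E - K)"
      unfolding content_def using zero_test by (intro ennreal_SUP_add_right[symmetric]) auto
    finally have "ennreal (\<Phi> f) + content (E - K) \<le> content E" .
    moreover have "outer (E - U) \<le> content (E - K)"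
      using outer_mono[of "E - U" "E - K"] outer_open[OF V] K(2) by auto
    ultimately show ?thesis by (meson add_left_mono order_trans)
  qed
  then have "(SUP f\<in>test_functions (E \<inter> U). ennreal (\<Phi> f) + outer (E - U)) \<le> content E"
    by (rule SUP_least)
  also have "(SUP f\<in>test_functions (E \<inter> U). ennreal (\<Phi> f) + outer (E - U)) =
      content (E \<inter> U) + outer (E - U)"
    unfolding content_def using zero_test by (intro ennreal_SUP_add_left) auto
  finally show ?thesis .
qed

lemma open_in_lambda_system:
  assumes U: "openin X U"
  shows "U \<in> lambda_system (topspace X) (Pow (topspace X)) outer"
  unfolding lambda_system_def
proof (intro CollectI conjI ballI)
  show UX: "U \<in> Pow (topspace X)" using openin_subset[OF U] by simp
  fix B assume B: "B \<in> Pow (topspace X)"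
  show "outer (U \<inter> B) + outer ((topspace X - U) \<inter> B) = outer B"
  proof (rule antisym)
    show "outer (U \<inter> B) + outer ((topspace X - U) \<inter> B) \<le> outer B"
      unfolding outer_def[of B]
    proof (rule INF_greatest)
      fix E assume "E \<in> {E. openin X E \<and> B \<subseteq> E}"
      then have E: "openin X E" "B \<subseteq> E" by auto
      have "outer (U \<inter> B) + outer ((topspace X - U) \<inter> B) \<le> outer (E \<inter> U) + outer (E - U)"
        using E(2) by (intro add_mono outer_mono) auto
      also have "\<dots> \<le> content E"
        using content_split[OF U E(1)] outer_open[OF openin_Int[OF E(1) U]] by simp
      finally show "outer (U \<inter> B) + outer ((topspace X - U) \<inter> B) \<le> content E" .
    qed
    have "outer ((U \<inter> B) \<union> ((topspace X - U) \<inter> B)) \<le> outer (U \<inter> B) + outer ((topspace X - U) \<inter> B)"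
      using B by (intro outer_subadditive) auto
    moreover have "(U \<inter> B) \<union> ((topspace X - U) \<inter> B) = B" using B by auto
    ultimately show "outer B \<le> outer (U \<inter> B) + outer ((topspace X - U) \<inter> B)" by simp
  qed
qed

section \<open>The Riesz measure and its regularity\<close>

definition riesz_measure :: "'x measure" where
  "riesz_measure = measure_of (topspace X) {U. openin X U} outer"

text \<open>The sets that split \<open>outer\<close> additively form a sigma-algebra on which
  \<open>outer\<close> is a measure; it contains the open sets, hence the Borel sets.\<close>

lemma measure_space_outer:
  "measure_space (topspace X) (sigma_sets (topspace X) {U. openin X U}) outer"
proof -
  interpret sigma_algebra "topspace X" "Pow (topspace X)" by (rule sigma_algebra_Pow)
  have 1: "measure_space (topspace X) (lambda_system (topspace X) (Pow (topspace X)) outer) outer"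
    using caratheodory_lemma[OF outer_measure_space_outer] .
  then interpret L: sigma_algebra "topspace X" "lambda_system (topspace X) (Pow (topspace X)) outer"
    by (simp add: measure_space_def)
  show ?thesis
  proof (rule measure_down[OF 1])
    show "sigma_algebra (topspace X) (sigma_sets (topspace X) {U. openin X U})"
      by (rule sigma_algebra_sigma_sets) (auto dest: openin_subset)
    show "sigma_sets (topspace X) {U. openin X U} \<subseteq> lambda_system (topspace X) (Pow (topspace X)) outer"
      by (intro L.sigma_sets_subset) (auto intro: open_in_lambda_system)
  qed
qed

lemma opens_Pow: "{U. openin X U} \<subseteq> Pow (topspace X)"
  by (auto dest: openin_subset)

lemma space_riesz: "space riesz_measure = topspace X"
  and sets_riesz: "sets riesz_measure = sigma_sets (topspace X) {U. openin X U}"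
  unfolding riesz_measure_def by (auto simp: space_measure_of[OF opens_Pow] sets_measure_of[OF opens_Pow])

lemma emeasure_riesz: "B \<in> sets riesz_measure \<Longrightarrow> emeasure riesz_measure B = outer B"
  using measure_space_outer unfolding measure_space_def sets_riesz
  by (intro emeasure_measure_of[OF riesz_measure_def opens_Pow]) (auto simp: sets_riesz)

lemma openin_sets_riesz: "openin X U \<Longrightarrow> U \<in> sets riesz_measure"
  by (simp add: sets_riesz sigma_sets.Basic)

lemma compactin_sets_riesz:
  assumes "compactin X K"
  shows "K \<in> sets riesz_measure"
proof -
  have "topspace X - (topspace X - K) \<in> sets riesz_measure"
    using compact_closed[OF assms] unfolding sets_riesz
    by (intro sigma_sets.Compl sigma_sets.Basic) blast
  moreover have "topspace X - (topspace X - K) = K"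
    using compactin_subset_topspace[OF assms] by auto
  ultimately show ?thesis by simp
qed

text \<open>A cutoff equal to 1 on an open \<open>V\<close> around \<open>K\<close> dominates every
  test function of \<open>V\<close>, so its value under \<open>\<Phi>\<close> bounds
  \<open>content V\<close>.\<close>

lemma outer_compact_finite:
  assumes "compactin X K"
  shows "outer K < \<infinity>"
proof -
  obtain \<theta> V where \<theta>: "\<theta> \<in> Cp X" "openin X V" "K \<subseteq> V" "\<forall>x\<in>V. \<theta> x = 1"
    using bump[OF assms openin_topspace] compactin_subset_topspace[OF assms] by blast
  have "outer K \<le> content V" using outer_mono[OF \<theta>(3)] outer_open[OF \<theta>(2)] by simp
  also have "\<dots> \<le> ennreal (\<Phi> \<theta>)"
    unfolding content_def
  proof (rule SUP_least)
    fix g assume g: "g \<in> test_functions V"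
    then have g': "g x \<le> 1" "x \<notin> V \<Longrightarrow> g x = 0" for x
      by (auto simp: test_functions_def csupp_def)
    have "g x \<le> \<theta> x" for x
      using \<theta>(4) Cp_D(2)[OF \<theta>(1), of x] g'[of x] by (cases "x \<in> V") auto
    then show "ennreal (\<Phi> g) \<le> ennreal (\<Phi> \<theta>)"
      using g \<theta>(1) by (intro ennreal_leI Phi_mono) (auto simp: test_functions_def)
  qed
  finally show ?thesis by (simp add: order_le_less_trans)
qed

lemma Phi_le_outer:
  assumes "f \<in> Cp X" "\<And>x. f x \<le> 1" "compactin X K" "\<And>x. x \<notin> K \<Longrightarrow> f x = 0"
  shows "ennreal (\<Phi> f) \<le> outer K"
  unfolding outer_def
  by (rule INF_greatest, rule content_upper)
     (use assms in \<open>auto simp: test_functions_def intro!: csuppI[of X K]\<close>)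

lemma riesz_regular: "radon_borel_measure X riesz_measure"
  unfolding radon_borel_measure_def
proof (intro conjI allI impI ballI)
  fix K assume "compactin X K"
  then show "emeasure riesz_measure K < \<infinity>"
    using outer_compact_finite by (simp add: emeasure_riesz compactin_sets_riesz)
next
  fix B assume "B \<in> sets riesz_measure"
  then show "emeasure riesz_measure B = (INF U\<in>{U. openin X U \<and> B \<subseteq> U}. emeasure riesz_measure U)"
    using outer_def[of B] by (simp add: emeasure_riesz openin_sets_riesz outer_open cong: INF_cong_simp)
next
  fix U assume U: "openin X U"
  have "content U \<le> (SUP K\<in>{K. compactin X K \<and> K \<subseteq> U}. emeasure riesz_measure K)"
    unfolding content_def
  proof (rule SUP_least)
    fix f assume f: "f \<in> test_functions U"
    then obtain K where K: "compactin X K" "K \<subseteq> U" "\<And>x. x \<notin> K \<Longrightarrow> f x = 0"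
      unfolding csupp_def test_functions_def by blast
    have "ennreal (\<Phi> f) \<le> outer K"
      using f K by (intro Phi_le_outer) (auto simp: test_functions_def)
    also have "\<dots> = emeasure riesz_measure K" by (simp add: emeasure_riesz compactin_sets_riesz K)
    also have "\<dots> \<le> (SUP K\<in>{K. compactin X K \<and> K \<subseteq> U}. emeasure riesz_measure K)"
      using K by (intro SUP_upper) auto
    finally show "ennreal (\<Phi> f) \<le> (SUP K\<in>{K. compactin X K \<and> K \<subseteq> U}. emeasure riesz_measure K)" .
  qed
  moreover have "(SUP K\<in>{K. compactin X K \<and> K \<subseteq> U}. emeasure riesz_measure K) \<le> emeasure riesz_measure U"
    by (intro SUP_least emeasure_mono) (auto intro: openin_sets_riesz U)
  ultimately show "emeasure riesz_measure U = (SUP K\<in>{K. compactin X K \<and> K \<subseteq> U}. emeasure riesz_measure K)"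
    using U by (intro antisym) (auto simp: emeasure_riesz openin_sets_riesz outer_open)
qed (auto simp: space_riesz sets_riesz)

end

section \<open>Measurability and integrability for Radon measures\<close>

lemma radon_borel_measureD:
  assumes "radon_borel_measure X M"
  shows "space M = topspace X" "sets M = sigma_sets (topspace X) {U. openin X U}"
    "compactin X K \<Longrightarrow> emeasure M K < \<infinity>"
    "B \<in> sets M \<Longrightarrow> emeasure M B = (INF U\<in>{U. openin X U \<and> B \<subseteq> U}. emeasure M U)"
    "openin X U \<Longrightarrow> emeasure M U = (SUP K\<in>{K. compactin X K \<and> K \<subseteq> U}. emeasure M K)"
  using assms unfolding radon_borel_measure_def by auto

lemma radon_openin_sets: "radon_borel_measure X M \<Longrightarrow> openin X U \<Longrightarrow> U \<in> sets M"
  by (simp add: radon_borel_measureD(2) sigma_sets.Basic)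

lemma borel_measurable_open_piece:
  fixes f :: "'x \<Rightarrow> 'b::{topological_space, zero}"
  assumes M: "radon_borel_measure X M" and V: "openin X V"
    and f: "continuous_map (subtopology X V) euclidean f" and z: "\<And>x. x \<notin> V \<Longrightarrow> f x = 0"
  shows "f \<in> borel_measurable M"
proof (rule borel_measurableI)
  fix S :: "'b set" assume "open S"
  have VX: "V \<subseteq> topspace X" using V by (rule openin_subset)
  have "openin (subtopology X V) {x \<in> topspace (subtopology X V). f x \<in> S}"
    using f \<open>open S\<close> by (auto simp: continuous_map_def)
  then have 1: "{x \<in> V. f x \<in> S} \<in> sets M"
    using V VX by (intro radon_openin_sets[OF M]) (simp add: openin_open_subtopology Int_absorb1)
  have "f -` S \<inter> space M = {x \<in> V. f x \<in> S} \<union> (if 0 \<in> S then space M - V else {})"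
    using VX z by (auto simp: radon_borel_measureD(1)[OF M] split: if_splits) (metis)+
  also have "\<dots> \<in> sets M" using 1 radon_openin_sets[OF M V] by auto
  finally show "f -` S \<inter> space M \<in> sets M" .
qed

context locally_compact_Hausdorff begin

lemma radon_compactin_sets:
  assumes "radon_borel_measure X M" "compactin X K"
  shows "K \<in> sets M"
proof -
  have "space M - (topspace X - K) \<in> sets M"
    using compact_closed[OF assms(2)] assms(1)
    by (intro sets.compl_sets radon_openin_sets[of X M]) (auto simp: openin_diff)
  moreover have "space M - (topspace X - K) = K"
    using compactin_subset_topspace[OF assms(2)] by (auto simp: radon_borel_measureD(1)[OF assms(1)])
  ultimately show ?thesis by simp
qed

lemma integrable_open_piece:
  fixes f :: "'x \<Rightarrow> 'b::{banach, second_countable_topology}"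
  assumes M: "radon_borel_measure X M" and V: "openin X V"
    and f: "continuous_map (subtopology X V) euclidean f" and z: "\<And>x. x \<notin> V \<Longrightarrow> f x = 0"
    and K: "compactin X K" "\<And>x. x \<notin> K \<Longrightarrow> f x = 0" and B: "\<And>x. norm (f x) \<le> B"
  shows "integrable M f"
proof (rule integrableI_bounded_set[of K _ _ B])
  show "f \<in> borel_measurable M" by (rule borel_measurable_open_piece[OF M V f z])
qed (use K B radon_borel_measureD(3)[OF M K(1)] in \<open>auto simp: radon_compactin_sets[OF M]\<close>)

lemma integrable_csupp:
  fixes f :: "'x \<Rightarrow> 'b::{banach, second_countable_topology}"
  assumes M: "radon_borel_measure X M" and f: "continuous_map X euclidean f" "csupp X U f"
  shows "integrable M f"
proof -
  obtain K where K: "compactin X K" "\<And>x. x \<notin> K \<Longrightarrow> f x = 0"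
    using f(2) unfolding csupp_def by blast
  obtain c where c: "\<And>x. norm (f x) \<le> c" using bounded_csupp[OF f] by blast
  have "x \<notin> topspace X \<Longrightarrow> f x = 0" for x
    using K(2) compactin_subset_topspace[OF K(1)] by blast
  then show ?thesis
    using integrable_open_piece[OF M openin_topspace _ _ K c] f(1) by simp
qed

end

section \<open>The Riesz measure represents the functional\<close>

context positive_functional begin

text \<open>For \<open>a < 1\<close> the set where \<open>g > a\<close> is an open neighbourhood of
  \<open>K\<close>, and every test function of it is at most \<open>g / a\<close>. This gives the
  bound \<open>\<Phi> g / a\<close>, and \<open>a\<close> tends to 1.\<close>

lemma outer_level_le:
  assumes g: "g \<in> Cp X" and K: "K \<in> sets riesz_measure" "\<And>x. x \<in> K \<Longrightarrow> 1 \<le> g x"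
  shows "emeasure riesz_measure K \<le> ennreal (\<Phi> g)"
proof -
  have le: "outer K \<le> ennreal (\<Phi> g / a)" if a: "0 < a" "a < 1" for a
  proof -
    let ?W = "{x \<in> topspace X. g x \<in> {a<..}}"
    have W: "openin X ?W"
      using Cp_D(1)[OF g] by (rule openin_continuous_map_preimage) simp
    have "K \<subseteq> ?W" using K sets.sets_into_space[OF K(1)] a by (fastforce simp: space_riesz)
    then have "outer K \<le> outer ?W" by (rule outer_mono)
    also have "\<dots> = content ?W" by (rule outer_open[OF W])
    also have "\<dots> \<le> ennreal (\<Phi> g / a)"
      unfolding content_def
    proof (rule SUP_least)
      fix \<phi> assume \<phi>: "\<phi> \<in> test_functions ?W"
      then have p: "\<phi> \<in> Cp X" "\<phi> x \<le> 1" "x \<notin> ?W \<Longrightarrow> \<phi> x = 0" for x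
        by (auto simp: test_functions_def csupp_def)
      have "\<phi> x \<le> (1 / a) * g x" for x
      proof (cases "x \<in> ?W")
        case True
        have "a * \<phi> x \<le> a" using mult_left_mono[OF p(2)[of x], of a] a by simp
        also have "a \<le> g x" using True by simp
        finally show ?thesis using a by (simp add: field_simps)
      qed (use p(3)[of x] a Cp_D(2)[OF g, of x] in auto)
      then have "\<Phi> \<phi> \<le> \<Phi> (\<lambda>x. (1/a) * g x)"
        using a by (intro Phi_mono p(1) Cp_scale g) auto
      then show "ennreal (\<Phi> \<phi>) \<le> ennreal (\<Phi> g / a)"
        using Phi_scale[OF g, of "1/a"] a by (intro ennreal_leI) simp
    qed
    finally show ?thesis .
  qed
  have fin: "outer K < \<infinity>" using le[of "1/2"] by (auto intro: order_le_less_trans)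
  have "z * enn2real (outer K) \<le> \<Phi> g" if "0 < z" "z < 1" for z
  proof -
    have "enn2real (outer K) \<le> \<Phi> g / z"
      using le[OF that] fin Phi_nonneg[OF g] that by (intro enn2real_leI) auto
    then show ?thesis using that by (simp add: field_simps)
  qed
  then have "enn2real (outer K) \<le> \<Phi> g" by (rule field_le_mult_one_interval)
  then have "outer K \<le> ennreal (\<Phi> g)"
    using fin by (metis ennreal_enn2real ennreal_leI infinity_ennreal_def)
  then show ?thesis using emeasure_riesz[OF K(1)] by simp
qed

text \<open>Cuts the height \<open>y\<close>, capped at \<open>n\<close>, into unit slices: the
  source of the layer-cake decomposition of a function.\<close>

lemma clamp_sum:
  fixes y :: real
  assumes "0 \<le> y"
  shows "(\<Sum>i<n. min (max (y - real i) 0) 1) = min y (real n)"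
  using assms by (induction n) (auto simp: min_def max_def)

text \<open>Counting only the completely filled slices loses at most one unit. The second conjunct
  carries the induction through the step in which \<open>y\<close> lies between \<open>n\<close> and
  \<open>n + 1\<close>.\<close>

lemma clamp_sum_le:
  fixes y :: real
  assumes "0 \<le> y"
  shows "min y (real n) \<le> (\<Sum>i<n. if real i + 1 \<le> y then 1 else 0) + 1
    \<and> (real n \<le> y \<longrightarrow> (\<Sum>i<n. if real i + 1 \<le> y then 1 else 0) = real n)"
  using assms by (induction n) (auto simp: min_def split: if_splits)

text \<open>Layer-cake argument: \<open>n * f\<close> is the sum of the slices \<open>F i\<close>,
  the full levels satisfy \<open>measure (A i) \<le> \<Phi> (F i)\<close> by
  \<open>outer_level_le\<close>, and what the levels miss is at most 1 on \<open>K\<close>. So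
  \<open>n\<close> times the integral exceeds \<open>n * \<Phi> f\<close> by at most the measure of
  \<open>K\<close>, for every positive \<open>n\<close>.\<close>

lemma integral_le_Phi_1:
  assumes f: "f \<in> Cp X" "\<And>x. f x \<le> 1"
  shows "(\<integral>x. f x \<partial>riesz_measure) \<le> \<Phi> f"
proof -
  let ?M = riesz_measure
  note M = riesz_regular
  obtain K where K: "compactin X K" "\<And>x. x \<notin> K \<Longrightarrow> f x = 0"
    using Cp_D(3)[OF f(1)] unfolding csupp_def by blast
  have Ks: "K \<in> sets ?M" by (rule compactin_sets_riesz[OF K(1)])
  have Kf: "emeasure ?M K < \<infinity>" using radon_borel_measureD(3)[OF M K(1)] .
  have int: "integrable ?M f" using integrable_csupp[OF M] Cp_D[OF f(1)] by blast
  have bound: "real n * (\<integral>x. f x \<partial>?M) \<le> real n * \<Phi> f + measure ?M K" if n: "0 < n" for n :: nat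
  proof -
    define F where "F i x = min (max (real n * f x - real i) 0) 1" for i x
    have F: "F i \<in> Cp X" for i
      unfolding F_def Cp_def using Cp_D[OF f(1)]
      by (auto intro!: continuous_intros continuous_map_real_mult_left intro: csupp_weaken)
    have Fs: "(\<lambda>x. \<Sum>i<m. F i x) \<in> Cp X \<and> \<Phi> (\<lambda>x. \<Sum>i<m. F i x) = (\<Sum>i<m. \<Phi> (F i))" for m
    proof (induction m)
      case (Suc m)
      then show ?case using Phi_add[OF _ F, of "\<lambda>x. \<Sum>i<m. F i x"] Cp_add[OF _ F, of "\<lambda>x. \<Sum>i<m. F i x"] by simp
    qed (simp add: Cp_0 Phi_0)
    have "(\<lambda>x. \<Sum>i<n. F i x) = (\<lambda>x. real n * f x)"
      unfolding F_def using clamp_sum[of "real n * f _" n] f(2) Cp_D(2)[OF f(1)] n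
      by (auto simp: min_def)
    then have sumPhi: "(\<Sum>i<n. \<Phi> (F i)) = real n * \<Phi> f"
      using Fs[of n] Phi_scale[OF f(1), of "real n"] by simp
    define A where "A i = {x \<in> space ?M. 1 \<le> F i x}" for i
    have Fm: "F i \<in> borel_measurable ?M" for i
      using integrable_csupp[OF M] Cp_D[OF F] borel_measurable_integrable by blast
    have A: "A i \<in> sets ?M" for i
      unfolding A_def using Fm[of i] by measurable
    have Afin: "emeasure ?M (A i) \<le> ennreal (\<Phi> (F i))" for i
      by (rule outer_level_le[OF F A]) (simp add: A_def)
    then have Afin2: "emeasure ?M (A i) < \<infinity>" for i
      using order_le_less_trans[OF Afin ennreal_less_top] by simp
    have Am: "measure ?M (A i) \<le> \<Phi> (F i)" for i
      using Afin[of i] Phi_nonneg[OF F, of i] by (simp add: measure_def enn2real_leI)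
    have pw: "real n * f x \<le> (\<Sum>i<n. indicat_real (A i) x) + indicat_real K x" if x: "x \<in> space ?M" for x
    proof (cases "x \<in> K")
      case True
      have "(1 \<le> F i x) = (real i + 1 \<le> real n * f x)" for i
        by (auto simp: F_def)
      then have "indicat_real (A i) x = (if real i + 1 \<le> real n * f x then 1 else 0)" for i
        using x by (auto simp: A_def indicator_def)
      then show ?thesis
        using clamp_sum_le[of "real n * f x" n] f(2)[of x] Cp_D(2)[OF f(1), of x] True n
        by (auto simp: min_def mult_le_cancel_left1 split: if_splits)
    qed (use K in \<open>auto intro!: sum_nonneg\<close>)
    have "real n * (\<integral>x. f x \<partial>?M) = (\<integral>x. real n * f x \<partial>?M)" by simp
    also have "\<dots> \<le> (\<integral>x. (\<Sum>i<n. indicat_real (A i) x) + indicat_real K x \<partial>?M)"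
      using Afin2 Kf A Ks int pw by (intro integral_mono) auto
    also have "\<dots> = (\<Sum>i<n. measure ?M (A i)) + measure ?M K"
      using Afin2 Kf A Ks by (simp add: Bochner_Integration.integral_sum)
    also have "\<dots> \<le> real n * \<Phi> f + measure ?M K"
      using sum_mono[of "{..<n}" "\<lambda>i. measure ?M (A i)", OF Am] sumPhi by simp
    finally show ?thesis .
  qed
  show ?thesis
  proof (rule ccontr)
    assume "\<not> ?thesis"
    then have d: "(\<integral>x. f x \<partial>?M) - \<Phi> f > 0" by simp
    then obtain n where n: "measure ?M K < real n * ((\<integral>x. f x \<partial>?M) - \<Phi> f)"
      using reals_Archimedean3 by blast
    moreover have "n > 0" using n by (cases n) (auto simp: not_less)
    ultimately show False using bound[of n] by (simp add: algebra_simps)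
  qed
qed

lemma integral_le_Phi:
  assumes f: "f \<in> Cp X"
  shows "(\<integral>x. f x \<partial>riesz_measure) \<le> \<Phi> f"
proof -
  obtain c where c: "c > 0" "\<And>x. \<bar>f x\<bar> \<le> c"
    using bounded_csupp Cp_D(1,3)[OF f] by (metis real_norm_def)
  have "(\<integral>x. (1/c) * f x \<partial>riesz_measure) \<le> \<Phi> (\<lambda>x. (1/c) * f x)"
    using c by (intro integral_le_Phi_1 Cp_scale f) (auto simp: field_simps abs_le_iff)
  then show ?thesis
    using c(1) Phi_scale[OF f, of "1/c"] by (simp add: field_simps)
qed

text \<open>The missing inequality comes from \<open>integral_le_Phi\<close> applied to
  \<open>c * k - f\<close>, where \<open>k\<close> is 1 on the carrier of \<open>f\<close>: this
  reverses the sign of \<open>f\<close> at the price of comparing \<open>\<Phi> k\<close> with the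
  integral of \<open>k\<close>.\<close>

lemma integral_eq_Phi:
  assumes f: "f \<in> Cp X"
  shows "(\<integral>x. f x \<partial>riesz_measure) = \<Phi> f"
proof (rule antisym[OF integral_le_Phi[OF f]])
  let ?M = riesz_measure
  note M = riesz_regular
  obtain K where K: "compactin X K" "\<And>x. x \<notin> K \<Longrightarrow> f x = 0"
    using Cp_D(3)[OF f] unfolding csupp_def by blast
  obtain c where c: "c > 0" "\<And>x. \<bar>f x\<bar> \<le> c"
    using bounded_csupp Cp_D(1,3)[OF f] by (metis real_norm_def)
  have int: "integrable ?M g" if "g \<in> Cp X" for g
    using integrable_csupp[OF M] Cp_D[OF that] by blast
  have Ks: "K \<in> sets ?M" by (rule compactin_sets_riesz[OF K(1)])
  have Kf: "emeasure ?M K < \<infinity>" using radon_borel_measureD(3)[OF M K(1)] .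
  have "\<Phi> f \<le> (\<integral>x. f x \<partial>?M) + c * e" if e: "0 < e" for e
  proof -
    have "outer K < outer K + ennreal e"
      using e outer_compact_finite[OF K(1)] by (simp add: less_top)
    \<comment> \<open>The neighbourhood is chosen tight, so that a cutoff \<open>k\<close> carried
      in it has \<open>\<Phi> k\<close> at most \<open>measure K + e\<close>, while the integral of
      \<open>k\<close> is at least the measure of \<open>K\<close>.\<close>
    then obtain W where W: "openin X W" "K \<subseteq> W" "content W < outer K + ennreal e"
      unfolding outer_def[of K] INF_less_iff by blast
    obtain k V where k: "k \<in> Cp X" "\<forall>x. k x \<le> 1" "csupp X W k" "K \<subseteq> V" "\<forall>x\<in>V. k x = 1"
      using bump[OF K(1) W(1,2)] by blast
    have le: "f x \<le> c * k x" for x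
      using c K(2)[of x] k(4,5) Cp_D(2)[OF k(1), of x] by (cases "x \<in> K") (auto simp: abs_le_iff)
    have "(\<integral>x. c * k x - f x \<partial>?M) \<le> \<Phi> (\<lambda>x. c * k x - f x)"
      using c(1) by (intro integral_le_Phi Cp_diff Cp_scale k(1) f le) auto
    moreover have "\<Phi> (\<lambda>x. c * k x - f x) = c * \<Phi> k - \<Phi> f"
      using Phi_add[OF f, of "\<lambda>x. c * k x - f x"] Phi_scale[OF k(1), of c] c(1)
        Cp_diff[OF Cp_scale[OF k(1), of c] f le] by simp
    moreover have "(\<integral>x. c * k x - f x \<partial>?M) = c * (\<integral>x. k x \<partial>?M) - (\<integral>x. f x \<partial>?M)"
      using int[OF k(1)] int[OF f] by simp
    moreover have "\<Phi> k \<le> (\<integral>x. k x \<partial>?M) + e"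
    proof -
      have "ennreal (\<Phi> k) \<le> content W"
        using k by (intro content_upper) (auto simp: test_functions_def)
      also have "\<dots> \<le> outer K + ennreal e" using W(3) by simp
      also have "outer K = ennreal (measure ?M K)"
        using emeasure_riesz[OF Ks] Kf by (simp add: measure_def)
      also have "\<dots> + ennreal e = ennreal (measure ?M K + e)"
        using e by (simp add: ennreal_plus)
      finally have "\<Phi> k \<le> measure ?M K + e"
        using e by (subst (asm) ennreal_le_iff) auto
      also have "measure ?M K = (\<integral>x. indicat_real K x \<partial>?M)"
        using Ks sets.sets_into_space[OF Ks] by (simp add: Int_absorb2)
      also have "\<dots> \<le> (\<integral>x. k x \<partial>?M)"
      proof (rule integral_mono)
        show "integrable ?M (indicat_real K)" using Ks Kf by (rule integrable_real_indicator)
        show "indicat_real K x \<le> k x" for x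
          using k(4,5) Cp_D(2)[OF k(1), of x] by (cases "x \<in> K") auto
      qed (rule int[OF k(1)])
      finally show ?thesis by simp
    qed
    then have "c * \<Phi> k \<le> c * ((\<integral>x. k x \<partial>?M) + e)" using c(1) by (intro mult_left_mono) auto
    ultimately show ?thesis by (simp add: algebra_simps)
  qed
  from this[of "_ / c"] have "\<Phi> f \<le> (\<integral>x. f x \<partial>?M) + e" if "0 < e" for e
    using that c(1) by simp
  then show "\<Phi> f \<le> (\<integral>x. f x \<partial>?M)" by (rule field_le_epsilon)
qed

end

section \<open>Jordan decomposition of real Radon functionals\<close>

definition Cc_linear :: "'x topology \<Rightarrow> (('x \<Rightarrow> complex) \<Rightarrow> complex) \<Rightarrow> bool" where
  "Cc_linear X \<mu> \<longleftrightarrow>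
     (\<forall>f\<in>Cc X. \<forall>h\<in>Cc X. \<mu> (\<lambda>x. f x + h x) = \<mu> f + \<mu> h) \<and>
     (\<forall>c. \<forall>f\<in>Cc X. \<mu> (\<lambda>x. c * f x) = c * \<mu> f)"

lemma real_radon_linear: "real_radon X \<mu> \<Longrightarrow> Cc_linear X \<mu>"
  by (simp add: real_radon_def Cc_linear_def)

lemma real_radon_cnj: "real_radon X \<mu> \<Longrightarrow> f \<in> Cc X \<Longrightarrow> \<mu> (\<lambda>x. cnj (f x)) = cnj (\<mu> f)"
  by (simp add: real_radon_def)

lemma real_radon_bound:
  assumes "real_radon X \<mu>" "compactin X K"
  obtains C where "\<And>f. f \<in> Cc X \<Longrightarrow> (\<And>x. x \<notin> K \<Longrightarrow> f x = 0) \<Longrightarrow> cmod (\<mu> f) \<le> C * (SUP x. cmod (f x))"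
  using assms unfolding real_radon_def by meson

lemma Cc_D:
  assumes "f \<in> Cc X"
  shows "continuous_map X euclidean f" "csupp X UNIV f"
  using assms by (auto simp: Cc_iff)

lemma Cc_add: "f \<in> Cc X \<Longrightarrow> g \<in> Cc X \<Longrightarrow> (\<lambda>x. f x + g x) \<in> Cc X"
  unfolding Cc_iff by (auto intro!: continuous_map_add intro: csupp_combine[of X UNIV f g])

lemma Cc_scale: "f \<in> Cc X \<Longrightarrow> (\<lambda>x. c * f x) \<in> Cc X"
  unfolding Cc_iff by (auto intro!: continuous_map_times intro: csupp_weaken[of X UNIV f])

lemma Cc_mult: "f \<in> Cc X \<Longrightarrow> continuous_map X euclidean g \<Longrightarrow> (\<lambda>x. f x * g x) \<in> Cc X"
  unfolding Cc_iff by (auto intro!: continuous_map_times intro: csupp_weaken[of X UNIV f])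

lemma Cc_cnj: "f \<in> Cc X \<Longrightarrow> (\<lambda>x. cnj (f x)) \<in> Cc X"
  unfolding Cc_iff
  by (auto intro!: continuous_map_compose_continuous_on[of _ _ cnj] continuous_intros intro: csupp_weaken[of X UNIV f])

lemma continuous_map_of_real:
  "continuous_map X euclideanreal f \<Longrightarrow> continuous_map X euclidean (\<lambda>x. complex_of_real (f x))"
  by (rule continuous_map_compose_continuous_on) (auto intro!: continuous_intros)

lemma Cc_of_real: "f \<in> Cp X \<Longrightarrow> (\<lambda>x. complex_of_real (f x)) \<in> Cc X"
  unfolding Cp_def Cc_iff by (auto intro!: continuous_map_of_real intro: csupp_weaken[of X UNIV f])

text \<open>Positive and negative parts of the real and imaginary parts write \<open>h\<close> as a
  combination of four members of \<open>Cp X\<close>.\<close>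

lemma Cc_linear_eq:
  assumes L: "Cc_linear X \<mu>" "Cc_linear X \<nu>"
    and eq: "\<And>f. f \<in> Cp X \<Longrightarrow> \<mu> (\<lambda>x. complex_of_real (f x)) = \<nu> (\<lambda>x. complex_of_real (f x))"
    and h: "h \<in> Cc X"
  shows "\<mu> h = \<nu> h"
proof -
  have C: "(\<lambda>x. max (g (h x)) 0) \<in> Cp X" if "continuous_on UNIV g" "g 0 = 0" for g :: "complex \<Rightarrow> real"
    using that continuous_map_compose_continuous_on[OF Cc_D(1)[OF h] that(1)] Cc_D(2)[OF h]
    by (auto simp: Cp_def intro!: continuous_intros intro: csupp_weaken[of X UNIV h])
  have 1: "(\<lambda>x. max (Re (h x)) 0) \<in> Cp X" "(\<lambda>x. max (- Re (h x)) 0) \<in> Cp X"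
    "(\<lambda>x. max (Im (h x)) 0) \<in> Cp X" "(\<lambda>x. max (- Im (h x)) 0) \<in> Cp X"
    by (intro C continuous_intros; simp)+
  let ?f = "\<lambda>x. ((complex_of_real (max (Re (h x)) 0) + (-1) * complex_of_real (max (- Re (h x)) 0))
      + \<i> * complex_of_real (max (Im (h x)) 0)) + (-\<i>) * complex_of_real (max (- Im (h x)) 0)"
  have h': "h = ?f" by (auto simp: complex_eq_iff max_def)
  note c = 1[THEN Cc_of_real]
  have "\<kappa> ?f = ((\<kappa> (\<lambda>x. complex_of_real (max (Re (h x)) 0)) + (-1) * \<kappa> (\<lambda>x. complex_of_real (max (- Re (h x)) 0)))
      + \<i> * \<kappa> (\<lambda>x. complex_of_real (max (Im (h x)) 0))) + (-\<i>) * \<kappa> (\<lambda>x. complex_of_real (max (- Im (h x)) 0))"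
    if "Cc_linear X \<kappa>" for \<kappa>
  proof -
    have a: "f \<in> Cc X \<Longrightarrow> g \<in> Cc X \<Longrightarrow> \<kappa> (\<lambda>x. f x + g x) = \<kappa> f + \<kappa> g"
      and s: "f \<in> Cc X \<Longrightarrow> \<kappa> (\<lambda>x. d * f x) = d * \<kappa> f" for f g d
      using that by (auto simp: Cc_linear_def)
    show ?thesis
      using c by (simp only: a s Cc_add Cc_scale)
  qed
  from this[OF L(1)] this[OF L(2)] show ?thesis
    using eq[OF 1(1)] eq[OF 1(2)] eq[OF 1(3)] eq[OF 1(4)] h' by metis
qed

context locally_compact_Hausdorff begin

lemma integral_Cc_linear:
  assumes "radon_borel_measure X M" "radon_borel_measure X N"
  shows "Cc_linear X (\<lambda>h. (\<integral>x. h x \<partial>M) - (\<integral>x. h x \<partial>N))"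
proof -
  have "integrable M f" "integrable N f" if "f \<in> Cc X" for f :: "'x \<Rightarrow> complex"
    using integrable_csupp assms Cc_D[OF that] by blast+
  then show ?thesis by (auto simp: Cc_linear_def algebra_simps)
qed

lemma real_radon_of_real:
  assumes \<mu>: "real_radon X \<mu>" and f: "f \<in> Cp X"
  shows "\<mu> (\<lambda>x. complex_of_real (f x)) = complex_of_real (Re (\<mu> (\<lambda>x. complex_of_real (f x))))"
proof -
  have "\<mu> (\<lambda>x. cnj (complex_of_real (f x))) = cnj (\<mu> (\<lambda>x. complex_of_real (f x)))"
    by (rule real_radon_cnj[OF \<mu> Cc_of_real[OF f]])
  then show ?thesis by (simp add: complex_eq_iff)
qed

text \<open>Lets a positive functional be represented in the same two-measure format as a real one;
  positivity of the trace is later read off from the second measure being null. Sets of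
  \<open>M\<close> lie in \<open>topspace X\<close>, so the infimum is over a nonempty
  family.\<close>

lemma radon_null_measure:
  assumes "radon_borel_measure X M"
  shows "radon_borel_measure X (null_measure M)"
  unfolding radon_borel_measure_def
proof (intro conjI allI impI ballI)
  fix B assume "B \<in> sets (null_measure M)"
  then have "B \<subseteq> topspace X"
    using sets.sets_into_space[of B M] by (simp add: radon_borel_measureD(1)[OF assms])
  then have "{U. openin X U \<and> B \<subseteq> U} \<noteq> {}" by blast
  then show "emeasure (null_measure M) B = (INF U\<in>{U. openin X U \<and> B \<subseteq> U}. emeasure (null_measure M) U)"
    by simp
next
  fix U assume "openin X U"
  have "{K. compactin X K \<and> K \<subseteq> U} \<noteq> {}" by (auto intro: exI[of _ "{}"])
  then show "emeasure (null_measure M) U = (SUP K\<in>{K. compactin X K \<and> K \<subseteq> U}. emeasure (null_measure M) K)"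
    by simp
qed (use radon_borel_measureD[OF assms] in simp_all)

theorem positive_radon_representation:
  assumes \<mu>: "positive_radon X \<mu>"
  shows "\<exists>M. radon_borel_measure X M \<and> (\<forall>h\<in>Cc X. \<mu> h = (\<integral>x. h x \<partial>M) - (\<integral>x. h x \<partial>null_measure M))"
proof -
  have r: "real_radon X \<mu>" using \<mu> by (simp add: positive_radon_def)
  note L = real_radon_linear[OF r]
  define \<Phi> where "\<Phi> f = Re (\<mu> (\<lambda>x. complex_of_real (f x)))" for f
  interpret positive_functional X \<Phi>
  proof
    fix f g :: "'x \<Rightarrow> real" and c :: real
    assume f: "f \<in> Cp X"
    note F = Cc_of_real[OF f]
    show "\<Phi> (\<lambda>x. f x + g x) = \<Phi> f + \<Phi> g" if "g \<in> Cp X"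
      using L F Cc_of_real[OF that] by (auto simp: \<Phi>_def Cc_linear_def)
    show "\<Phi> (\<lambda>x. c * f x) = c * \<Phi> f"
      using L F by (auto simp: \<Phi>_def Cc_linear_def)
    have "\<mu> (\<lambda>x. complex_of_real (f x)) \<in> \<real>\<^sub>\<ge>\<^sub>0"
      using \<mu> F Cp_D(2)[OF f] unfolding positive_radon_def by auto
    then show "0 \<le> \<Phi> f" by (auto simp: \<Phi>_def elim: nonneg_Reals_cases)
  qed
  have "\<mu> h = (\<integral>x. h x \<partial>riesz_measure) - (\<integral>x. h x \<partial>null_measure riesz_measure)" if "h \<in> Cc X" for h
  proof (rule Cc_linear_eq[OF L integral_Cc_linear _ that])
    fix f assume f: "f \<in> Cp X"
    then show "\<mu> (\<lambda>x. complex_of_real (f x)) = (\<integral>x. complex_of_real (f x) \<partial>riesz_measure) -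
        (\<integral>x. complex_of_real (f x) \<partial>null_measure riesz_measure)"
      using integral_eq_Phi[OF f] real_radon_of_real[OF r f] by (simp add: \<Phi>_def)
  qed (use riesz_regular radon_null_measure in auto)
  then show ?thesis using riesz_regular by blast
qed

text \<open>Jordan decomposition: \<open>P\<close> is the upper variation of the real functional
  \<open>m\<close>, and both \<open>P\<close> and \<open>P - m\<close> are positive on the cone;
  each is represented by its own Riesz measure.\<close>

theorem real_radon_representation:
  assumes \<mu>: "real_radon X \<mu>"
  shows "\<exists>M N. radon_borel_measure X M \<and> radon_borel_measure X N \<and>
    (\<forall>h\<in>Cc X. \<mu> h = (\<integral>x. h x \<partial>M) - (\<integral>x. h x \<partial>N))"
proof -
  note L = real_radon_linear[OF \<mu>]
  define m where "m f = Re (\<mu> (\<lambda>x. complex_of_real (f x)))" for f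
  have madd: "m (\<lambda>x. f x + g x) = m f + m g" if "f \<in> Cp X" "g \<in> Cp X" for f g
    using L that[THEN Cc_of_real] by (auto simp: m_def Cc_linear_def)
  have mscale: "m (\<lambda>x. c * f x) = c * m f" if "f \<in> Cp X" for f c
    using L that[THEN Cc_of_real] by (auto simp: m_def Cc_linear_def)
  define S where "S f = {g \<in> Cp X. \<forall>x. g x \<le> f x}" for f
  define P where "P f = Sup (m ` S f)" for f
  \<comment> \<open>Continuity for the inductive limit topology is used here: all \<open>g\<close>
    below \<open>f\<close> share the carrier \<open>K\<close> of \<open>f\<close>, so one constant
    bounds \<open>m g\<close> and the supremum is finite.\<close>
  have bdd: "bdd_above (m ` S f)" if f: "f \<in> Cp X" for f
  proof -
    obtain K where K: "compactin X K" "\<And>x. x \<notin> K \<Longrightarrow> f x = 0"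
      using Cp_D(3)[OF f] unfolding csupp_def by blast
    obtain c where c: "c > 0" "\<And>x. \<bar>f x\<bar> \<le> c"
      using bounded_csupp Cp_D(1,3)[OF f] by (metis real_norm_def)
    obtain C where C: "\<And>g. g \<in> Cc X \<Longrightarrow> (\<And>x. x \<notin> K \<Longrightarrow> g x = 0) \<Longrightarrow> cmod (\<mu> g) \<le> C * (SUP x. cmod (g x))"
      using real_radon_bound[OF \<mu> K(1)] by blast
    have "m g \<le> \<bar>C\<bar> * c" if g: "g \<in> S f" for g
    proof -
      have g': "g \<in> Cp X" "g x \<le> f x" "0 \<le> g x" for x using g Cp_D(2) by (auto simp: S_def)
      have z: "g x = 0" if "x \<notin> K" for x using g'(2,3)[of x] K(2)[OF that] by simp
      have b: "cmod (complex_of_real (g x)) \<le> c" for x using g'(2,3)[of x] c(2)[of x] by (simp add: abs_le_iff)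
      have "m g \<le> cmod (\<mu> (\<lambda>x. complex_of_real (g x)))" unfolding m_def by (rule complex_Re_le_cmod)
      also have "\<dots> \<le> C * (SUP x. cmod (complex_of_real (g x)))"
        using z by (intro C Cc_of_real g'(1)) auto
      also have "\<dots> \<le> \<bar>C\<bar> * (SUP x. cmod (complex_of_real (g x)))"
      proof (rule mult_right_mono[OF abs_ge_self])
        have "bdd_above (range (\<lambda>x. cmod (complex_of_real (g x))))" using b by (intro bdd_aboveI2)
        then have "cmod (complex_of_real (g undefined)) \<le> (SUP x. cmod (complex_of_real (g x)))"
          by (intro cSUP_upper) auto
        then show "0 \<le> (SUP x. cmod (complex_of_real (g x)))" by (meson norm_ge_zero order_trans)
      qed
      also have "\<dots> \<le> \<bar>C\<bar> * c" by (intro mult_left_mono cSUP_least b) auto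
      finally show ?thesis .
    qed
    then show ?thesis by (intro bdd_aboveI2)
  qed
  have zero: "(\<lambda>x. 0) \<in> S f" if "f \<in> Cp X" for f
    using Cp_D(2)[OF that] by (auto simp: S_def Cp_0)
  have m0: "m (\<lambda>x. 0) = 0" using mscale[OF Cp_0, of 0] by simp
  have up: "m g \<le> P f" if "f \<in> Cp X" "g \<in> S f" for f g
    unfolding P_def using that by (intro cSup_upper bdd) auto
  have least: "P f \<le> c" if "f \<in> Cp X" "\<And>g. g \<in> S f \<Longrightarrow> m g \<le> c" for f c
    unfolding P_def using that zero by (intro cSup_least) blast+
  have Pnn: "0 \<le> P f" if "f \<in> Cp X" for f
    using up[OF that zero[OF that]] m0 by simp
  have Padd: "P (\<lambda>x. f x + g x) = P f + P g" if f: "f \<in> Cp X" and g: "g \<in> Cp X" for f g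
  proof (rule antisym)
    show "P (\<lambda>x. f x + g x) \<le> P f + P g"
    proof (rule least[OF Cp_add[OF f g]])
      fix h assume h: "h \<in> S (\<lambda>x. f x + g x)"
      then have h': "h \<in> Cp X" "h x \<le> f x + g x" for x by (auto simp: S_def)
      \<comment> \<open>Riesz decomposition: a function below \<open>f + g\<close> is a function
        below \<open>f\<close> plus one below \<open>g\<close>, the split being given by the minimum
        with \<open>f\<close>.\<close>
      have 1: "(\<lambda>x. min (h x) (f x)) \<in> S f"
        using Cp_min[OF h'(1) Cp_D(1,2)[OF f]] by (auto simp: S_def)
      have 2: "(\<lambda>x. h x - min (h x) (f x)) \<in> S g"
        using 1 Cp_diff[OF h'(1), of "\<lambda>x. min (h x) (f x)"] Cp_D(2)[OF g] h'(2)
        unfolding S_def by (auto simp: min_def diff_le_eq add.commute)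
      have "m h = m (\<lambda>x. min (h x) (f x)) + m (\<lambda>x. h x - min (h x) (f x))"
        using madd[of "\<lambda>x. min (h x) (f x)" "\<lambda>x. h x - min (h x) (f x)"] 1 2 by (simp add: S_def)
      then show "m h \<le> P f + P g" using up[OF f 1] up[OF g 2] by simp
    qed
    have "m a + m b \<le> P (\<lambda>x. f x + g x)" if "a \<in> S f" "b \<in> S g" for a b
      using up[OF Cp_add[OF f g], of "\<lambda>x. a x + b x"] that madd[of a b]
      by (auto simp: S_def intro!: Cp_add add_mono)
    then have "m a \<le> P (\<lambda>x. f x + g x) - m b" if "a \<in> S f" "b \<in> S g" for a b
      using that by (simp add: algebra_simps)
    then have "P f \<le> P (\<lambda>x. f x + g x) - m b" if "b \<in> S g" for b
      using that by (intro least f)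
    then have "m b \<le> P (\<lambda>x. f x + g x) - P f" if "b \<in> S g" for b
      using that by (simp add: algebra_simps)
    then have "P g \<le> P (\<lambda>x. f x + g x) - P f" by (intro least g)
    then show "P f + P g \<le> P (\<lambda>x. f x + g x)" by simp
  qed
  have Pscale_le: "P (\<lambda>x. c * f x) \<le> c * P f" if f: "f \<in> Cp X" and c: "0 < c" for c f
  proof (rule least[OF Cp_scale[OF f]])
    fix h assume h: "h \<in> S (\<lambda>x. c * f x)"
    then have "(\<lambda>x. (1/c) * h x) \<in> S f" using c by (auto simp: S_def field_simps dest: Cp_scale[of h X "1/c"])
    from up[OF f this] have "(1/c) * m h \<le> P f"
      using mscale[of h "1/c"] h by (simp add: S_def)
    then show "m h \<le> c * P f" using c by (simp add: field_simps)
  qed (use c in simp)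
  have Pscale: "P (\<lambda>x. c * f x) = c * P f" if f: "f \<in> Cp X" and c: "0 \<le> c" for c f
  proof (cases "c = 0")
    case True
    have "S (\<lambda>x. 0) = {\<lambda>x. 0}" using zero[OF Cp_0] by (auto simp: S_def Cp_def intro!: ext antisym)
    then show ?thesis using True m0 by (simp add: P_def)
  next
    case False
    then have c: "0 < c" using c by simp
    show ?thesis
      using Pscale_le[OF f c] Pscale_le[OF Cp_scale[OF f], of c "1/c"] c
      by (auto simp: field_simps)
  qed
  interpret P: positive_functional X P
    by unfold_locales (auto simp: Padd Pscale Pnn)
  interpret N: positive_functional X "\<lambda>f. P f - m f"
  proof
    show "0 \<le> P f - m f" if "f \<in> Cp X" for f
      using up[OF that, of f] that by (simp add: S_def)
  qed (auto simp: Padd Pscale madd mscale algebra_simps)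
  have "\<mu> h = (\<integral>x. h x \<partial>P.riesz_measure) - (\<integral>x. h x \<partial>N.riesz_measure)" if "h \<in> Cc X" for h
  proof (rule Cc_linear_eq[OF L integral_Cc_linear _ that])
    fix f assume f: "f \<in> Cp X"
    then show "\<mu> (\<lambda>x. complex_of_real (f x)) = (\<integral>x. complex_of_real (f x) \<partial>P.riesz_measure) -
        (\<integral>x. complex_of_real (f x) \<partial>N.riesz_measure)"
      using P.integral_eq_Phi[OF f] N.integral_eq_Phi[OF f] real_radon_of_real[OF \<mu> f] by (simp add: m_def)
  qed (use P.riesz_regular N.riesz_regular in auto)
  then show ?thesis using P.riesz_regular N.riesz_regular by blast
qed

text \<open>\<open>V\<close> may have infinite measure, so inner regularity is applied to its part
  in an open \<open>U\<close> around \<open>K\<close> that is contained in a compact set.\<close>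

lemma inner_approximation:
  assumes M: "radon_borel_measure X M" and V: "openin X V" and K: "compactin X K" and e: "0 < e"
  shows "\<exists>C. compactin X C \<and> C \<subseteq> V \<and> measure M (V \<inter> K - C) < e"
proof -
  obtain U D where U: "openin X U" "compactin X D" "K \<subseteq> U" "U \<subseteq> D"
    using compact_neighbourhood[OF K openin_topspace] compactin_subset_topspace[OF K] by blast
  have VU: "openin X (V \<inter> U)" "V \<inter> U \<in> sets M"
    using V U(1) radon_openin_sets[OF M] by auto
  have fin: "emeasure M (V \<inter> U) < \<infinity>"
  proof (rule order_le_less_trans)
    show "emeasure M (V \<inter> U) \<le> emeasure M D"
      using U(4) radon_compactin_sets[OF M U(2)] by (intro emeasure_mono) auto
  qed (rule radon_borel_measureD(3)[OF M U(2)])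
  have "\<exists>C. compactin X C \<and> C \<subseteq> V \<inter> U \<and> emeasure M (V \<inter> U) < emeasure M C + ennreal e"
  proof (rule ccontr)
    assume "\<not> ?thesis"
    then have "(SUP C\<in>{C. compactin X C \<and> C \<subseteq> V \<inter> U}. emeasure M C + ennreal e) \<le> emeasure M (V \<inter> U)"
      by (intro SUP_least) (auto simp: not_less)
    moreover have "{C. compactin X C \<and> C \<subseteq> V \<inter> U} \<noteq> {}" by (auto intro: exI[of _ "{}"])
    ultimately have "emeasure M (V \<inter> U) + ennreal e \<le> emeasure M (V \<inter> U)"
      using radon_borel_measureD(5)[OF M VU(1)] by (simp add: ennreal_SUP_add_left)
    then show False using fin e by (simp add: ennreal_le_epsilon less_top)
  qed
  then obtain C where C: "compactin X C" "C \<subseteq> V \<inter> U" "emeasure M (V \<inter> U) < emeasure M C + ennreal e"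
    by blast
  have Cs: "C \<in> sets M" by (rule radon_compactin_sets[OF M C(1)])
  have Ks: "K \<in> sets M" by (rule radon_compactin_sets[OF M K])
  have Vs: "V \<in> sets M" by (rule radon_openin_sets[OF M V])
  have "measure M (V \<inter> U) < measure M C + e"
  proof -
    have "ennreal (measure M (V \<inter> U)) < ennreal (measure M C) + ennreal e"
      using C(3) fin radon_borel_measureD(3)[OF M C(1)] by (simp add: emeasure_eq_ennreal_measure less_top)
    then show ?thesis using e by (simp add: ennreal_plus[symmetric] ennreal_less_iff del: ennreal_plus)
  qed
  moreover have "measure M (V \<inter> K - C) \<le> measure M (V \<inter> U - C)"
    using U(3) VU Cs Ks Vs fin radon_openin_sets[OF M U(1)] Vs
    by (intro measure_mono_fmeasurable fmeasurableI) 
      (auto intro: order_le_less_trans[OF emeasure_mono[of _ "V \<inter> U"]])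
  moreover have "measure M (V \<inter> U - C) = measure M (V \<inter> U) - measure M C"
    using C(2) Cs VU fin by (intro measure_Diff) (auto simp: less_top)
  ultimately have "measure M (V \<inter> K - C) < e" by simp
  then show ?thesis using C by blast
qed

end

section \<open>Discontinuous integrands\<close>

text \<open>The restriction to \<open>\<G>\<^sup>0\<close> of a section supported on one bisection: \<open>F\<close> may be discontinuous on the
  boundary of \<open>V\<close>, because a compact subset of a non-Hausdorff \<open>\<G>\<close> need not be closed.\<close>

definition compact_piece :: "'x topology \<Rightarrow> 'x set \<Rightarrow> ('x \<Rightarrow> complex) \<Rightarrow> bool" where
  "compact_piece X V F \<longleftrightarrow> openin X V \<and> continuous_map (subtopology X V) euclidean F \<and>
     (\<forall>x. x \<notin> V \<longrightarrow> F x = 0) \<and> csupp X UNIV F \<and> (\<exists>B. \<forall>x. cmod (F x) \<le> B)"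

text \<open>The bound is asked for every cutoff that is 1 on \<open>C\<close>. Hence one compact set
  can serve several measures after taking unions, and a cutoff transported along a bisection
  qualifies as well.\<close>

definition cutoff_within ::
    "'x topology \<Rightarrow> 'x measure \<Rightarrow> ('x \<Rightarrow> complex) \<Rightarrow> 'x set \<Rightarrow> real \<Rightarrow> bool" where
  "cutoff_within X M F C e \<longleftrightarrow>
    (\<forall>\<theta>. continuous_map X euclideanreal \<theta> \<longrightarrow> (\<forall>x. 0 \<le> \<theta> x \<and> \<theta> x \<le> 1) \<longrightarrow> (\<forall>x\<in>C. \<theta> x = 1) \<longrightarrow>
      cmod ((\<integral>x. F x \<partial>M) - (\<integral>x. complex_of_real (\<theta> x) * F x \<partial>M)) < e)"

lemma cutoff_within_mono: "cutoff_within X M F C e \<Longrightarrow> C \<subseteq> D \<Longrightarrow> cutoff_within X M F D e"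
  unfolding cutoff_within_def by blast

context locally_compact_Hausdorff begin

lemma compact_piece_integrable:
  assumes "radon_borel_measure X M" "compact_piece X V F"
  shows "integrable M F"
  using assms integrable_open_piece[OF assms(1)] unfolding compact_piece_def csupp_def by metis

text \<open>A cutoff carried in \<open>V\<close> removes the jump of \<open>F\<close> at the
  boundary of \<open>V\<close>, which brings a piece within reach of a functional on
  \<open>Cc X\<close>.\<close>

lemma compact_piece_times_continuous:
  assumes F: "compact_piece X V F" and \<theta>: "continuous_map X euclidean \<theta>" "csupp X V \<theta>"
  shows "(\<lambda>x. \<theta> x * F x) \<in> Cc X"
proof -
  have "continuous_map (subtopology X V) euclidean (\<lambda>x. \<theta> x * F x)"
    using F continuous_map_from_subtopology[OF \<theta>(1), of V] unfolding compact_piece_def by (auto intro!: continuous_map_times)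
  moreover have s: "csupp X V (\<lambda>x. \<theta> x * F x)" by (rule csupp_weaken[OF \<theta>(2)]) auto
  ultimately have "continuous_map X euclidean (\<lambda>x. \<theta> x * F x)"
    using F Hausdorff unfolding compact_piece_def by (intro continuous_map_extend_zero[of X V]) auto
  then show ?thesis using csupp_mono[OF s] by (auto simp: Cc_iff)
qed

lemma compact_piece_approximation_single:
  assumes M: "radon_borel_measure X M" and F: "compact_piece X V F" and e: "0 < e"
  shows "\<exists>C. compactin X C \<and> C \<subseteq> V \<and>
    cutoff_within X M F C e"
proof -
  have V: "openin X V" and F': "continuous_map (subtopology X V) euclidean F" "\<And>x. x \<notin> V \<Longrightarrow> F x = 0"
    using F by (auto simp: compact_piece_def)
  obtain K where K: "compactin X K" "\<And>x. x \<notin> K \<Longrightarrow> F x = 0"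
    using F unfolding compact_piece_def csupp_def by blast
  obtain B0 where B0: "\<And>x. cmod (F x) \<le> B0" using F unfolding compact_piece_def by blast
  \<comment> \<open>The maximum with 1 keeps the bound positive. The cut-off integrand differs from
    \<open>F\<close> only on \<open>V \<inter> K - C\<close>, by at most \<open>B\<close>, so that
    set has to have measure below \<open>e / B\<close>.\<close>
  define B where "B = max B0 1"
  have B: "0 < B" "\<And>x. cmod (F x) \<le> B" using B0 by (auto simp: B_def intro: max.coboundedI1)
  obtain C where C: "compactin X C" "C \<subseteq> V" "measure M (V \<inter> K - C) < e / B"
    using inner_approximation[OF M V K(1), of "e / B"] e B(1) by auto
  have sets: "V \<in> sets M" "K \<in> sets M" "C \<in> sets M"
    using radon_openin_sets[OF M V] radon_compactin_sets[OF M] K(1) C(1) by auto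
  have int: "integrable M F" by (rule compact_piece_integrable[OF M F])
  have fin: "emeasure M (V \<inter> K - C) < \<infinity>"
    using sets order_le_less_trans[OF emeasure_mono radon_borel_measureD(3)[OF M K(1)], of "V \<inter> K - C"] by auto
  have "cmod ((\<integral>x. F x \<partial>M) - (\<integral>x. complex_of_real (\<theta> x) * F x \<partial>M)) < e"
    if \<theta>: "continuous_map X euclideanreal \<theta>" "\<forall>x. 0 \<le> \<theta> x \<and> \<theta> x \<le> 1" "\<forall>x\<in>C. \<theta> x = 1" for \<theta>
  proof -
    have int2: "integrable M (\<lambda>x. complex_of_real (\<theta> x) * F x)"
    proof (rule Bochner_Integration.integrable_bound[OF int])
      have "(\<lambda>x. complex_of_real (\<theta> x)) \<in> borel_measurable M"
        by (rule borel_measurable_open_piece[OF M openin_topspace, where f = "\<lambda>x. if x \<in> topspace X then complex_of_real (\<theta> x) else 0", THEN measurable_cong[THEN iffD1, rotated]])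
          (use \<theta>(1) radon_borel_measureD(1)[OF M] in \<open>auto intro: continuous_map_eq[OF continuous_map_of_real]\<close>)
      then show "(\<lambda>x. complex_of_real (\<theta> x) * F x) \<in> borel_measurable M" using int by measurable
      show "AE x in M. cmod (complex_of_real (\<theta> x) * F x) \<le> cmod (F x)"
        using \<theta>(2) by (auto simp: norm_mult intro!: mult_left_le_one_le)
    qed
    have "cmod ((\<integral>x. F x \<partial>M) - (\<integral>x. complex_of_real (\<theta> x) * F x \<partial>M)) =
        cmod (\<integral>x. F x - complex_of_real (\<theta> x) * F x \<partial>M)"
      using int int2 by simp
    also have "\<dots> \<le> (\<integral>x. cmod (F x - complex_of_real (\<theta> x) * F x) \<partial>M)" by (rule integral_norm_bound)
    also have "\<dots> \<le> (\<integral>x. B * indicat_real (V \<inter> K - C) x \<partial>M)"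
    proof (rule integral_mono)
      show "integrable M (\<lambda>x. cmod (F x - complex_of_real (\<theta> x) * F x))" using int int2 by auto
      show "integrable M (\<lambda>x. B * indicat_real (V \<inter> K - C) x)"
        using sets fin by (intro integrable_mult_right integrable_real_indicator) auto
      show "cmod (F x - complex_of_real (\<theta> x) * F x) \<le> B * indicat_real (V \<inter> K - C) x" for x
      proof (cases "x \<in> V \<inter> K - C")
        case True
        have "F x - complex_of_real (\<theta> x) * F x = complex_of_real (1 - \<theta> x) * F x" by (simp add: algebra_simps)
        moreover have "cmod (complex_of_real (1 - \<theta> x) * F x) \<le> 1 * B"
          unfolding norm_mult using \<theta>(2) B by (intro mult_mono) (auto simp del: of_real_diff)
        ultimately show ?thesis using True by simp
      qed (use F'(2) K(2) \<theta>(3) in auto)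
    qed
    also have "\<dots> = B * measure M (V \<inter> K - C)"
      using sets sets.sets_into_space[of "V \<inter> K - C" M] by (simp add: Int_absorb2)
    also have "\<dots> < e" using C(3) B(1) by (simp add: field_simps)
    finally show ?thesis .
  qed
  then show ?thesis using C unfolding cutoff_within_def by blast
qed

lemma compact_piece_approximation:
  assumes "finite \<M>" "\<And>M. M \<in> \<M> \<Longrightarrow> radon_borel_measure X M" and F: "compact_piece X V F" and e: "0 < e"
  shows "\<exists>C. compactin X C \<and> C \<subseteq> V \<and>
    (\<forall>M\<in>\<M>. cutoff_within X M F C e)"
  using assms(1,2)
proof (induction \<M>)
  case empty
  then show ?case by (auto intro: exI[of _ "{}"])
next
  case (insert M \<M>)
  then obtain C where C: "compactin X C" "C \<subseteq> V" "\<forall>M\<in>\<M>. cutoff_within X M F C e"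
    by auto
  obtain D where D: "compactin X D" "D \<subseteq> V" "cutoff_within X M F D e"
    using compact_piece_approximation_single[OF _ F e, of M] insert.prems by auto
  have "compactin X (C \<union> D)" using C D by (auto intro: compactin_Un)
  moreover have "\<forall>L\<in>insert M \<M>. cutoff_within X L F (C \<union> D) e"
    using C(3) D(3) cutoff_within_mono by (metis Un_upper1 Un_upper2 insert_iff)
  ultimately show ?case using C(2) D(2) by (intro exI[of _ "C \<union> D"]) auto
qed

text \<open>Makes the integral of a discontinuous restriction independent of the decomposition of
  \<open>\<mu>\<close>: one cutoff is within \<open>e/4\<close> for all four measures at once, and
  the cut-off function lies in \<open>Cc X\<close>, where the differences agree.\<close>

lemma radon_difference_eq_on_pieces:
  assumes M: "radon_borel_measure X M" "radon_borel_measure X N"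
      "radon_borel_measure X M'" "radon_borel_measure X N'"
    and eq: "\<And>h. h \<in> Cc X \<Longrightarrow> (\<integral>x. h x \<partial>M) - (\<integral>x. h x \<partial>N) = (\<integral>x. h x \<partial>M') - (\<integral>x. h x \<partial>N')"
    and F: "compact_piece X V F"
  shows "(\<integral>x. F x \<partial>M) - (\<integral>x. F x \<partial>N) = (\<integral>x. F x \<partial>M') - (\<integral>x. F x \<partial>N')"
proof -
  let ?d = "cmod (((\<integral>x. F x \<partial>M) - (\<integral>x. F x \<partial>N)) - ((\<integral>x. F x \<partial>M') - (\<integral>x. F x \<partial>N')))"
  have "?d \<le> 0 + e" if e: "0 < e" for e
  proof -
    obtain C where C: "compactin X C" "C \<subseteq> V" "\<forall>L\<in>{M, N, M', N'}. cutoff_within X L F C (e/4)"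
      using compact_piece_approximation[of "{M,N,M',N'}" V F "e/4"] M F e by auto
    have "openin X V" using F by (simp add: compact_piece_def)
    then obtain \<theta> W where \<theta>: "\<theta> \<in> Cp X" "\<forall>x. \<theta> x \<le> 1" "csupp X V \<theta>" "C \<subseteq> W" "\<forall>x\<in>W. \<theta> x = 1"
      using bump[OF C(1) _ C(2)] by blast
    have "(\<lambda>x. complex_of_real (\<theta> x) * F x) \<in> Cc X"
      using \<theta> Cp_D(1)[OF \<theta>(1)]
      by (intro compact_piece_times_continuous[OF F] continuous_map_of_real) (auto intro: csupp_weaken)
    note e1 = eq[OF this]
    have b: "cmod ((\<integral>x. F x \<partial>L) - (\<integral>x. complex_of_real (\<theta> x) * F x \<partial>L)) < e / 4" if "L \<in> {M, N, M', N'}" for L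
      using \<theta> Cp_D[OF \<theta>(1)] that C(3) unfolding cutoff_within_def by blast
    define a where "a L = (\<integral>x. F x \<partial>L) - (\<integral>x. complex_of_real (\<theta> x) * F x \<partial>L)" for L
    have "((\<integral>x. F x \<partial>M) - (\<integral>x. F x \<partial>N)) - ((\<integral>x. F x \<partial>M') - (\<integral>x. F x \<partial>N')) = (a M - a N) - (a M' - a N')"
      using e1 by (simp add: a_def algebra_simps)
    also have "cmod \<dots> \<le> (cmod (a M) + cmod (a N)) + (cmod (a M') + cmod (a N'))"
      by (intro order_trans[OF norm_triangle_ineq4] add_mono norm_triangle_ineq4)
    also have "\<dots> \<le> e" using b[of M] b[of N] b[of M'] b[of N'] by (simp add: a_def)
    finally show ?thesis by simp
  qed
  then have "?d \<le> 0" by (rule field_le_epsilon)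
  then show ?thesis by simp
qed

text \<open>Localisation principle: an additive statement about \<open>Cc X\<close> needs checking
  only for functions carried in one set of an open cover. Each step of the induction over a finite
  subcover applies \<open>split_cover\<close>.\<close>

lemma Cc_local_induct:
  assumes h: "h \<in> Cc X" "\<And>x. x \<notin> K \<Longrightarrow> h x = 0" "compactin X K"
    and W: "K \<subseteq> \<Union>\<W>" "\<And>W. W \<in> \<W> \<Longrightarrow> openin X W"
    and local: "\<And>W k. W \<in> \<W> \<Longrightarrow> k \<in> Cc X \<Longrightarrow> csupp X W k \<Longrightarrow> P k"
    and zero: "P (\<lambda>x. 0)"
    and add: "\<And>k l. k \<in> Cc X \<Longrightarrow> l \<in> Cc X \<Longrightarrow> P k \<Longrightarrow> P l \<Longrightarrow> P (\<lambda>x. k x + l x)"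
  shows "P h"
proof -
  obtain \<F> where \<F>: "finite \<F>" "\<F> \<subseteq> \<W>" "K \<subseteq> \<Union>\<F>"
    using compactinD[OF h(3)] W by meson
  have "\<forall>h K. h \<in> Cc X \<longrightarrow> (\<forall>x. x \<notin> K \<longrightarrow> h x = 0) \<longrightarrow> compactin X K \<longrightarrow> K \<subseteq> \<Union>\<F> \<longrightarrow> P h"
    using \<F>(1,2)
  proof (induction \<F>)
    case empty
    have "h = (\<lambda>x. 0)" if "\<forall>x. x \<notin> K \<longrightarrow> h x = 0" "K \<subseteq> \<Union>{}" for h :: "'x \<Rightarrow> complex" and K
      using that by auto
    then show ?case using zero by metis
  next
    case (insert U \<F>)
    show ?case
    proof (intro allI impI)
      fix h K assume h: "h \<in> Cc X" "\<forall>x. x \<notin> K \<longrightarrow> h x = 0" "compactin X K" "K \<subseteq> \<Union>(insert U \<F>)"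
      have U: "U \<in> \<W>" "openin X U" "openin X (\<Union>\<F>)" using insert.prems W(2) by auto
      obtain \<theta> L where \<theta>: "\<theta> \<in> Cp X" "csupp X U \<theta>" and L: "compactin X L" "L \<subseteq> \<Union>\<F>" "\<forall>x\<in>K-L. \<theta> x = 1"
        using split_cover[OF h(3) U(2,3)] h(4) by auto
      let ?k = "\<lambda>x. h x * complex_of_real (\<theta> x)" and ?l = "\<lambda>x. h x * complex_of_real (1 - \<theta> x)"
      have k: "?k \<in> Cc X" "?l \<in> Cc X"
        using Cp_D(1)[OF \<theta>(1)] by (auto simp del: of_real_diff intro!: Cc_mult[OF h(1)] continuous_map_of_real continuous_map_diff)
      have "P ?k" by (rule local[OF U(1) k(1)]) (auto intro: csupp_weaken[OF \<theta>(2)])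
      moreover have "?l x = 0" if "x \<notin> L" for x
        using that L(3) h(2) by (cases "x \<in> K") auto
      then have "P ?l" using insert.IH insert.prems k(2) L(1,2) by blast
      ultimately have "P (\<lambda>x. ?k x + ?l x)" by (intro add k)
      moreover have "(\<lambda>x. ?k x + ?l x) = h" by (auto simp: algebra_simps)
      ultimately show "P h" by simp
    qed
  qed
  then show ?thesis using h \<F>(3) by blast
qed

end

section \<open>Functionals on C*-algebras and the Pedersen ideal\<close>

lemma scaleC_minus1: "(-1) *\<^sub>C x = - (x::'a::complex_banach)"
  using scaleR_scaleC[of "-1" x] by simp

lemma scaleC_0_left: "0 *\<^sub>C x = (0::'a::complex_banach)"
  using scaleR_scaleC[of 0 x] by simp

lemma scaleC_0_right: "c *\<^sub>C (0::'a::complex_banach) = 0"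
  using scaleC_add_right[of c 0 0] by simp

lemma eq_on_dense:
  fixes f g :: "'a::topological_space \<Rightarrow> 'b::t2_space"
  assumes "closure S = UNIV" "continuous_on UNIV f" "continuous_on UNIV g" "\<And>x. x \<in> S \<Longrightarrow> f x = g x"
  shows "f x = g x"
proof -
  have "closed {x. f x = g x}" using closed_Collect_eq assms(2,3) by blast
  then have "closure S \<subseteq> {x. f x = g x}" using assms(4) by (intro closure_minimal) auto
  then show ?thesis using assms(1) by auto
qed

section \<open>Bounded functionals: extension by density and uniform boundedness\<close>

definition bounded_cfunctional :: "('a::complex_banach \<Rightarrow> complex) \<Rightarrow> bool" where
  "bounded_cfunctional \<phi> \<longleftrightarrow> (\<forall>x y. \<phi> (x + y) = \<phi> x + \<phi> y) \<and> (\<forall>c x. \<phi> (c *\<^sub>C x) = c * \<phi> x) \<and>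
     (\<exists>C. \<forall>x. cmod (\<phi> x) \<le> C * norm x)"

lemma bounded_cfunctionalD:
  assumes "bounded_cfunctional \<phi>"
  shows "\<phi> (x + y) = \<phi> x + \<phi> y" "\<phi> (c *\<^sub>C x) = c * \<phi> x" "\<phi> 0 = 0" "bounded_linear \<phi>"
    "continuous_on UNIV \<phi>"
proof -
  show a: "\<phi> (x + y) = \<phi> x + \<phi> y" "\<phi> (c *\<^sub>C x) = c * \<phi> x" for x y c
    using assms by (auto simp: bounded_cfunctional_def)
  show "\<phi> 0 = 0" using a(1)[of 0 0] by simp
  obtain C where C: "\<And>x. cmod (\<phi> x) \<le> C * norm x" using assms by (auto simp: bounded_cfunctional_def)
  show b: "bounded_linear \<phi>"
    by (rule bounded_linear_intro[where K = C])
      (auto simp: a scaleR_scaleC mult.commute[of _ C] scaleR_conv_of_real C)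
  show "continuous_on UNIV \<phi>" using b by (rule linear_continuous_on)
qed

text \<open>Sums and multiples are requested only up to a representative \<open>k\<close>, because
  sections form no vector space type. The map \<open>\<iota>\<close> may fail to be injective: the
  bound makes \<open>T\<close> depend on \<open>\<iota> f\<close> alone, and Lipschitz in
  it.\<close>

lemma dense_functional_extension:
  fixes \<iota> :: "'s \<Rightarrow> 'a::complex_banach" and T :: "'s \<Rightarrow> complex"
  assumes dense: "closure (\<iota> ` V) = UNIV"
    and add: "\<And>f h. f \<in> V \<Longrightarrow> h \<in> V \<Longrightarrow> \<exists>k\<in>V. \<iota> k = \<iota> f + \<iota> h \<and> T k = T f + T h"
    and scale: "\<And>f c. f \<in> V \<Longrightarrow> \<exists>k\<in>V. \<iota> k = c *\<^sub>C \<iota> f \<and> T k = c * T f"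
    and bound: "\<And>f. f \<in> V \<Longrightarrow> cmod (T f) \<le> C * norm (\<iota> f)"
  shows "\<exists>\<phi>. bounded_cfunctional \<phi> \<and> (\<forall>f\<in>V. \<phi> (\<iota> f) = T f)"
proof -
  have lip: "cmod (T f - T h) \<le> C * norm (\<iota> f - \<iota> h)" if fV: "f \<in> V" and hV: "h \<in> V" for f h
  proof -
    obtain h' where "h' \<in> V" "\<iota> h' = - \<iota> h" "T h' = - T h"
      using scale[OF hV, of "-1"] by (auto simp: scaleC_minus1)
    then obtain k where "k \<in> V" "\<iota> k = \<iota> f - \<iota> h" "T k = T f - T h"
      using add[OF fV, of h'] by auto
    then show ?thesis using bound by metis
  qed
  define t where "t y = T (SOME f. f \<in> V \<and> \<iota> f = y)" for y
  have t: "t (\<iota> f) = T f" if "f \<in> V" for f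
  proof -
    have *: "(SOME g. g \<in> V \<and> \<iota> g = \<iota> f) \<in> V \<and> \<iota> (SOME g. g \<in> V \<and> \<iota> g = \<iota> f) = \<iota> f"
      using that by (intro someI[of "\<lambda>g. g \<in> V \<and> \<iota> g = \<iota> f"]) auto
    have "cmod (t (\<iota> f) - T f) \<le> 0" using lip[OF conjunct1[OF *] that] * by (simp add: t_def)
    then show ?thesis by simp
  qed
  have "uniformly_continuous_on (\<iota> ` V) t"
    unfolding uniformly_continuous_on_def
  proof (intro allI impI)
    fix e :: real assume e: "e > 0"
    show "\<exists>d>0. \<forall>x\<in>\<iota> ` V. \<forall>x'\<in>\<iota> ` V. dist x' x < d \<longrightarrow> dist (t x') (t x) < e"
    proof (intro exI[of _ "e / (\<bar>C\<bar> + 1)"] conjI ballI impI)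
      fix x x' assume x: "x \<in> \<iota> ` V" "x' \<in> \<iota> ` V" "dist x' x < e / (\<bar>C\<bar> + 1)"
      then have "dist (t x') (t x) \<le> C * dist x' x" using lip t by (auto simp: dist_norm)
      also have "\<dots> \<le> (\<bar>C\<bar> + 1) * dist x' x" by (intro mult_right_mono) auto
      also have "\<dots> < e" using x(3) by (simp add: field_simps)
      finally show "dist (t x') (t x) < e" .
    qed (use e in auto)
  qed
  then obtain \<phi> where \<phi>: "uniformly_continuous_on (closure (\<iota> ` V)) \<phi>" "\<And>x. x \<in> \<iota> ` V \<Longrightarrow> t x = \<phi> x"
    by (rule uniformly_continuous_on_extension_on_closure) blast
  have c: "continuous_on UNIV \<phi>" using \<phi>(1) dense uniformly_continuous_imp_continuous by metis
  have cc: "continuous_on A (\<lambda>x. \<phi> (u x))" if "continuous_on A u" for A and u :: "'a \<Rightarrow> 'a"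
    using continuous_on_compose2[OF c that] by auto
  have eq: "\<phi> (\<iota> f) = T f" if "f \<in> V" for f using \<phi>(2) t that by (metis imageI)
  have csc: "continuous_on UNIV (\<lambda>x::'a. c *\<^sub>C x)" for c :: complex
  proof -
    have "bounded_linear (\<lambda>x::'a. c *\<^sub>C x)"
      by (rule bounded_linear_intro[where K = "cmod c"])
        (auto simp: scaleC_add_right scaleR_scaleC scaleC_scaleC mult.commute norm_scaleC)
    then show ?thesis by (rule linear_continuous_on)
  qed
  have add1: "\<phi> (\<iota> f + \<iota> h) = \<phi> (\<iota> f) + \<phi> (\<iota> h)" if fh: "f \<in> V" "h \<in> V" for f h
  proof -
    obtain k where "k \<in> V" "\<iota> k = \<iota> f + \<iota> h" "T k = T f + T h" using add[OF fh] by blast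
    then show ?thesis using eq fh by metis
  qed
  have add2: "\<phi> (x + \<iota> h) = \<phi> x + \<phi> (\<iota> h)" if "h \<in> V" for x h
    by (rule eq_on_dense[OF dense]) (use add1 that in \<open>auto intro!: continuous_intros cc\<close>)
  have add3: "\<phi> (x + y) = \<phi> x + \<phi> y" for x y
    by (rule eq_on_dense[OF dense, where f = "\<lambda>y. \<phi> (x + y)" and g = "\<lambda>y. \<phi> x + \<phi> y"])
       (use add2 in \<open>auto intro!: continuous_intros cc\<close>)
  have sc1: "\<phi> (c *\<^sub>C \<iota> f) = c * \<phi> (\<iota> f)" if f: "f \<in> V" for f c
  proof -
    obtain k where "k \<in> V" "\<iota> k = c *\<^sub>C \<iota> f" "T k = c * T f" using scale[OF f] by blast
    then show ?thesis using eq f by metis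
  qed
  have sc: "\<phi> (c *\<^sub>C x) = c * \<phi> x" for c x
    by (rule eq_on_dense[OF dense]) (use sc1 in \<open>auto intro!: continuous_intros cc csc\<close>)
  have "closed {x. cmod (\<phi> x) \<le> C * norm x}"
    by (intro closed_Collect_le continuous_intros cc)
  then have "closure (\<iota> ` V) \<subseteq> {x. cmod (\<phi> x) \<le> C * norm x}"
    using bound eq by (intro closure_minimal) auto
  then have "\<forall>x. cmod (\<phi> x) \<le> C * norm x" using dense by auto
  then show ?thesis using add3 sc eq unfolding bounded_cfunctional_def by blast
qed

text \<open>The Baire category argument is run inside \<open>D\<close>: the functionals that arise
  are pointwise bounded on the Pedersen ideal, which need not be complete, whereas its closed
  subspaces are.\<close>

lemma uniform_boundedness_on_subspace:
  fixes D :: "'a::complex_banach set"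
  assumes D: "csubspace D" "closed D"
    and \<F>: "\<And>\<phi>. \<phi> \<in> \<F> \<Longrightarrow> bounded_cfunctional \<phi>"
    and pw: "\<And>x. x \<in> D \<Longrightarrow> \<exists>B. \<forall>\<phi>\<in>\<F>. cmod (\<phi> x) \<le> B"
  shows "\<exists>C. \<forall>\<phi>\<in>\<F>. \<forall>x\<in>D. cmod (\<phi> x) \<le> C * norm x"
proof -
  define E where "E n = {x\<in>D. \<forall>\<phi>\<in>\<F>. cmod (\<phi> x) \<le> real n}" for n :: nat
  have cl: "closed (E n)" for n
  proof -
    have "closed {x. cmod (\<phi> x) \<le> real n}" if "\<phi> \<in> \<F>" for \<phi>
      by (intro closed_Collect_le continuous_intros bounded_cfunctionalD(5) \<F> that)
    moreover have "E n = D \<inter> (\<Inter>\<phi>\<in>\<F>. {x. cmod (\<phi> x) \<le> real n})" by (auto simp: E_def)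
    ultimately show ?thesis using D(2) by auto
  qed
  have un: "(\<Union>n. E n) = D"
  proof -
    have "\<exists>n. x \<in> E n" if "x \<in> D" for x
    proof -
      obtain B where B: "\<And>\<phi>. \<phi>\<in>\<F> \<Longrightarrow> cmod (\<phi> x) \<le> B" using pw \<open>x \<in> D\<close> by blast
      obtain n where "B \<le> real n" using real_arch_simple by blast
      then show ?thesis using B that by (auto simp: E_def intro!: exI[of _ n] intro: order_trans)
    qed
    then show ?thesis by (auto simp: E_def)
  qed
  have "completely_metrizable_space (top_of_set D)"
    using completely_metrizable_space_closedin completely_metrizable_space_euclidean D(2) closed_closedin by blast
  then have "\<exists>n. top_of_set D interior_of E n \<noteq> {}"
  proof (rule_tac ccontr)
    assume *: "completely_metrizable_space (top_of_set D)" "\<not> (\<exists>n. top_of_set D interior_of E n \<noteq> {})"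
    have "top_of_set D interior_of (\<Union>(range E)) = {}"
    proof (rule Baire_category_alt)
      show "countable (range E)" by simp
      show "\<And>T. T \<in> range E \<Longrightarrow> closedin (top_of_set D) T \<and> top_of_set D interior_of T = {}"
        using * cl by (auto simp: E_def intro!: closed_subset)
    qed (use * in simp)
    moreover have "0 \<in> D" using D(1) by (simp add: csubspace_def)
    ultimately show False using un interior_of_topspace[of "top_of_set D"] by auto
  qed
  then obtain n x0 where "x0 \<in> top_of_set D interior_of E n" by blast
  then obtain U where U: "openin (top_of_set D) U" "x0 \<in> U" "U \<subseteq> E n" by (auto simp: interior_of_def)
  then obtain r where r: "r > 0" "\<And>y. y \<in> D \<Longrightarrow> dist y x0 < r \<Longrightarrow> y \<in> U" and x0: "x0 \<in> D"
    unfolding openin_euclidean_subtopology_iff by blast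
  have "cmod (\<phi> x) \<le> (4 * real n / r) * norm x" if \<phi>: "\<phi> \<in> \<F>" and x: "x \<in> D" for \<phi> x
  proof (cases "x = 0")
    case True
    then show ?thesis using bounded_cfunctionalD(3)[OF \<F>[OF \<phi>]] by simp
  next
    case False
    \<comment> \<open>The factor moves \<open>x0\<close> by exactly \<open>r / 2\<close>, staying in
      the ball contained in \<open>E n\<close>; subtracting the value at \<open>x0\<close> doubles
      the bound to \<open>2 * n\<close>.\<close>
    let ?c = "complex_of_real (r / (2 * norm x))"
    have y: "x0 + ?c *\<^sub>C x \<in> D" using D(1) x x0 unfolding csubspace_def by blast
    have "dist (x0 + ?c *\<^sub>C x) x0 = r / 2" using False r(1) by (simp add: dist_norm norm_scaleC norm_divide norm_mult)
    then have "cmod (\<phi> (x0 + ?c *\<^sub>C x)) \<le> real n" "cmod (\<phi> x0) \<le> real n"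
      using r U \<phi> y by (auto simp: E_def subset_iff)
    moreover have "\<phi> (x0 + ?c *\<^sub>C x) = \<phi> x0 + ?c * \<phi> x"
      by (simp only: bounded_cfunctionalD(1,2)[OF \<F>[OF \<phi>]])
    ultimately have "cmod (?c * \<phi> x) \<le> 2 * real n"
      using norm_triangle_ineq4[of "\<phi> x0 + ?c * \<phi> x" "\<phi> x0"] by simp
    moreover have "cmod (?c * \<phi> x) = r / (2 * norm x) * cmod (\<phi> x)"
      using r(1) by (simp only: norm_mult norm_of_real) simp
    ultimately have "r / (2 * norm x) * cmod (\<phi> x) \<le> 2 * real n" by simp
    then show ?thesis using False r(1) by (simp add: field_simps)
  qed
  then show ?thesis by blast
qed

text \<open>Formally \<open>1 + w\<close> is the inverse of \<open>1 - z\<close>, in a form that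
  makes sense in a nonunital algebra; \<open>w\<close> is the fixed point of a contraction.\<close>

lemma quasi_inverse:
  fixes z :: "'a::{real_normed_algebra, banach}"
  assumes "norm z < 1"
  shows "\<exists>w. w = z + z * w"
proof -
  have "\<exists>!w. z + z * w = w"
  proof (rule banach_fix_type)
    show "\<forall>x y. dist (z + z * x) (z + z * y) \<le> norm z * dist x y"
      using norm_mult_ineq[of z] by (auto simp: dist_norm right_diff_distrib[symmetric])
  qed (use assms in auto)
  then show ?thesis by metis
qed

text \<open>Choose \<open>y\<close> in \<open>J\<close> close to \<open>h\<close> and put
  \<open>z = h - y\<close>. Formally \<open>f = f (1 - z) (1 + w)\<close>, and
  \<open>f (1 - z) = f y\<close> lies in \<open>J\<close>.\<close>

lemma dense_ideal_absorbs:
  fixes f h :: "'a::cstar_algebra"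
  assumes J: "two_sided_ideal J" "closure J = UNIV" and fh: "f * h = f"
  shows "f \<in> J"
proof -
  obtain y where y: "y \<in> J" "dist y h < 1"
    using J(2) closure_approachable[of h J] by (metis UNIV_I zero_less_one)
  define z where "z = h - y"
  have "norm z < 1" using y(2) by (simp add: z_def dist_norm norm_minus_commute)
  then obtain w where w: "w = z + z * w" using quasi_inverse by blast
  have "f = f * y + (f * y) * w"
  proof -
    have "f * y = f - f * z" using fh by (simp add: z_def algebra_simps)
    then have "f * y + (f * y) * w = (f - f * z) + (f - f * z) * w" by simp
    also have "\<dots> = f + (f * w - (f * z + f * (z * w)))"
      by (simp add: algebra_simps)
    also have "f * w = f * (z + z * w)" using w by simp
    finally show ?thesis by (simp add: distrib_left)
  qed
  moreover have "f * y + (f * y) * w \<in> J"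
    using J(1) y(1) unfolding two_sided_ideal_def csubspace_def by blast
  ultimately show ?thesis by simp
qed

text \<open>Scalars and further factors are absorbed by the outer factors \<open>a\<close> and
  \<open>b\<close>, so zero, generators and sums suffice for a two-sided ideal.\<close>

inductive_set ideal_span :: "'a::cstar_algebra set \<Rightarrow> 'a set" for E where
  ideal_span_0: "0 \<in> ideal_span E"
| ideal_span_gen: "f \<in> E \<Longrightarrow> a * f * b \<in> ideal_span E"
| ideal_span_add: "x \<in> ideal_span E \<Longrightarrow> y \<in> ideal_span E \<Longrightarrow> x + y \<in> ideal_span E"

lemma two_sided_ideal_ideal_span: "two_sided_ideal (ideal_span E)"
proof -
  have l: "c * x \<in> ideal_span E" and r: "x * c \<in> ideal_span E" and s: "d *\<^sub>C x \<in> ideal_span E"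
    if "x \<in> ideal_span E" for c x d
    using that
  proof (induction)
    case (ideal_span_gen f a b)
    { case 1 show ?case using ideal_span.ideal_span_gen[OF ideal_span_gen, of "c * a" b] by (simp add: mult.assoc) }
    { case 2 show ?case using ideal_span.ideal_span_gen[OF ideal_span_gen, of "a" "b * c"] by (simp add: mult.assoc) }
    { case 3 show ?case using ideal_span.ideal_span_gen[OF ideal_span_gen, of "d *\<^sub>C a" "b"] by (simp add: mult_scaleC_left) }
  qed (auto simp: distrib_left distrib_right scaleC_add_right scaleC_0_right intro: ideal_span.intros)
  show ?thesis
    unfolding two_sided_ideal_def csubspace_def using l r s by (auto intro: ideal_span.intros)
qed

text \<open>The span is one of the dense ideals that are intersected, and each dense ideal contains
  \<open>E\<close> by \<open>dense_ideal_absorbs\<close>.\<close>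

lemma pedersen_eq_ideal_span:
  assumes E: "\<And>f. f \<in> E \<Longrightarrow> \<exists>h. f * h = f" and dense: "closure (ideal_span E) = UNIV"
  shows "pedersen_ideal = ideal_span E"
proof
  show "pedersen_ideal \<subseteq> ideal_span E"
    unfolding pedersen_ideal_def using two_sided_ideal_ideal_span dense by blast
  have "x \<in> J" if "x \<in> ideal_span E" and J: "two_sided_ideal J" "closure J = UNIV" for x J
    using that(1)
  proof induction
    case ideal_span_0
    then show ?case using J by (simp add: two_sided_ideal_def csubspace_def)
  next
    case (ideal_span_gen f a b)
    then have "f \<in> J" using E dense_ideal_absorbs[OF J] by blast
    then show ?case using J(1) by (simp add: two_sided_ideal_def)
  next
    case (ideal_span_add x y)
    then show ?case using J(1) by (simp add: two_sided_ideal_def csubspace_def)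
  qed
  then show "ideal_span E \<subseteq> pedersen_ideal" unfolding pedersen_ideal_def by blast
qed

lemma star_0: "star (0::'a::cstar_algebra) = 0"
  using star_scaleC[of 0 0] by (simp add: scaleC_0_left)

lemma norm_star: "norm (star x) = norm (x::'a::cstar_algebra)"
proof -
  have le: "norm y \<le> norm (star y)" for y :: 'a
  proof (cases "y = 0")
    case False
    have "norm y * norm y = norm (star y * y)" using cstar_identity[of y] by (simp add: power2_eq_square)
    also have "\<dots> \<le> norm (star y) * norm y" by (rule norm_mult_ineq)
    finally show ?thesis using False by simp
  qed (simp add: star_0)
  from le[of x] le[of "star x"] show ?thesis by (simp add: star_star)
qed

lemma continuous_on_star: "continuous_on UNIV (star :: 'a::cstar_algebra \<Rightarrow> 'a)"
proof -
  have "bounded_linear (star :: 'a \<Rightarrow> 'a)"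
    by (rule bounded_linear_intro[where K = 1]) (auto simp: star_add scaleR_scaleC star_scaleC norm_star)
  then show ?thesis by (rule linear_continuous_on)
qed

text \<open>By the C*-identity each squaring of a self-adjoint element squares its norm, so a norm
  above 1 would make the iterated squares unbounded.\<close>

lemma selfadjoint_contraction:
  fixes x :: "'a::cstar_algebra"
  assumes sa: "star x = x" and bound: "\<And>n. norm (((\<lambda>y. y * y) ^^ n) x) \<le> C"
  shows "norm x \<le> 1"
proof (rule ccontr)
  assume "\<not> ?thesis"
  then have x: "norm x > 1" by simp
  have *: "star (((\<lambda>y. y * y) ^^ n) x) = ((\<lambda>y. y * y) ^^ n) x \<and> norm (((\<lambda>y. y * y) ^^ n) x) = norm x ^ (2 ^ n)" for n
  proof (induction n)
    case (Suc n)
    let ?y = "((\<lambda>y. y * y) ^^ n) x"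
    have "norm (?y * ?y) = (norm ?y)\<^sup>2" using cstar_identity[of ?y] Suc by simp
    then show ?case using Suc by (simp add: star_mult power_mult[symmetric] mult.commute)
  qed (simp add: sa)
  obtain n where n: "C < norm x ^ n" using real_arch_pow[OF x] by blast
  have "norm x ^ n \<le> norm x ^ (2 ^ n)" using x by (intro power_increasing) (auto intro: less_imp_le)
  then show False using n bound[of n] * by (metis order_le_less_trans order_less_irrefl order_trans)
qed

section \<open>Traces as limits along an approximate unit\<close>

text \<open>\<open>P\<close> will be \<open>Cc\<close> of the unit space and \<open>Q\<close> the
  cutoffs with values between 0 and 1. Two index sets are kept because generators need all of
  \<open>P\<close>, whereas the uniform bounds rest on \<open>contraction\<close>, which is known on
  \<open>Q\<close>.\<close>

locale approximate_trace =
  fixes j :: "'e \<Rightarrow> 'a::cstar_algebra" and P Q :: "'e set" and F :: "'e filter"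
    and \<phi> :: "'e \<Rightarrow> 'a \<Rightarrow> complex"
  assumes F: "F \<noteq> bot" "\<forall>\<^sub>F e in F. e \<in> Q" and QP: "Q \<subseteq> P"
    and functional: "f \<in> P \<Longrightarrow> bounded_cfunctional (\<phi> f)"
    and approximate_unit: "((\<lambda>e. x * j e) \<longlongrightarrow> x) F"
    and contraction: "e \<in> Q \<Longrightarrow> norm (j e) \<le> 1"
    and swap: "e \<in> P \<Longrightarrow> f \<in> P \<Longrightarrow> \<phi> e (a * j f * b) = \<phi> f (b * j e * a)"
    and pedersen: "pedersen_ideal = ideal_span (j ` P)"
begin

definition trace_limit :: "'a \<Rightarrow> complex" where
  "trace_limit x = Lim F (\<lambda>e. \<phi> e x)"

text \<open>\<open>swap\<close> moves the varying \<open>e\<close> from the index of the functional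
  into the argument of the fixed functional \<open>\<phi> f\<close>, where the approximate unit
  acts.\<close>

lemma tendsto_generator:
  assumes "f \<in> P"
  shows "((\<lambda>e. \<phi> e (a * j f * b)) \<longlongrightarrow> \<phi> f (b * a)) F"
proof -
  have "((\<lambda>e. b * j e * a) \<longlongrightarrow> b * a) F"
    using approximate_unit by (intro tendsto_intros)
  then have "((\<lambda>e. \<phi> f (b * j e * a)) \<longlongrightarrow> \<phi> f (b * a)) F"
    using bounded_linear.tendsto[OF bounded_cfunctionalD(4)[OF functional[OF assms]]] by blast
  moreover have "\<forall>\<^sub>F e in F. \<phi> f (b * j e * a) = \<phi> e (a * j f * b)"
    using F(2) by (rule eventually_mono) (use swap assms QP in \<open>auto simp: subset_iff\<close>)
  ultimately show ?thesis by (rule Lim_transform_eventually)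
qed

lemma tendsto_trace_limit:
  assumes "x \<in> pedersen_ideal"
  shows "((\<lambda>e. \<phi> e x) \<longlongrightarrow> trace_limit x) F"
proof -
  have add: "\<phi> e (x + y) = \<phi> e x + \<phi> e y" if "e \<in> P" for e x y
    using bounded_cfunctionalD(1)[OF functional[OF that]] .
  have ev: "\<forall>\<^sub>F e in F. e \<in> P" using F(2) by (rule eventually_mono) (use QP in auto)
  have "\<exists>l. ((\<lambda>e. \<phi> e x) \<longlongrightarrow> l) F"
    using assms unfolding pedersen
  proof induction
    case ideal_span_0
    have "((\<lambda>e. \<phi> e 0) \<longlongrightarrow> 0) F"
      by (rule tendsto_eventually, rule eventually_mono[OF ev]) (simp add: bounded_cfunctionalD(3) functional)
    then show ?case by blast
  next
    case (ideal_span_gen f a b)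
    then show ?case using tendsto_generator by blast
  next
    case (ideal_span_add x y)
    then obtain l m where "((\<lambda>e. \<phi> e x) \<longlongrightarrow> l) F" "((\<lambda>e. \<phi> e y) \<longlongrightarrow> m) F" by blast
    then have "((\<lambda>e. \<phi> e x + \<phi> e y) \<longlongrightarrow> l + m) F" by (rule tendsto_add)
    moreover have "\<forall>\<^sub>F e in F. \<phi> e x + \<phi> e y = \<phi> e (x + y)"
      using ev by (rule eventually_mono) (simp add: add)
    ultimately have "((\<lambda>e. \<phi> e (x + y)) \<longlongrightarrow> l + m) F" by (rule Lim_transform_eventually)
    then show ?case by blast
  qed
  then show ?thesis unfolding trace_limit_def using F(1) tendsto_Lim by metis
qed

lemma trace_limit_eqI: "((\<lambda>e. \<phi> e x) \<longlongrightarrow> l) F \<Longrightarrow> trace_limit x = l"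
  unfolding trace_limit_def using F(1) tendsto_Lim by metis

lemma trace_limit_generator: "f \<in> P \<Longrightarrow> trace_limit (a * j f * b) = \<phi> f (b * a)"
  by (rule trace_limit_eqI[OF tendsto_generator])

lemma pedersen_mult: "x \<in> pedersen_ideal \<Longrightarrow> x * a \<in> pedersen_ideal \<and> a * x \<in> pedersen_ideal" for x a :: 'a
  using two_sided_ideal_ideal_span[of "j ` P"] unfolding pedersen two_sided_ideal_def by auto

lemma trace_limit_add:
  assumes "x \<in> pedersen_ideal" "y \<in> pedersen_ideal"
  shows "trace_limit (x + y) = trace_limit x + trace_limit y"
proof (rule trace_limit_eqI)
  have ev: "\<forall>\<^sub>F e in F. \<phi> e x + \<phi> e y = \<phi> e (x + y)"
    using F(2) by (rule eventually_mono) (use QP bounded_cfunctionalD(1)[OF functional] in auto)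
  show "((\<lambda>e. \<phi> e (x + y)) \<longlongrightarrow> trace_limit x + trace_limit y) F"
    using tendsto_add[OF assms[THEN tendsto_trace_limit]] ev by (rule Lim_transform_eventually)
qed

lemma trace_limit_scale:
  assumes "x \<in> pedersen_ideal"
  shows "trace_limit (c *\<^sub>C x) = c * trace_limit x"
proof (rule trace_limit_eqI)
  have ev: "\<forall>\<^sub>F e in F. c * \<phi> e x = \<phi> e (c *\<^sub>C x)"
    using F(2) by (rule eventually_mono) (use QP bounded_cfunctionalD(2)[OF functional] in auto)
  show "((\<lambda>e. \<phi> e (c *\<^sub>C x)) \<longlongrightarrow> c * trace_limit x) F"
    using tendsto_mult_left[OF tendsto_trace_limit[OF assms]] ev by (rule Lim_transform_eventually)
qed

text \<open>On a generator \<open>a * j e * b\<close> both sides equal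
  \<open>\<phi> e (b * y * a)\<close>; the second factor may be any element of the algebra.\<close>

lemma trace_limit_commute:
  assumes "x \<in> pedersen_ideal"
  shows "trace_limit (x * y) = trace_limit (y * x)"
  using assms unfolding pedersen
proof induction
  case (ideal_span_gen f a b)
  then obtain e where "e \<in> P" "f = j e" by blast
  then show ?case
    using trace_limit_generator[of e a "b * y"] trace_limit_generator[of e "y * a" b] by (simp add: mult.assoc)
next
  case (ideal_span_add u v)
  then have "u \<in> pedersen_ideal" "v \<in> pedersen_ideal" by (auto simp: pedersen)
  then show ?case using ideal_span_add.IH pedersen_mult
    by (simp add: distrib_left distrib_right trace_limit_add)
qed simp

text \<open>After \<open>swap\<close> only the fixed functional of the generator remains, evaluated
  at elements whose norms are bounded because \<open>j e\<close> is a contraction.\<close>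

lemma pointwise_bounded:
  assumes "x \<in> pedersen_ideal"
  shows "\<exists>B. \<forall>e\<in>Q. cmod (\<phi> e x) \<le> B"
  using assms unfolding pedersen
proof induction
  case ideal_span_0
  have "\<forall>e\<in>Q. cmod (\<phi> e 0) \<le> 0" using QP bounded_cfunctionalD(3)[OF functional] by auto
  then show ?case by blast
next
  case (ideal_span_gen f a b)
  then obtain k where k: "k \<in> P" "f = j k" by blast
  obtain C where C: "\<And>x. cmod (\<phi> k x) \<le> C * norm x" using functional[OF k(1)] by (auto simp: bounded_cfunctional_def)
  have "cmod (\<phi> e (a * f * b)) \<le> \<bar>C\<bar> * (norm b * norm a)" if "e \<in> Q" for e
  proof -
    have "norm (b * j e * a) \<le> norm b * norm (j e) * norm a"
      by (intro order_trans[OF norm_mult_ineq] mult_right_mono norm_mult_ineq) auto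
    also have "\<dots> \<le> norm b * 1 * norm a"
      by (intro mult_right_mono mult_left_mono contraction that) auto
    finally have n: "norm (b * j e * a) \<le> norm b * norm a" by simp
    have "cmod (\<phi> e (a * f * b)) = cmod (\<phi> k (b * j e * a))"
      using swap[of e k a b] that QP k by auto
    also have "\<dots> \<le> \<bar>C\<bar> * norm (b * j e * a)"
      by (rule order_trans[OF C]) (intro mult_right_mono; simp)
    also have "\<dots> \<le> \<bar>C\<bar> * (norm b * norm a)" using n by (intro mult_left_mono) auto
    finally show ?thesis .
  qed
  then show ?case by blast
next
  case (ideal_span_add x y)
  then obtain B B' where "\<And>e. e \<in> Q \<Longrightarrow> cmod (\<phi> e x) \<le> B" "\<And>e. e \<in> Q \<Longrightarrow> cmod (\<phi> e y) \<le> B'" by blast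
  then have "cmod (\<phi> e (x + y)) \<le> B + B'" if "e \<in> Q" for e
  proof -
    have "\<phi> e (x + y) = \<phi> e x + \<phi> e y" using that QP bounded_cfunctionalD(1)[OF functional, of e x y] by auto
    then show ?thesis
      using \<open>\<And>e. e \<in> Q \<Longrightarrow> cmod (\<phi> e x) \<le> B\<close>[OF that] \<open>\<And>e. e \<in> Q \<Longrightarrow> cmod (\<phi> e y) \<le> B'\<close>[OF that]
        norm_triangle_ineq[of "\<phi> e x" "\<phi> e y"] by simp
  qed
  then show ?case by blast
qed

theorem continuous_trace_limit: "continuous_trace trace_limit"
  unfolding continuous_trace_def
proof (intro conjI ballI allI impI)
  fix D :: "'a set" assume D: "cstar_subalgebra D \<and> D \<subseteq> pedersen_ideal"
  have "\<exists>C. \<forall>\<psi>\<in>\<phi> ` Q. \<forall>x\<in>D. cmod (\<psi> x) \<le> C * norm x"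
  proof (rule uniform_boundedness_on_subspace)
    show "csubspace D" "closed D" using D by (auto simp: cstar_subalgebra_def)
    show "\<And>\<psi>. \<psi> \<in> \<phi> ` Q \<Longrightarrow> bounded_cfunctional \<psi>" using functional QP by auto
    show "\<exists>B. \<forall>\<psi>\<in>\<phi> ` Q. cmod (\<psi> x) \<le> B" if "x \<in> D" for x
      using pointwise_bounded[of x] D that by auto
  qed
  then obtain C where C: "\<And>e x. e \<in> Q \<Longrightarrow> x \<in> D \<Longrightarrow> cmod (\<phi> e x) \<le> C * norm x" by blast
  have "cmod (trace_limit x) \<le> C * norm x" if "x \<in> D" for x
  proof (rule tendsto_upperbound[OF _ _ F(1)])
    show "((\<lambda>e. cmod (\<phi> e x)) \<longlongrightarrow> cmod (trace_limit x)) F"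
      using tendsto_trace_limit D that by (intro tendsto_norm) auto
    show "\<forall>\<^sub>F e in F. cmod (\<phi> e x) \<le> C * norm x"
      using F(2) by (rule eventually_mono) (use C that in auto)
  qed
  then show "\<exists>C. \<forall>x\<in>D. cmod (trace_limit x) \<le> C * norm x" by blast
qed (auto simp: trace_limit_add trace_limit_scale trace_limit_commute)

lemma selfadjoint_trace_limit:
  assumes "\<And>e x. e \<in> Q \<Longrightarrow> \<phi> e (star x) = cnj (\<phi> e x)"
    and "\<And>x::'a. x \<in> pedersen_ideal \<Longrightarrow> star x \<in> pedersen_ideal"
  shows "selfadjoint_on_pedersen trace_limit"
  unfolding selfadjoint_on_pedersen_def
proof
  fix x :: 'a assume x: "x \<in> pedersen_ideal"
  show "trace_limit (star x) = cnj (trace_limit x)"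
  proof (rule trace_limit_eqI)
    have "\<forall>\<^sub>F e in F. cnj (\<phi> e x) = \<phi> e (star x)"
      using F(2) by (rule eventually_mono) (simp add: assms(1))
    then show "((\<lambda>e. \<phi> e (star x)) \<longlongrightarrow> cnj (trace_limit x)) F"
      using tendsto_cnj[OF tendsto_trace_limit[OF x]] by (rule Lim_transform_eventually[rotated])
  qed
qed

lemma positive_trace_limit:
  assumes "\<And>e y. e \<in> Q \<Longrightarrow> \<phi> e (star y * y) \<in> \<real>\<^sub>\<ge>\<^sub>0"
  shows "positive_on_pedersen trace_limit"
  unfolding positive_on_pedersen_def
proof
  fix x :: 'a assume x: "x \<in> pedersen_ideal \<inter> positive_elements"
  then obtain y where y: "x = star y * y" by (auto simp: positive_elements_def)
  have t: "((\<lambda>e. \<phi> e x) \<longlongrightarrow> trace_limit x) F" using x tendsto_trace_limit by blast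
  have ev: "\<forall>\<^sub>F e in F. \<phi> e x \<in> \<real>\<^sub>\<ge>\<^sub>0"
    using F(2) by (rule eventually_mono) (simp add: assms y)
  show "trace_limit x \<in> \<real>\<^sub>\<ge>\<^sub>0"
    by (rule Lim_in_closed_set[OF closed_nonneg_Reals_complex ev F(1) t])
qed

end

section \<open>Etale groupoids and bisections\<close>

lemma (in topological_groupoid) units_iff: "u \<in> units G \<longleftrightarrow> u \<in> arrows G \<and> rng G u = u"
  unfolding units_def using rng_closed rng_rng by force

context topological_groupoid begin

lemma units_arrows: "units G \<subseteq> arrows G"
  by (auto simp: units_iff)

lemma src_unit: "u \<in> units G \<Longrightarrow> src G u = u"
  using src_rng[of u] by (auto simp: units_iff)

lemma rng_unit: "u \<in> units G \<Longrightarrow> rng G u = u"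
  by (auto simp: units_iff)

lemma rng_in_units: "g \<in> arrows G \<Longrightarrow> rng G g \<in> units G"
  by (auto simp: units_def)

lemma src_in_units: "g \<in> arrows G \<Longrightarrow> src G g \<in> units G"
  by (auto simp: units_iff src_closed rng_src)

lemma topspace_unit_space: "topspace (unit_space G) = units G"
  using units_arrows by (auto simp: unit_space_def)

lemma gmult_left_cancel:
  assumes "g \<in> arrows G" "h \<in> arrows G" "src G g = rng G h"
  shows "gmult G (ginv G g) (gmult G g h) = h"
proof -
  have "gmult G (ginv G g) (gmult G g h) = gmult G (gmult G (ginv G g) g) h"
    using assms by (subst gmult_assoc) (auto simp: ginv_closed src_ginv)
  then show ?thesis using assms by (simp add: gmult_ginv_left gmult_rng)
qed

lemma gmult_inv_left:
  assumes "g \<in> arrows G" "h \<in> arrows G" "rng G g = rng G h"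
  shows "gmult G g (gmult G (ginv G g) h) = h"
proof -
  have "gmult G g (gmult G (ginv G g) h) = gmult G (gmult G g (ginv G g)) h"
    using assms by (subst gmult_assoc) (auto simp: ginv_closed src_ginv rng_ginv)
  then show ?thesis using assms by (simp add: gmult_ginv_right gmult_rng)
qed

text \<open>Once the first factor \<open>k\<close> is fixed, \<open>g\<close> determines the second
  one; convolution sums can therefore be indexed by first factors.\<close>

lemma gmult_factor:
  assumes "k \<in> arrows G" "g \<in> arrows G" "rng G k = rng G g"
  shows "gmult G (ginv G k) g \<in> arrows G" "src G k = rng G (gmult G (ginv G k) g)"
    "gmult G k (gmult G (ginv G k) g) = g"
  using assms by (simp_all add: gmult_closed ginv_closed src_ginv rng_gmult rng_ginv gmult_inv_left)

lemma ginv_unique: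
  assumes "g \<in> arrows G" "h \<in> arrows G" "src G g = rng G h" "gmult G g h = rng G g"
  shows "h = ginv G g"
  using gmult_left_cancel[OF assms(1-3)] assms gmult_src[OF ginv_closed[OF assms(1)]]
  by (simp add: src_ginv)

lemma ginv_ginv: "g \<in> arrows G \<Longrightarrow> ginv G (ginv G g) = g"
  using ginv_unique[of "ginv G g" g] by (simp add: ginv_closed src_ginv rng_ginv gmult_ginv_left)

lemma ginv_unit: "u \<in> units G \<Longrightarrow> ginv G u = u"
  using ginv_unique[of u u] gmult_rng[of u] by (auto simp: units_iff src_unit)

lemma gmult_eq_unit_iff:
  assumes "g \<in> arrows G" "h \<in> arrows G" "src G g = rng G h" "u \<in> units G"
  shows "gmult G g h = u \<longleftrightarrow> h = ginv G g \<and> rng G g = u"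
proof
  assume "gmult G g h = u"
  then have "rng G g = u" using rng_gmult[OF assms(1-3)] assms(4) by (simp add: rng_unit)
  then show "h = ginv G g \<and> rng G g = u" using ginv_unique[OF assms(1-3)] \<open>gmult G g h = u\<close> by simp
qed (use assms in \<open>simp add: gmult_ginv_right\<close>)

lemma homeomorphic_maps_ginv: "homeomorphic_maps (gtop G) (gtop G) (ginv G) (ginv G)"
  unfolding homeomorphic_maps_def using continuous_ginv ginv_ginv by auto

lemma openin_ginv: "openin (gtop G) U \<Longrightarrow> openin (gtop G) (ginv G ` U)"
  using homeomorphic_maps_ginv homeomorphic_maps_imp_map homeomorphic_imp_open_map open_map_def by metis

lemma continuous_map_gmult:
  assumes "continuous_map Y (gtop G) a" "continuous_map Y (gtop G) b"
    and "\<And>y. y \<in> topspace Y \<Longrightarrow> src G (a y) = rng G (b y)"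
  shows "continuous_map Y (gtop G) (\<lambda>y. gmult G (a y) (b y))"
proof -
  have "continuous_map Y (subtopology (prod_topology (gtop G) (gtop G)) {(g, h). src G g = rng G h}) (\<lambda>y. (a y, b y))"
    using assms by (auto simp: continuous_map_in_subtopology intro!: continuous_map_pairedI)
  from continuous_map_compose[OF this continuous_gmult] show ?thesis by (simp add: o_def)
qed

end

lemma (in topological_groupoid) open_bisectionD:
  assumes "open_bisection G U"
  shows "openin (gtop G) U" "inj_on (rng G) U" "inj_on (src G) U" "U \<subseteq> arrows G"
  using assms openin_subset by (auto simp: open_bisection_def)

section \<open>Topology of the range and source maps\<close>

context etale_groupoid begin

abbreviation "r \<equiv> rng G"
abbreviation "s \<equiv> src G"
abbreviation "X \<equiv> unit_space G"
abbreviation "T \<equiv> gtop G"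

sublocale units: locally_compact_Hausdorff "unit_space G"
  using locally_compact_unit_space Hausdorff_unit_space by unfold_locales

lemma rng_local:
  assumes "g \<in> arrows G"
  obtains U where "openin T U" "g \<in> U" "openin X (r ` U)" "homeomorphic_map (subtopology T U) (subtopology X (r ` U)) r"
  using local_homeomorphism_rng assms unfolding local_homeomorphism_def by blast

lemma continuous_rng: "continuous_map T X r"
  unfolding continuous_map_eq_topcontinuous_at
proof
  fix g assume "g \<in> arrows G"
  then obtain U where U: "openin T U" "g \<in> U" "openin X (r ` U)" "homeomorphic_map (subtopology T U) (subtopology X (r ` U)) r"
    by (rule rng_local)
  show "topcontinuous_at T X r g"
    unfolding topcontinuous_at_def
  proof (intro conjI allI impI)
    show "g \<in> topspace T" by fact
    show "r \<in> topspace T \<rightarrow> topspace X" by (simp add: topspace_unit_space rng_in_units)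
    fix V assume V: "openin X V \<and> r g \<in> V"
    have c: "continuous_map (subtopology T U) (subtopology X (r ` U)) r"
      using U(4) homeomorphic_imp_continuous_map by blast
    have "openin (subtopology X (r ` U)) (V \<inter> r ` U)" using V by (auto simp: openin_subtopology)
    from openin_continuous_map_preimage[OF c this]
    have "openin T {x \<in> topspace (subtopology T U). r x \<in> V \<inter> r ` U}"
      using U(1) openin_trans_full by blast
    then show "\<exists>U. openin T U \<and> g \<in> U \<and> (\<forall>y\<in>U. r y \<in> V)"
      using U(2) V \<open>g \<in> arrows G\<close> by (intro exI[of _ "{x \<in> topspace (subtopology T U). r x \<in> V \<inter> r ` U}"]) auto
  qed
qed

lemma open_rng: "openin T U \<Longrightarrow> openin X (r ` U)"
proof -
  assume U: "openin T U"
  have "\<exists>W. openin X W \<and> y \<in> W \<and> W \<subseteq> r ` U" if "y \<in> r ` U" for y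
  proof -
    obtain g where g: "g \<in> U" "y = r g" using \<open>y \<in> r ` U\<close> by blast
    then have "g \<in> arrows G" using U openin_subset by blast
    then obtain V where V: "openin T V" "g \<in> V" "openin X (r ` V)" "homeomorphic_map (subtopology T V) (subtopology X (r ` V)) r"
      by (rule rng_local)
    have "openin (subtopology T V) (U \<inter> V)" using U by (auto simp: openin_subtopology)
    moreover have "open_map (subtopology T V) (subtopology X (r ` V)) r"
      using V(4) homeomorphic_imp_open_map by blast
    ultimately have "openin (subtopology X (r ` V)) (r ` (U \<inter> V))" by (auto simp: open_map_def)
    then have "openin X (r ` (U \<inter> V))" using V(3) openin_trans_full by blast
    then show ?thesis using g V(2) by (intro exI[of _ "r ` (U \<inter> V)"]) auto
  qed
  then show "openin X (r ` U)" by (subst openin_subopen) blast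
qed

lemma continuous_src: "continuous_map T X s"
proof -
  have "continuous_map T X (r \<circ> ginv G)"
    using continuous_ginv continuous_rng by (rule continuous_map_compose)
  then show ?thesis by (rule continuous_map_eq) (simp add: rng_ginv)
qed

lemma src_image_eq: "U \<subseteq> arrows G \<Longrightarrow> s ` U = r ` ginv G ` U"
  by (auto simp: rng_ginv image_image subset_iff intro!: image_cong)

lemma open_src: "openin T U \<Longrightarrow> openin X (s ` U)"
  using src_image_eq[OF openin_subset] open_rng openin_ginv by metis

text \<open>The range map is injective near a unit \<open>u\<close>. If both \<open>g\<close> and
  \<open>r g\<close> lie in that neighbourhood, they have the same range and hence coincide.\<close>

lemma open_units: "openin T (units G)"
proof (subst openin_subopen, intro ballI)
  fix u assume u: "u \<in> units G"
  then have "u \<in> arrows G" using units_arrows by auto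
  then obtain U where U: "openin T U" "u \<in> U" "openin X (r ` U)" "homeomorphic_map (subtopology T U) (subtopology X (r ` U)) r"
    by (rule rng_local)
  have inj: "inj_on r U"
    using homeomorphic_imp_injective_map[OF U(4)] openin_subset[OF U(1)] by (simp add: Int_absorb1)
  have "openin X (U \<inter> units G)" using U(1) unfolding unit_space_def by (auto simp: openin_subtopology)
  from openin_continuous_map_preimage[OF continuous_rng this]
  have 1: "openin T (U \<inter> {g \<in> arrows G. r g \<in> U \<inter> units G})" using U(1) by auto
  show "\<exists>W. openin T W \<and> u \<in> W \<and> W \<subseteq> units G"
  proof (intro exI conjI)
    show "U \<inter> {g \<in> arrows G. r g \<in> U \<inter> units G} \<subseteq> units G"
    proof
      fix g assume g: "g \<in> U \<inter> {g \<in> arrows G. r g \<in> U \<inter> units G}"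
      then have "r g = g" using inj_onD[OF inj, of "r g" g] rng_rng[of g] by auto
      then show "g \<in> units G" using g by auto
    qed
  qed (use 1 u U(2) \<open>u \<in> arrows G\<close> rng_unit in auto)
qed

lemma openin_unit_space: "openin X U \<longleftrightarrow> openin T U \<and> U \<subseteq> units G"
  unfolding unit_space_def using open_units by (simp add: openin_open_subtopology)

lemma compactin_unit_space: "compactin X K \<longleftrightarrow> compactin T K \<and> K \<subseteq> units G"
  unfolding unit_space_def by (simp add: compactin_subtopology)

lemma open_bisection_units: "open_bisection G (units G)"
  unfolding open_bisection_def using open_units by (auto intro!: inj_onI simp: rng_unit src_unit)

lemma open_bisection_subset: "open_bisection G U \<Longrightarrow> openin T V \<Longrightarrow> V \<subseteq> U \<Longrightarrow> open_bisection G V"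
  unfolding open_bisection_def by (auto intro: inj_on_subset)

lemma open_bisection_Int: "open_bisection G U \<Longrightarrow> openin T V \<Longrightarrow> open_bisection G (U \<inter> V)"
  using open_bisection_subset[of U "U \<inter> V"] by (auto simp: open_bisection_def)

lemma open_bisection_ginv:
  assumes "open_bisection G U"
  shows "open_bisection G (ginv G ` U)"
  unfolding open_bisection_def
proof (intro conjI)
  note U = open_bisectionD[OF assms]
  show "openin T (ginv G ` U)" using U(1) by (rule openin_ginv)
  show "inj_on r (ginv G ` U)"
    using U by (auto intro!: inj_onI simp: rng_ginv subset_iff) (metis inj_onD)
  show "inj_on s (ginv G ` U)"
    using U by (auto intro!: inj_onI simp: src_ginv subset_iff) (metis inj_onD)
qed

lemma continuous_inv_rng:
  assumes "open_bisection G U"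
  shows "continuous_map (subtopology X (r ` U)) (subtopology T U) (inv_into U r)"
proof -
  note U = open_bisectionD[OF assms]
  have rU: "openin X (r ` U)" by (rule open_rng[OF U(1)])
  have top: "topspace (subtopology X (r ` U)) = r ` U" using openin_subset[OF rU] by auto
  have "openin (subtopology X (r ` U)) {x \<in> r ` U. inv_into U r x \<in> W}" if W: "openin T W" for W
  proof -
    have "{x \<in> r ` U. inv_into U r x \<in> W} = r ` (U \<inter> W)"
      using U(2) by (auto simp: inv_into_f_f)
    moreover have "openin X (r ` (U \<inter> W))" using open_rng U(1) W by blast
    ultimately show ?thesis using rU by (auto simp: openin_open_subtopology)
  qed
  then have "continuous_map (subtopology X (r ` U)) T (inv_into U r)"
    unfolding continuous_map_def top
    by (intro conjI allI impI Pi_I) (use inv_into_into[of _ r U] U(4) in blast, simp)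
  then show ?thesis unfolding continuous_map_in_subtopology top by (auto intro: inv_into_into)
qed

lemma continuous_inv_src:
  assumes "open_bisection G U"
  shows "continuous_map (subtopology X (s ` U)) (subtopology T U) (inv_into U s)"
proof -
  note U = open_bisectionD[OF assms]
  have sU: "openin X (s ` U)" by (rule open_src[OF U(1)])
  have top: "topspace (subtopology X (s ` U)) = s ` U" using openin_subset[OF sU] by auto
  have "openin (subtopology X (s ` U)) {x \<in> s ` U. inv_into U s x \<in> W}" if W: "openin T W" for W
  proof -
    have "{x \<in> s ` U. inv_into U s x \<in> W} = s ` (U \<inter> W)"
      using U(3) by (auto simp: inv_into_f_f)
    moreover have "openin X (s ` (U \<inter> W))" using open_src U(1) W by blast
    ultimately show ?thesis using sU by (auto simp: openin_open_subtopology)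
  qed
  then have "continuous_map (subtopology X (s ` U)) T (inv_into U s)"
    unfolding continuous_map_def top
    by (intro conjI allI impI Pi_I) (use inv_into_into[of _ s U] U(4) in blast, simp)
  then show ?thesis unfolding continuous_map_in_subtopology top by (auto intro: inv_into_into)
qed

section \<open>Products of bisections and of compact sets\<close>

definition set_mult :: "'a set \<Rightarrow> 'a set \<Rightarrow> 'a set" where
  "set_mult U V = {gmult G g h | g h. g \<in> U \<and> h \<in> V \<and> s g = r h}"

lemma set_mult_factor:
  assumes U: "open_bisection G U" and V: "open_bisection G V" and gh: "g \<in> U" "h \<in> V" "s g = r h"
  shows "inv_into U r (r (gmult G g h)) = g" "inv_into V s (s (gmult G g h)) = h"
  using open_bisectionD[OF U] open_bisectionD[OF V] gh
  by (auto simp: rng_gmult src_gmult subset_iff inv_into_f_f)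

text \<open>The right side is a preimage: the first factor is recovered from \<open>r k\<close>, the
  second as a continuous function of \<open>k\<close>, so openness of the product reduces to
  openness of \<open>V\<close>.\<close>

lemma set_mult_eq:
  assumes U: "open_bisection G U" and V: "open_bisection G V"
  shows "set_mult U V = {k \<in> {k \<in> arrows G. r k \<in> r ` U}. gmult G (ginv G (inv_into U r (r k))) k \<in> V}"
    (is "_ = {k \<in> ?A. ?m k \<in> V}")
proof (intro Set.set_eqI iffI)
  note u = open_bisectionD[OF U] and v = open_bisectionD[OF V]
  fix k assume "k \<in> set_mult U V"
  then obtain g h where gh: "k = gmult G g h" "g \<in> U" "h \<in> V" "s g = r h" by (auto simp: set_mult_def)
  then have "g \<in> arrows G" "h \<in> arrows G" using u v by auto
  then show "k \<in> {k \<in> ?A. ?m k \<in> V}"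
    using gh set_mult_factor(1)[OF U V gh(2-4)] by (simp add: rng_gmult gmult_closed gmult_left_cancel)
next
  note u = open_bisectionD[OF U] and v = open_bisectionD[OF V]
  fix k assume k: "k \<in> {k \<in> ?A. ?m k \<in> V}"
  let ?g = "inv_into U r (r k)"
  have g: "?g \<in> U" "r ?g = r k" using k by (auto intro: inv_into_into f_inv_into_f)
  then have "?g \<in> arrows G" using u by auto
  then have "gmult G ?g (?m k) = k" "r (?m k) = s ?g"
    using k g(2) by (auto simp: gmult_inv_left rng_gmult ginv_closed src_ginv rng_ginv)
  moreover have "?m k \<in> V" using k by blast
  ultimately show "k \<in> set_mult U V" using g(1) unfolding set_mult_def mem_Collect_eq by metis
qed

lemma open_bisection_set_mult:
  assumes U: "open_bisection G U" and V: "open_bisection G V"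
  shows "open_bisection G (set_mult U V)"
  unfolding open_bisection_def
proof (intro conjI)
  note u = open_bisectionD[OF U] and v = open_bisectionD[OF V]
  let ?A = "{k \<in> arrows G. r k \<in> r ` U}" and ?m = "\<lambda>k. gmult G (ginv G (inv_into U r (r k))) k"
  have A: "openin T ?A" by (rule openin_continuous_map_preimage[OF continuous_rng open_rng[OF u(1)]])
  have top: "topspace (subtopology T ?A) = ?A" by auto
  have c1: "continuous_map (subtopology T ?A) (subtopology X (r ` U)) r"
    using continuous_rng by (auto simp: continuous_map_in_subtopology continuous_map_from_subtopology)
  have "continuous_map (subtopology T ?A) (subtopology T U) (\<lambda>k. inv_into U r (r k))"
    using continuous_map_compose[OF c1 continuous_inv_rng[OF U]] by (simp add: o_def)
  then have c2: "continuous_map (subtopology T ?A) T (\<lambda>k. inv_into U r (r k))"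
    by (simp add: continuous_map_in_subtopology)
  have c3: "continuous_map (subtopology T ?A) T (\<lambda>k. ginv G (inv_into U r (r k)))"
    using continuous_map_compose[OF c2 continuous_ginv] by (simp add: o_def)
  have "continuous_map (subtopology T ?A) T ?m"
  proof (rule continuous_map_gmult[OF c3])
    show "continuous_map (subtopology T ?A) T (\<lambda>k. k)" by (rule continuous_map_from_subtopology) simp
    fix k assume "k \<in> topspace (subtopology T ?A)"
    then have k: "inv_into U r (r k) \<in> U" "r (inv_into U r (r k)) = r k" by (auto intro: inv_into_into f_inv_into_f)
    then show "s (ginv G (inv_into U r (r k))) = r k" using u(4) by (auto simp: src_ginv)
  qed
  from openin_continuous_map_preimage[OF this v(1)]
  have "openin (subtopology T ?A) {k \<in> ?A. ?m k \<in> V}" unfolding top .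
  then show "openin T (set_mult U V)"
    unfolding set_mult_eq[OF U V] using A openin_trans_full by blast
  have *: "\<exists>g h. k = gmult G g h \<and> g \<in> U \<and> h \<in> V \<and> g \<in> arrows G \<and> h \<in> arrows G \<and> s g = r h \<and> r k = r g \<and> s k = s h"
    if "k \<in> set_mult U V" for k
    using that u(4) v(4) unfolding set_mult_def by (force simp: rng_gmult src_gmult)
  show "inj_on r (set_mult U V)" "inj_on s (set_mult U V)"
    using * u(2,3) v(2,3) by (intro inj_onI; metis inj_onD)+
qed

text \<open>A product is a unit only if its factors are inverse to each other. With \<open>U\<close>
  and \<open>V\<close> exchanged, the same arrows appear through their sources instead of their
  ranges, which is the geometric content of the trace property.\<close>

lemma set_mult_units:
  assumes "U \<subseteq> arrows G" "V \<subseteq> arrows G"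
  shows "set_mult U V \<inter> units G = r ` (U \<inter> ginv G ` V)"
proof (intro Set.set_eqI iffI)
  fix x assume "x \<in> set_mult U V \<inter> units G"
  then obtain g k where g: "x = gmult G g k" "g \<in> U" "k \<in> V" "s g = r k" "x \<in> units G" by (auto simp: set_mult_def)
  have "g \<in> arrows G" "k \<in> arrows G" using g assms by auto
  then have k: "k = ginv G g \<and> r g = x" using gmult_eq_unit_iff[of g k x] g by auto
  then have "g \<in> U \<inter> ginv G ` V" using g ginv_ginv[OF \<open>g \<in> arrows G\<close>] by (metis IntI imageI)
  then show "x \<in> r ` (U \<inter> ginv G ` V)" using k by blast
next
  fix x assume "x \<in> r ` (U \<inter> ginv G ` V)"
  then obtain g where g: "g \<in> U" "ginv G g \<in> V" "g \<in> arrows G" "x = r g" using assms by (auto simp: ginv_ginv subset_iff)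
  have "x = gmult G g (ginv G g)" "s g = r (ginv G g)" using g by (auto simp: gmult_ginv_right rng_ginv)
  then have "x \<in> set_mult U V"
    unfolding set_mult_def using g by (intro CollectI exI[of _ g] exI[of _ "ginv G g"]) simp
  then show "x \<in> set_mult U V \<inter> units G" using g(3,4) rng_in_units by blast
qed

text \<open>Composable pairs form a closed set because the unit space is Hausdorff, even if
  \<open>G\<close> is not; hence the composable part of a product of compact sets is
  compact.\<close>

lemma compactin_set_mult:
  assumes "compactin T K" "compactin T L"
  shows "compactin T (set_mult K L)"
proof -
  let ?S = "{p \<in> topspace (prod_topology T T). s (fst p) = r (snd p)}"
  have "continuous_map (prod_topology T T) X (s \<circ> fst)" "continuous_map (prod_topology T T) X (r \<circ> snd)"
    by (auto intro!: continuous_map_compose continuous_map_fst continuous_map_snd continuous_src continuous_rng)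
  then have "closedin (prod_topology T T) ?S"
    using closedin_continuous_maps_eq[OF Hausdorff_unit_space] by fastforce
  moreover have "compactin (prod_topology T T) (K \<times> L)" using assms by (simp add: compactin_Times)
  ultimately have "compactin (prod_topology T T) (?S \<inter> K \<times> L)" by (rule closed_Int_compactin)
  then have c: "compactin (subtopology (prod_topology T T) {(g, h). s g = r h}) (?S \<inter> K \<times> L)"
    by (auto simp: compactin_subtopology)
  have "K \<subseteq> arrows G" "L \<subseteq> arrows G" using assms compactin_subset_topspace by auto
  then have "(\<lambda>(g, h). gmult G g h) ` (?S \<inter> K \<times> L) = set_mult K L"
    by (auto simp: set_mult_def subset_iff image_iff) force
  with image_compactin[OF c continuous_gmult] show ?thesis by simp
qed

end

section \<open>Fell line bundles\<close>

lemma continuous_map_local: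
  assumes "\<And>x. x \<in> topspace Y \<Longrightarrow> \<exists>U. openin Y U \<and> x \<in> U \<and> continuous_map (subtopology Y U) Z f"
  shows "continuous_map Y Z f"
  unfolding continuous_map_eq_topcontinuous_at
proof
  fix x assume "x \<in> topspace Y"
  then obtain U where U: "openin Y U" "x \<in> U" "continuous_map (subtopology Y U) Z f" using assms by blast
  have fZ: "f y \<in> topspace Z" if "y \<in> topspace Y" for y
  proof -
    obtain W where "openin Y W" "y \<in> W" "continuous_map (subtopology Y W) Z f" using assms \<open>y \<in> topspace Y\<close> by blast
    then show ?thesis using that continuous_map_image_subset_topspace by fastforce
  qed
  show "topcontinuous_at Y Z f x"
    unfolding topcontinuous_at_def
  proof (intro conjI allI impI)
    fix V assume V: "openin Z V \<and> f x \<in> V"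
    have "openin (subtopology Y U) {y \<in> topspace (subtopology Y U). f y \<in> V}"
      using V by (intro openin_continuous_map_preimage[OF U(3)]) auto
    then have "openin Y {y \<in> topspace (subtopology Y U). f y \<in> V}" using U(1) openin_trans_full by blast
    then show "\<exists>U. openin Y U \<and> x \<in> U \<and> (\<forall>y\<in>U. f y \<in> V)"
      using U V \<open>x \<in> topspace Y\<close> by (intro exI[of _ "{y \<in> topspace (subtopology Y U). f y \<in> V}"]) auto
  qed (use \<open>x \<in> topspace Y\<close> fZ in auto)
qed

lemma continuous_map_norm_diff:
  fixes c :: "'y \<Rightarrow> 'b::real_normed_vector"
  assumes "\<And>y. y \<in> topspace Y \<Longrightarrow> continuous_map Y euclideanreal (\<lambda>z. norm (c z - c y))"
  shows "continuous_map Y euclidean c"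
  unfolding continuous_map_eq_topcontinuous_at
proof
  fix y assume y: "y \<in> topspace Y"
  show "topcontinuous_at Y euclidean c y"
    unfolding topcontinuous_at_def
  proof (intro conjI allI impI)
    fix V assume V: "openin euclidean V \<and> c y \<in> V"
    then obtain e where e: "e > 0" "\<And>z. dist z (c y) < e \<Longrightarrow> z \<in> V" using open_dist by (metis open_openin)
    have "openin Y {z \<in> topspace Y. norm (c z - c y) \<in> {..<e}}"
      by (rule openin_continuous_map_preimage[OF assms[OF y]]) simp
    then show "\<exists>U. openin Y U \<and> y \<in> U \<and> (\<forall>z\<in>U. c z \<in> V)"
      using e y by (intro exI[of _ "{z \<in> topspace Y. norm (c z - c y) \<in> {..<e}}"]) (auto simp: dist_norm)
  qed (use y in auto)
qed

context banach_line_bundle begin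

lemma fibreD: "a \<in> fibre L g \<Longrightarrow> a \<in> topspace (total L) \<and> proj L a = g"
  by (simp add: fibre_def)

lemma proj_in: "a \<in> topspace (total L) \<Longrightarrow> proj L a \<in> topspace X"
  using continuous_proj continuous_map_image_subset_topspace by blast

context fixes g assumes g: "g \<in> topspace X" begin

interpretation M: Module.module complex_field "fibre_space L g" by (rule fibre_module[OF g])

lemma lzero_fibre: "lzero L g \<in> fibre L g"
  and ladd_fibre: "a \<in> fibre L g \<Longrightarrow> b \<in> fibre L g \<Longrightarrow> ladd L a b \<in> fibre L g"
  and lscale_fibre: "a \<in> fibre L g \<Longrightarrow> lscale L c a \<in> fibre L g"
  and ladd_lzero: "a \<in> fibre L g \<Longrightarrow> ladd L a (lzero L g) = a"
  and lscale_lscale: "a \<in> fibre L g \<Longrightarrow> lscale L c (lscale L d a) = lscale L (c * d) a"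
  and lscale_add: "a \<in> fibre L g \<Longrightarrow> lscale L (c + d) a = ladd L (lscale L c a) (lscale L d a)"
  and lscale_1: "a \<in> fibre L g \<Longrightarrow> lscale L 1 a = a"
  and lscale_lzero: "lscale L c (lzero L g) = lzero L g"
  and abelian_monoid_fibre: "abelian_monoid (fibre_space L g)"
  using M.zero_closed M.a_closed[of a b] M.smult_closed[of c a] M.r_zero[of a] M.smult_assoc1[of c d a]
    M.smult_l_distr[of c d a] M.smult_one[of a] M.smult_r_null[of c] M.abelian_monoid_axioms
  by (auto simp: fibre_space_def complex_field_def)

lemma lscale_0: "a \<in> fibre L g \<Longrightarrow> lscale L 0 a = lzero L g"
  using M.smult_l_null[of a] by (auto simp: fibre_space_def complex_field_def)

end

lemma lscale_eq_lzero:
  assumes "a \<in> fibre L g" "g \<in> topspace X" "lscale L c a = lzero L g" "a \<noteq> lzero L g"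
  shows "c = 0"
proof -
  have "lnorm L (lscale L c a) = 0"
    using assms lnorm_eq_0_iff[of "lzero L g"] lzero_fibre[of g] by (auto simp: fibre_def)
  moreover have "lnorm L a \<noteq> 0" using assms lnorm_eq_0_iff[of a] by (auto simp: fibre_def)
  ultimately show ?thesis using lnorm_lscale[of a c] fibreD[OF assms(1)] by auto
qed

lemma lscale_cancel:
  assumes "a \<in> fibre L g" "g \<in> topspace X" "lscale L c a = lscale L d a" "a \<noteq> lzero L g"
  shows "c = d"
proof -
  have "lscale L (c + - d) a = lscale L (d + - d) a"
    using assms by (simp only: lscale_add[OF assms(2,1)])
  then have "lscale L (c - d) a = lzero L g" using lscale_0[OF assms(2,1)] by simp
  from lscale_eq_lzero[OF assms(1,2) this assms(4)] show ?thesis by simp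
qed

lemma spans:
  assumes "a \<in> fibre L g" "g \<in> topspace X" "a \<noteq> lzero L g" "b \<in> fibre L g"
  shows "\<exists>c. b = lscale L c a"
proof -
  obtain e where e: "e \<in> fibre L g" "\<And>a. a \<in> fibre L g \<Longrightarrow> \<exists>c. a = lscale L c e"
    using fibre_one_dimensional[OF assms(2)] by blast
  obtain c where c: "a = lscale L c e" using e(2) assms(1) by blast
  obtain d where d: "b = lscale L d e" using e(2) assms(4) by blast
  have "c \<noteq> 0" using assms(3) c lscale_0[OF assms(2) e(1)] by auto
  then have "b = lscale L (d / c) a" using c d lscale_lscale[OF assms(2) e(1)] by simp
  then show ?thesis by blast
qed

lemma lnorm_lzero: "g \<in> topspace X \<Longrightarrow> lnorm L (lzero L g) = 0"
  using lnorm_eq_0_iff lzero_fibre by (auto simp: fibre_def)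

lemma continuous_map_ladd:
  assumes "continuous_map Y (total L) a" "continuous_map Y (total L) b"
    and "\<And>y. y \<in> topspace Y \<Longrightarrow> proj L (a y) = proj L (b y)"
  shows "continuous_map Y (total L) (\<lambda>y. ladd L (a y) (b y))"
proof -
  have "continuous_map Y (subtopology (prod_topology (total L) (total L)) {(a, b). proj L a = proj L b}) (\<lambda>y. (a y, b y))"
    using assms by (auto simp: continuous_map_in_subtopology intro!: continuous_map_pairedI)
  from continuous_map_compose[OF this continuous_ladd] show ?thesis by (simp add: o_def)
qed

lemma continuous_map_lscale:
  assumes "continuous_map Y euclidean c" "continuous_map Y (total L) a"
  shows "continuous_map Y (total L) (\<lambda>y. lscale L (c y) (a y))"
proof -
  have "continuous_map Y (prod_topology euclidean (total L)) (\<lambda>y. (c y, a y))"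
    using assms by (auto intro!: continuous_map_pairedI)
  from continuous_map_compose[OF this continuous_lscale] show ?thesis by (simp add: o_def)
qed

lemma continuous_map_lnorm:
  "continuous_map Y (total L) a \<Longrightarrow> continuous_map Y euclideanreal (\<lambda>y. lnorm L (a y))"
  using continuous_map_compose[OF _ continuous_lnorm] by (simp add: o_def)

text \<open>Since \<open>e\<close> has norm one, \<open>|c z - c y|\<close> is the norm at
  \<open>z\<close> of the continuous section \<open>a - c y e\<close>; continuity of the coefficient
  is thus read off from that of the bundle norm.\<close>

lemma continuous_coefficient:
  assumes a: "continuous_map Y (total L) a" and e: "continuous_map Y (total L) e"
    and eq: "\<And>y. y \<in> topspace Y \<Longrightarrow> a y = lscale L (c y) (e y)"
    and nz: "\<And>y. y \<in> topspace Y \<Longrightarrow> lnorm L (e y) = 1"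
  shows "continuous_map Y euclidean c"
proof (rule continuous_map_norm_diff)
  fix y assume y: "y \<in> topspace Y"
  have eF: "e z \<in> fibre L (proj L (e z))" "proj L (e z) \<in> topspace X" if "z \<in> topspace Y" for z
  proof -
    have "e z \<in> topspace (total L)" using continuous_map_image_subset_topspace[OF e] that by blast
    then show "e z \<in> fibre L (proj L (e z))" "proj L (e z) \<in> topspace X" using proj_in by (auto simp: fibre_def)
  qed
  have pa: "proj L (a z) = proj L (lscale L d (e z))" if "z \<in> topspace Y" for z d
    using lscale_fibre[OF eF(2,1)[OF that]] eq[OF that] by (auto simp: fibre_def)
  have "continuous_map Y (total L) (\<lambda>z. ladd L (a z) (lscale L (- c y) (e z)))"
    by (intro continuous_map_ladd continuous_map_lscale a e) (auto simp: pa)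
  then have "continuous_map Y euclideanreal (\<lambda>z. lnorm L (ladd L (a z) (lscale L (- c y) (e z))))"
    by (rule continuous_map_lnorm)
  then show "continuous_map Y euclideanreal (\<lambda>z. cmod (c z - c y))"
  proof (rule continuous_map_eq)
    fix z assume z: "z \<in> topspace Y"
    have "ladd L (a z) (lscale L (- c y) (e z)) = lscale L (c z - c y) (e z)"
      using lscale_add[OF eF(2,1)[OF z], of "c z" "- c y"] eq[OF z] by simp
    then show "lnorm L (ladd L (a z) (lscale L (- c y) (e z))) = cmod (c z - c y)"
      using lnorm_lscale[of "e z"] eF(1)[OF z] nz[OF z] by (auto simp: fibre_def)
  qed
qed

end

context twisted_etale_groupoid begin

abbreviation "Fb \<equiv> fibre L"

lemma continuous_map_lmult:
  assumes "continuous_map Y (total L) a" "continuous_map Y (total L) b"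
    and "\<And>y. y \<in> topspace Y \<Longrightarrow> s (proj L (a y)) = r (proj L (b y))"
  shows "continuous_map Y (total L) (\<lambda>y. lmult L (a y) (b y))"
proof -
  have "continuous_map Y (subtopology (prod_topology (total L) (total L)) {(a, b). s (proj L a) = r (proj L b)}) (\<lambda>y. (a y, b y))"
    using assms by (auto simp: continuous_map_in_subtopology intro!: continuous_map_pairedI)
  from continuous_map_compose[OF this continuous_lmult] show ?thesis by (simp add: o_def)
qed

lemma continuous_map_lstar:
  "continuous_map Y (total L) a \<Longrightarrow> continuous_map Y (total L) (\<lambda>y. lstar L (a y))"
  using continuous_map_compose[OF _ continuous_lstar] by (simp add: o_def)

lemma lstar_lzero: "g \<in> arrows G \<Longrightarrow> lstar L (lzero L g) = lzero L (ginv G g)"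
  using lstar_lscale[of g "lzero L g" 0] lscale_0[OF ginv_closed, OF _ lstar_closed, of g "lzero L g"]
    lscale_0[of g "lzero L g"] lzero_fibre[of g] by simp

lemma lmult_lzero:
  assumes "g \<in> arrows G" "h \<in> arrows G" "s g = r h"
  shows "a \<in> Fb g \<Longrightarrow> lmult L a (lzero L h) = lzero L (gmult G g h)"
    and "b \<in> Fb h \<Longrightarrow> lmult L (lzero L g) b = lzero L (gmult G g h)"
proof -
  note z = lzero_fibre[OF assms(1)] lzero_fibre[OF assms(2)]
  have gh: "gmult G g h \<in> arrows G" using assms by (simp add: gmult_closed)
  show "lmult L a (lzero L h) = lzero L (gmult G g h)" if "a \<in> Fb g"
    using lmult_lscale_right[OF assms that z(2), of 0] lscale_0[OF gh lmult_closed[OF assms that z(2)]]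
      lscale_0[OF assms(2) z(2)] by simp
  show "lmult L (lzero L g) b = lzero L (gmult G g h)" if "b \<in> Fb h"
    using lmult_lscale_left[OF assms z(1) that, of 0] lscale_0[OF gh lmult_closed[OF assms z(1) that]]
      lscale_0[OF assms(1) z(1)] by simp
qed

lemma gmult_unit: "u \<in> units G \<Longrightarrow> gmult G u u = u"
  using gmult_rng[of u] by (auto simp: units_iff)

lemma lmult_unit_fibre: "u \<in> units G \<Longrightarrow> a \<in> Fb u \<Longrightarrow> b \<in> Fb u \<Longrightarrow> lmult L a b \<in> Fb u"
  using lmult_closed[of u u a b] by (simp add: gmult_unit src_unit rng_unit subsetD[OF units_arrows])

text \<open>If \<open>e\<close> spans the fibre and \<open>e e = c e\<close>, then
  \<open>e / c\<close> is an identity; the C*-identity for the bundle norm excludes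
  \<open>c = 0\<close>.\<close>

lemma ex_fibre_unit:
  assumes u: "u \<in> units G"
  shows "\<exists>e. e \<in> Fb u \<and> (\<forall>a\<in>Fb u. lmult L e a = a \<and> lmult L a e = a)"
proof -
  note uG = subsetD[OF units_arrows u]
  note uu = uG uG trans[OF src_unit[OF u] rng_unit[OF u, symmetric]]
  obtain e where e: "e \<in> Fb u" "e \<noteq> lzero L u" and span: "\<And>a. a \<in> Fb u \<Longrightarrow> \<exists>c. a = lscale L c e"
    using fibre_one_dimensional[OF uG] by blast
  obtain c where c: "lmult L e e = lscale L c e" using span lmult_unit_fibre[OF u e(1) e(1)] by blast
  obtain d where d: "lstar L e = lscale L d e" using span lstar_closed[OF uG e(1)] ginv_unit[OF u] by metis
  have "c \<noteq> 0"
  proof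
    assume "c = 0"
    then have "lmult L (lstar L e) e = lzero L u"
      using lmult_lscale_left[OF uu e(1) e(1), of d] c d lscale_0[OF uG e(1)] lscale_lzero[OF uG] by simp
    then have "(lnorm L e)\<^sup>2 = 0" using lnorm_lstar_lmult[OF uG e(1)] lnorm_lzero[OF uG] by simp
    then show False using lnorm_eq_0_iff[of e] e by (auto simp: fibre_def)
  qed
  have m: "lmult L (lscale L x e) (lscale L y e) = lscale L (x * y * c) e" for x y
    using lmult_lscale_left[OF uu e(1) lscale_fibre[OF uG e(1)], of x y] lmult_lscale_right[OF uu e(1) e(1), of y] c
    by (simp add: lscale_lscale[OF uG e(1)] mult.assoc)
  show ?thesis
  proof (intro exI[of _ "lscale L (1/c) e"] conjI ballI)
    show "lscale L (1/c) e \<in> Fb u" by (rule lscale_fibre[OF uG e(1)])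
    fix a assume "a \<in> Fb u"
    then obtain x where x: "a = lscale L x e" using span by blast
    show "lmult L (lscale L (1/c) e) a = a" "lmult L a (lscale L (1/c) e) = a"
      using \<open>c \<noteq> 0\<close> by (simp_all add: x m)
  qed
qed

lemma fibre_unit:
  assumes u: "u \<in> units G"
  shows "fibre_unit L u \<in> Fb u" "a \<in> Fb u \<Longrightarrow> lmult L (fibre_unit L u) a = a" "a \<in> Fb u \<Longrightarrow> lmult L a (fibre_unit L u) = a"
proof -
  have "\<exists>!e. e \<in> Fb u \<and> (\<forall>a\<in>Fb u. lmult L e a = a \<and> lmult L a e = a)"
    using ex_fibre_unit[OF u] by metis
  from theI'[OF this] show "fibre_unit L u \<in> Fb u" "a \<in> Fb u \<Longrightarrow> lmult L (fibre_unit L u) a = a" "a \<in> Fb u \<Longrightarrow> lmult L a (fibre_unit L u) = a"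
    unfolding fibre_unit_def by auto
qed

lemma lstar_fibre_unit:
  assumes u: "u \<in> units G"
  shows "lstar L (fibre_unit L u) = fibre_unit L u"
proof -
  note uG = subsetD[OF units_arrows u] and e = fibre_unit[OF u]
  note uu = uG uG trans[OF src_unit[OF u] rng_unit[OF u, symmetric]]
  have s: "lstar L (fibre_unit L u) \<in> Fb u" using lstar_closed[OF uG e(1)] ginv_unit[OF u] by simp
  have "lstar L (lmult L (lstar L (fibre_unit L u)) (fibre_unit L u)) =
      lmult L (lstar L (fibre_unit L u)) (lstar L (lstar L (fibre_unit L u)))"
    by (rule lstar_lmult[OF uu s e(1)])
  then show ?thesis using e(3)[OF s] lstar_lstar[OF uG e(1)] by simp
qed

lemma fibre_unit_nonzero:
  assumes u: "u \<in> units G"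
  shows "fibre_unit L u \<noteq> lzero L u"
proof
  note uG = subsetD[OF units_arrows u] and e = fibre_unit[OF u]
  note uu = uG uG trans[OF src_unit[OF u] rng_unit[OF u, symmetric]]
  assume z: "fibre_unit L u = lzero L u"
  obtain a where a: "a \<in> Fb u" "a \<noteq> lzero L u" using fibre_one_dimensional[OF uG] by blast
  then show False using e(2)[OF a(1)] lmult_lzero(2)[OF uu a(1)] z gmult_unit[OF u] by simp
qed

lemma lnorm_fibre_unit:
  assumes u: "u \<in> units G"
  shows "lnorm L (fibre_unit L u) = 1"
proof -
  note uG = subsetD[OF units_arrows u] and e = fibre_unit[OF u]
  have "lnorm L (fibre_unit L u) = (lnorm L (fibre_unit L u))\<^sup>2"
    using lnorm_lstar_lmult[OF uG e(1)] e(2)[OF e(1)] lstar_fibre_unit[OF u] by simp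
  moreover have "lnorm L (fibre_unit L u) \<noteq> 0"
    using fibre_unit_nonzero[OF u] lnorm_eq_0_iff[of "fibre_unit L u"] e(1) by (auto simp: fibre_def)
  ultimately show ?thesis by (simp add: power2_eq_square)
qed

lemma lnorm_lstar:
  assumes "g \<in> arrows G" "a \<in> Fb g"
  shows "lnorm L (lstar L a) = lnorm L a"
proof -
  have le: "lnorm L a \<le> lnorm L (lstar L a)" if "g \<in> arrows G" "a \<in> Fb g" for g a
  proof (cases "lnorm L a = 0")
    case True
    then show ?thesis using lnorm_nonneg[of "lstar L a"] lstar_closed[OF that] by (auto simp: fibre_def)
  next
    case False
    have "lnorm L a * lnorm L a \<le> lnorm L (lstar L a) * lnorm L a"
      using lnorm_lstar_lmult[OF that] lnorm_lmult[of "ginv G g" g "lstar L a" a] that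
      by (simp add: power2_eq_square ginv_closed src_ginv lstar_closed)
    moreover have "0 \<le> lnorm L a" using lnorm_nonneg[of a] that by (auto simp: fibre_def)
    ultimately show ?thesis using False by simp
  qed
  from le[OF assms] le[OF ginv_closed[OF assms(1)] lstar_closed[OF assms]] show ?thesis
    using lstar_lstar[OF assms] by simp
qed

text \<open>The identity over \<open>r g\<close> acts on the line over \<open>g\<close> by a scalar
  \<open>t\<close> with \<open>t * t = t\<close>. The value 0 would kill the product of
  \<open>a\<close> with its adjoint, against the norm identity.\<close>

lemma fibre_unit_left:
  assumes g: "g \<in> arrows G" and a: "a \<in> Fb g"
  shows "lmult L (fibre_unit L (r g)) a = a"
proof (cases "a = lzero L g")
  case True
  then show ?thesis
    using lmult_lzero(1)[of "r g" g "fibre_unit L (r g)"] fibre_unit(1)[of "r g"] g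
    by (simp add: rng_in_units rng_closed src_rng gmult_rng)
next
  case False
  note u = rng_in_units[OF g]
  note uG = rng_closed[OF g] and e = fibre_unit[OF u]
  note uu = uG uG trans[OF src_unit[OF u] rng_unit[OF u, symmetric]]
  have i: "ginv G g \<in> arrows G" "s g = r (ginv G g)" using g by (auto simp: ginv_closed rng_ginv)
  have ug: "s (r g) = r g" "gmult G (r g) g = g" using g by (auto simp: src_rng gmult_rng)
  have ea: "lmult L (fibre_unit L (r g)) a \<in> Fb g" using lmult_closed[OF uG g ug(1) e(1) a] ug(2) by simp
  then obtain t where t: "lmult L (fibre_unit L (r g)) a = lscale L t a" using spans[OF a g False] by blast
  have "lmult L (fibre_unit L (r g)) (lscale L t a) = lscale L t (lscale L t a)"
    using lmult_lscale_right[OF uG g ug(1) e(1) a, of t] t by simp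
  moreover have "lmult L (fibre_unit L (r g)) (lmult L (fibre_unit L (r g)) a) = lmult L (fibre_unit L (r g)) a"
    using lmult_assoc[OF uG uG g uu(3) ug(1) e(1) e(1) a] e(2)[OF e(1)] by simp
  ultimately have "lscale L (t * t) a = lscale L t a" using t lscale_lscale[OF g a] by simp
  then have "t * t = t" using lscale_cancel[OF a g] False by blast
  moreover have "t \<noteq> 0"
  proof
    assume "t = 0"
    then have z: "lmult L (fibre_unit L (r g)) a = lzero L g" using t lscale_0[OF g a] by simp
    have as: "lmult L a (lstar L a) \<in> Fb (r g)"
      using lmult_closed[OF g i a lstar_closed[OF g a]] g by (simp add: gmult_ginv_right)
    have "lmult L a (lstar L a) = lmult L (fibre_unit L (r g)) (lmult L a (lstar L a))"
      using e(2)[OF as] by simp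
    also have "\<dots> = lmult L (lzero L g) (lstar L a)"
      using lmult_assoc[OF uG g i(1) ug(1) i(2) e(1) a lstar_closed[OF g a]] z by simp
    also have "\<dots> = lzero L (r g)"
      using lmult_lzero(2)[OF g i lstar_closed[OF g a]] g by (simp add: gmult_ginv_right)
    finally have "lnorm L (lmult L a (lstar L a)) = 0" using lnorm_lzero[OF uG] by simp
    then have "(lnorm L (lstar L a))\<^sup>2 = 0"
      using lnorm_lstar_lmult[OF i(1) lstar_closed[OF g a]] lstar_lstar[OF g a] by simp
    then have "lnorm L a = 0" using lnorm_lstar[OF g a] by simp
    then show False using lnorm_eq_0_iff[of a] a False by (auto simp: fibre_def)
  qed
  ultimately have "t = 1" by simp
  then show ?thesis using t lscale_1[OF g a] by simp
qed

lemma fibre_unit_right: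
  assumes g: "g \<in> arrows G" and a: "a \<in> Fb g"
  shows "lmult L a (fibre_unit L (s g)) = a"
proof -
  note u = src_in_units[OF g]
  have i: "ginv G g \<in> arrows G" "lstar L a \<in> Fb (ginv G g)" using g a by (auto simp: ginv_closed lstar_closed)
  have m: "lmult L a (fibre_unit L (s g)) \<in> Fb g"
    using lmult_closed[OF g src_closed[OF g] _ a fibre_unit(1)[OF u]] g by (simp add: rng_src gmult_src)
  have "lstar L (lmult L a (fibre_unit L (s g))) = lmult L (fibre_unit L (s g)) (lstar L a)"
    using lstar_lmult[OF g src_closed[OF g] _ a fibre_unit(1)[OF u]] g lstar_fibre_unit[OF u] by (simp add: rng_src)
  also have "\<dots> = lstar L a" using fibre_unit_left[OF i] g by (simp add: rng_ginv)
  finally show ?thesis using lstar_lstar[OF g m] lstar_lstar[OF g a] by simp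
qed

text \<open>The positivity axiom replaces \<open>a\<close> by an element \<open>b\<close> of the
  fibre over \<open>s g\<close>. This \<open>b\<close> is a multiple \<open>t\<close> of the
  identity, and the norm identity evaluates the square of \<open>|t|\<close>.\<close>

lemma lstar_lmult_self:
  assumes g: "g \<in> arrows G" and a: "a \<in> Fb g"
  shows "lmult L (lstar L a) a = lscale L (complex_of_real ((lnorm L a)\<^sup>2)) (fibre_unit L (s g))"
proof -
  note u = src_in_units[OF g]
  note uG = src_closed[OF g] and e = fibre_unit[OF u]
  note uu = uG uG trans[OF src_unit[OF u] rng_unit[OF u, symmetric]]
  obtain b where b: "b \<in> Fb (s g)" "lmult L (lstar L a) a = lmult L (lstar L b) b"
    using lstar_lmult_positive[OF g a] by blast
  obtain t where t: "b = lscale L t (fibre_unit L (s g))"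
    using spans[OF e(1) uG fibre_unit_nonzero[OF u] b(1)] by blast
  have "lmult L (lstar L b) b = lscale L (cnj t) (lscale L t (fibre_unit L (s g)))"
    unfolding t using lstar_lscale[OF uG e(1), of t] lstar_fibre_unit[OF u]
      lmult_lscale_left[OF uu e(1) lscale_fibre[OF uG e(1)], of "cnj t" t] e(2)[OF lscale_fibre[OF uG e(1)]] by simp
  then have eq: "lmult L (lstar L a) a = lscale L (cnj t * t) (fibre_unit L (s g))"
    using b(2) lscale_lscale[OF uG e(1)] by simp
  have "(lnorm L a)\<^sup>2 = cmod (cnj t * t)"
    using lnorm_lstar_lmult[OF g a] eq lnorm_lscale[of "fibre_unit L (s g)"] e(1) lnorm_fibre_unit[OF u]
    by (simp add: fibre_def)
  then have "complex_of_real ((lnorm L a)\<^sup>2) = cnj t * t"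
    using complex_norm_square[of t] by (simp add: norm_mult power2_eq_square mult.commute)
  then show ?thesis using eq by simp
qed

end

section \<open>Coordinates and convolution\<close>

context twisted_etale_groupoid begin

text \<open>A discontinuous trivialisation of the bundle by unit vectors.  Over the units it is the identity
  section, so that \<open>cf\<close> extends the coordinate used in the restriction of sections to the units.\<close>

definition bas :: "'g \<Rightarrow> 'l" where
  "bas g = (if g \<in> units G then fibre_unit L g else (SOME e. e \<in> Fb g \<and> lnorm L e = 1))"

definition cf :: "'l \<Rightarrow> complex" where
  "cf a = (THE c. a = lscale L c (bas (proj L a)))"

lemma bas:
  assumes g: "g \<in> arrows G"
  shows "bas g \<in> Fb g" "lnorm L (bas g) = 1"
proof -
  have "bas g \<in> Fb g \<and> lnorm L (bas g) = 1"
  proof (cases "g \<in> units G")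
    case True
    then show ?thesis using fibre_unit(1) lnorm_fibre_unit by (simp add: bas_def)
  next
    case False
    obtain e where e: "e \<in> Fb g" "e \<noteq> lzero L g" using fibre_one_dimensional[OF g] by blast
    then have n: "lnorm L e > 0" using lnorm_nonneg[of e] lnorm_eq_0_iff[of e] by (auto simp: fibre_def)
    have "lscale L (1 / lnorm L e) e \<in> Fb g" using e(1) lscale_fibre[OF g] by blast
    moreover have "lnorm L (lscale L (1 / lnorm L e) e) = 1"
      using n lnorm_lscale[of e] fibreD[OF e(1)] by (simp add: norm_divide)
    ultimately have "\<exists>e. e \<in> Fb g \<and> lnorm L e = 1" by blast
    from someI_ex[OF this] show ?thesis using False by (simp add: bas_def)
  qed
  then show "bas g \<in> Fb g" "lnorm L (bas g) = 1" by auto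
qed

lemma bas_unit: "u \<in> units G \<Longrightarrow> bas u = fibre_unit L u"
  by (simp add: bas_def)

lemma bas_nonzero: "g \<in> arrows G \<Longrightarrow> bas g \<noteq> lzero L g"
  using bas(2) lnorm_lzero by fastforce

lemma cf_lscale_bas:
  assumes g: "g \<in> arrows G"
  shows "cf (lscale L c (bas g)) = c"
proof -
  have "proj L (lscale L c (bas g)) = g" using lscale_fibre[OF g bas(1)[OF g]] by (simp add: fibre_def)
  then show ?thesis
    unfolding cf_def using lscale_cancel[OF bas(1)[OF g] g _ bas_nonzero[OF g]] by (intro the_equality) auto
qed

lemma cf_bas: "g \<in> arrows G \<Longrightarrow> cf (bas g) = 1"
  using cf_lscale_bas[of g 1] lscale_1[of g "bas g"] bas(1)[of g] by simp

lemma cf_eq: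
  assumes g: "g \<in> arrows G" and a: "a \<in> Fb g"
  shows "lscale L (cf a) (bas g) = a"
proof -
  obtain c where c: "a = lscale L c (bas g)" using spans[OF bas(1)[OF g] g bas_nonzero[OF g] a] by blast
  then show ?thesis by (simp add: cf_lscale_bas[OF g])
qed

context fixes g assumes g: "g \<in> arrows G" begin

lemma cf_inj: "a \<in> Fb g \<Longrightarrow> b \<in> Fb g \<Longrightarrow> cf a = cf b \<Longrightarrow> a = b"
  using cf_eq[OF g] by metis

lemma cf_lscale: "a \<in> Fb g \<Longrightarrow> cf (lscale L c a) = c * cf a"
  using cf_eq[OF g, of a] lscale_lscale[OF g bas(1)[OF g]] cf_lscale_bas[OF g] by metis

lemma cf_ladd: "a \<in> Fb g \<Longrightarrow> b \<in> Fb g \<Longrightarrow> cf (ladd L a b) = cf a + cf b"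
  using cf_eq[OF g, of a] cf_eq[OF g, of b] lscale_add[OF g bas(1)[OF g]] cf_lscale_bas[OF g] by metis

lemma cf_lzero: "cf (lzero L g) = 0"
  using cf_lscale_bas[OF g, of 0] lscale_0[OF g bas(1)[OF g]] by simp

lemma cf_eq_0_iff: "a \<in> Fb g \<Longrightarrow> cf a = 0 \<longleftrightarrow> a = lzero L g"
  using cf_inj[of a "lzero L g"] cf_lzero lzero_fibre[OF g] by auto

lemma lnorm_cf: "a \<in> Fb g \<Longrightarrow> lnorm L a = cmod (cf a)"
  using cf_eq[OF g, of a] lnorm_lscale[of "bas g" "cf a"] bas[OF g] by (simp add: fibre_def)

lemma cf_finsum:
  assumes "finite A" "\<And>i. i \<in> A \<Longrightarrow> f i \<in> Fb g"
  shows "finsum (fibre_space L g) f A \<in> Fb g \<and> cf (finsum (fibre_space L g) f A) = (\<Sum>i\<in>A. cf (f i))"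
proof -
  interpret abelian_monoid "fibre_space L g" by (rule abelian_monoid_fibre[OF g])
  have car: "carrier (fibre_space L g) = Fb g" "add (fibre_space L g) = ladd L" "zero (fibre_space L g) = lzero L g"
    by (auto simp: fibre_space_def)
  show ?thesis
    using assms
  proof (induction A)
    case empty
    then show ?case using lzero_fibre[OF g] cf_lzero by (simp add: car)
  next
    case (insert x A)
    have "finsum (fibre_space L g) f (insert x A) = ladd L (f x) (finsum (fibre_space L g) f A)"
      using insert by (subst finsum_insert) (auto simp: car)
    then show ?case using insert ladd_fibre[OF g] cf_ladd by simp
  qed
qed

end

lemma restrict_units_cf:
  assumes u: "u \<in> units G" and f: "f u \<in> Fb u"
  shows "restrict_units G L f u = cf (f u)"
proof -
  have g: "u \<in> arrows G" using u units_arrows by auto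
  show ?thesis
    unfolding restrict_units_def
    using u cf_eq[OF g f] lscale_cancel[OF bas(1)[OF g] g _ bas_nonzero[OF g]] 
    by (auto simp: bas_unit intro!: the_equality)
qed

lemma restrict_units_outside: "u \<notin> units G \<Longrightarrow> restrict_units G L f u = 0"
  by (simp add: restrict_units_def)

text \<open>The trace property on fibres: the two products lie over the possibly different units
  \<open>r g\<close> and \<open>s g\<close>, yet have equal coordinates. In one dimension
  \<open>b\<close> is a multiple \<open>t\<close> of the adjoint of \<open>a\<close> when
  \<open>a\<close> is nonzero, and both coordinates are \<open>t\<close> times the squared norm of
  \<open>a\<close>.\<close>

lemma cf_lmult_commute:
  assumes g: "g \<in> arrows G" and a: "a \<in> Fb g" and b: "b \<in> Fb (ginv G g)"
  shows "cf (lmult L a b) = cf (lmult L b a)"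
proof -
  have i: "ginv G g \<in> arrows G" "s g = r (ginv G g)" "s (ginv G g) = r g" using g by (auto simp: ginv_closed rng_ginv src_ginv)
  have ru: "r g \<in> arrows G" "s g \<in> arrows G" "r g \<in> units G" "s g \<in> units G"
    using g by (auto simp: rng_closed src_closed rng_in_units src_in_units)
  show ?thesis
  proof (cases "a = lzero L g")
    case True
    then show ?thesis
      using lmult_lzero(2)[OF g i(1,2) b] lmult_lzero(1)[OF i(1) g i(3) b] ru
      by (simp add: gmult_ginv_right gmult_ginv_left g cf_lzero)
  next
    case False
    have sa: "lstar L a \<in> Fb (ginv G g)" by (rule lstar_closed[OF g a])
    have "lstar L a \<noteq> lzero L (ginv G g)"
      using False lstar_lstar[OF g a] lstar_lzero[OF i(1)] g by (auto simp: ginv_ginv)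
    then obtain t where t: "b = lscale L t (lstar L a)" using spans[OF sa i(1) _ b] by blast
    have 1: "lmult L (lstar L a) a = lscale L (complex_of_real ((lnorm L a)\<^sup>2)) (bas (s g))"
      using lstar_lmult_self[OF g a] ru by (simp add: bas_unit)
    have 2: "lmult L a (lstar L a) = lscale L (complex_of_real ((lnorm L a)\<^sup>2)) (bas (r g))"
      using lstar_lmult_self[OF i(1) sa] ru lstar_lstar[OF g a] lnorm_lstar[OF g a] i by (simp add: bas_unit)
    show ?thesis
      unfolding t lmult_lscale_right[OF g i(1,2) a sa] lmult_lscale_left[OF i(1) g i(3) sa a] 1 2
      using ru bas(1) by (simp add: cf_lscale cf_lscale_bas lscale_fibre cf_bas)
  qed
qed

lemma cf_lstar_lmult:
  assumes g: "g \<in> arrows G" and a: "a \<in> Fb g"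
  shows "cf (lmult L (lstar L a) a) = complex_of_real ((cmod (cf a))\<^sup>2)"
  using lstar_lmult_self[OF g a] cf_lscale_bas[OF src_closed[OF g]] g
  by (simp add: bas_unit src_in_units lnorm_cf[OF g a])

lemma cf_lstar_unit:
  assumes u: "u \<in> units G" and a: "a \<in> Fb u"
  shows "cf (lstar L a) = cnj (cf a)"
proof -
  have g: "u \<in> arrows G" using u units_arrows by auto
  have "lstar L (lscale L (cf a) (bas u)) = lscale L (cnj (cf a)) (bas u)"
    using lstar_lscale[OF g bas(1)[OF g]] lstar_fibre_unit[OF u] by (simp add: bas_unit[OF u])
  then show ?thesis using cf_eq[OF g a] cf_lscale_bas[OF g] by simp
qed

lemma lmult_scaled_unit_left:
  assumes g: "g \<in> arrows G" and a: "a \<in> Fb g"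
  shows "lmult L (lscale L c (fibre_unit L (r g))) a = lscale L c a"
  using lmult_lscale_left[OF rng_closed[OF g] g src_rng[OF g] fibre_unit(1)[OF rng_in_units[OF g]] a]
    fibre_unit_left[OF g a] by simp

lemma lmult_scaled_unit_right:
  assumes g: "g \<in> arrows G" and a: "a \<in> Fb g"
  shows "lmult L a (lscale L c (fibre_unit L (s g))) = lscale L c a"
  using lmult_lscale_right[OF g src_closed[OF g] _ a fibre_unit(1)[OF src_in_units[OF g]]] g
    fibre_unit_right[OF g a] by (simp add: rng_src)

lemma sectionsD: "f \<in> sections G L \<Longrightarrow> g \<in> arrows G \<Longrightarrow> f g \<in> Fb g"
  by (auto simp: sections_def)

lemma sections_eqI:
  assumes "f \<in> sections G L" "h \<in> sections G L" "\<And>g. g \<in> arrows G \<Longrightarrow> cf (f g) = cf (h g)"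
  shows "f = h"
proof (rule PiE_ext)
  show "f \<in> (\<Pi>\<^sub>E g \<in> arrows G. Fb g)" "h \<in> (\<Pi>\<^sub>E g \<in> arrows G. Fb g)"
    using assms by (auto simp: sections_def)
qed (use assms cf_inj sectionsD in blast)

lemma sections_restrict: "(\<And>g. g \<in> arrows G \<Longrightarrow> f g \<in> Fb g) \<Longrightarrow> (\<lambda>g\<in>arrows G. f g) \<in> sections G L"
  by (auto simp: sections_def)

lemma sec_add_sections: "f \<in> sections G L \<Longrightarrow> h \<in> sections G L \<Longrightarrow> sec_add G L f h \<in> sections G L"
  unfolding sec_add_def by (intro sections_restrict ladd_fibre) (auto intro: sectionsD)

lemma sec_scale_sections: "f \<in> sections G L \<Longrightarrow> sec_scale G L c f \<in> sections G L"
  unfolding sec_scale_def by (intro sections_restrict lscale_fibre) (auto intro: sectionsD)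

lemma sec_star_sections: "f \<in> sections G L \<Longrightarrow> sec_star G L f \<in> sections G L"
  unfolding sec_star_def
  by (intro sections_restrict) (metis ginv_closed ginv_ginv lstar_closed sectionsD)

lemma sec_star_sec_star:
  assumes f: "f \<in> sections G L"
  shows "sec_star G L (sec_star G L f) = f"
proof (rule sections_eqI)
  fix g assume "g \<in> arrows G"
  then show "cf (sec_star G L (sec_star G L f) g) = cf (f g)"
    using lstar_lstar[of g "f g"] sectionsD[OF f] by (simp add: sec_star_def ginv_closed ginv_ginv)
qed (use f in \<open>auto simp: sec_star_sections\<close>)

lemma cf_sec_add: "f \<in> sections G L \<Longrightarrow> h \<in> sections G L \<Longrightarrow> g \<in> arrows G \<Longrightarrow> cf (sec_add G L f h g) = cf (f g) + cf (h g)"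
  unfolding sec_add_def by (simp add: cf_ladd sectionsD)

lemma cf_sec_scale: "f \<in> sections G L \<Longrightarrow> g \<in> arrows G \<Longrightarrow> cf (sec_scale G L c f g) = c * cf (f g)"
  unfolding sec_scale_def by (simp add: cf_lscale sectionsD)

text \<open>The possible first factors in a convolution at an arrow with range \<open>x\<close>.
  Finiteness of all rows is the property of \<open>Gamma_c\<close> that keeps convolution sums
  finite, also when the right factor is an arbitrary section.\<close>

definition row :: "('g \<Rightarrow> 'l) \<Rightarrow> 'g \<Rightarrow> 'g set" where
  "row f x = {g \<in> arrows G. r g = x \<and> f g \<noteq> lzero L g}"

text \<open>Reindexes the sum over factorisations by the first factor. Any finite \<open>A\<close>
  between the row and the arrows with range \<open>r g\<close> is allowed, so that two convolutions
  can be summed over a common index set.\<close>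

lemma conv_cf:
  assumes f: "f \<in> sections G L" and h: "h \<in> sections G L" and g: "g \<in> arrows G"
    and A: "finite A" "row f (r g) \<subseteq> A" "A \<subseteq> {k \<in> arrows G. r k = r g}"
  shows "conv G L f h g \<in> Fb g"
    "cf (conv G L f h g) = (\<Sum>k\<in>A. cf (lmult L (f k) (h (gmult G (ginv G k) g))))"
proof -
  define S where "S = {(g1, g2). g1 \<in> arrows G \<and> g2 \<in> arrows G \<and> s g1 = r g2 \<and> gmult G g1 g2 = g \<and>
      f g1 \<noteq> lzero L g1 \<and> h g2 \<noteq> lzero L g2}"
  define m where "m = (\<lambda>k. (k, gmult G (ginv G k) g))"
  define A' where "A' = {k \<in> A. f k \<noteq> lzero L k \<and> h (snd (m k)) \<noteq> lzero L (snd (m k))}"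
  have k: "k \<in> arrows G \<and> snd (m k) \<in> arrows G \<and> s k = r (snd (m k)) \<and> gmult G k (snd (m k)) = g" if "k \<in> A" for k
    using A(3) that g by (auto simp: m_def gmult_inv_left gmult_closed ginv_closed src_ginv rng_gmult rng_ginv)
  have S: "S = m ` A'"
  proof (intro Set.set_eqI iffI)
    fix p assume "p \<in> S"
    then obtain g1 g2 where p: "p = (g1, g2)" "g1 \<in> arrows G" "g2 \<in> arrows G" "s g1 = r g2" "gmult G g1 g2 = g"
        "f g1 \<noteq> lzero L g1" "h g2 \<noteq> lzero L g2" unfolding S_def by blast
    have "r g = r g1" using p rng_gmult by blast
    then have "g1 \<in> A" using p A(2) by (auto simp: row_def)
    moreover have "gmult G (ginv G g1) g = g2" using p gmult_left_cancel by blast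
    ultimately show "p \<in> m ` A'" using p by (auto simp: A'_def m_def)
  next
    fix p assume "p \<in> m ` A'"
    then obtain k' where k': "k' \<in> A'" "p = m k'" by blast
    then show "p \<in> S" using k[of k'] by (auto simp: A'_def S_def m_def)
  qed
  have fS: "finite S" unfolding S A'_def using A(1) by simp
  have mem: "(\<lambda>(g1, g2). lmult L (f g1) (h g2)) p \<in> Fb g" if "p \<in> S" for p
  proof -
    obtain k' where k': "k' \<in> A" "p = m k'" using \<open>p \<in> S\<close> S by (auto simp: A'_def)
    have "lmult L (f k') (h (snd (m k'))) \<in> Fb (gmult G k' (snd (m k')))"
      using k[OF k'(1)] by (intro lmult_closed sectionsD f h) auto
    then show ?thesis using k[OF k'(1)] k'(2) by (simp add: m_def)
  qed
  have c: "conv G L f h g = finsum (fibre_space L g) (\<lambda>(g1, g2). lmult L (f g1) (h g2)) S"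
    using g by (simp add: conv_def S_def)
  show "conv G L f h g \<in> Fb g" unfolding c using cf_finsum[OF g fS, of "\<lambda>(g1, g2). lmult L (f g1) (h g2)"] mem by blast
  have "cf (conv G L f h g) = (\<Sum>p\<in>S. cf ((\<lambda>(g1, g2). lmult L (f g1) (h g2)) p))"
    unfolding c using cf_finsum[OF g fS, of "\<lambda>(g1, g2). lmult L (f g1) (h g2)"] mem by blast
  also have "\<dots> = (\<Sum>k\<in>A'. cf (lmult L (f k) (h (snd (m k)))))"
    unfolding S by (subst sum.reindex) (auto simp: inj_on_def m_def)
  also have "\<dots> = (\<Sum>k\<in>A. cf (lmult L (f k) (h (snd (m k)))))"
  proof (rule sum.mono_neutral_left[OF A(1)])
    show "A' \<subseteq> A" by (auto simp: A'_def)
    show "\<forall>k\<in>A - A'. cf (lmult L (f k) (h (snd (m k)))) = 0"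
    proof
      fix k' assume k': "k' \<in> A - A'"
      then have z: "f k' = lzero L k' \<or> h (snd (m k')) = lzero L (snd (m k'))" by (auto simp: A'_def)
      have "lmult L (f k') (h (snd (m k'))) = lzero L g"
        using z k[of k'] k' lmult_lzero[of k' "snd (m k')"] sectionsD[OF f, of k'] sectionsD[OF h, of "snd (m k')"] by auto
      then show "cf (lmult L (f k') (h (snd (m k')))) = 0" by (simp add: cf_lzero g)
    qed
  qed
  finally show "cf (conv G L f h g) = (\<Sum>k\<in>A. cf (lmult L (f k) (h (gmult G (ginv G k) g))))"
    by (simp add: m_def)
qed

lemma conv_sections:
  assumes "f \<in> sections G L" "h \<in> sections G L" "\<And>x. finite (row f x)"
  shows "conv G L f h \<in> sections G L"
  unfolding sections_def
proof (rule PiE_I)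
  show "conv G L f h g \<in> Fb g" if "g \<in> arrows G" for g
    by (rule conv_cf(1)[OF assms(1,2) that assms(3) order_refl]) (auto simp: row_def)
qed (simp add: conv_def)

text \<open>Injectivity of the range map on \<open>U\<close> leaves at most one first
  factor.\<close>

lemma conv_bisection:
  assumes f: "f \<in> sections G L" and h: "h \<in> sections G L" and g: "g \<in> arrows G"
    and U: "open_bisection G U" "\<And>k. k \<in> arrows G - U \<Longrightarrow> f k = lzero L k"
  shows "conv G L f h g =
    (if r g \<in> r ` U then lmult L (f (inv_into U r (r g))) (h (gmult G (ginv G (inv_into U r (r g))) g)) else lzero L g)"
proof -
  note u = open_bisectionD[OF U(1)]
  let ?k = "inv_into U r (r g)"
  show ?thesis
  proof (cases "r g \<in> r ` U")
    case True
    have k: "?k \<in> U" "r ?k = r g" using True by (auto intro: inv_into_into f_inv_into_f)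
    have kG: "?k \<in> arrows G" using k u by auto
    have row: "row f (r g) \<subseteq> {?k}"
    proof
      fix k' assume "k' \<in> row f (r g)"
      then have "k' \<in> U" "r k' = r g" using U(2) by (auto simp: row_def)
      then show "k' \<in> {?k}" using k inj_onD[OF u(2)] by auto
    qed
    have A: "finite {?k}" "{?k} \<subseteq> {k \<in> arrows G. r k = r g}" using k kG by auto
    have mem: "lmult L (f ?k) (h (gmult G (ginv G ?k) g)) \<in> Fb (gmult G ?k (gmult G (ginv G ?k) g))"
      using kG k g by (intro lmult_closed sectionsD[OF f] sectionsD[OF h])
        (auto simp: gmult_closed ginv_closed src_ginv rng_gmult rng_ginv)
    then have mem: "lmult L (f ?k) (h (gmult G (ginv G ?k) g)) \<in> Fb g"
      using kG k g by (simp add: gmult_inv_left)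
    from conv_cf[OF f h g A(1) row A(2)] show ?thesis
      using True cf_inj[OF g _ mem] by simp
  next
    case False
    then have row: "row f (r g) \<subseteq> {}" using U(2) unfolding row_def by (auto intro: ccontr) (metis DiffI imageI)
    from conv_cf[OF f h g _ row] show ?thesis
      using False cf_eq_0_iff[OF g] by simp
  qed
qed

end

section \<open>The convolution algebra: supports, involution and products\<close>

context twisted_etale_groupoid begin

lemma Gamma_c_onD:
  assumes "f \<in> Gamma_c_on G L U"
  shows "f \<in> sections G L" "continuous_map (subtopology T U) (total L) f"
    "\<exists>K\<subseteq>U. compactin T K \<and> (\<forall>g\<in>arrows G - K. f g = lzero L g)"
  using assms by (auto simp: Gamma_c_on_def)

lemma Gamma_c_on_zero_outside: "f \<in> Gamma_c_on G L U \<Longrightarrow> g \<in> arrows G - U \<Longrightarrow> f g = lzero L g"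
  unfolding Gamma_c_on_def by blast

lemma Gamma_c_sections: "f \<in> Gamma_c G L \<Longrightarrow> f \<in> sections G L"
  by (induction rule: Gamma_c.induct) (auto simp: Gamma_c_on_def sec_add_sections sec_scale_sections)

lemma Gamma_c_row: "f \<in> Gamma_c G L \<Longrightarrow> finite (row f x)"
proof (induction rule: Gamma_c.induct)
  case (base U f)
  have "row f x \<subseteq> {inv_into U r x}"
  proof
    fix g assume "g \<in> row f x"
    then have "g \<in> U" "r g = x" using Gamma_c_on_zero_outside[OF base(2)] by (auto simp: row_def)
    then show "g \<in> {inv_into U r x}" using open_bisectionD(2)[OF base(1)] by auto
  qed
  then show ?case using finite_subset by blast
next
  case (add f h)
  have "row (sec_add G L f h) x \<subseteq> row f x \<union> row h x"
    using ladd_lzero lzero_fibre by (auto simp: row_def sec_add_def)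
  then show ?case using add finite_subset by blast
next
  case (scale f c)
  have "row (sec_scale G L c f) x \<subseteq> row f x"
    using lscale_lzero by (auto simp: row_def sec_scale_def)
  then show ?case using scale finite_subset by blast
qed

lemma Gamma_c_support:
  assumes "f \<in> Gamma_c G L"
  shows "\<exists>K. compactin X K \<and> (\<forall>g\<in>arrows G. f g \<noteq> lzero L g \<longrightarrow> r g \<in> K \<and> s g \<in> K)"
  using assms
proof (induction rule: Gamma_c.induct)
  case (base U f)
  then obtain K where K: "compactin T K" "\<forall>g\<in>arrows G - K. f g = lzero L g" using Gamma_c_onD(3) by blast
  have "compactin X (r ` K \<union> s ` K)"
    using image_compactin[OF K(1)] continuous_rng continuous_src by (intro compactin_Un) auto
  then show ?case using K(2) by (intro exI[of _ "r ` K \<union> s ` K"]) auto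
next
  case (add f h)
  then obtain K K' where K: "compactin X K" "\<forall>g\<in>arrows G. f g \<noteq> lzero L g \<longrightarrow> r g \<in> K \<and> s g \<in> K"
    "compactin X K'" "\<forall>g\<in>arrows G. h g \<noteq> lzero L g \<longrightarrow> r g \<in> K' \<and> s g \<in> K'" by blast
  have "sec_add G L f h g = lzero L g" if "f g = lzero L g" "h g = lzero L g" "g \<in> arrows G" for g
    using that ladd_lzero lzero_fibre by (simp add: sec_add_def)
  then show ?case using K compactin_Un[OF K(1,3)] by (intro exI[of _ "K \<union> K'"]) blast
next
  case (scale f c)
  have "sec_scale G L c f g = lzero L g" if "f g = lzero L g" "g \<in> arrows G" for g
    using that lscale_lzero by (simp add: sec_scale_def)
  then show ?case using scale by metis
qed

lemma continuous_map_extensional: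
  assumes "continuous_map (subtopology T U) (total L) f" "\<And>g. g \<in> arrows G \<Longrightarrow> g \<in> U \<Longrightarrow> f g = h g"
  shows "continuous_map (subtopology T U) (total L) h"
  using assms(1) by (rule continuous_map_eq) (use assms(2) in auto)

lemma sec_star_Gamma_c_on:
  assumes U: "open_bisection G U" and f: "f \<in> Gamma_c_on G L U"
  shows "sec_star G L f \<in> Gamma_c_on G L (ginv G ` U)"
  unfolding Gamma_c_on_def
proof (intro CollectI conjI)
  note u = open_bisectionD[OF U]
  obtain K where K: "K \<subseteq> U" "compactin T K" "\<forall>g\<in>arrows G - K. f g = lzero L g" using Gamma_c_onD(3)[OF f] by blast
  show "sec_star G L f \<in> sections G L" using Gamma_c_onD(1)[OF f] by (rule sec_star_sections)
  have "continuous_map (subtopology T (ginv G ` U)) (subtopology T U) (ginv G)"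
    using continuous_ginv u(4) by (auto simp: continuous_map_in_subtopology continuous_map_from_subtopology ginv_ginv subset_iff)
  from continuous_map_compose[OF this Gamma_c_onD(2)[OF f]]
  have "continuous_map (subtopology T (ginv G ` U)) (total L) (\<lambda>g. lstar L (f (ginv G g)))"
    by (intro continuous_map_lstar) (simp add: o_def)
  then show "continuous_map (subtopology T (ginv G ` U)) (total L) (sec_star G L f)"
    by (rule continuous_map_extensional) (simp add: sec_star_def)
  have "compactin T (ginv G ` K)" using K(2) continuous_ginv by (rule image_compactin)
  moreover have "sec_star G L f g = lzero L g" if "g \<in> arrows G - ginv G ` K" for g
  proof -
    have "ginv G g \<notin> K" using that by (metis DiffD1 DiffD2 ginv_ginv imageI)
    then show ?thesis using that K(3) lstar_lzero by (auto simp: sec_star_def ginv_closed ginv_ginv)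
  qed
  ultimately show "\<exists>K\<subseteq>ginv G ` U. compactin T K \<and> (\<forall>g\<in>arrows G - K. sec_star G L f g = lzero L g)"
    using K(1) by (intro exI[of _ "ginv G ` K"]) auto
qed

lemma sec_star_add:
  assumes "f \<in> sections G L" "h \<in> sections G L"
  shows "sec_star G L (sec_add G L f h) = sec_add G L (sec_star G L f) (sec_star G L h)"
  unfolding sec_star_def sec_add_def
  by (rule restrict_ext) (simp add: ginv_closed lstar_ladd[OF ginv_closed] sectionsD assms)

lemma sec_star_scale:
  assumes "f \<in> sections G L"
  shows "sec_star G L (sec_scale G L c f) = sec_scale G L (cnj c) (sec_star G L f)"
  unfolding sec_star_def sec_scale_def
  by (rule restrict_ext) (simp add: ginv_closed lstar_lscale[OF ginv_closed] sectionsD assms)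

lemma sec_star_Gamma_c: "f \<in> Gamma_c G L \<Longrightarrow> sec_star G L f \<in> Gamma_c G L"
proof (induction rule: Gamma_c.induct)
  case (base U f)
  then show ?case using sec_star_Gamma_c_on open_bisection_ginv Gamma_c.base by blast
qed (auto simp: sec_star_add sec_star_scale Gamma_c_sections intro: Gamma_c.intros)

text \<open>On the product bisection both factors are continuous functions of the product, one
  through \<open>r\<close> and the other through \<open>s\<close>, which gives continuity; the
  compact carrier is the product of the two compact carriers.\<close>

lemma conv_Gamma_c_on:
  assumes U: "open_bisection G U" and V: "open_bisection G V"
    and f: "f \<in> Gamma_c_on G L U" and h: "h \<in> Gamma_c_on G L V"
  shows "conv G L f h \<in> Gamma_c_on G L (set_mult U V)"
  unfolding Gamma_c_on_def
proof (intro CollectI conjI)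
  note u = open_bisectionD[OF U] and v = open_bisectionD[OF V]
  note UV = open_bisection_set_mult[OF U V]
  note uv = open_bisectionD[OF UV]
  note fs = Gamma_c_onD(1)[OF f] and hs = Gamma_c_onD(1)[OF h]
  have fG: "f \<in> Gamma_c G L" using Gamma_c.base[OF U f] .
  obtain K where K: "K \<subseteq> U" "compactin T K" "\<forall>g\<in>arrows G - K. f g = lzero L g" using Gamma_c_onD(3)[OF f] by blast
  obtain K' where K': "K' \<subseteq> V" "compactin T K'" "\<forall>g\<in>arrows G - K'. h g = lzero L g" using Gamma_c_onD(3)[OF h] by blast
  show "conv G L f h \<in> sections G L" by (rule conv_sections[OF fs hs Gamma_c_row[OF fG]])
  have formula: "conv G L f h g = (if r g \<in> r ` U then lmult L (f (inv_into U r (r g))) (h (gmult G (ginv G (inv_into U r (r g))) g)) else lzero L g)"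
    if "g \<in> arrows G" for g
    by (rule conv_bisection[OF fs hs that U]) (rule Gamma_c_on_zero_outside[OF f])
  let ?a = "\<lambda>k. inv_into U r (r k)" and ?b = "\<lambda>k. inv_into V s (s k)"
  let ?Y = "subtopology T (set_mult U V)"
  have fac: "?a k \<in> U \<and> ?b k \<in> V \<and> s (?a k) = r (?b k) \<and> k = gmult G (?a k) (?b k) \<and> r k \<in> r ` U \<and> s k \<in> s ` V"
    if k: "k \<in> set_mult U V" for k
  proof -
    obtain g g' where g: "k = gmult G g g'" "g \<in> U" "g' \<in> V" "s g = r g'" using k by (auto simp: set_mult_def)
    have "g \<in> arrows G" "g' \<in> arrows G" using g u v by auto
    then have "r k = r g" "s k = s g'" using g by (auto simp: rng_gmult src_gmult)
    then show ?thesis using set_mult_factor[OF U V g(2-4)] g by auto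
  qed
  have topY: "topspace ?Y = set_mult U V" using uv(4) by auto
  have "continuous_map ?Y (subtopology X (r ` U)) r"
    using continuous_rng fac by (auto simp: continuous_map_in_subtopology continuous_map_from_subtopology)
  from continuous_map_compose[OF continuous_map_compose[OF this continuous_inv_rng[OF U]] Gamma_c_onD(2)[OF f]]
  have ca: "continuous_map ?Y (total L) (\<lambda>k. f (?a k))" by (simp add: o_def)
  have "continuous_map ?Y (subtopology X (s ` V)) s"
    using continuous_src fac by (auto simp: continuous_map_in_subtopology continuous_map_from_subtopology)
  from continuous_map_compose[OF continuous_map_compose[OF this continuous_inv_src[OF V]] Gamma_c_onD(2)[OF h]]
  have cb: "continuous_map ?Y (total L) (\<lambda>k. h (?b k))" by (simp add: o_def)
  have p: "proj L (f k) = k" "proj L (h k) = k" if "k \<in> arrows G" for k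
    using sectionsD[OF fs that] sectionsD[OF hs that] by (auto simp: fibre_def)
  have eq: "conv G L f h k = lmult L (f (?a k)) (h (?b k))" if k: "k \<in> set_mult U V" for k
  proof -
    have ab: "?a k \<in> arrows G" "?b k \<in> arrows G" using fac[OF k] u v by auto
    have "gmult G (ginv G (?a k)) k = ?b k"
      using fac[OF k] gmult_left_cancel[OF ab] by metis
    then show ?thesis using formula[of k] fac[OF k] k uv(4) by auto
  qed
  have "continuous_map ?Y (total L) (\<lambda>k. lmult L (f (?a k)) (h (?b k)))"
  proof (rule continuous_map_lmult[OF ca cb])
    fix k assume "k \<in> topspace ?Y"
    then have k: "k \<in> set_mult U V" using topY by simp
    then have "?a k \<in> arrows G" "?b k \<in> arrows G" using fac[OF k] u v by auto
    then show "s (proj L (f (?a k))) = r (proj L (h (?b k)))" using fac[OF k] p by simp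
  qed
  then show "continuous_map ?Y (total L) (conv G L f h)"
    by (rule continuous_map_extensional) (simp add: eq)
  have "set_mult K K' \<subseteq> set_mult U V" using K(1) K'(1) by (auto simp: set_mult_def)
  moreover have "compactin T (set_mult K K')" using compactin_set_mult[OF K(2) K'(2)] .
  moreover have "conv G L f h g = lzero L g" if g: "g \<in> arrows G - set_mult K K'" for g
  proof (cases "r g \<in> r ` U")
    case True
    have a: "?a g \<in> U" "r (?a g) = r g" using True by (auto intro: inv_into_into f_inv_into_f)
    then have aG: "?a g \<in> arrows G" using u by auto
    let ?h = "gmult G (ginv G (?a g)) g"
    have h': "?h \<in> arrows G" "s (?a g) = r ?h" "gmult G (?a g) ?h = g"
      using aG a g by (auto simp: gmult_closed ginv_closed src_ginv rng_gmult rng_ginv gmult_inv_left)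
    then have "?a g \<notin> K \<or> ?h \<notin> K'" using g unfolding set_mult_def by (metis (mono_tags, lifting) DiffD2 mem_Collect_eq)
    then have "f (?a g) = lzero L (?a g) \<or> h ?h = lzero L ?h" using K(3) K'(3) aG h'(1) by blast
    then show ?thesis
      using formula[of g] g True lmult_lzero[OF aG h'(1,2)] sectionsD[OF fs aG] sectionsD[OF hs h'(1)] h'(3) by auto
  next
    case False
    then show ?thesis using formula[of g] g by simp
  qed
  ultimately show "\<exists>K\<subseteq>set_mult U V. compactin T K \<and> (\<forall>g\<in>arrows G - K. conv G L f h g = lzero L g)" by blast
qed

lemma row_sub: "row f x \<subseteq> {k \<in> arrows G. r k = x}"
  by (auto simp: row_def)

lemma conv_add_left:
  assumes f: "f \<in> sections G L" "\<And>x. finite (row f x)" and f': "f' \<in> sections G L" "\<And>x. finite (row f' x)"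
    and h: "h \<in> sections G L"
  shows "conv G L (sec_add G L f f') h = sec_add G L (conv G L f h) (conv G L f' h)"
proof (rule sections_eqI)
  note ff = sec_add_sections[OF f(1) f'(1)]
  have row: "row (sec_add G L f f') x \<subseteq> row f x \<union> row f' x" for x
    using ladd_lzero lzero_fibre by (auto simp: row_def sec_add_def)
  have fin: "finite (row (sec_add G L f f') x)" for x
    using row f(2) f'(2) finite_subset by blast
  show "conv G L (sec_add G L f f') h \<in> sections G L" by (rule conv_sections[OF ff h fin])
  note c = conv_sections[OF f(1) h f(2)] conv_sections[OF f'(1) h f'(2)]
  show "sec_add G L (conv G L f h) (conv G L f' h) \<in> sections G L" using c by (rule sec_add_sections)
  fix g assume g: "g \<in> arrows G"
  let ?A = "row f (r g) \<union> row f' (r g)"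
  have A: "finite ?A" "?A \<subseteq> {k \<in> arrows G. r k = r g}" using f(2) f'(2) row_sub by auto
  have "cf (conv G L (sec_add G L f f') h g) = (\<Sum>k\<in>?A. cf (lmult L (sec_add G L f f' k) (h (gmult G (ginv G k) g))))"
    by (rule conv_cf(2)[OF ff h g A(1) row A(2)])
  also have "\<dots> = (\<Sum>k\<in>?A. cf (lmult L (f k) (h (gmult G (ginv G k) g))) + cf (lmult L (f' k) (h (gmult G (ginv G k) g))))"
  proof (rule sum.cong[OF refl])
    fix k assume "k \<in> ?A"
    then have k: "k \<in> arrows G" "r k = r g" using A(2) by auto
    note k' = gmult_factor[OF k(1) g k(2)]
    note m = sectionsD[OF f(1) k(1)] sectionsD[OF f'(1) k(1)] sectionsD[OF h k'(1)]
    show "cf (lmult L (sec_add G L f f' k) (h (gmult G (ginv G k) g))) =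
        cf (lmult L (f k) (h (gmult G (ginv G k) g))) + cf (lmult L (f' k) (h (gmult G (ginv G k) g)))"
      using cf_ladd[OF g] lmult_closed[OF k(1) k'(1,2) m(1,3)] lmult_closed[OF k(1) k'(1,2) m(2,3)]
        lmult_ladd_left[OF k(1) k'(1,2) m] k k'(3) by (simp add: sec_add_def)
  qed
  also have "\<dots> = cf (conv G L f h g) + cf (conv G L f' h g)"
    using conv_cf(2)[OF f(1) h g A(1) _ A(2)] conv_cf(2)[OF f'(1) h g A(1) _ A(2)]
    by (simp add: sum.distrib)
  finally show "cf (conv G L (sec_add G L f f') h g) = cf (sec_add G L (conv G L f h) (conv G L f' h) g)"
    using cf_sec_add[OF c g] by simp
qed

lemma conv_add_right:
  assumes f: "f \<in> sections G L" "\<And>x. finite (row f x)" and h: "h \<in> sections G L" "h' \<in> sections G L"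
  shows "conv G L f (sec_add G L h h') = sec_add G L (conv G L f h) (conv G L f h')"
proof (rule sections_eqI)
  note hh = sec_add_sections[OF h]
  note c = conv_sections[OF f(1) h(1) f(2)] conv_sections[OF f(1) h(2) f(2)]
  show "conv G L f (sec_add G L h h') \<in> sections G L" by (rule conv_sections[OF f(1) hh f(2)])
  show "sec_add G L (conv G L f h) (conv G L f h') \<in> sections G L" using c by (rule sec_add_sections)
  fix g assume g: "g \<in> arrows G"
  note e = conv_cf(2)[OF f(1) _ g f(2) order_refl row_sub]
  have "cf (conv G L f (sec_add G L h h') g) = (\<Sum>k\<in>row f (r g). cf (lmult L (f k) (h (gmult G (ginv G k) g))) + cf (lmult L (f k) (h' (gmult G (ginv G k) g))))"
    unfolding e[OF hh]
  proof (rule sum.cong[OF refl])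
    fix k assume "k \<in> row f (r g)"
    then have k: "k \<in> arrows G" "r k = r g" by (auto simp: row_def)
    note k' = gmult_factor[OF k(1) g k(2)]
    note m = sectionsD[OF f(1) k(1)] sectionsD[OF h(1) k'(1)] sectionsD[OF h(2) k'(1)]
    show "cf (lmult L (f k) (sec_add G L h h' (gmult G (ginv G k) g))) =
        cf (lmult L (f k) (h (gmult G (ginv G k) g))) + cf (lmult L (f k) (h' (gmult G (ginv G k) g)))"
      using cf_ladd[OF g] lmult_closed[OF k(1) k'(1,2) m(1,2)] lmult_closed[OF k(1) k'(1,2) m(1,3)]
        lmult_ladd_right[OF k(1) k'(1,2) m] k k' by (simp add: sec_add_def)
  qed
  then show "cf (conv G L f (sec_add G L h h') g) = cf (sec_add G L (conv G L f h) (conv G L f h') g)"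
    using cf_sec_add[OF c g] e[OF h(1)] e[OF h(2)] by (simp add: sum.distrib)
qed

text \<open>Pointwise multiplication along the range, for arbitrary functions. It agrees with
  convolution by \<open>emb h\<close> from the left, but constants are allowed too, and these yield
  the rule for scalar multiples.\<close>

definition lact :: "('g \<Rightarrow> complex) \<Rightarrow> ('g \<Rightarrow> 'l) \<Rightarrow> 'g \<Rightarrow> 'l" where
  "lact h f = (\<lambda>g\<in>arrows G. lscale L (h (r g)) (f g))"

lemma lact_sections: "f \<in> sections G L \<Longrightarrow> lact h f \<in> sections G L"
  unfolding lact_def by (intro sections_restrict lscale_fibre) (auto intro: sectionsD)

lemma cf_lact: "f \<in> sections G L \<Longrightarrow> g \<in> arrows G \<Longrightarrow> cf (lact h f g) = h (r g) * cf (f g)"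
  unfolding lact_def by (simp add: cf_lscale sectionsD)

lemma conv_lact_left:
  assumes f: "f \<in> sections G L" "\<And>x. finite (row f x)" and h: "h \<in> sections G L"
  shows "conv G L (lact e f) h = lact e (conv G L f h)"
proof (rule sections_eqI)
  note cs = lact_sections[OF f(1), of e]
  have row: "row (lact e f) x \<subseteq> row f x" for x
    using lscale_lzero by (auto simp: row_def lact_def)
  have fin: "finite (row (lact e f) x)" for x using row f(2) finite_subset by blast
  note co = conv_sections[OF f(1) h f(2)]
  show "conv G L (lact e f) h \<in> sections G L" by (rule conv_sections[OF cs h fin])
  show "lact e (conv G L f h) \<in> sections G L" using co by (rule lact_sections)
  fix g assume g: "g \<in> arrows G"
  have "cf (conv G L (lact e f) h g) = (\<Sum>k\<in>row f (r g). e (r g) * cf (lmult L (f k) (h (gmult G (ginv G k) g))))"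
    unfolding conv_cf(2)[OF cs h g f(2) row row_sub]
  proof (rule sum.cong[OF refl])
    fix k assume "k \<in> row f (r g)"
    then have k: "k \<in> arrows G" "r k = r g" by (auto simp: row_def)
    note k' = gmult_factor[OF k(1) g k(2)]
    note m = sectionsD[OF f(1) k(1)] sectionsD[OF h k'(1)]
    show "cf (lmult L (lact e f k) (h (gmult G (ginv G k) g))) = e (r g) * cf (lmult L (f k) (h (gmult G (ginv G k) g)))"
      using cf_lscale[OF g] lmult_closed[OF k(1) k'(1,2) m] lmult_lscale_left[OF k(1) k'(1,2) m] k k' by (simp add: lact_def)
  qed
  then show "cf (conv G L (lact e f) h g) = cf (lact e (conv G L f h) g)"
    using cf_lact[OF co g] conv_cf(2)[OF f(1) h g f(2) order_refl row_sub] by (simp add: sum_distrib_left)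
qed

lemma conv_scale_left:
  assumes f: "f \<in> sections G L" "\<And>x. finite (row f x)" and h: "h \<in> sections G L"
  shows "conv G L (sec_scale G L c f) h = sec_scale G L c (conv G L f h)"
proof -
  have "sec_scale G L c f = lact (\<lambda>_. c) f" for f by (simp add: sec_scale_def lact_def)
  then show ?thesis using conv_lact_left[OF assms] by simp
qed

lemma conv_scale_right:
  assumes f: "f \<in> sections G L" "\<And>x. finite (row f x)" and h: "h \<in> sections G L"
  shows "conv G L f (sec_scale G L c h) = sec_scale G L c (conv G L f h)"
proof (rule sections_eqI)
  note cs = sec_scale_sections[OF h, of c]
  note co = conv_sections[OF f(1) h f(2)]
  show "conv G L f (sec_scale G L c h) \<in> sections G L" by (rule conv_sections[OF f(1) cs f(2)])
  show "sec_scale G L c (conv G L f h) \<in> sections G L" using co by (rule sec_scale_sections)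
  fix g assume g: "g \<in> arrows G"
  have "cf (conv G L f (sec_scale G L c h) g) = (\<Sum>k\<in>row f (r g). c * cf (lmult L (f k) (h (gmult G (ginv G k) g))))"
    unfolding conv_cf(2)[OF f(1) cs g f(2) order_refl row_sub]
  proof (rule sum.cong[OF refl])
    fix k assume "k \<in> row f (r g)"
    then have k: "k \<in> arrows G" "r k = r g" by (auto simp: row_def)
    note k' = gmult_factor[OF k(1) g k(2)]
    note m = sectionsD[OF f(1) k(1)] sectionsD[OF h k'(1)]
    show "cf (lmult L (f k) (sec_scale G L c h (gmult G (ginv G k) g))) = c * cf (lmult L (f k) (h (gmult G (ginv G k) g)))"
      using cf_lscale[OF g] lmult_closed[OF k(1) k'(1,2) m] lmult_lscale_right[OF k(1) k'(1,2) m] k k' by (simp add: sec_scale_def)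
  qed
  then show "cf (conv G L f (sec_scale G L c h) g) = cf (sec_scale G L c (conv G L f h) g)"
    using cf_sec_scale[OF co g] conv_cf(2)[OF f(1) h g f(2) order_refl row_sub] by (simp add: sum_distrib_left)
qed

lemma conv_Gamma_c:
  assumes f: "f \<in> Gamma_c G L" and h: "h \<in> Gamma_c G L"
  shows "conv G L f h \<in> Gamma_c G L"
  using f h
proof (induction arbitrary: h rule: Gamma_c.induct)
  case (base U f)
  have f: "f \<in> Gamma_c G L" using base by (intro Gamma_c.base)
  show ?case using base(3)
  proof (induction rule: Gamma_c.induct)
    case (base V h)
    show ?case using conv_Gamma_c_on open_bisection_set_mult Gamma_c.base \<open>open_bisection G U\<close> \<open>f \<in> Gamma_c_on G L U\<close> base by blast
  qed (auto simp: conv_add_right conv_scale_right Gamma_c_sections Gamma_c_row f intro: Gamma_c.intros)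
qed (auto simp: conv_add_left conv_scale_left Gamma_c_sections Gamma_c_row intro: Gamma_c.intros)

end

section \<open>The action of functions on the unit space\<close>

context twisted_etale_groupoid begin

text \<open>A local section through the unit vector \<open>bas g\<close> is nonzero near
  \<open>g\<close> and can be normalised there; \<open>bas\<close> itself need not be
  continuous.\<close>

lemma local_unit_section:
  assumes g: "g \<in> arrows G"
  shows "\<exists>V e. openin T V \<and> g \<in> V \<and> continuous_map (subtopology T V) (total L) e \<and>
    (\<forall>k\<in>V. e k \<in> Fb k \<and> lnorm L (e k) = 1)"
proof -
  have b: "bas g \<in> topspace (total L)" "proj L (bas g) = g" using fibreD[OF bas(1)[OF g]] by auto
  obtain V f where V: "openin T V" "g \<in> V" "continuous_map (subtopology T V) (total L) f"
      "\<forall>k\<in>V. proj L (f k) = k" "f g = bas g"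
    using local_sections[OF b(1)] b(2) by metis
  have VT: "V \<subseteq> arrows G" using V(1) by (rule openin_subset)
  have fF: "f k \<in> Fb k" if "k \<in> V" for k
    using continuous_map_image_subset_topspace[OF V(3)] that V(4) VT by (auto simp: fibre_def)
  let ?W = "{k \<in> topspace (subtopology T V). lnorm L (f k) \<in> {0<..}}"
  have W: "openin (subtopology T V) ?W"
    using continuous_map_lnorm[OF V(3)] by (rule openin_continuous_map_preimage) simp
  have WT: "openin T ?W" using W V(1) openin_trans_full by blast
  have cf: "continuous_map (subtopology T ?W) (total L) f"
    by (rule continuous_map_from_subtopology_mono[OF V(3)]) auto
  have cn: "continuous_map (subtopology T ?W) euclideanreal (\<lambda>k. lnorm L (f k))"
    by (rule continuous_map_lnorm[OF cf])
  have "continuous_map (subtopology T ?W) euclideanreal (\<lambda>k. 1 / lnorm L (f k))"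
    using cn by (intro continuous_map_real_divide) auto
  then have c: "continuous_map (subtopology T ?W) (total L) (\<lambda>k. lscale L (complex_of_real (1 / lnorm L (f k))) (f k))"
    by (intro continuous_map_lscale[OF continuous_map_of_real cf])
  have "lscale L (complex_of_real (1 / lnorm L (f k))) (f k) \<in> Fb k \<and> lnorm L (lscale L (complex_of_real (1 / lnorm L (f k))) (f k)) = 1"
    if "k \<in> ?W" for k
    using that fF[of k] lscale_fibre[of k "f k"] lnorm_lscale[of "f k"] VT by (auto simp: fibre_def norm_divide)
  moreover have "g \<in> ?W" using V(2,5) bas(2)[OF g] g by auto
  ultimately show ?thesis using WT c by blast
qed

text \<open>Near a unit the identity section is the product of \<open>lstar (e k)\<close> and
  \<open>e k\<close> for a continuous local section \<open>e\<close> of norm one.\<close>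

lemma continuous_fibre_unit: "continuous_map X (total L) (fibre_unit L)"
proof (rule continuous_map_local)
  fix u assume "u \<in> topspace X"
  then have u: "u \<in> units G" "u \<in> arrows G" using units_arrows by (auto simp: topspace_unit_space)
  obtain V e where V: "openin T V" "u \<in> V" "continuous_map (subtopology T V) (total L) e"
      "\<And>k. k\<in>V \<Longrightarrow> e k \<in> Fb k" "\<And>k. k\<in>V \<Longrightarrow> lnorm L (e k) = 1"
    using local_unit_section[OF u(2)] by blast
  have VT: "V \<subseteq> arrows G" using V(1) by (rule openin_subset)
  let ?Y = "subtopology X (V \<inter> units G)"
  have Y: "?Y = subtopology T (V \<inter> units G)" "topspace ?Y = V \<inter> units G"
    using VT by (auto simp: unit_space_def subtopology_subtopology Int_absorb1)
  have "continuous_map ?Y (total L) e"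
    unfolding Y(1) by (rule continuous_map_from_subtopology_mono[OF V(3)]) auto
  then have "continuous_map ?Y (total L) (\<lambda>k. lmult L (lstar L (e k)) (e k))"
  proof (intro continuous_map_lmult continuous_map_lstar)
    fix k assume "k \<in> topspace ?Y"
    then have k: "k \<in> V" "k \<in> units G" "k \<in> arrows G" using Y(2) VT by auto
    show "s (proj L (lstar L (e k))) = r (proj L (e k))"
      using lstar_closed[OF k(3) V(4)[OF k(1)]] V(4)[OF k(1)] k(2) by (auto simp: fibre_def ginv_unit src_unit rng_unit)
  qed auto
  moreover have "lmult L (lstar L (e k)) (e k) = fibre_unit L k" if "k \<in> V \<inter> units G" for k
  proof -
    have k: "k \<in> V" "k \<in> units G" "k \<in> arrows G" using that VT by auto
    show ?thesis
      using lstar_lmult_self[OF k(3) V(4)[OF k(1)]] V(5)[OF k(1)] lscale_1[OF k(3) fibre_unit(1)[OF k(2)]] by (simp add: src_unit[OF k(2)])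
  qed
  ultimately have "continuous_map ?Y (total L) (fibre_unit L)"
    using Y(2) by (auto intro: continuous_map_eq)
  moreover have "openin X (V \<inter> units G)" using V(1) open_units by (auto simp: openin_unit_space)
  ultimately show "\<exists>U. openin X U \<and> u \<in> U \<and> continuous_map (subtopology X U) (total L) (fibre_unit L)"
    using V(2) u(1) by (intro exI[of _ "V \<inter> units G"]) auto
qed

lemma Gamma_c_on_bounded:
  assumes f: "f \<in> Gamma_c_on G L U"
  shows "\<exists>B. \<forall>g\<in>arrows G. cmod (cf (f g)) \<le> B"
proof -
  note fs = Gamma_c_onD(1)[OF f]
  obtain K where K: "K \<subseteq> U" "compactin T K" "\<forall>g\<in>arrows G - K. f g = lzero L g" using Gamma_c_onD(3)[OF f] by blast
  have "compactin (subtopology T U) K" using K by (simp add: compactin_subtopology)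
  from image_compactin[OF this continuous_map_lnorm[OF Gamma_c_onD(2)[OF f]]]
  have "compact ((\<lambda>g. lnorm L (f g)) ` K)" by simp
  then obtain B where B: "\<And>g. g \<in> K \<Longrightarrow> \<bar>lnorm L (f g)\<bar> \<le> B" 
    using compact_imp_bounded bounded_iff by (metis imageI real_norm_def)
  have "cmod (cf (f g)) \<le> \<bar>B\<bar>" if g: "g \<in> arrows G" for g
  proof (cases "g \<in> K")
    case True
    then show ?thesis using B[of g] lnorm_cf[OF g sectionsD[OF fs g]] by linarith
  next
    case False
    then show ?thesis using K(3) g cf_lzero[OF g] by simp
  qed
  then show ?thesis by blast
qed

lemma restrict_units_eq_cf:
  assumes "f \<in> sections G L"
  shows "restrict_units G L f x = (if x \<in> units G then cf (f x) else 0)"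
  using restrict_units_cf[of x f] restrict_units_outside[of x f] sectionsD[OF assms, of x] units_arrows by auto

text \<open>Continuity holds on the open set of units in \<open>U\<close>. The carrier is taken to
  be the image of \<open>K\<close> under \<open>r\<close>, since the units inside \<open>K\<close>
  need not form a compact set when \<open>G\<close> is not Hausdorff.\<close>

lemma restrict_units_piece:
  assumes U: "open_bisection G U" and f: "f \<in> Gamma_c_on G L U"
  shows "compact_piece X (U \<inter> units G) (restrict_units G L f)"
  unfolding compact_piece_def
proof (intro conjI allI impI)
  note u = open_bisectionD[OF U] and fs = Gamma_c_onD(1)[OF f]
  obtain K where K: "K \<subseteq> U" "compactin T K" "\<forall>g\<in>arrows G - K. f g = lzero L g" using Gamma_c_onD(3)[OF f] by blast
  let ?Y = "subtopology X (U \<inter> units G)"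
  have Y: "?Y = subtopology T (U \<inter> units G)" "topspace ?Y = U \<inter> units G"
    using u(4) by (auto simp: unit_space_def subtopology_subtopology Int_absorb1)
  show "openin X (U \<inter> units G)" using u(1) open_units by (auto simp: openin_unit_space)
  have cf1: "continuous_map ?Y (total L) f"
    unfolding Y(1) by (rule continuous_map_from_subtopology_mono[OF Gamma_c_onD(2)[OF f]]) auto
  have cf2: "continuous_map ?Y (total L) (fibre_unit L)"
    using continuous_fibre_unit by (rule continuous_map_from_subtopology)
  show "continuous_map ?Y euclidean (restrict_units G L f)"
  proof (rule continuous_coefficient[OF cf1 cf2])
    fix y assume "y \<in> topspace ?Y"
    then have y: "y \<in> units G" "y \<in> arrows G" using Y(2) u(4) by auto
    show "f y = lscale L (restrict_units G L f y) (fibre_unit L y)"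
      using cf_eq[OF y(2) sectionsD[OF fs y(2)]] restrict_units_cf[where f = f, OF y(1) sectionsD[OF fs y(2)]] bas_unit[OF y(1)] by simp
    show "lnorm L (fibre_unit L y) = 1" by (rule lnorm_fibre_unit[OF y(1)])
  qed
  have z: "restrict_units G L f x = 0" if "x \<notin> K" for x
  proof (cases "x \<in> units G")
    case True
    then have x: "x \<in> arrows G" using units_arrows by auto
    then show ?thesis using restrict_units_cf[where f = f, OF True sectionsD[OF fs x]] K(3) that cf_lzero[OF x] by simp
  qed (rule restrict_units_outside)
  show "restrict_units G L f x = 0" if "x \<notin> U \<inter> units G" for x
    using that z[of x] K(1) restrict_units_outside[of x f] by auto
  have "compactin X (r ` K)" using image_compactin[OF K(2) continuous_rng] .
  moreover have "restrict_units G L f x = 0" if "x \<notin> r ` K" for x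
  proof (cases "x \<in> units G")
    case True
    then have "x \<notin> K" using that rng_unit[OF True] by force
    then show ?thesis by (rule z)
  qed (rule restrict_units_outside)
  ultimately show "csupp X UNIV (restrict_units G L f)" by (intro csuppI) auto
  obtain B where "\<forall>g\<in>arrows G. cmod (cf (f g)) \<le> B" using Gamma_c_on_bounded[OF f] by blast
  then have "cmod (restrict_units G L f x) \<le> max B 0" for x
    using units_arrows by (auto simp: restrict_units_eq_cf[OF fs] intro: max.coboundedI1)
  then show "\<exists>B. \<forall>x. cmod (restrict_units G L f x) \<le> B" by blast
qed

definition ract :: "('g \<Rightarrow> complex) \<Rightarrow> ('g \<Rightarrow> 'l) \<Rightarrow> 'g \<Rightarrow> 'l" where
  "ract h f = (\<lambda>g\<in>arrows G. lscale L (h (s g)) (f g))"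

definition emb :: "('g \<Rightarrow> complex) \<Rightarrow> 'g \<Rightarrow> 'l" where
  "emb h = (\<lambda>g\<in>arrows G. if g \<in> units G then lscale L (h g) (fibre_unit L g) else lzero L g)"

lemma scaled_Gamma_c_on:
  assumes f: "f \<in> Gamma_c_on G L U" and c: "continuous_map (subtopology T U) euclidean c"
  shows "(\<lambda>g\<in>arrows G. lscale L (c g) (f g)) \<in> Gamma_c_on G L U"
  unfolding Gamma_c_on_def
proof (intro CollectI conjI)
  show "(\<lambda>g\<in>arrows G. lscale L (c g) (f g)) \<in> sections G L"
    using Gamma_c_onD(1)[OF f] by (intro sections_restrict lscale_fibre) (auto intro: sectionsD)
  show "continuous_map (subtopology T U) (total L) (\<lambda>g\<in>arrows G. lscale L (c g) (f g))"
    by (rule continuous_map_extensional[OF continuous_map_lscale[OF c Gamma_c_onD(2)[OF f]]]) auto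
  obtain K where "K \<subseteq> U" "compactin T K" "\<forall>g\<in>arrows G - K. f g = lzero L g" using Gamma_c_onD(3)[OF f] by blast
  then show "\<exists>K\<subseteq>U. compactin T K \<and> (\<forall>g\<in>arrows G - K. (\<lambda>g\<in>arrows G. lscale L (c g) (f g)) g = lzero L g)"
    using lscale_lzero by (intro exI[of _ K]) auto
qed

lemma lact_Gamma_c_on: "f \<in> Gamma_c_on G L U \<Longrightarrow> continuous_map X euclidean h \<Longrightarrow> lact h f \<in> Gamma_c_on G L U"
  unfolding lact_def using continuous_map_compose[OF continuous_rng, of euclidean h]
  by (intro scaled_Gamma_c_on continuous_map_from_subtopology) (auto simp: o_def)

lemma ract_sections: "f \<in> sections G L \<Longrightarrow> ract h f \<in> sections G L"
  unfolding ract_def by (intro sections_restrict lscale_fibre) (auto intro: sectionsD)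

lemma cf_ract: "f \<in> sections G L \<Longrightarrow> g \<in> arrows G \<Longrightarrow> cf (ract h f g) = h (s g) * cf (f g)"
  unfolding ract_def by (simp add: cf_lscale sectionsD)

lemma lact_Gamma_c:
  assumes h: "continuous_map X euclidean h"
  shows "f \<in> Gamma_c G L \<Longrightarrow> lact h f \<in> Gamma_c G L"
proof (induction rule: Gamma_c.induct)
  case (base U f)
  then show ?case using lact_Gamma_c_on[OF _ h] Gamma_c.base by blast
next
  case (add f f')
  have "lact h (sec_add G L f f') = sec_add G L (lact h f) (lact h f')"
    using add by (intro sections_eqI) (auto simp: cf_lact cf_sec_add lact_sections sec_add_sections Gamma_c_sections distrib_left)
  then show ?case using add Gamma_c.add by simp
next
  case (scale f c)
  have "lact h (sec_scale G L c f) = sec_scale G L c (lact h f)"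
    using scale by (intro sections_eqI) (auto simp: cf_lact cf_sec_scale lact_sections sec_scale_sections Gamma_c_sections)
  then show ?case using scale Gamma_c.scale by simp
qed

lemma emb_sections: "emb h \<in> sections G L"
  unfolding emb_def by (rule sections_restrict) (auto simp: lzero_fibre lscale_fibre fibre_unit)

lemma cf_emb: "g \<in> arrows G \<Longrightarrow> cf (emb h g) = (if g \<in> units G then h g else 0)"
  unfolding emb_def by (simp add: cf_lzero cf_lscale_bas flip: bas_unit)

lemma emb_Gamma_c_on:
  assumes h: "h \<in> Cc X"
  shows "emb h \<in> Gamma_c_on G L (units G)"
  unfolding Gamma_c_on_def
proof (intro CollectI conjI)
  show "emb h \<in> sections G L" by (rule emb_sections)
  have X: "subtopology T (units G) = X" by (simp add: unit_space_def)
  have "continuous_map X (total L) (\<lambda>u. lscale L (h u) (fibre_unit L u))"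
    by (intro continuous_map_lscale continuous_fibre_unit Cc_D[OF h])
  then show "continuous_map (subtopology T (units G)) (total L) (emb h)"
    unfolding X by (rule continuous_map_eq) (use units_arrows in \<open>auto simp: topspace_unit_space emb_def\<close>)
  obtain K where K: "compactin X K" "\<And>x. x \<notin> K \<Longrightarrow> h x = 0"
    using Cc_D(2)[OF h] unfolding csupp_def by blast
  then show "\<exists>K\<subseteq>units G. compactin T K \<and> (\<forall>g\<in>arrows G - K. emb h g = lzero L g)"
    using units_arrows by (intro exI[of _ K]) (auto simp: compactin_unit_space emb_def lscale_0 fibre_unit)
qed

lemma emb_Gamma_c: "h \<in> Cc X \<Longrightarrow> emb h \<in> Gamma_c G L"
  using emb_Gamma_c_on open_bisection_units Gamma_c.base by blast

lemma conv_emb_left: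
  assumes f: "f \<in> sections G L"
  shows "conv G L (emb h) f = lact h f"
proof -
  have "conv G L (emb h) f g = lact h f g" for g
  proof (cases "g \<in> arrows G")
    case True
    have i: "inv_into (units G) r (r g) = r g"
      using inv_into_f_f[OF open_bisectionD(2)[OF open_bisection_units], of "r g"] True
      by (simp add: rng_in_units rng_rng)
    have "r g \<in> r ` units G" using True rng_in_units[OF True] rng_rng[OF True] by (metis imageI)
    then have "conv G L (emb h) f g = lmult L (emb h (r g)) (f (gmult G (ginv G (r g)) g))"
      using conv_bisection[OF emb_sections f True open_bisection_units, of h] i by (auto simp: emb_def)
    also have "\<dots> = lact h f g"
      using True lmult_scaled_unit_left[OF True sectionsD[OF f True]]
      by (simp add: emb_def lact_def rng_in_units rng_closed ginv_unit gmult_rng)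
    finally show ?thesis .
  qed (simp add: conv_def lact_def)
  then show ?thesis by blast
qed

lemma conv_emb_right:
  assumes f: "f \<in> sections G L" "\<And>x. finite (row f x)"
  shows "conv G L f (emb h) = ract h f"
proof (rule sections_eqI)
  show "conv G L f (emb h) \<in> sections G L" by (rule conv_sections[OF f(1) emb_sections f(2)])
  show "ract h f \<in> sections G L" using f(1) by (rule ract_sections)
  fix g assume g: "g \<in> arrows G"
  \<comment> \<open>Only the first factor \<open>g\<close> contributes, but \<open>f g\<close> may
    vanish, in which case \<open>g\<close> is not in the row; it is added so that one formula covers
    both cases.\<close>
  let ?A = "insert g (row f (r g))"
  have A: "finite ?A" "row f (r g) \<subseteq> ?A" "?A \<subseteq> {k \<in> arrows G. r k = r g}"
    using f(2) g by (auto simp: row_def)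
  have "cf (conv G L f (emb h) g) = (\<Sum>k\<in>?A. cf (lmult L (f k) (emb h (gmult G (ginv G k) g))))"
    by (rule conv_cf(2)[OF f(1) emb_sections g A])
  also have "\<dots> = (\<Sum>k\<in>{g}. cf (lmult L (f k) (emb h (gmult G (ginv G k) g))))"
  proof (rule sum.mono_neutral_right)
    show "\<forall>k\<in>?A - {g}. cf (lmult L (f k) (emb h (gmult G (ginv G k) g))) = 0"
    proof
      fix k assume "k \<in> ?A - {g}"
      then have k: "k \<in> arrows G" "r k = r g" "k \<noteq> g" by (auto simp: row_def)
      note k' = gmult_factor[OF k(1) g k(2)]
      have "gmult G (ginv G k) g \<notin> units G"
      proof
        assume "gmult G (ginv G k) g \<in> units G"
        then have "g = ginv G (ginv G k)"
          using gmult_eq_unit_iff[of "ginv G k" g "gmult G (ginv G k) g"] k g by (simp add: ginv_closed src_ginv)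
        then show False using k by (simp add: ginv_ginv)
      qed
      then have "emb h (gmult G (ginv G k) g) = lzero L (gmult G (ginv G k) g)" using k'(1) by (simp add: emb_def)
      then show "cf (lmult L (f k) (emb h (gmult G (ginv G k) g))) = 0"
        using lmult_lzero(1)[OF k(1) k'(1,2) sectionsD[OF f(1) k(1)]] k'(3) cf_lzero[OF g] by simp
    qed
  qed (use A in auto)
  also have "\<dots> = cf (ract h f g)"
    using g lmult_scaled_unit_right[OF g sectionsD[OF f(1) g]]
    by (simp add: gmult_ginv_left emb_def ract_def src_closed src_in_units)
  finally show "cf (conv G L f (emb h) g) = cf (ract h f g)" .
qed

lemma conv_emb_right_Gamma_c: "f \<in> Gamma_c G L \<Longrightarrow> conv G L f (emb h) = ract h f"
  by (intro conv_emb_right Gamma_c_sections Gamma_c_row)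

lemma ract_Gamma_c: "f \<in> Gamma_c G L \<Longrightarrow> h \<in> Cc X \<Longrightarrow> ract h f \<in> Gamma_c G L"
  using conv_Gamma_c[OF _ emb_Gamma_c] conv_emb_right_Gamma_c by metis

lemma emb_add: "sec_add G L (emb h) (emb k) = emb (\<lambda>x. h x + k x)"
  by (rule sections_eqI) (auto simp: sec_add_sections emb_sections cf_sec_add cf_emb)

lemma emb_scale: "sec_scale G L c (emb h) = emb (\<lambda>x. c * h x)"
  by (rule sections_eqI) (auto simp: sec_scale_sections emb_sections cf_sec_scale cf_emb)

lemma emb_mult: "conv G L (emb h) (emb k) = emb (\<lambda>x. h x * k x)"
  unfolding conv_emb_left[OF emb_sections]
  by (rule sections_eqI) (auto simp: lact_sections emb_sections cf_lact cf_emb rng_unit)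

lemma restrict_units_sec_star:
  assumes "f \<in> sections G L"
  shows "restrict_units G L (sec_star G L f) x = cnj (restrict_units G L f x)"
  unfolding restrict_units_eq_cf[OF assms] restrict_units_eq_cf[OF sec_star_sections[OF assms]]
  using units_arrows by (auto simp: sec_star_def ginv_unit cf_lstar_unit sectionsD[OF assms] subset_iff)

lemma emb_star: "sec_star G L (emb h) = emb (\<lambda>x. cnj (h x))"
proof (rule sections_eqI)
  fix g assume g: "g \<in> arrows G"
  show "cf (sec_star G L (emb h) g) = cf (emb (\<lambda>x. cnj (h x)) g)"
  proof (cases "g \<in> units G")
    case True
    then show ?thesis
      using restrict_units_sec_star[OF emb_sections, of h g] g
      by (simp add: restrict_units_eq_cf[OF emb_sections] restrict_units_eq_cf[OF sec_star_sections[OF emb_sections]] cf_emb)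
  next
    case False
    then have "ginv G g \<notin> units G" using g ginv_ginv ginv_unit by metis
    then show ?thesis using False g lstar_lzero[of "ginv G g"]
      by (simp add: sec_star_def emb_def ginv_closed ginv_ginv)
  qed
qed (auto simp: sec_star_sections emb_sections)

text \<open>The compact set contains the ranges and the sources of all arrows where \<open>f\<close>
  is nonzero, so a factor that is 1 there changes nothing.\<close>

lemma Gamma_c_local_unit:
  assumes f: "f \<in> Gamma_c G L"
  shows "\<exists>K. compactin X K \<and> (\<forall>h. (\<forall>x\<in>K. h x = 1) \<longrightarrow> lact h f = f \<and> ract h f = f)"
proof -
  note fs = Gamma_c_sections[OF f]
  obtain K where K: "compactin X K" "\<forall>g\<in>arrows G. f g \<noteq> lzero L g \<longrightarrow> r g \<in> K \<and> s g \<in> K"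
    using Gamma_c_support[OF f] by blast
  have "lact h f = f \<and> ract h f = f" if h: "\<forall>x\<in>K. h x = 1" for h
  proof -
    have "h (r g) * cf (f g) = cf (f g) \<and> h (s g) * cf (f g) = cf (f g)" if g: "g \<in> arrows G" for g
      using K(2) h g cf_lzero[OF g] by (cases "f g = lzero L g") auto
    then show ?thesis
      using sections_eqI[OF lact_sections[OF fs] fs] sections_eqI[OF ract_sections[OF fs] fs] fs
      by (auto simp: cf_lact cf_ract)
  qed
  then show ?thesis using K(1) by blast
qed

end

section \<open>The regular norm\<close>

context twisted_etale_groupoid begin

definition l2_mass :: "('g \<Rightarrow> 'l) \<Rightarrow> real" where
  "l2_mass \<xi> = (\<Sum>\<^sub>\<infinity>g\<in>arrows G. (lnorm L (\<xi> g))\<^sup>2)"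

lemma l2_sectionsD:
  assumes "\<xi> \<in> l2_sections G L"
  shows "\<xi> \<in> sections G L" "(\<lambda>g. (lnorm L (\<xi> g))\<^sup>2) summable_on arrows G"
  using assms by (auto simp: l2_sections_def)

lemma finite_sum_le_l2_mass:
  assumes \<xi>: "\<xi> \<in> l2_sections G L" and F: "finite F" "F \<subseteq> arrows G"
  shows "(\<Sum>g\<in>F. (cmod (cf (\<xi> g)))\<^sup>2) \<le> l2_mass \<xi>"
proof -
  have "(\<Sum>g\<in>F. (cmod (cf (\<xi> g)))\<^sup>2) = (\<Sum>g\<in>F. (lnorm L (\<xi> g))\<^sup>2)"
    using F sectionsD[OF l2_sectionsD(1)[OF \<xi>]] by (intro sum.cong refl) (auto simp: lnorm_cf subset_iff)
  also have "\<dots> \<le> l2_mass \<xi>"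
    unfolding l2_mass_def using F l2_sectionsD(2)[OF \<xi>] by (intro finite_sum_le_infsum) auto
  finally show ?thesis .
qed

text \<open>The regular norm is a supremum of reals, which is meaningful only for bounded sets.\<close>

lemma conv_l2_bounded:
  assumes "f \<in> Gamma_c G L"
  shows "\<exists>C. \<forall>\<xi>\<in>l2_sections G L. \<forall>F. finite F \<and> F \<subseteq> arrows G \<longrightarrow>
    (\<Sum>g\<in>F. (cmod (cf (conv G L f \<xi> g)))\<^sup>2) \<le> C * l2_mass \<xi>"
  using assms
proof (induction rule: Gamma_c.induct)
  case (base U f)
  note u = open_bisectionD[OF base(1)] and fs = Gamma_c_onD(1)[OF base(2)]
  obtain B where B: "\<And>g. g\<in>arrows G \<Longrightarrow> cmod (cf (f g)) \<le> B" using Gamma_c_on_bounded[OF base(2)] by blast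
  show ?case
  proof (intro exI[of _ "B\<^sup>2"] ballI allI impI)
    fix \<xi> F assume \<xi>: "\<xi> \<in> l2_sections G L" and F: "finite F \<and> F \<subseteq> arrows G"
    note xs = l2_sectionsD(1)[OF \<xi>]
    let ?k = "\<lambda>g. inv_into U r (r g)"
    let ?\<beta> = "\<lambda>g. gmult G (ginv G (?k g)) g"
    let ?A = "{g \<in> F. r g \<in> r ` U}"
    have k: "?k g \<in> U \<and> ?k g \<in> arrows G \<and> r (?k g) = r g \<and> g \<in> arrows G \<and> ?\<beta> g \<in> arrows G \<and> s (?k g) = r (?\<beta> g) \<and> gmult G (?k g) (?\<beta> g) = g"
      if g: "g \<in> ?A" for g
    proof -
      have a: "?k g \<in> U" "r (?k g) = r g" using g by (auto intro: inv_into_into f_inv_into_f)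
      then show ?thesis using u(4) F g
        by (auto simp: gmult_closed ginv_closed src_ginv rng_gmult rng_ginv gmult_inv_left subset_iff)
    qed
    \<comment> \<open>The second factor determines the arrow: its range is the source of the first
      factor, which lies in \<open>U\<close>, where \<open>s\<close> is injective. So a section on a
      bisection moves coordinates injectively and rescales them by at most \<open>B\<close>.\<close>
    have inj: "inj_on ?\<beta> ?A"
    proof (rule inj_onI)
      fix g h assume gh: "g \<in> ?A" "h \<in> ?A" "?\<beta> g = ?\<beta> h"
      have a: "s (?k g) = r (?\<beta> g)" "?k g \<in> U" "gmult G (?k g) (?\<beta> g) = g" using k[OF gh(1)] by blast+
      have b: "s (?k h) = r (?\<beta> h)" "?k h \<in> U" "gmult G (?k h) (?\<beta> h) = h" using k[OF gh(2)] by blast+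
      have "s (?k g) = s (?k h)" unfolding a(1) b(1) gh(3) ..
      then have "?k g = ?k h" using inj_onD[OF u(3)] a(2) b(2) by blast
      then have "gmult G (?k g) (?\<beta> g) = gmult G (?k h) (?\<beta> h)" using gh(3) by (rule arg_cong2)
      then show "g = h" unfolding a(3) b(3) .
    qed
    have eq: "conv G L f \<xi> g = (if r g \<in> r ` U then lmult L (f (?k g)) (\<xi> (?\<beta> g)) else lzero L g)" if "g \<in> arrows G" for g
      by (rule conv_bisection[OF fs xs that base(1)]) (rule Gamma_c_on_zero_outside[OF base(2)])
    have "(\<Sum>g\<in>F. (cmod (cf (conv G L f \<xi> g)))\<^sup>2) = (\<Sum>g\<in>?A. (cmod (cf (conv G L f \<xi> g)))\<^sup>2)"
      using F eq by (intro sum.mono_neutral_right) (auto simp: cf_lzero subset_iff)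
    also have "\<dots> \<le> (\<Sum>g\<in>?A. B\<^sup>2 * (cmod (cf (\<xi> (?\<beta> g))))\<^sup>2)"
    proof (rule sum_mono)
      fix g assume g: "g \<in> ?A"
      note kg = k[OF g]
      have f1: "f (?k g) \<in> Fb (?k g)" "\<xi> (?\<beta> g) \<in> Fb (?\<beta> g)" using kg sectionsD[OF fs] sectionsD[OF xs] by auto
      have "lmult L (f (?k g)) (\<xi> (?\<beta> g)) \<in> Fb (gmult G (?k g) (?\<beta> g))" using kg f1 by (intro lmult_closed) auto
      then have m: "lmult L (f (?k g)) (\<xi> (?\<beta> g)) \<in> Fb g" using kg by simp
      have "cmod (cf (conv G L f \<xi> g)) = lnorm L (lmult L (f (?k g)) (\<xi> (?\<beta> g)))"
        using eq[of g] g kg lnorm_cf[OF _ m] by simp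
      also have "\<dots> \<le> lnorm L (f (?k g)) * lnorm L (\<xi> (?\<beta> g))" using kg f1 by (intro lnorm_lmult) auto
      also have "\<dots> = cmod (cf (f (?k g))) * cmod (cf (\<xi> (?\<beta> g)))" using kg f1 lnorm_cf by metis
      also have "\<dots> \<le> B * cmod (cf (\<xi> (?\<beta> g)))" using B[of "?k g"] kg by (intro mult_right_mono) auto
      finally show "(cmod (cf (conv G L f \<xi> g)))\<^sup>2 \<le> B\<^sup>2 * (cmod (cf (\<xi> (?\<beta> g))))\<^sup>2"
        unfolding power_mult_distrib[symmetric] by (intro power_mono) auto
    qed
    also have "\<dots> = B\<^sup>2 * (\<Sum>k\<in>?\<beta> ` ?A. (cmod (cf (\<xi> k)))\<^sup>2)"
      by (simp add: sum_distrib_left sum.reindex[OF inj])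
    also have "\<dots> \<le> B\<^sup>2 * l2_mass \<xi>"
      using F k by (intro mult_left_mono finite_sum_le_l2_mass[OF \<xi>]) auto
    finally show "(\<Sum>g\<in>F. (cmod (cf (conv G L f \<xi> g)))\<^sup>2) \<le> B\<^sup>2 * l2_mass \<xi>" .
  qed
next
  case (add f f')
  obtain C where C: "\<And>\<xi> F. \<xi>\<in>l2_sections G L \<Longrightarrow> finite F \<and> F \<subseteq> arrows G \<Longrightarrow> (\<Sum>g\<in>F. (cmod (cf (conv G L f \<xi> g)))\<^sup>2) \<le> C * l2_mass \<xi>"
    using add.IH(1) by blast
  obtain C' where C': "\<And>\<xi> F. \<xi>\<in>l2_sections G L \<Longrightarrow> finite F \<and> F \<subseteq> arrows G \<Longrightarrow> (\<Sum>g\<in>F. (cmod (cf (conv G L f' \<xi> g)))\<^sup>2) \<le> C' * l2_mass \<xi>"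
    using add.IH(2) by blast
  show ?case
  proof (intro exI[of _ "2 * C + 2 * C'"] ballI allI impI)
    fix \<xi> F assume \<xi>: "\<xi> \<in> l2_sections G L" and F: "finite F \<and> F \<subseteq> arrows G"
    note xs = l2_sectionsD(1)[OF \<xi>] and fs = Gamma_c_sections[OF add.hyps(1)] Gamma_c_sections[OF add.hyps(2)]
    note rows = Gamma_c_row[OF add.hyps(1)] Gamma_c_row[OF add.hyps(2)]
    \<comment> \<open>The factor 2 in this elementary inequality is the origin of the constant
      \<open>2 * C + 2 * C'\<close>.\<close>
    have sq: "(cmod (a + b))\<^sup>2 \<le> 2 * (cmod a)\<^sup>2 + 2 * (cmod b)\<^sup>2" for a b :: complex
    proof -
      have "(cmod (a + b))\<^sup>2 \<le> (cmod a + cmod b)\<^sup>2" by (intro power_mono norm_triangle_ineq) auto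
      also have "\<dots> \<le> 2 * (cmod a)\<^sup>2 + 2 * (cmod b)\<^sup>2"
        using sum_squares_bound[of "cmod a" "cmod b"] by (simp add: power2_sum)
      finally show ?thesis .
    qed
    have "(\<Sum>g\<in>F. (cmod (cf (conv G L (sec_add G L f f') \<xi> g)))\<^sup>2) \<le>
        (\<Sum>g\<in>F. 2 * (cmod (cf (conv G L f \<xi> g)))\<^sup>2 + 2 * (cmod (cf (conv G L f' \<xi> g)))\<^sup>2)"
      unfolding conv_add_left[OF fs(1) rows(1) fs(2) rows(2) xs]
      using F sq by (intro sum_mono) (auto simp: cf_sec_add conv_sections fs xs rows subset_iff)
    also have "\<dots> \<le> 2 * (C * l2_mass \<xi>) + 2 * (C' * l2_mass \<xi>)"
      using C[OF \<xi> F] C'[OF \<xi> F] by (simp add: sum.distrib flip: sum_distrib_left)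
    finally show "(\<Sum>g\<in>F. (cmod (cf (conv G L (sec_add G L f f') \<xi> g)))\<^sup>2) \<le> (2 * C + 2 * C') * l2_mass \<xi>"
      by (simp add: algebra_simps)
  qed
next
  case (scale f c)
  obtain C where C: "\<And>\<xi> F. \<xi>\<in>l2_sections G L \<Longrightarrow> finite F \<and> F \<subseteq> arrows G \<Longrightarrow> (\<Sum>g\<in>F. (cmod (cf (conv G L f \<xi> g)))\<^sup>2) \<le> C * l2_mass \<xi>"
    using scale.IH by blast
  show ?case
  proof (intro exI[of _ "(cmod c)\<^sup>2 * C"] ballI allI impI)
    fix \<xi> F assume \<xi>: "\<xi> \<in> l2_sections G L" and F: "finite F \<and> F \<subseteq> arrows G"
    note xs = l2_sectionsD(1)[OF \<xi>] and fs = Gamma_c_sections[OF scale.hyps]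
    note rows = Gamma_c_row[OF scale.hyps]
    have "(\<Sum>g\<in>F. (cmod (cf (conv G L (sec_scale G L c f) \<xi> g)))\<^sup>2) =
        (cmod c)\<^sup>2 * (\<Sum>g\<in>F. (cmod (cf (conv G L f \<xi> g)))\<^sup>2)"
      unfolding conv_scale_left[OF fs rows xs] sum_distrib_left
      using F by (intro sum.cong refl) (auto simp: cf_sec_scale conv_sections fs xs rows subset_iff norm_mult power_mult_distrib)
    also have "\<dots> \<le> (cmod c)\<^sup>2 * (C * l2_mass \<xi>)" using C[OF \<xi> F] by (intro mult_left_mono) auto
    finally show "(\<Sum>g\<in>F. (cmod (cf (conv G L (sec_scale G L c f) \<xi> g)))\<^sup>2) \<le> (cmod c)\<^sup>2 * C * l2_mass \<xi>"
      by (simp add: mult.assoc)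
  qed
qed

lemma conv_l2_sections:
  assumes f: "f \<in> Gamma_c G L"
  shows "\<exists>C. \<forall>\<xi>\<in>l2_sections G L. conv G L f \<xi> \<in> l2_sections G L \<and> l2_mass (conv G L f \<xi>) \<le> C * l2_mass \<xi>"
proof -
  obtain C where C: "\<And>\<xi> F. \<xi>\<in>l2_sections G L \<Longrightarrow> finite F \<and> F \<subseteq> arrows G \<Longrightarrow> (\<Sum>g\<in>F. (cmod (cf (conv G L f \<xi> g)))\<^sup>2) \<le> C * l2_mass \<xi>"
    using conv_l2_bounded[OF f] by blast
  have "conv G L f \<xi> \<in> l2_sections G L \<and> l2_mass (conv G L f \<xi>) \<le> C * l2_mass \<xi>" if \<xi>: "\<xi> \<in> l2_sections G L" for \<xi>
  proof -
    have cs: "conv G L f \<xi> \<in> sections G L"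
      using conv_sections Gamma_c_sections[OF f] l2_sectionsD(1)[OF \<xi>] Gamma_c_row[OF f] by blast
    have le: "(\<Sum>g\<in>F. (lnorm L (conv G L f \<xi> g))\<^sup>2) \<le> C * l2_mass \<xi>" if F: "finite F" "F \<subseteq> arrows G" for F
    proof -
      have "(\<Sum>g\<in>F. (lnorm L (conv G L f \<xi> g))\<^sup>2) = (\<Sum>g\<in>F. (cmod (cf (conv G L f \<xi> g)))\<^sup>2)"
        using F sectionsD[OF cs] by (intro sum.cong refl) (auto simp: lnorm_cf subset_iff)
      then show ?thesis using C[OF \<xi>] F by simp
    qed
    have sm: "(\<lambda>g. (lnorm L (conv G L f \<xi> g))\<^sup>2) summable_on arrows G"
      by (rule nonneg_bdd_above_summable_on) (use le in \<open>auto intro!: bdd_aboveI2\<close>)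
    moreover have "l2_mass (conv G L f \<xi>) \<le> C * l2_mass \<xi>"
      unfolding l2_mass_def[of "conv G L f \<xi>"] using le by (intro infsum_le_finite_sums sm) auto
    ultimately show ?thesis using cs by (simp add: l2_sections_def)
  qed
  then show ?thesis by blast
qed

lemma l2_norm_eq: "l2_norm G L \<xi> = sqrt (l2_mass \<xi>)"
  by (simp add: l2_norm_def l2_mass_def)

lemma l2_mass_nonneg: "0 \<le> l2_mass \<xi>"
  unfolding l2_mass_def by (rule infsum_nonneg) auto

lemma cf_unit_le_regular_norm:
  assumes f: "f \<in> Gamma_c G L" and u: "u \<in> units G"
  shows "cmod (cf (f u)) \<le> regular_norm G L f"
proof -
  note fs = Gamma_c_sections[OF f] and uG = subsetD[OF units_arrows u]
  obtain C where C: "\<And>\<xi>. \<xi>\<in>l2_sections G L \<Longrightarrow> conv G L f \<xi> \<in> l2_sections G L \<and> l2_mass (conv G L f \<xi>) \<le> C * l2_mass \<xi>"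
    using conv_l2_sections[OF f] by blast
  let ?B = "{\<xi> \<in> l2_sections G L. l2_norm G L \<xi> \<le> 1}"
  have bdd: "bdd_above ((\<lambda>\<xi>. l2_norm G L (regular_rep G L f \<xi>)) ` ?B)"
  proof (rule bdd_aboveI2)
    fix \<xi> assume "\<xi> \<in> ?B"
    then have \<xi>: "\<xi> \<in> l2_sections G L" "l2_mass \<xi> \<le> 1" by (auto simp: l2_norm_eq)
    have "l2_mass (conv G L f \<xi>) \<le> C * l2_mass \<xi>" using C[OF \<xi>(1)] by blast
    also have "\<dots> \<le> \<bar>C\<bar> * 1" using \<xi>(2) l2_mass_nonneg[of \<xi>] by (intro mult_mono) auto
    finally have "l2_mass (conv G L f \<xi>) \<le> \<bar>C\<bar> * 1" .
    then show "l2_norm G L (regular_rep G L f \<xi>) \<le> sqrt \<bar>C\<bar>"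
      by (simp add: l2_norm_eq regular_rep_def)
  qed
  \<comment> \<open>\<open>emb\<close> also makes sense for discontinuous functions; convolving with \<open>\<delta>\<close> extracts the column of \<open>f\<close> at \<open>u\<close>.\<close>
  define \<delta> where "\<delta> = emb (\<lambda>x. if x = u then 1 else 0)"
  have ds: "\<delta> \<in> sections G L" unfolding \<delta>_def by (rule emb_sections)
  have d: "(lnorm L (\<delta> g))\<^sup>2 = (if g = u then 1 else 0)" if "g \<in> arrows G" for g
    using lnorm_cf[OF that sectionsD[OF ds that]] that u by (simp add: \<delta>_def cf_emb)
  have hs: "((\<lambda>g. (lnorm L (\<delta> g))\<^sup>2) has_sum 1) (arrows G)"
  proof -
    have "((\<lambda>g. 1::real) has_sum (\<Sum>g\<in>{u}. 1)) {u}" by (rule has_sum_finite) simp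
    then have "((\<lambda>g. 1::real) has_sum 1) {u}" by simp
    then show ?thesis
      by (subst has_sum_cong_neutral[where T = "{u}" and g = "\<lambda>g. 1"]) (use d uG in auto)
  qed
  have "\<delta> \<in> l2_sections G L" using ds hs has_sum_imp_summable by (auto simp: l2_sections_def)
  moreover have "l2_mass \<delta> = 1" unfolding l2_mass_def using hs by (rule infsumI)
  ultimately have dB: "\<delta> \<in> ?B" by (simp add: l2_norm_eq)
  have "conv G L f \<delta> \<in> l2_sections G L" using C dB by blast
  from finite_sum_le_l2_mass[OF this, of "{u}"] uG
  have "(cmod (cf (conv G L f \<delta> u)))\<^sup>2 \<le> l2_mass (conv G L f \<delta>)" by simp
  moreover have "cf (conv G L f \<delta> u) = cf (f u)"
    unfolding \<delta>_def conv_emb_right_Gamma_c[OF f] using cf_ract[OF fs uG] src_unit[OF u] by simp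
  ultimately have "cmod (cf (f u)) \<le> l2_norm G L (regular_rep G L f \<delta>)"
    by (simp add: l2_norm_eq regular_rep_def real_le_rsqrt)
  also have "\<dots> \<le> regular_norm G L f"
    unfolding regular_norm_def using dB bdd by (rule cSUP_upper)
  finally show ?thesis .
qed

end

section \<open>The trace property on the convolution algebra\<close>

context etale_groupoid begin

text \<open>The carrier is lifted to \<open>W\<close> by the inverse of the range map and then
  projected by \<open>s\<close>; extension by zero gives a global continuous function.\<close>

lemma transport_csupp:
  fixes k :: "_ \<Rightarrow> 'b::{topological_space, zero}"
  assumes W: "open_bisection G W" and k: "continuous_map X euclidean k" "csupp X (r ` W) k"
  defines "k' \<equiv> \<lambda>x. if x \<in> s ` W then k (bisection_map G W x) else 0"
  shows "continuous_map X euclidean k'" "csupp X (s ` W) k'"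
proof -
  note w = open_bisectionD[OF W]
  have sW: "openin X (s ` W)" by (rule open_src[OF w(1)])
  have top: "topspace (subtopology X (s ` W)) = s ` W" using openin_subset[OF sW] by auto
  have c1: "continuous_map (subtopology T W) X r" using continuous_rng by (rule continuous_map_from_subtopology)
  have c2: "continuous_map (subtopology T W) X s" using continuous_src by (rule continuous_map_from_subtopology)
  have bm: "continuous_map (subtopology X (s ` W)) X (bisection_map G W)"
    using continuous_map_compose[OF continuous_inv_src[OF W] c1] by (simp add: o_def bisection_map_def[abs_def])
  obtain K where K: "compactin X K" "K \<subseteq> r ` W" "\<And>x. x \<notin> K \<Longrightarrow> k x = 0" using k(2) unfolding csupp_def by blast
  have "compactin (subtopology X (r ` W)) K" using K by (simp add: compactin_subtopology)
  then have "compactin (subtopology T W) (inv_into W r ` K)" using continuous_inv_rng[OF W] by (rule image_compactin)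
  then have comp: "compactin X (s ` inv_into W r ` K)" using c2 by (rule image_compactin)
  have sub: "s ` inv_into W r ` K \<subseteq> s ` W" using K(2) by (auto intro!: imageI inv_into_into)
  have z: "k' x = 0" if x: "x \<notin> s ` inv_into W r ` K" for x
  proof (cases "x \<in> s ` W")
    case True
    then obtain g where g: "g \<in> W" "x = s g" by blast
    have "bisection_map G W x = r g" using g w(3) by (simp add: bisection_map_def inv_into_f_f)
    moreover have "r g \<notin> K"
    proof
      assume "r g \<in> K"
      moreover have "inv_into W r (r g) = g" using g w(2) by (simp add: inv_into_f_f)
      ultimately show False using x g(2) by (metis imageI)
    qed
    ultimately show ?thesis using K(3) by (simp add: k'_def)
  qed (simp add: k'_def)
  show cs: "csupp X (s ` W) k'" using comp sub z by (rule csuppI)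
  have "continuous_map (subtopology X (s ` W)) euclidean (\<lambda>x. k (bisection_map G W x))"
    using continuous_map_compose[OF bm k(1)] by (simp add: o_def)
  then have "continuous_map (subtopology X (s ` W)) euclidean k'"
    by (rule continuous_map_eq) (simp add: k'_def)
  then show "continuous_map X euclidean k'"
    using continuous_map_extend_zero[OF Hausdorff_unit_space sW] cs by blast
qed

lemma bisection_map_src: "open_bisection G W \<Longrightarrow> g \<in> W \<Longrightarrow> bisection_map G W (s g) = r g"
  by (simp add: bisection_map_def inv_into_f_f open_bisectionD(3))

end

context twisted_etale_groupoid begin

lemma restrict_units_sec_add:
  assumes "f \<in> sections G L" "h \<in> sections G L"
  shows "restrict_units G L (sec_add G L f h) = (\<lambda>x. restrict_units G L f x + restrict_units G L h x)"
  using assms units_arrows by (auto simp: fun_eq_iff restrict_units_eq_cf sec_add_sections cf_sec_add)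

lemma restrict_units_sec_scale:
  assumes "f \<in> sections G L"
  shows "restrict_units G L (sec_scale G L c f) = (\<lambda>x. c * restrict_units G L f x)"
  using assms units_arrows by (auto simp: fun_eq_iff restrict_units_eq_cf sec_scale_sections cf_sec_scale)

lemma restrict_units_lact:
  assumes "f \<in> sections G L"
  shows "restrict_units G L (lact h f) = (\<lambda>x. h x * restrict_units G L f x)"
  using assms units_arrows by (auto simp: fun_eq_iff restrict_units_eq_cf lact_sections cf_lact rng_unit)

lemma restrict_units_integrable:
  assumes M: "radon_borel_measure X M" and f: "f \<in> Gamma_c G L"
  shows "integrable M (restrict_units G L f)"
  using f
proof (induction rule: Gamma_c.induct)
  case (base U f)
  then show ?case using units.compact_piece_integrable[OF M restrict_units_piece] by blast
qed (simp_all add: restrict_units_sec_add restrict_units_sec_scale Gamma_c_sections)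

definition tr :: "'g measure \<Rightarrow> 'g measure \<Rightarrow> ('g \<Rightarrow> 'l) \<Rightarrow> complex" where
  "tr M N f = (\<integral>x. restrict_units G L f x \<partial>M) - (\<integral>x. restrict_units G L f x \<partial>N)"

context
  fixes M N assumes M: "radon_borel_measure X M" and N: "radon_borel_measure X N"
begin

lemma tr_add:
  assumes "f \<in> Gamma_c G L" "h \<in> Gamma_c G L"
  shows "tr M N (sec_add G L f h) = tr M N f + tr M N h"
  using assms restrict_units_integrable[OF M] restrict_units_integrable[OF N]
  by (simp add: tr_def restrict_units_sec_add Gamma_c_sections)

lemma tr_scale: "f \<in> Gamma_c G L \<Longrightarrow> tr M N (sec_scale G L c f) = c * tr M N f"
  by (simp add: tr_def restrict_units_sec_scale Gamma_c_sections right_diff_distrib)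

lemma tr_independent:
  assumes M': "radon_borel_measure X M'" and N': "radon_borel_measure X N'"
    and eq: "\<And>h. h \<in> Cc X \<Longrightarrow> (\<integral>x. h x \<partial>M) - (\<integral>x. h x \<partial>N) = (\<integral>x. h x \<partial>M') - (\<integral>x. h x \<partial>N')"
    and f: "f \<in> Gamma_c G L"
  shows "tr M N f = tr M' N' f"
  using f
proof (induction rule: Gamma_c.induct)
  case (base U f)
  show ?case
    unfolding tr_def by (rule units.radon_difference_eq_on_pieces[OF M N M' N' eq restrict_units_piece[OF base]])
next
  case (add f h)
  then show ?case
    using restrict_units_integrable[OF M] restrict_units_integrable[OF N] restrict_units_integrable[OF M'] restrict_units_integrable[OF N']
    by (simp add: tr_def restrict_units_sec_add Gamma_c_sections algebra_simps)
next
  case (scale f c)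
  then show ?case by (simp add: tr_def restrict_units_sec_scale Gamma_c_sections flip: right_diff_distrib)
qed

text \<open>With \<open>W\<close> the arrows of \<open>U\<close> whose inverses lie in
  \<open>V\<close>, the two products meet the units in the ranges and in the sources of
  \<open>W\<close>, and their restrictions correspond under the homeomorphism of \<open>W\<close> by
  \<open>cf_lmult_commute\<close>. Invariance speaks of continuous functions, so it is applied after
  a cutoff, and the errors of four integrals are controlled.\<close>

lemma tr_commute_bisections:
  assumes eq: "\<And>h. h \<in> Cc X \<Longrightarrow> \<mu> h = (\<integral>x. h x \<partial>M) - (\<integral>x. h x \<partial>N)"
    and inv: "invariant_radon G \<mu>"
    and U: "open_bisection G U" and V: "open_bisection G V"
    and f: "f \<in> Gamma_c_on G L U" and h: "h \<in> Gamma_c_on G L V"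
  shows "tr M N (conv G L f h) = tr M N (conv G L h f)"
proof -
  note u = open_bisectionD[OF U] and v = open_bisectionD[OF V]
  note fs = Gamma_c_onD(1)[OF f] and hs = Gamma_c_onD(1)[OF h]
  define W where "W = U \<inter> ginv G ` V"
  have W: "open_bisection G W" unfolding W_def using U openin_ginv[OF v(1)] by (rule open_bisection_Int)
  note w = open_bisectionD[OF W]
  have Wg: "g \<in> U \<and> ginv G g \<in> V \<and> g \<in> arrows G" if "g \<in> W" for g
    using that u v by (auto simp: W_def ginv_ginv subset_iff)
  have UV: "set_mult U V \<inter> units G = r ` W" unfolding W_def by (rule set_mult_units[OF u(4) v(4)])
  have "V \<inter> ginv G ` U = ginv G ` W"
  proof (intro Set.set_eqI iffI)
    fix x assume "x \<in> V \<inter> ginv G ` U"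
    then obtain g where g: "x \<in> V" "g \<in> U" "x = ginv G g" by blast
    then have "g = ginv G x" using ginv_ginv[of g] u(4) by auto
    then show "x \<in> ginv G ` W" using g unfolding W_def by blast
  next
    fix x assume "x \<in> ginv G ` W"
    then obtain g k where g: "x = ginv G g" "g \<in> U" "g = ginv G k" "k \<in> V" unfolding W_def by blast
    then have "x = k" using ginv_ginv[of k] v(4) by auto
    then show "x \<in> V \<inter> ginv G ` U" using g by blast
  qed
  then have VU: "set_mult V U \<inter> units G = s ` W"
    using set_mult_units[OF v(4) u(4)] src_image_eq[OF w(4)] by simp
  let ?F1 = "restrict_units G L (conv G L f h)" and ?F2 = "restrict_units G L (conv G L h f)"
  have F1: "compact_piece X (r ` W) ?F1"
    using restrict_units_piece[OF open_bisection_set_mult[OF U V] conv_Gamma_c_on[OF U V f h]] UV by simp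
  have F2: "compact_piece X (s ` W) ?F2"
    using restrict_units_piece[OF open_bisection_set_mult[OF V U] conv_Gamma_c_on[OF V U h f]] VU by simp
  have F12: "?F1 (r g) = ?F2 (s g)" if g: "g \<in> W" for g
  proof -
    note gg = Wg[OF g]
    have ig: "ginv G g \<in> arrows G" using gg by (simp add: ginv_closed)
    have c1: "conv G L f h \<in> sections G L" "conv G L h f \<in> sections G L"
      using conv_Gamma_c_on[OF U V f h] conv_Gamma_c_on[OF V U h f] Gamma_c_onD(1) by auto
    have i1: "inv_into U r (r (r g)) = g" using gg u(2) by (simp add: rng_rng inv_into_f_f)
    have i2: "inv_into V r (r (s g)) = ginv G g" using gg v(2) inv_into_f_f[OF v(2), of "ginv G g"] by (simp add: rng_src rng_ginv)
    have "conv G L f h (r g) = lmult L (f g) (h (ginv G g))"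
      using conv_bisection[OF fs hs rng_closed U Gamma_c_on_zero_outside[OF f], of g] gg i1
        gmult_src[OF ig] src_ginv[of g] by (auto simp: rng_rng)
    moreover have "r (s g) \<in> r ` V" using gg rng_ginv[of g] by (metis imageI rng_src)
    then have "conv G L h f (s g) = lmult L (h (ginv G g)) (f g)"
      using conv_bisection[OF hs fs src_closed V Gamma_c_on_zero_outside[OF h], of g] gg i2
      by (simp add: ginv_ginv gmult_src)
    ultimately show ?thesis
      using gg cf_lmult_commute[of g "f g" "h (ginv G g)"] sectionsD[OF fs, of g] sectionsD[OF hs ig]
      by (simp add: restrict_units_eq_cf c1 rng_in_units src_in_units)
  qed
  have "cmod (tr M N (conv G L f h) - tr M N (conv G L h f)) \<le> 0 + e" if e: "0 < e" for e
  proof -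
    have fin: "finite {M, N}" "\<And>Z. Z \<in> {M, N} \<Longrightarrow> radon_borel_measure X Z" using M N by auto
    obtain C1 where C1: "compactin X C1" "C1 \<subseteq> r ` W" "\<forall>Z\<in>{M,N}. cutoff_within X Z ?F1 C1 (e/4)"
      using units.compact_piece_approximation[OF fin F1, of "e/4"] e by auto
    obtain C2 where C2: "compactin X C2" "C2 \<subseteq> s ` W" "\<forall>Z\<in>{M,N}. cutoff_within X Z ?F2 C2 (e/4)"
      using units.compact_piece_approximation[OF fin F2, of "e/4"] e by auto
    \<comment> \<open>The compact set for the second product is carried over to the ranges; one
      cutoff \<open>\<theta>\<close> equal to 1 on the union, together with its transport
      \<open>\<theta>'\<close>, then serves both products.\<close>
    let ?C = "C1 \<union> r ` inv_into W s ` C2"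
    have "compactin (subtopology X (s ` W)) C2" using C2 by (simp add: compactin_subtopology)
    then have "compactin (subtopology T W) (inv_into W s ` C2)" using continuous_inv_src[OF W] by (rule image_compactin)
    then have "compactin X (r ` inv_into W s ` C2)"
      using continuous_map_from_subtopology[OF continuous_rng] by (rule image_compactin)
    then have C: "compactin X ?C" using C1(1) by (intro compactin_Un)
    have Cs: "?C \<subseteq> r ` W" using C1(2) C2(2) by (auto intro!: imageI inv_into_into)
    obtain \<theta> D where \<theta>: "\<theta> \<in> Cp X" "\<forall>x. \<theta> x \<le> 1" "csupp X (r ` W) \<theta>" "?C \<subseteq> D" "\<forall>x\<in>D. \<theta> x = 1"
      using units.bump[OF C open_rng[OF w(1)] Cs] by blast
    define \<theta>' where "\<theta>' = (\<lambda>x. if x \<in> s ` W then \<theta> (bisection_map G W x) else 0)"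
    have \<theta>': "continuous_map X euclidean \<theta>'" "csupp X (s ` W) \<theta>'"
      unfolding \<theta>'_def using transport_csupp[OF W Cp_D(1)[OF \<theta>(1)] \<theta>(3)] by auto
    have \<theta>'01: "\<forall>x. 0 \<le> \<theta>' x \<and> \<theta>' x \<le> 1" using \<theta>(2) Cp_D(2)[OF \<theta>(1)] by (auto simp: \<theta>'_def)
    have \<theta>'1: "\<forall>x\<in>C2. \<theta>' x = 1"
    proof
      fix x assume x: "x \<in> C2"
      then have "bisection_map G W x \<in> ?C" by (auto simp: bisection_map_def)
      then have "\<theta> (bisection_map G W x) = 1" using \<theta>(4,5) by blast
      then show "\<theta>' x = 1" using x C2(2) by (auto simp: \<theta>'_def)
    qed
    let ?k = "\<lambda>x. complex_of_real (\<theta> x) * ?F1 x" and ?k' = "\<lambda>x. complex_of_real (\<theta>' x) * ?F2 x"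
    have k: "?k \<in> Cc X"
      by (rule units.compact_piece_times_continuous[OF F1 continuous_map_of_real[OF Cp_D(1)[OF \<theta>(1)]]])
         (auto intro: csupp_weaken[OF \<theta>(3)])
    have k': "?k' \<in> Cc X"
      by (rule units.compact_piece_times_continuous[OF F2 continuous_map_of_real[OF \<theta>'(1)]])
         (auto intro: csupp_weaken[OF \<theta>'(2)])
    have "csupp X (r ` W) ?k" by (rule csupp_weaken[OF \<theta>(3)]) auto
    then have kW: "?k \<in> Cc (subtopology X (r ` W))"
      using continuous_map_from_subtopology[OF Cc_D(1)[OF k], of "r ` W"]
      unfolding Cc_iff csupp_def by (auto simp: compactin_subtopology)
    have tk: "(\<lambda>x. if x \<in> s ` W then ?k (bisection_map G W x) else 0) = ?k'"
      using F12 bisection_map_src[OF W] by (auto simp: \<theta>'_def fun_eq_iff)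
    have "\<mu> ?k = \<mu> ?k'"
      using inv[unfolded invariant_radon_def, rule_format, OF W kW] unfolding tk .
    then have "(\<integral>x. ?k x \<partial>M) - (\<integral>x. ?k x \<partial>N) = (\<integral>x. ?k' x \<partial>M) - (\<integral>x. ?k' x \<partial>N)"
      using eq k k' by simp
    moreover have a: "cmod ((\<integral>x. ?F1 x \<partial>Z) - (\<integral>x. ?k x \<partial>Z)) < e/4" if "Z \<in> {M, N}" for Z
    proof -
      have "\<forall>x\<in>C1. \<theta> x = 1" using \<theta>(4,5) by auto
      then show ?thesis using C1(3) that \<theta>(2) Cp_D[OF \<theta>(1)] unfolding cutoff_within_def by blast
    qed
    moreover have b: "cmod ((\<integral>x. ?F2 x \<partial>Z) - (\<integral>x. ?k' x \<partial>Z)) < e/4" if "Z \<in> {M, N}" for Z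
      using C2(3) that \<theta>'(1) \<theta>'01 \<theta>'1 unfolding cutoff_within_def by blast
    ultimately have d: "tr M N (conv G L f h) - tr M N (conv G L h f) =
        (((\<integral>x. ?F1 x \<partial>M) - (\<integral>x. ?k x \<partial>M)) - ((\<integral>x. ?F1 x \<partial>N) - (\<integral>x. ?k x \<partial>N))) -
        (((\<integral>x. ?F2 x \<partial>M) - (\<integral>x. ?k' x \<partial>M)) - ((\<integral>x. ?F2 x \<partial>N) - (\<integral>x. ?k' x \<partial>N)))"
      (is "_ = (?a - ?b) - (?c - ?d)")
      unfolding tr_def by (simp add: algebra_simps)
    have "cmod ((?a - ?b) - (?c - ?d)) \<le> (cmod ?a + cmod ?b) + (cmod ?c + cmod ?d)"
      by (intro order_trans[OF norm_triangle_ineq4] add_mono norm_triangle_ineq4)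
    also have "\<dots> \<le> e" using a[of M] a[of N] b[of M] b[of N] by simp
    finally show ?thesis unfolding d by simp
  qed
  then have "cmod (tr M N (conv G L f h) - tr M N (conv G L h f)) \<le> 0" by (rule field_le_epsilon)
  then show ?thesis by simp
qed

lemma tr_commute:
  assumes eq: "\<And>h. h \<in> Cc X \<Longrightarrow> \<mu> h = (\<integral>x. h x \<partial>M) - (\<integral>x. h x \<partial>N)"
    and inv: "invariant_radon G \<mu>"
    and f: "f \<in> Gamma_c G L" and h: "h \<in> Gamma_c G L"
  shows "tr M N (conv G L f h) = tr M N (conv G L h f)"
  using f h
proof (induction arbitrary: h rule: Gamma_c.induct)
  case (base U f)
  have f: "f \<in> Gamma_c G L" using base by (intro Gamma_c.base)
  note fr = Gamma_c_sections[OF f] Gamma_c_row[OF f]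
  show ?case using base(3)
  proof (induction rule: Gamma_c.induct)
    case (base V h)
    show ?case
      by (rule tr_commute_bisections[OF eq inv \<open>open_bisection G U\<close> base(1) \<open>f \<in> Gamma_c_on G L U\<close> base(2)])
  next
    case (add h h')
    then show ?case
      by (simp add: conv_add_right[OF fr] conv_add_left[OF _ _ _ _ fr(1)] Gamma_c_sections Gamma_c_row tr_add conv_Gamma_c f)
  next
    case (scale h c)
    then show ?case
      by (simp add: conv_scale_right[OF fr] conv_scale_left[OF _ _ fr(1)] Gamma_c_sections Gamma_c_row tr_scale conv_Gamma_c f)
  qed
next
  case (add f f')
  then show ?case
    by (simp add: conv_add_right conv_add_left Gamma_c_sections Gamma_c_row tr_add conv_Gamma_c)
next
  case (scale f c)
  then show ?case
    by (simp add: conv_scale_right conv_scale_left Gamma_c_sections Gamma_c_row tr_scale conv_Gamma_c)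
qed

text \<open>The form of the trace property behind \<open>swap\<close> in the limit construction: the
  two sections are the products of \<open>lact e a\<close> and \<open>lact k b\<close> in either
  order.\<close>

lemma tr_swap:
  assumes eq: "\<And>h. h \<in> Cc X \<Longrightarrow> \<mu> h = (\<integral>x. h x \<partial>M) - (\<integral>x. h x \<partial>N)"
    and inv: "invariant_radon G \<mu>"
    and e: "e \<in> Cc X" and k: "k \<in> Cc X" and a: "a \<in> Gamma_c G L" and b: "b \<in> Gamma_c G L"
  shows "tr M N (lact e (conv G L a (lact k b))) = tr M N (lact k (conv G L b (lact e a)))"
proof -
  have ea: "lact e a \<in> Gamma_c G L" and kb: "lact k b \<in> Gamma_c G L"
    using lact_Gamma_c[OF Cc_D(1)] e k a b by auto
  have "lact e (conv G L a (lact k b)) = conv G L (lact e a) (lact k b)"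
    using conv_lact_left[OF Gamma_c_sections[OF a] Gamma_c_row[OF a] Gamma_c_sections[OF kb]] by simp
  moreover have "lact k (conv G L b (lact e a)) = conv G L (lact k b) (lact e a)"
    using conv_lact_left[OF Gamma_c_sections[OF b] Gamma_c_row[OF b] Gamma_c_sections[OF ea]] by simp
  ultimately show ?thesis using tr_commute[OF eq inv ea kb] by simp
qed

text \<open>The measures may be infinite, but \<open>e\<close> is integrable; the constant is the
  integral of \<open>|e|\<close> against \<open>M\<close> plus that against
  \<open>N\<close>.\<close>

lemma tr_lact_bound:
  assumes e: "e \<in> Cc X"
  shows "\<exists>C\<ge>0. \<forall>f\<in>Gamma_c G L. \<forall>B. (\<forall>u\<in>units G. cmod (cf (f u)) \<le> B) \<longrightarrow> 0 \<le> B \<longrightarrow> cmod (tr M N (lact e f)) \<le> C * B"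
proof -
  have int: "integrable M (\<lambda>x. cmod (e x))" "integrable N (\<lambda>x. cmod (e x))"
    using units.integrable_csupp[OF M Cc_D[OF e]] units.integrable_csupp[OF N Cc_D[OF e]] by auto
  have one: "cmod (\<integral>x. restrict_units G L (lact e f) x \<partial>Z) \<le> (\<integral>x. cmod (e x) \<partial>Z) * B"
    if f: "f \<in> Gamma_c G L" and B: "\<forall>u\<in>units G. cmod (cf (f u)) \<le> B" "0 \<le> B"
      and Z: "radon_borel_measure X Z" "integrable Z (\<lambda>x. cmod (e x))" for f B Z
  proof -
    note fs = Gamma_c_sections[OF f]
    have "cmod (\<integral>x. restrict_units G L (lact e f) x \<partial>Z) \<le> (\<integral>x. cmod (restrict_units G L (lact e f) x) \<partial>Z)"
      by (rule integral_norm_bound)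
    also have "\<dots> \<le> (\<integral>x. cmod (e x) * B \<partial>Z)"
    proof (rule integral_mono)
      show "integrable Z (\<lambda>x. cmod (restrict_units G L (lact e f) x))"
        using restrict_units_integrable[OF Z(1) lact_Gamma_c[OF Cc_D(1)[OF e] f]] by simp
      show "integrable Z (\<lambda>x. cmod (e x) * B)" using Z(2) by simp
      show "cmod (restrict_units G L (lact e f) x) \<le> cmod (e x) * B" for x
        using B by (auto simp: restrict_units_lact[OF fs] norm_mult restrict_units_eq_cf[OF fs] intro!: mult_left_mono)
    qed
    finally show ?thesis by simp
  qed
  let ?C = "(\<integral>x. cmod (e x) \<partial>M) + (\<integral>x. cmod (e x) \<partial>N)"
  have "cmod (tr M N (lact e f)) \<le> ?C * B"
    if "f \<in> Gamma_c G L" "\<forall>u\<in>units G. cmod (cf (f u)) \<le> B" "0 \<le> B" for f B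
    unfolding tr_def distrib_right
    using one[OF that M int(1)] one[OF that N int(2)] by (intro order_trans[OF norm_triangle_ineq4] add_mono)
  moreover have "0 \<le> ?C" by (intro add_nonneg_nonneg integral_nonneg) auto
  ultimately show ?thesis by blast
qed

end

end

section \<open>The completion\<close>

locale groupoid_completion = twisted_etale_groupoid G L
  for G :: "'g groupoid" and L :: "('g, 'l) fell_bundle" +
  fixes \<pi> :: "('g \<Rightarrow> 'l) \<Rightarrow> 'h::complex_hilbert \<Rightarrow> 'h"
    and \<iota> :: "('g \<Rightarrow> 'l) \<Rightarrow> 'a::cstar_algebra"
  assumes representation: "star_representation G L \<pi>"
    and weak_containment: "weakly_contains_regular G L \<pi>"
    and completion: "cstar_completion G L \<pi> \<iota>"
begin

lemma iota_add: "f \<in> Gamma_c G L \<Longrightarrow> h \<in> Gamma_c G L \<Longrightarrow> \<iota> (sec_add G L f h) = \<iota> f + \<iota> h"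
  and iota_scale: "f \<in> Gamma_c G L \<Longrightarrow> \<iota> (sec_scale G L c f) = c *\<^sub>C \<iota> f"
  and iota_conv: "f \<in> Gamma_c G L \<Longrightarrow> h \<in> Gamma_c G L \<Longrightarrow> \<iota> (conv G L f h) = \<iota> f * \<iota> h"
  and iota_star: "f \<in> Gamma_c G L \<Longrightarrow> \<iota> (sec_star G L f) = star (\<iota> f)"
  and norm_iota: "f \<in> Gamma_c G L \<Longrightarrow> norm (\<iota> f) = onorm (\<pi> f)"
  and iota_dense: "closure (\<iota> ` Gamma_c G L) = UNIV"
  using completion unfolding cstar_completion_def by auto

text \<open>Weak containment enters here: the values of a section on the units are controlled by the
  norm of the completion, since they are coefficients of the regular representation.\<close>

lemma cf_unit_le_norm: "f \<in> Gamma_c G L \<Longrightarrow> u \<in> units G \<Longrightarrow> cmod (cf (f u)) \<le> norm (\<iota> f)"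
  using cf_unit_le_regular_norm[of f u] weak_containment norm_iota[of f]
  unfolding weakly_contains_regular_def by fastforce

definition j :: "('g \<Rightarrow> complex) \<Rightarrow> 'a" where
  "j h = \<iota> (emb h)"

lemma j_add: "h \<in> Cc X \<Longrightarrow> k \<in> Cc X \<Longrightarrow> j (\<lambda>x. h x + k x) = j h + j k"
  unfolding j_def by (simp add: iota_add emb_Gamma_c flip: emb_add)

lemma j_scale: "h \<in> Cc X \<Longrightarrow> j (\<lambda>x. c * h x) = c *\<^sub>C j h"
  unfolding j_def by (simp add: iota_scale emb_Gamma_c flip: emb_scale)

lemma j_mult: "h \<in> Cc X \<Longrightarrow> k \<in> Cc X \<Longrightarrow> j h * j k = j (\<lambda>x. h x * k x)"
  unfolding j_def by (simp add: emb_Gamma_c flip: iota_conv emb_mult)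

lemma j_star: "h \<in> Cc X \<Longrightarrow> star (j h) = j (\<lambda>x. cnj (h x))"
  unfolding j_def by (simp add: emb_Gamma_c flip: iota_star emb_star)

lemma j_lact: "h \<in> Cc X \<Longrightarrow> f \<in> Gamma_c G L \<Longrightarrow> j h * \<iota> f = \<iota> (lact h f)"
  unfolding j_def by (simp add: emb_Gamma_c conv_emb_left Gamma_c_sections flip: iota_conv)

lemma j_ract: "h \<in> Cc X \<Longrightarrow> f \<in> Gamma_c G L \<Longrightarrow> \<iota> f * j h = \<iota> (ract h f)"
  unfolding j_def by (simp add: emb_Gamma_c conv_emb_right_Gamma_c flip: iota_conv)

section \<open>Norm estimates for functions on the unit space\<close>

lemma representation_norm_square:
  assumes f: "f \<in> Gamma_c G L"
  shows "complex_of_real ((norm (\<pi> f v))\<^sup>2) = cinner v (\<pi> (conv G L (sec_star G L f) f) v)"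
proof -
  have fs: "sec_star G L f \<in> Gamma_c G L" by (rule sec_star_Gamma_c[OF f])
  note ss = sec_star_sec_star[OF Gamma_c_sections[OF f]]
  have "cinner (\<pi> f v) (\<pi> f v) = cinner (\<pi> (sec_star G L (sec_star G L f)) v) (\<pi> f v)" by (simp add: ss)
  also have "\<dots> = cinner v (\<pi> (sec_star G L f) (\<pi> f v))"
    using representation fs unfolding star_representation_def by blast
  also have "\<pi> (sec_star G L f) (\<pi> f v) = \<pi> (conv G L (sec_star G L f) f) v"
    using representation fs f unfolding star_representation_def by simp
  finally show ?thesis by (simp add: cinner_self)
qed

text \<open>Let \<open>g\<close> be the square root of \<open>k^2 - |h|^2\<close>. Then
  \<open>k^2 = |h|^2 + |g|^2\<close> makes the squared norm of \<open>\<pi> (emb k) v\<close> the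
  sum of those of \<open>\<pi> (emb h) v\<close> and \<open>\<pi> (emb g) v\<close>, for every
  vector \<open>v\<close>.\<close>

lemma norm_j_mono:
  assumes h: "h \<in> Cc X" and k: "k \<in> Cp X" and le: "\<And>x. cmod (h x) \<le> k x"
  shows "norm (j h) \<le> norm (j (\<lambda>x. complex_of_real (k x)))"
proof -
  let ?k = "\<lambda>x. complex_of_real (k x)"
  define g where "g x = complex_of_real (sqrt ((k x)\<^sup>2 - (cmod (h x))\<^sup>2))" for x
  have "continuous_map X euclideanreal (\<lambda>x. sqrt ((k x)\<^sup>2 - (cmod (h x))\<^sup>2))"
  proof (rule continuous_map_compose_continuous_on[of _ _ sqrt])
    have "continuous_map X euclideanreal (\<lambda>x. cmod (h x))"
      by (rule continuous_map_compose_continuous_on[OF Cc_D(1)[OF h]]) (intro continuous_intros)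
    then show "continuous_map X euclideanreal (\<lambda>x. (k x)\<^sup>2 - (cmod (h x))\<^sup>2)"
      using Cp_D(1)[OF k] by (intro continuous_map_diff continuous_map_real_pow)
  qed (intro continuous_intros)
  moreover have "k x = 0 \<Longrightarrow> h x = 0" for x using le[of x] by simp
  ultimately have g: "g \<in> Cc X"
    unfolding g_def[abs_def] Cc_iff using Cp_D(3)[OF k]
    by (auto intro!: continuous_map_of_real intro: csupp_weaken[of X UNIV k])
  have gg: "(\<lambda>x. cnj (g x) * g x) = (\<lambda>x. complex_of_real ((k x)\<^sup>2 - (cmod (h x))\<^sup>2))"
    using le by (auto simp: g_def power_mono simp flip: of_real_mult)
  have hh: "(\<lambda>x. cnj (h x) * h x) = (\<lambda>x. complex_of_real ((cmod (h x))\<^sup>2))"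
    by (auto simp: complex_norm_square mult.commute simp flip: of_real_power)
  have kk: "(\<lambda>x. cnj (?k x) * ?k x) = (\<lambda>x. (cnj (h x) * h x) + (cnj (g x) * g x))"
    unfolding fun_eq_iff
  proof
    fix x
    show "cnj (?k x) * ?k x = (cnj (h x) * h x) + (cnj (g x) * g x)"
      using fun_cong[OF gg, of x] fun_cong[OF hh, of x] by (simp add: power2_eq_square)
  qed
  note kC = Cc_of_real[OF k]
  have cc: "(\<lambda>x. cnj (h x) * h x) \<in> Cc X" if "h \<in> Cc X" for h
    using Cc_mult[OF Cc_cnj[OF that] Cc_D(1)[OF that]] .
  have sq: "complex_of_real ((norm (\<pi> (emb f) v))\<^sup>2) = cinner v (\<pi> (emb (\<lambda>x. cnj (f x) * f x)) v)" if "f \<in> Cc X" for f v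
    using representation_norm_square[OF emb_Gamma_c[OF that]] by (simp add: emb_star emb_mult)
  have le_v: "norm (\<pi> (emb h) v) \<le> norm (\<pi> (emb ?k) v)" for v
  proof -
    have "\<pi> (emb (\<lambda>x. cnj (?k x) * ?k x)) v = \<pi> (emb (\<lambda>x. cnj (h x) * h x)) v + \<pi> (emb (\<lambda>x. cnj (g x) * g x)) v"
      unfolding kk using representation emb_Gamma_c[OF cc[OF h]] emb_Gamma_c[OF cc[OF g]]
      by (simp add: star_representation_def flip: emb_add)
    then have "complex_of_real ((norm (\<pi> (emb ?k) v))\<^sup>2) =
        complex_of_real ((norm (\<pi> (emb h) v))\<^sup>2) + complex_of_real ((norm (\<pi> (emb g) v))\<^sup>2)"
      unfolding sq[OF h] sq[OF g] sq[OF kC] by (simp add: cinner_add_right)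
    then have "(norm (\<pi> (emb ?k) v))\<^sup>2 = (norm (\<pi> (emb h) v))\<^sup>2 + (norm (\<pi> (emb g) v))\<^sup>2"
      unfolding of_real_add[symmetric] of_real_eq_iff .
    then show ?thesis by (simp add: power2_le_imp_le)
  qed
  have bl: "bounded_linear (\<pi> (emb f))" if "f \<in> Cc X" for f
    using representation emb_Gamma_c[OF that] by (auto simp: star_representation_def bounded_clinear_def)
  have "onorm (\<pi> (emb h)) \<le> onorm (\<pi> (emb ?k))"
  proof (rule onorm_bound)
    show "0 \<le> onorm (\<pi> (emb ?k))" by (rule onorm_pos_le[OF bl[OF kC]])
    show "norm (\<pi> (emb h) v) \<le> onorm (\<pi> (emb ?k)) * norm v" for v
      using le_v[of v] onorm[OF bl[OF kC], of v] by simp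
  qed
  then show ?thesis unfolding j_def by (simp add: norm_iota emb_Gamma_c h kC)
qed

definition cutoffs :: "('g \<Rightarrow> complex) set" where
  "cutoffs = {(\<lambda>x. complex_of_real (\<theta> x)) | \<theta>. \<theta> \<in> Cp X \<and> (\<forall>x. \<theta> x \<le> 1)}"

lemma cutoffs_Cc: "cutoffs \<subseteq> Cc X"
  unfolding cutoffs_def using Cc_of_real by blast

text \<open>All powers \<open>e^(2^n)\<close> are dominated by a single \<open>k\<close> that is 1
  on the carrier of \<open>e\<close>, so the iterated squares of \<open>j e\<close> stay bounded and
  \<open>selfadjoint_contraction\<close> applies.\<close>

lemma cutoff_contraction:
  assumes "e \<in> cutoffs"
  shows "norm (j e) \<le> 1"
proof -
  obtain \<theta> where \<theta>: "\<theta> \<in> Cp X" "\<And>x. \<theta> x \<le> 1" "e = (\<lambda>x. complex_of_real (\<theta> x))"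
    using assms unfolding cutoffs_def by blast
  have e: "e \<in> Cc X" using assms cutoffs_Cc by blast
  obtain K where K: "compactin X K" "\<And>x. x \<notin> K \<Longrightarrow> \<theta> x = 0"
    using Cp_D(3)[OF \<theta>(1)] unfolding csupp_def by blast
  obtain k V where k: "k \<in> Cp X" "K \<subseteq> V" "\<forall>x\<in>V. k x = 1"
    using units.bump[OF K(1) openin_topspace compactin_subset_topspace[OF K(1)]] by blast
  have kK: "\<And>x. x \<in> K \<Longrightarrow> k x = 1" using k by blast
  let ?p = "\<lambda>n x. e x ^ (2 ^ n)"
  have p: "?p n \<in> Cc X \<and> ((\<lambda>y. y * y) ^^ n) (j e) = j (?p n)" for n
  proof (induction n)
    case (Suc n)
    have sq: "(\<lambda>x. ?p n x * ?p n x) = ?p (Suc n)" by (simp add: mult_2 power_add)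
    have "?p (Suc n) \<in> Cc X" unfolding sq[symmetric] using Suc Cc_mult Cc_D(1) by blast
    then show ?case using Suc j_mult[of "?p n" "?p n"] unfolding sq by simp
  qed (use e in simp)
  have bound: "norm (((\<lambda>y. y * y) ^^ n) (j e)) \<le> norm (j (\<lambda>x. complex_of_real (k x)))" for n
  proof -
    have "cmod (?p n x) \<le> k x" for x
    proof (cases "x \<in> K")
      case True
      then show ?thesis using kK[OF True] \<theta>(2)[of x] Cp_D(2)[OF \<theta>(1), of x]
        by (simp add: \<theta>(3) norm_power power_le_one)
    next
      case False
      then show ?thesis using K(2)[OF False] Cp_D(2)[OF k(1), of x] by (simp add: \<theta>(3) zero_power)
    qed
    from norm_j_mono[OF conjunct1[OF p] k(1) this] show ?thesis
      unfolding conjunct2[OF p] .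
  qed
  have "star (j e) = j e" unfolding j_star[OF e] by (simp add: \<theta>(3))
  then show ?thesis using bound by (rule selfadjoint_contraction)
qed

lemma ex_cutoff:
  assumes "compactin X K"
  shows "\<exists>e\<in>cutoffs. \<forall>x\<in>K. e x = 1"
proof -
  obtain \<theta> V where "\<theta> \<in> Cp X" "\<forall>x. \<theta> x \<le> 1" "K \<subseteq> V" "\<forall>x\<in>V. \<theta> x = 1"
    using units.bump[OF assms openin_topspace compactin_subset_topspace[OF assms]] by blast
  then show ?thesis unfolding cutoffs_def by (intro bexI[of _ "\<lambda>x. complex_of_real (\<theta> x)"]) auto
qed

lemma ex_local_cutoff:
  assumes "f \<in> Gamma_c G L"
  shows "\<exists>K. compactin X K \<and> (\<forall>e\<in>Cc X. (\<forall>x\<in>K. e x = 1) \<longrightarrow> lact e f = f \<and> ract e f = f \<and> j e * \<iota> f = \<iota> f \<and> \<iota> f * j e = \<iota> f)"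
proof -
  obtain K where K: "compactin X K" "\<And>e. (\<forall>x\<in>K. e x = 1) \<Longrightarrow> lact e f = f \<and> ract e f = f"
    using Gamma_c_local_unit[OF assms] by blast
  then show ?thesis using j_lact[OF _ assms] j_ract[OF _ assms] by (intro exI[of _ K]) auto
qed

lemma j_cutoff:
  assumes h: "h \<in> Cc X"
  shows "\<exists>e\<in>cutoffs. (\<lambda>x. h x * e x) = h"
proof -
  obtain K where K: "compactin X K" "\<And>x. x \<notin> K \<Longrightarrow> h x = 0"
    using Cc_D(2)[OF h] unfolding csupp_def by blast
  obtain e where e: "e \<in> cutoffs" "\<forall>x\<in>K. e x = 1" using ex_cutoff[OF K(1)] by blast
  have "h x * e x = h x" for x using K(2)[of x] e(2) by (cases "x \<in> K") auto
  then show ?thesis using e(1) by blast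
qed

text \<open>If a cutoff \<open>e\<close> acts as an identity on \<open>f\<close>, then
  \<open>\<iota> f = \<iota> f * j e * j e\<close> is itself a generator.\<close>

lemma iota_in_ideal_span:
  assumes f: "f \<in> Gamma_c G L"
  shows "\<iota> f \<in> ideal_span (j ` Cc X)"
proof -
  obtain K where K: "compactin X K" "\<And>e. e\<in>Cc X \<Longrightarrow> (\<forall>x\<in>K. e x = 1) \<Longrightarrow> \<iota> f * j e = \<iota> f"
    using ex_local_cutoff[OF f] by blast
  obtain e where e: "e \<in> Cc X" "\<forall>x\<in>K. e x = 1" using ex_cutoff[OF K(1)] cutoffs_Cc by blast
  have "\<iota> f * j e * j e = \<iota> f" using K(2)[OF e] by simp
  then show ?thesis using ideal_span.ideal_span_gen[of "j e" "j ` Cc X" "\<iota> f" "j e"] e(1) by simp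
qed

lemma pedersen_eq: "pedersen_ideal = ideal_span (j ` Cc X)"
proof (rule pedersen_eq_ideal_span)
  fix f assume "f \<in> j ` Cc X"
  then obtain h where h: "h \<in> Cc X" "f = j h" by blast
  obtain e where "e \<in> cutoffs" "(\<lambda>x. h x * e x) = h" using j_cutoff[OF h(1)] by blast
  then have "j h * j e = j h" using j_mult[OF h(1), of e] cutoffs_Cc by auto
  then show "\<exists>h. f * h = f" using h(2) by blast
next
  have "closure (\<iota> ` Gamma_c G L) \<subseteq> closure (ideal_span (j ` Cc X))"
    using iota_in_ideal_span by (intro closure_mono) auto
  then show "closure (ideal_span (j ` Cc X)) = UNIV" using iota_dense by auto
qed

lemma iota_in_pedersen: "f \<in> Gamma_c G L \<Longrightarrow> \<iota> f \<in> pedersen_ideal"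
  unfolding pedersen_eq by (rule iota_in_ideal_span)

lemma pedersen_star: "x \<in> pedersen_ideal \<Longrightarrow> star x \<in> pedersen_ideal" for x :: 'a
  unfolding pedersen_eq
proof (induction rule: ideal_span.induct)
  case ideal_span_0
  then show ?case by (simp add: star_0 ideal_span.intros)
next
  case (ideal_span_gen f a b)
  then obtain h where h: "h \<in> Cc X" "f = j h" by blast
  then have "star f \<in> j ` Cc X" using j_star Cc_cnj by blast
  then show ?case using ideal_span.ideal_span_gen[of "star f" _ "star b" "star a"] by (simp add: star_mult mult.assoc)
next
  case (ideal_span_add x y)
  then show ?case by (simp add: star_add ideal_span.intros)
qed

text \<open>The approximate unit as a filter: a property holds eventually if it holds for all
  cutoffs that are 1 on some compact set. This avoids choosing a net.\<close>

definition cutoff_filter :: "('g \<Rightarrow> complex) filter" where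
  "cutoff_filter = (INF K\<in>{K. compactin X K}. Filter.principal {e \<in> cutoffs. \<forall>x\<in>K. e x = 1})"

lemma eventually_cutoff_filter:
  "eventually P cutoff_filter \<longleftrightarrow> (\<exists>K. compactin X K \<and> (\<forall>e\<in>cutoffs. (\<forall>x\<in>K. e x = 1) \<longrightarrow> P e))"
  unfolding cutoff_filter_def
proof (subst eventually_INF_base)
  show "{K. compactin X K} \<noteq> {}" by (auto intro: exI[of _ "{}"])
  fix a b assume "a \<in> {K. compactin X K}" "b \<in> {K. compactin X K}"
  then show "\<exists>x\<in>{K. compactin X K}. Filter.principal {e \<in> cutoffs. \<forall>y\<in>x. e y = 1} \<le>
      inf (Filter.principal {e \<in> cutoffs. \<forall>x\<in>a. e x = 1}) (Filter.principal {e \<in> cutoffs. \<forall>x\<in>b. e x = 1})"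
    by (intro bexI[of _ "a \<union> b"]) (auto intro: compactin_Un)
qed (auto simp: eventually_principal)

lemma cutoff_filter_nonbot: "cutoff_filter \<noteq> bot"
  unfolding trivial_limit_def eventually_cutoff_filter using ex_cutoff by blast

lemma eventually_cutoffs: "\<forall>\<^sub>F e in cutoff_filter. e \<in> cutoffs"
  unfolding eventually_cutoff_filter by (auto intro: exI[of _ "{}"])

lemma cutoffs_approximate_unit: "((\<lambda>e. x * j e) \<longlongrightarrow> x) cutoff_filter"
proof (rule tendstoI)
  fix \<epsilon> :: real assume "0 < \<epsilon>"
  then obtain f where f: "f \<in> Gamma_c G L" "dist (\<iota> f) x < \<epsilon> / 2"
    using iota_dense closure_approachable[of x "\<iota> ` Gamma_c G L"] by (auto dest: spec[of _ "\<epsilon>/2"])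
  obtain K where K: "compactin X K" "\<And>e. e\<in>Cc X \<Longrightarrow> (\<forall>x\<in>K. e x = 1) \<Longrightarrow> \<iota> f * j e = \<iota> f"
    using ex_local_cutoff[OF f(1)] by blast
  have "dist (x * j e) x < \<epsilon>" if e: "e \<in> cutoffs" "\<forall>x\<in>K. e x = 1" for e
  proof -
    have "x * j e - x = (x - \<iota> f) * j e + (\<iota> f - x)"
      using K(2)[of e] e cutoffs_Cc by (auto simp: left_diff_distrib)
    also have "norm \<dots> \<le> norm (x - \<iota> f) * norm (j e) + norm (\<iota> f - x)"
      by (intro order_trans[OF norm_triangle_ineq] add_mono norm_mult_ineq) auto
    also have "\<dots> \<le> norm (x - \<iota> f) * 1 + norm (\<iota> f - x)"
      using cutoff_contraction[OF e(1)] by (intro add_mono mult_left_mono) auto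
    also have "\<dots> < \<epsilon>" using f(2) by (simp add: dist_norm norm_minus_commute)
    finally show ?thesis by (simp add: dist_norm)
  qed
  then show "\<forall>\<^sub>F e in cutoff_filter. dist (x * j e) x < \<epsilon>"
    unfolding eventually_cutoff_filter using K(1) by blast
qed

section \<open>From invariant measures to traces\<close>

lemma ex_cutoff_functional:
  assumes M: "radon_borel_measure X M" and N: "radon_borel_measure X N" and e: "e \<in> Cc X"
  shows "\<exists>\<phi>. bounded_cfunctional \<phi> \<and> (\<forall>f\<in>Gamma_c G L. \<phi> (\<iota> f) = tr M N (lact e f))"
proof -
  obtain C where C: "C \<ge> 0" "\<And>f B. f\<in>Gamma_c G L \<Longrightarrow> (\<forall>u\<in>units G. cmod (cf (f u)) \<le> B) \<Longrightarrow> 0 \<le> B \<Longrightarrow> cmod (tr M N (lact e f)) \<le> C * B"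
    using tr_lact_bound[OF M N e] by blast
  have la: "lact e (sec_add G L f h) = sec_add G L (lact e f) (lact e h)" if "f \<in> Gamma_c G L" "h \<in> Gamma_c G L" for f h
    using that by (intro sections_eqI) (auto simp: cf_lact cf_sec_add lact_sections sec_add_sections Gamma_c_sections distrib_left)
  have ls: "lact e (sec_scale G L c f) = sec_scale G L c (lact e f)" if "f \<in> Gamma_c G L" for f c
    using that by (intro sections_eqI) (auto simp: cf_lact cf_sec_scale lact_sections sec_scale_sections Gamma_c_sections)
  note lG = lact_Gamma_c[OF Cc_D(1)[OF e]]
  show ?thesis
  proof (rule dense_functional_extension[OF iota_dense])
    fix f h assume fh: "f \<in> Gamma_c G L" "h \<in> Gamma_c G L"
    show "\<exists>k\<in>Gamma_c G L. \<iota> k = \<iota> f + \<iota> h \<and> tr M N (lact e k) = tr M N (lact e f) + tr M N (lact e h)"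
      using fh by (intro bexI[of _ "sec_add G L f h"]) (auto simp: iota_add la tr_add[OF M N] lG Gamma_c.add)
  next
    fix f c assume f: "f \<in> Gamma_c G L"
    show "\<exists>k\<in>Gamma_c G L. \<iota> k = c *\<^sub>C \<iota> f \<and> tr M N (lact e k) = c * tr M N (lact e f)"
      using f by (intro bexI[of _ "sec_scale G L c f"]) (auto simp: iota_scale ls tr_scale[OF M N] lG Gamma_c.scale)
  next
    fix f assume "f \<in> Gamma_c G L"
    then show "cmod (tr M N (lact e f)) \<le> C * norm (\<iota> f)" using C(2) cf_unit_le_norm by simp
  qed
qed

theorem trace_of_invariant_measure:
  assumes M: "radon_borel_measure X M" and N: "radon_borel_measure X N"
    and eq: "\<And>h. h \<in> Cc X \<Longrightarrow> \<mu> h = (\<integral>x. h x \<partial>M) - (\<integral>x. h x \<partial>N)"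
    and inv: "invariant_radon G \<mu>"
  shows "\<exists>\<tau>. continuous_trace \<tau> \<and> selfadjoint_on_pedersen \<tau> \<and>
    (\<forall>f\<in>Gamma_c G L. \<tau> (\<iota> f) = tr M N f) \<and> (N = null_measure M \<longrightarrow> positive_on_pedersen \<tau>)"
proof -
  define \<phi> where "\<phi> e = (SOME \<phi>. bounded_cfunctional \<phi> \<and> (\<forall>f\<in>Gamma_c G L. \<phi> (\<iota> f) = tr M N (lact e f)))" for e
  have \<phi>: "bounded_cfunctional (\<phi> e)" "\<And>f. f\<in>Gamma_c G L \<Longrightarrow> \<phi> e (\<iota> f) = tr M N (lact e f)" if "e \<in> Cc X" for e
    using someI_ex[OF ex_cutoff_functional[OF M N that]] unfolding \<phi>_def by auto
  have cont: "continuous_on UNIV (\<lambda>y. \<phi> e (u y))" if "e \<in> Cc X" "continuous_on UNIV u" for e and u :: "'a \<Rightarrow> 'a"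
    using continuous_on_compose2[OF bounded_cfunctionalD(5)[OF \<phi>(1)[OF that(1)]] that(2)] by auto
  \<comment> \<open>Known for sections from \<open>tr_swap\<close>, then extended to the whole
    algebra by density, one variable at a time.\<close>
  have swap: "\<phi> e (a * j k * b) = \<phi> k (b * j e * a)" if e: "e \<in> Cc X" and k: "k \<in> Cc X" for e k a b
  proof -
    have 1: "\<phi> e (\<iota> a * j k * \<iota> b) = \<phi> k (\<iota> b * j e * \<iota> a)" if a: "a \<in> Gamma_c G L" and b: "b \<in> Gamma_c G L" for a b
    proof -
      note ea = lact_Gamma_c[OF Cc_D(1)[OF e] a] and kb = lact_Gamma_c[OF Cc_D(1)[OF k] b]
      have "\<iota> a * j k * \<iota> b = \<iota> (conv G L a (lact k b))" "\<iota> b * j e * \<iota> a = \<iota> (conv G L b (lact e a))"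
        using j_lact[OF k b] j_lact[OF e a] iota_conv[OF a kb] iota_conv[OF b ea] by (simp_all add: mult.assoc)
      then show ?thesis
        using tr_swap[OF M N eq inv e k a b] \<phi>(2)[OF e conv_Gamma_c[OF a kb]] \<phi>(2)[OF k conv_Gamma_c[OF b ea]] by simp
    qed
    have 2: "\<phi> e (a * j k * \<iota> b) = \<phi> k (\<iota> b * j e * a)" if b: "b \<in> Gamma_c G L" for a b
      by (rule eq_on_dense[OF iota_dense]) (use 1[OF _ b] in \<open>auto intro!: cont e k continuous_intros\<close>)
    show ?thesis
      by (rule eq_on_dense[OF iota_dense, where f = "\<lambda>b. \<phi> e (a * j k * b)" and g = "\<lambda>b. \<phi> k (b * j e * a)"])
         (use 2 in \<open>auto intro!: cont e k continuous_intros\<close>)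
  qed
  interpret approximate_trace j "Cc X" cutoffs cutoff_filter \<phi>
  proof
    show "cutoff_filter \<noteq> bot" by (rule cutoff_filter_nonbot)
    show "\<forall>\<^sub>F e in cutoff_filter. e \<in> cutoffs" by (rule eventually_cutoffs)
    show "cutoffs \<subseteq> Cc X" by (rule cutoffs_Cc)
    show "pedersen_ideal = ideal_span (j ` Cc X)" by (rule pedersen_eq)
  qed (use \<phi> swap cutoff_contraction cutoffs_approximate_unit in auto)
  \<comment> \<open>On a section the limit is attained: every cutoff that is 1 on the ranges and
    sources of its support gives the same value.\<close>
  have val: "trace_limit (\<iota> f) = tr M N f" if f: "f \<in> Gamma_c G L" for f
  proof (rule trace_limit_eqI)
    obtain K where K: "compactin X K" "\<And>e. e\<in>Cc X \<Longrightarrow> (\<forall>x\<in>K. e x = 1) \<Longrightarrow> lact e f = f"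
      using ex_local_cutoff[OF f] by blast
    then have "\<forall>\<^sub>F e in cutoff_filter. \<phi> e (\<iota> f) = tr M N f"
      unfolding eventually_cutoff_filter using \<phi>(2)[OF _ f] cutoffs_Cc by (intro exI[of _ K]) auto
    then show "((\<lambda>e. \<phi> e (\<iota> f)) \<longlongrightarrow> tr M N f) cutoff_filter" by (rule tendsto_eventually)
  qed
  have sa: "selfadjoint_on_pedersen trace_limit"
  proof (rule selfadjoint_trace_limit[OF _ pedersen_star])
    fix e x assume e: "e \<in> cutoffs"
    then have eC: "e \<in> Cc X" and re: "\<And>x. cnj (e x) = e x" using cutoffs_Cc by (auto simp: cutoffs_def)
    show "\<phi> e (star x) = cnj (\<phi> e x)"
    proof (rule eq_on_dense[OF iota_dense, where f = "\<lambda>x. \<phi> e (star x)" and g = "\<lambda>x. cnj (\<phi> e x)"])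
      show "continuous_on UNIV (\<lambda>x. \<phi> e (star x))" by (intro cont eC continuous_on_star)
      show "continuous_on UNIV (\<lambda>x. cnj (\<phi> e x))"
        by (intro continuous_on_cnj cont eC continuous_intros)
      fix x assume "x \<in> \<iota> ` Gamma_c G L"
      then obtain f where f: "f \<in> Gamma_c G L" "x = \<iota> f" by blast
      note fs = Gamma_c_sections[OF f(1)]
      have "restrict_units G L (lact e (sec_star G L f)) = (\<lambda>x. cnj (restrict_units G L (lact e f) x))"
        by (simp add: restrict_units_lact sec_star_sections fs restrict_units_sec_star re)
      then have "tr M N (lact e (sec_star G L f)) = cnj (tr M N (lact e f))"
        by (simp add: tr_def)
      then show "\<phi> e (star x) = cnj (\<phi> e x)"
        using \<phi>(2)[OF eC f(1)] \<phi>(2)[OF eC sec_star_Gamma_c[OF f(1)]] iota_star[OF f(1)] f(2) by simp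
    qed
  qed
  \<comment> \<open>With the null measure as \<open>N\<close>, the value at
    \<open>star (\<iota> f) * \<iota> f\<close> is the integral over \<open>u\<close> of
    \<open>\<theta> u\<close> times the sum of \<open>|f|^2\<close> over arrows with source
    \<open>u\<close>. This is nonnegative, and closedness passes the sign to all
    \<open>y\<close>.\<close>
  have pos: "positive_on_pedersen trace_limit" if null: "N = null_measure M"
  proof (rule positive_trace_limit)
    fix e y assume e: "e \<in> cutoffs"
    then have eC: "e \<in> Cc X" using cutoffs_Cc by blast
    obtain \<theta> where \<theta>: "\<theta> \<in> Cp X" "e = (\<lambda>x. complex_of_real (\<theta> x))" using e unfolding cutoffs_def by blast
    have "closed {y. \<phi> e (star y * y) \<in> \<real>\<^sub>\<ge>\<^sub>0}"
      using closed_nonneg_Reals_complex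
      by (intro closed_vimage[of _ "\<lambda>y. \<phi> e (star y * y)", unfolded vimage_def] cont eC continuous_intros continuous_on_star)
    moreover have "\<phi> e (star (\<iota> f) * \<iota> f) \<in> \<real>\<^sub>\<ge>\<^sub>0" if f: "f \<in> Gamma_c G L" for f
    proof -
      note fs = Gamma_c_sections[OF f] and sf = sec_star_Gamma_c[OF f]
      note ss = Gamma_c_sections[OF sf]
      define F where "F = restrict_units G L (lact e (conv G L (sec_star G L f) f))"
      have cs: "conv G L (sec_star G L f) f \<in> Gamma_c G L" by (rule conv_Gamma_c[OF sf f])
      have "\<exists>c\<ge>0. F u = complex_of_real c" for u
      proof (cases "u \<in> units G")
        case True
        then have u: "u \<in> arrows G" using units_arrows by auto
        have "cf (conv G L (sec_star G L f) f u) = (\<Sum>k\<in>row (sec_star G L f) (r u). complex_of_real ((cmod (cf (f (ginv G k))))\<^sup>2))"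
          unfolding conv_cf(2)[OF ss fs u Gamma_c_row[OF sf] order_refl row_sub]
        proof (rule sum.cong[OF refl])
          fix k assume "k \<in> row (sec_star G L f) (r u)"
          then have k: "k \<in> arrows G" "r k = u" "ginv G k \<in> arrows G" using rng_unit[OF True] by (auto simp: row_def ginv_closed)
          then have "gmult G (ginv G k) u = ginv G k" using gmult_src[OF k(3)] src_ginv[OF k(1)] by simp
          then show "cf (lmult L (sec_star G L f k) (f (gmult G (ginv G k) u))) = complex_of_real ((cmod (cf (f (ginv G k))))\<^sup>2)"
            using cf_lstar_lmult[OF k(3) sectionsD[OF fs k(3)]] k(1) by (simp add: sec_star_def)
        qed
        also have "\<dots> = complex_of_real (\<Sum>k\<in>row (sec_star G L f) (r u). (cmod (cf (f (ginv G k))))\<^sup>2)" by simp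
        finally have "F u = complex_of_real (\<theta> u * (\<Sum>k\<in>row (sec_star G L f) (r u). (cmod (cf (f (ginv G k))))\<^sup>2))"
          unfolding F_def restrict_units_lact[OF Gamma_c_sections[OF cs]] restrict_units_eq_cf[OF Gamma_c_sections[OF cs]]
          using True by (simp add: \<theta>(2))
        moreover have "0 \<le> \<theta> u * (\<Sum>k\<in>row (sec_star G L f) (r u). (cmod (cf (f (ginv G k))))\<^sup>2)"
          using Cp_D(2)[OF \<theta>(1), of u] by (intro mult_nonneg_nonneg sum_nonneg) auto
        ultimately show ?thesis by blast
      next
        case False
        then show ?thesis unfolding F_def by (intro exI[of _ 0]) (simp add: restrict_units_outside)
      qed
      then obtain c where c: "\<And>u. 0 \<le> c u" "\<And>u. F u = complex_of_real (c u)" by metis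
      have "tr M N (lact e (conv G L (sec_star G L f) f)) = (\<integral>u. F u \<partial>M)"
        unfolding tr_def null F_def by simp
      also have "\<dots> = complex_of_real (\<integral>u. c u \<partial>M)" unfolding c(2) by simp
      also have "\<dots> \<in> \<real>\<^sub>\<ge>\<^sub>0" using c(1) by simp
      finally show ?thesis
        using \<phi>(2)[OF eC cs] iota_conv[OF sf f] iota_star[OF f] by simp
    qed
    then have "closure (\<iota> ` Gamma_c G L) \<subseteq> {y. \<phi> e (star y * y) \<in> \<real>\<^sub>\<ge>\<^sub>0}"
      using \<open>closed _\<close> by (intro closure_minimal) auto
    then show "\<phi> e (star y * y) \<in> \<real>\<^sub>\<ge>\<^sub>0" using iota_dense by auto
  qed
  show ?thesis using continuous_trace_limit sa val pos by blast
qed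

end

section \<open>Uniqueness and restriction of traces\<close>

lemma continuous_traceD:
  assumes "continuous_trace \<tau>"
  shows "x \<in> pedersen_ideal \<Longrightarrow> y \<in> pedersen_ideal \<Longrightarrow> \<tau> (x + y) = \<tau> x + \<tau> y"
    "x \<in> pedersen_ideal \<Longrightarrow> \<tau> (c *\<^sub>C x) = c * \<tau> x"
    "x \<in> pedersen_ideal \<Longrightarrow> y \<in> pedersen_ideal \<Longrightarrow> \<tau> (x * y) = \<tau> (y * x)"
    "cstar_subalgebra D \<Longrightarrow> D \<subseteq> pedersen_ideal \<Longrightarrow> \<exists>C. \<forall>x\<in>D. cmod (\<tau> x) \<le> C * norm x"
  using assms unfolding continuous_trace_def by auto

lemma continuous_trace_0: "continuous_trace \<tau> \<Longrightarrow> (0::'a) \<in> pedersen_ideal \<Longrightarrow> \<tau> (0::'a::cstar_algebra) = 0"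
  using continuous_traceD(2)[of \<tau> 0 0] by (simp add: scaleC_0_left)

lemma Cc_sqrt:
  assumes "\<theta> \<in> Cp X"
  shows "(\<lambda>x. complex_of_real (sqrt (\<theta> x))) \<in> Cc X"
  unfolding Cc_iff
proof
  show "continuous_map X euclidean (\<lambda>x. complex_of_real (sqrt (\<theta> x)))"
    by (intro continuous_map_of_real continuous_map_compose_continuous_on[OF Cp_D(1)[OF assms]] continuous_intros)
  show "csupp X UNIV (\<lambda>x. complex_of_real (sqrt (\<theta> x)))"
    by (rule csupp_weaken[OF Cp_D(3)[OF assms]]) simp
qed

context groupoid_completion begin

lemma pedersen_mult: "(x::'a) \<in> pedersen_ideal \<Longrightarrow> x * a \<in> pedersen_ideal \<and> a * x \<in> pedersen_ideal"
  and pedersen_zero: "(0::'a) \<in> pedersen_ideal"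
  using two_sided_ideal_ideal_span[of "j ` Cc X"] unfolding pedersen_eq two_sided_ideal_def csubspace_def by auto

lemma j_in_pedersen: "h \<in> Cc X \<Longrightarrow> j h \<in> pedersen_ideal"
  unfolding j_def by (intro iota_in_pedersen emb_Gamma_c)

text \<open>The elements on which \<open>j e\<close> acts as an identity. For a cutoff
  \<open>e\<close> they form a C*-subalgebra inside the Pedersen ideal, and there continuity of a
  trace turns into a norm estimate.\<close>

definition corner :: "('g \<Rightarrow> complex) \<Rightarrow> 'a set" where
  "corner e = {x. j e * x = x \<and> x * j e = x}"

lemma corner_cstar_subalgebra:
  assumes e: "e \<in> cutoffs"
  shows "cstar_subalgebra (corner e)" "corner e \<subseteq> pedersen_ideal"
proof -
  have eC: "e \<in> Cc X" using e cutoffs_Cc by blast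
  have se: "star (j e) = j e" using e unfolding j_star[OF eC] by (auto simp: cutoffs_def)
  have "closed {x. j e * x = x}" "closed {x. x * j e = x}"
    by (intro closed_Collect_eq continuous_intros)+
  then have "closed (corner e)" unfolding corner_def by (simp add: closed_Collect_conj)
  moreover have "star x \<in> corner e" if "x \<in> corner e" for x
  proof -
    have "j e * x = x" "x * j e = x" using that by (auto simp: corner_def)
    from this[THEN arg_cong[where f = star]] show ?thesis by (simp add: corner_def star_mult se)
  qed
  moreover have "x * y \<in> corner e" if "x \<in> corner e" "y \<in> corner e" for x y
  proof -
    have "j e * (x * y) = (j e * x) * y" "x * y * j e = x * (y * j e)" by (simp_all only: mult.assoc)
    then show ?thesis using that by (simp add: corner_def)
  qed
  moreover have "csubspace (corner e)"
    unfolding csubspace_def corner_def by (simp add: distrib_left distrib_right mult_scaleC_left mult_scaleC_right)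
  ultimately show "cstar_subalgebra (corner e)"
    unfolding cstar_subalgebra_def by blast
  show "corner e \<subseteq> pedersen_ideal"
    using pedersen_mult[OF j_in_pedersen[OF eC]] unfolding corner_def by (metis (mono_tags, lifting) mem_Collect_eq subsetI)
qed

theorem continuous_trace_unique:
  assumes \<tau>: "continuous_trace \<tau>" and \<tau>': "continuous_trace \<tau>'"
    and eq: "\<And>f. f \<in> Gamma_c G L \<Longrightarrow> \<tau> (\<iota> f) = \<tau>' (\<iota> f)" and x: "x \<in> pedersen_ideal"
  shows "\<tau> x = \<tau>' x"
  using x unfolding pedersen_eq
proof induction
  case ideal_span_0
  then show ?case using continuous_trace_0[OF \<tau>] continuous_trace_0[OF \<tau>'] pedersen_zero by simp
next
  case (ideal_span_add x y)
  then show ?case using continuous_traceD(1)[OF \<tau>] continuous_traceD(1)[OF \<tau>'] by (simp flip: pedersen_eq)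
next
  case (ideal_span_gen f a b)
  then obtain h where h: "h \<in> Cc X" "f = j h" by blast
  \<comment> \<open>A chain of cutoffs: \<open>k\<close> is an identity for \<open>h\<close> and
    \<open>e\<close> one for \<open>k\<close>, so everything of the form
    \<open>j h * y * j k\<close> lies in the corner of \<open>e\<close>.\<close>
  obtain k where k: "k \<in> cutoffs" "(\<lambda>x. h x * k x) = h" using j_cutoff[OF h(1)] by blast
  have kC: "k \<in> Cc X" using k(1) cutoffs_Cc by blast
  obtain e where e: "e \<in> cutoffs" "(\<lambda>x. k x * e x) = k" using j_cutoff[OF kC] by blast
  have eC: "e \<in> Cc X" using e(1) cutoffs_Cc by blast
  have ke: "j k * j e = j k" using j_mult[OF kC eC] e(2) by simp
  have hk: "j k * j h = j h" using j_mult[OF kC h(1)] k(2) by (simp add: mult.commute)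
  have "e x * h x = h x" for x using fun_cong[OF k(2), of x] fun_cong[OF e(2), of x] by (metis mult.assoc mult.commute)
  then have "(\<lambda>x. e x * h x) = h" by blast
  then have eh: "j e * j h = j h" using j_mult[OF eC h(1)] by simp
  have in_corner: "j h * y * j k \<in> corner e" for y
  proof -
    have "j e * (j h * y * j k) = (j e * j h) * y * j k" "(j h * y * j k) * j e = j h * y * (j k * j e)"
      by (simp_all only: mult.assoc)
    then show ?thesis by (simp add: corner_def eh ke)
  qed
  note corner = corner_cstar_subalgebra[OF e(1)]
  have cont: "continuous_on UNIV (\<lambda>y. \<sigma> (j h * y * j k))" if \<sigma>: "continuous_trace \<sigma>" for \<sigma>
  proof -
    obtain C where C: "\<And>x. x \<in> corner e \<Longrightarrow> cmod (\<sigma> x) \<le> C * norm x"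
      using continuous_traceD(4)[OF \<sigma> corner] by blast
    have ped: "j h * y * j k \<in> pedersen_ideal" for y using in_corner corner(2) by blast
    have "bounded_cfunctional (\<lambda>y. \<sigma> (j h * y * j k))"
      unfolding bounded_cfunctional_def
    proof (intro conjI allI exI[of _ "\<bar>C\<bar> * (norm (j h) * norm (j k))"])
      fix y z c
      show "\<sigma> (j h * (y + z) * j k) = \<sigma> (j h * y * j k) + \<sigma> (j h * z * j k)"
        using continuous_traceD(1)[OF \<sigma> ped ped] by (simp add: distrib_left distrib_right)
      show "\<sigma> (j h * (c *\<^sub>C y) * j k) = c * \<sigma> (j h * y * j k)"
        using continuous_traceD(2)[OF \<sigma> ped] by (simp add: mult_scaleC_left mult_scaleC_right)
      have "cmod (\<sigma> (j h * y * j k)) \<le> C * norm (j h * y * j k)" by (rule C[OF in_corner])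
      also have "\<dots> \<le> \<bar>C\<bar> * norm (j h * y * j k)" by (intro mult_right_mono) auto
      also have "\<dots> \<le> \<bar>C\<bar> * (norm (j h) * norm y * norm (j k))"
        by (intro mult_left_mono order_trans[OF norm_mult_ineq] mult_right_mono norm_mult_ineq) auto
      finally show "cmod (\<sigma> (j h * y * j k)) \<le> \<bar>C\<bar> * (norm (j h) * norm (j k)) * norm y"
        by (simp add: mult.commute mult.left_commute)
    qed
    then show ?thesis by (rule bounded_cfunctionalD(5))
  qed
  \<comment> \<open>Cyclic rotation: \<open>j h\<close> is written as \<open>j k * j h\<close>, so
    that both factors \<open>a * j k\<close> and \<open>j h * b\<close> lie in the Pedersen ideal,
    where the trace property is available.\<close>
  have red: "\<sigma> (a * f * b) = \<sigma> (j h * (b * a) * j k)" if \<sigma>: "continuous_trace \<sigma>" for \<sigma>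
  proof -
    have "(a * j k) * (j h * b) = a * (j k * j h) * b" by (simp only: mult.assoc)
    then have "a * f * b = (a * j k) * (j h * b)" unfolding h(2) hk by (rule sym)
    moreover have "a * j k \<in> pedersen_ideal" "j h * b \<in> pedersen_ideal"
      using pedersen_mult j_in_pedersen kC h(1) by blast+
    ultimately have "\<sigma> (a * f * b) = \<sigma> ((j h * b) * (a * j k))" using continuous_traceD(3)[OF \<sigma>] by simp
    also have "(j h * b) * (a * j k) = j h * (b * a) * j k" by (simp only: mult.assoc)
    finally show ?thesis .
  qed
  have "\<tau> (j h * y * j k) = \<tau>' (j h * y * j k)" for y
  proof (rule eq_on_dense[OF iota_dense cont[OF \<tau>] cont[OF \<tau>']])
    fix y assume "y \<in> \<iota> ` Gamma_c G L"
    then obtain g where g: "g \<in> Gamma_c G L" "y = \<iota> g" by blast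
    have "j h * y * j k = \<iota> (ract k (lact h g))"
      using g j_lact[OF h(1) g(1)] j_ract[OF kC lact_Gamma_c[OF Cc_D(1)[OF h(1)] g(1)]] by simp
    then show "\<tau> (j h * y * j k) = \<tau>' (j h * y * j k)"
      using eq ract_Gamma_c[OF lact_Gamma_c[OF Cc_D(1)[OF h(1)] g(1)] kC] by simp
  qed
  then show ?case using red[OF \<tau>] red[OF \<tau>'] by simp
qed

text \<open>\<open>has_radon_integral\<close> may use a different pair of measures for each section.
  Since the value does not depend on the pair, a single decomposition serves all sections.\<close>

lemma trace_induced_by_iff:
  assumes M: "radon_borel_measure X M" and N: "radon_borel_measure X N"
    and eq: "\<And>h. h \<in> Cc X \<Longrightarrow> \<mu> h = (\<integral>x. h x \<partial>M) - (\<integral>x. h x \<partial>N)"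
  shows "trace_induced_by G L \<iota> \<mu> \<tau> \<longleftrightarrow> (\<forall>f\<in>Gamma_c G L. \<tau> (\<iota> f) = tr M N f)"
proof
  assume t: "trace_induced_by G L \<iota> \<mu> \<tau>"
  show "\<forall>f\<in>Gamma_c G L. \<tau> (\<iota> f) = tr M N f"
  proof
    fix f assume f: "f \<in> Gamma_c G L"
    then obtain M' N' where M': "radon_borel_measure X M'" and N': "radon_borel_measure X N'"
        and eq': "\<And>h. h \<in> Cc X \<Longrightarrow> \<mu> h = (\<integral>x. h x \<partial>M') - (\<integral>x. h x \<partial>N')"
        and v: "\<tau> (\<iota> f) = tr M' N' f"
      using t unfolding trace_induced_by_def has_radon_integral_def tr_def by blast
    show "\<tau> (\<iota> f) = tr M N f"
      unfolding v using eq eq' by (intro tr_independent[OF M' N' M N _ f]) metis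
  qed
next
  assume "\<forall>f\<in>Gamma_c G L. \<tau> (\<iota> f) = tr M N f"
  then show "trace_induced_by G L \<iota> \<mu> \<tau>"
    unfolding trace_induced_by_def has_radon_integral_def
    using M N eq restrict_units_integrable[OF M] restrict_units_integrable[OF N]
    by (intro ballI exI[of _ M] exI[of _ N]) (auto simp: tr_def)
qed

lemma trace_exists_unique:
  assumes M: "radon_borel_measure X M" and N: "radon_borel_measure X N"
    and eq: "\<And>h. h \<in> Cc X \<Longrightarrow> \<mu> h = (\<integral>x. h x \<partial>M) - (\<integral>x. h x \<partial>N)"
    and inv: "invariant_radon G \<mu>"
  shows "\<exists>\<tau>. continuous_trace \<tau> \<and> selfadjoint_on_pedersen \<tau> \<and> (N = null_measure M \<longrightarrow> positive_on_pedersen \<tau>) \<and>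
    trace_induced_by G L \<iota> \<mu> \<tau> \<and>
    (\<forall>\<tau>'. continuous_trace \<tau>' \<and> trace_induced_by G L \<iota> \<mu> \<tau>' \<longrightarrow> (\<forall>x\<in>pedersen_ideal. \<tau>' x = \<tau> x))"
proof -
  obtain \<tau> where \<tau>: "continuous_trace \<tau>" "selfadjoint_on_pedersen \<tau>" "N = null_measure M \<longrightarrow> positive_on_pedersen \<tau>"
      "\<And>f. f\<in>Gamma_c G L \<Longrightarrow> \<tau> (\<iota> f) = tr M N f"
    using trace_of_invariant_measure[OF M N eq inv] by blast
  have "\<tau>' x = \<tau> x" if t: "continuous_trace \<tau>'" "trace_induced_by G L \<iota> \<mu> \<tau>'" "x \<in> pedersen_ideal" for \<tau>' x
  proof (rule continuous_trace_unique[OF t(1) \<tau>(1) _ t(3)])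
    show "\<tau>' (\<iota> f) = \<tau> (\<iota> f)" if "f \<in> Gamma_c G L" for f
      using t(2) \<tau>(4) that by (simp add: trace_induced_by_iff[OF M N eq])
  qed
  moreover have "trace_induced_by G L \<iota> \<mu> \<tau>" using \<tau>(4) by (simp add: trace_induced_by_iff[OF M N eq])
  ultimately show ?thesis using \<tau>(1-3) by blast
qed

theorem real_trace_exists_unique:
  assumes \<mu>: "real_radon X \<mu>" and inv: "invariant_radon G \<mu>"
  shows "\<exists>\<tau>. continuous_trace \<tau> \<and> selfadjoint_on_pedersen \<tau> \<and> trace_induced_by G L \<iota> \<mu> \<tau> \<and>
    (\<forall>\<tau>'. continuous_trace \<tau>' \<and> trace_induced_by G L \<iota> \<mu> \<tau>' \<longrightarrow> (\<forall>x\<in>pedersen_ideal. \<tau>' x = \<tau> x))"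
proof -
  obtain M N where M: "radon_borel_measure X M" and N: "radon_borel_measure X N"
      and eq: "\<And>h. h \<in> Cc X \<Longrightarrow> \<mu> h = (\<integral>x. h x \<partial>M) - (\<integral>x. h x \<partial>N)"
    using units.real_radon_representation[OF \<mu>] by blast
  from trace_exists_unique[OF M N eq inv] show ?thesis by blast
qed

theorem positive_trace_exists_unique:
  assumes \<mu>: "positive_radon X \<mu>" and inv: "invariant_radon G \<mu>"
  shows "\<exists>\<tau>. continuous_trace \<tau> \<and> positive_on_pedersen \<tau> \<and> trace_induced_by G L \<iota> \<mu> \<tau> \<and>
    (\<forall>\<tau>'. continuous_trace \<tau>' \<and> trace_induced_by G L \<iota> \<mu> \<tau>' \<longrightarrow> (\<forall>x\<in>pedersen_ideal. \<tau>' x = \<tau> x))"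
proof -
  obtain M where M: "radon_borel_measure X M"
      and eq: "\<And>h. h \<in> Cc X \<Longrightarrow> \<mu> h = (\<integral>x. h x \<partial>M) - (\<integral>x. h x \<partial>null_measure M)"
    using units.positive_radon_representation[OF \<mu>] by blast
  from trace_exists_unique[OF M units.radon_null_measure[OF M] eq inv] show ?thesis by blast
qed

section \<open>The functional that a trace induces on the unit space\<close>

definition restricted_functional :: "('a \<Rightarrow> complex) \<Rightarrow> ('g \<Rightarrow> complex) \<Rightarrow> complex" where
  "restricted_functional \<tau> h = \<tau> (j h)"

context fixes \<tau> :: "'a \<Rightarrow> complex" assumes \<tau>: "continuous_trace \<tau>" begin

lemma restricted_functional_linear: "Cc_linear X (restricted_functional \<tau>)"
  unfolding Cc_linear_def restricted_functional_def
  using continuous_traceD(1)[OF \<tau>] continuous_traceD(2)[OF \<tau>] by (simp add: j_add j_scale j_in_pedersen)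

text \<open>Functions carried by \<open>K\<close> land in the corner of one cutoff that is 1 on
  \<open>K\<close>, where \<open>\<tau>\<close> is bounded; comparing \<open>f\<close> with
  \<open>S * \<theta>\<close>, for \<open>S\<close> the supremum of \<open>|f|\<close>, bounds the
  norm of \<open>j f\<close> by \<open>S\<close>.\<close>

lemma restricted_functional_bound:
  assumes K: "compactin X K"
  shows "\<exists>C. \<forall>f\<in>Cc X. (\<forall>x. x \<notin> K \<longrightarrow> f x = 0) \<longrightarrow> cmod (restricted_functional \<tau> f) \<le> C * (SUP x. cmod (f x))"
proof -
  obtain \<theta> V where \<theta>: "\<theta> \<in> Cp X" "\<forall>x. \<theta> x \<le> 1" "K \<subseteq> V" "\<forall>x\<in>V. \<theta> x = 1"
    using units.bump[OF K openin_topspace compactin_subset_topspace[OF K]] by blast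
  let ?e = "\<lambda>x. complex_of_real (\<theta> x)"
  have e: "?e \<in> cutoffs" using \<theta> unfolding cutoffs_def by blast
  have eC: "?e \<in> Cc X" using e cutoffs_Cc by blast
  obtain C where C: "\<And>x. x \<in> corner ?e \<Longrightarrow> cmod (\<tau> x) \<le> C * norm x"
    using continuous_traceD(4)[OF \<tau> corner_cstar_subalgebra[OF e]] by blast
  have "cmod (restricted_functional \<tau> f) \<le> \<bar>C\<bar> * (SUP x. cmod (f x))"
    if f: "f \<in> Cc X" "\<forall>x. x \<notin> K \<longrightarrow> f x = 0" for f
  proof -
    have "?e x * f x = f x" for x using f(2) \<theta>(3,4) by (cases "x \<in> K") auto
    then have "(\<lambda>x. ?e x * f x) = f" by blast
    moreover from this have "(\<lambda>x. f x * ?e x) = f" by (simp only: mult.commute)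
    ultimately have "j ?e * j f = j f" "j f * j ?e = j f"
      using j_mult[OF eC f(1)] j_mult[OF f(1) eC] by simp_all
    then have "j f \<in> corner ?e" by (simp add: corner_def)
    then have "cmod (\<tau> (j f)) \<le> C * norm (j f)" by (rule C)
    also have "\<dots> \<le> \<bar>C\<bar> * norm (j f)" by (intro mult_right_mono) auto
    also have "\<dots> \<le> \<bar>C\<bar> * (SUP x. cmod (f x))"
    proof (rule mult_left_mono)
      let ?S = "SUP x. cmod (f x)"
      obtain c where "\<And>x. cmod (f x) \<le> c" using bounded_csupp[OF Cc_D[OF f(1)]] by blast
      then have "bdd_above (range (\<lambda>x. cmod (f x)))" by (intro bdd_aboveI2)
      then have up: "cmod (f x) \<le> ?S" for x by (rule cSUP_upper[OF UNIV_I])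
      have S0: "0 \<le> ?S" using order_trans[OF norm_ge_zero up] .
      have "norm (j f) \<le> norm (j (\<lambda>x. complex_of_real (?S * \<theta> x)))"
      proof (rule norm_j_mono[OF f(1) Cp_scale[OF \<theta>(1) S0]])
        show "cmod (f x) \<le> ?S * \<theta> x" for x
          using up[of x] f(2) \<theta>(3,4) S0 Cp_D(2)[OF \<theta>(1), of x] by (cases "x \<in> K") auto
      qed
      also have "j (\<lambda>x. complex_of_real (?S * \<theta> x)) = complex_of_real ?S *\<^sub>C j ?e"
        unfolding j_scale[OF eC, symmetric] by simp
      also have "norm \<dots> \<le> ?S * 1"
        unfolding norm_scaleC using S0 cutoff_contraction[OF e] by (intro mult_mono) auto
      finally show "norm (j f) \<le> (SUP x. cmod (f x))" by simp
    qed simp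
    finally show ?thesis unfolding restricted_functional_def .
  qed
  then show ?thesis by blast
qed

lemma restricted_functional_positive:
  assumes pos: "positive_on_pedersen \<tau>" and \<theta>: "\<theta> \<in> Cp X"
  shows "restricted_functional \<tau> (\<lambda>x. complex_of_real (\<theta> x)) \<in> \<real>\<^sub>\<ge>\<^sub>0"
proof -
  let ?g = "\<lambda>x. complex_of_real (sqrt (\<theta> x))"
  have g: "?g \<in> Cc X" by (rule Cc_sqrt[OF \<theta>])
  have "star (j ?g) * j ?g = j (\<lambda>x. complex_of_real (\<theta> x))"
    using j_star[OF g] j_mult[OF g g] Cp_D(2)[OF \<theta>] by (simp flip: of_real_mult)
  then have "j (\<lambda>x. complex_of_real (\<theta> x)) \<in> positive_elements" unfolding positive_elements_def by (metis (mono_tags, lifting) mem_Collect_eq)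
  then show ?thesis
    using pos j_in_pedersen[OF Cc_of_real[OF \<theta>]] unfolding positive_on_pedersen_def restricted_functional_def by blast
qed

lemma restricted_functional_real:
  assumes "selfadjoint_on_pedersen \<tau>"
  shows "real_radon X (restricted_functional \<tau>)"
  unfolding real_radon_def
proof (intro conjI allI impI restricted_functional_bound)
  show "\<forall>f\<in>Cc X. restricted_functional \<tau> (\<lambda>x. cnj (f x)) = cnj (restricted_functional \<tau> f)"
    unfolding restricted_functional_def using assms j_in_pedersen
    by (auto simp: selfadjoint_on_pedersen_def simp flip: j_star)
qed (use restricted_functional_linear in \<open>auto simp: Cc_linear_def\<close>)

text \<open>A positive trace is not assumed self-adjoint. Its functional takes real values on
  \<open>Cp X\<close>, so it agrees there, and by linearity on all of \<open>Cc X\<close>, with its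
  conjugate.\<close>

lemma restricted_functional_positive_radon:
  assumes pos: "positive_on_pedersen \<tau>"
  shows "positive_radon X (restricted_functional \<tau>)"
proof -
  let ?m = "restricted_functional \<tau>"
  have lin: "Cc_linear X (\<lambda>h. cnj (?m (\<lambda>x. cnj (h x))))"
    using restricted_functional_linear by (simp add: Cc_linear_def Cc_cnj)
  have cnj: "cnj (?m (\<lambda>x. cnj (h x))) = ?m h" if "h \<in> Cc X" for h
  proof (rule Cc_linear_eq[OF lin restricted_functional_linear _ that])
    fix f assume "f \<in> Cp X"
    from restricted_functional_positive[OF pos this]
    show "cnj (?m (\<lambda>x. cnj (complex_of_real (f x)))) = ?m (\<lambda>x. complex_of_real (f x))"
      by (auto elim!: nonneg_Reals_cases)
  qed
  have "real_radon X ?m"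
    unfolding real_radon_def
  proof (intro conjI allI impI restricted_functional_bound)
    show "\<forall>f\<in>Cc X. ?m (\<lambda>x. cnj (f x)) = cnj (?m f)" using cnj by (metis complex_cnj_cnj)
  qed (use restricted_functional_linear in \<open>auto simp: Cc_linear_def\<close>)
  moreover have "?m f \<in> \<real>\<^sub>\<ge>\<^sub>0" if f: "f \<in> Cc X" "\<forall>x. f x \<in> \<real>\<^sub>\<ge>\<^sub>0" for f
  proof -
    have re: "f x = complex_of_real (Re (f x))" "0 \<le> Re (f x)" for x
      using f(2)[rule_format, of x] by (auto elim!: nonneg_Reals_cases)
    have "continuous_map X euclideanreal (\<lambda>x. Re (f x))"
      by (rule continuous_map_compose_continuous_on[OF Cc_D(1)[OF f(1)]]) (intro continuous_intros)
    then have "(\<lambda>x. Re (f x)) \<in> Cp X"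
      using re(2) csupp_weaken[OF Cc_D(2)[OF f(1)], of "\<lambda>x. Re (f x)"] by (simp add: Cp_def)
    from restricted_functional_positive[OF pos this] show ?thesis using re(1) by simp
  qed
  ultimately show ?thesis by (simp add: positive_radon_def)
qed

end

end

section \<open>Principal groupoids\<close>

context twisted_etale_groupoid begin

lemma cmod_cf_lstar: "g \<in> arrows G \<Longrightarrow> a \<in> Fb g \<Longrightarrow> cmod (cf (lstar L a)) = cmod (cf a)"
  using lnorm_lstar[of g a] lnorm_cf[of g a] lnorm_cf[of "ginv G g" "lstar L a"] by (simp add: ginv_closed lstar_closed)

text \<open>The product of a section on a bisection with its adjoint lives on the units: a nonzero
  value elsewhere would force two different arrows of \<open>V\<close> with the same source. The
  result is \<open>|n|^2\<close> seen from the ranges.\<close>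

lemma conv_sec_star_right:
  assumes V: "open_bisection G V" and n: "n \<in> Gamma_c_on G L V"
  shows "conv G L n (sec_star G L n) =
    emb (\<lambda>u. if u \<in> r ` V then complex_of_real ((cmod (cf (n (inv_into V r u))))\<^sup>2) else 0)"
proof (rule sections_eqI)
  note v = open_bisectionD[OF V] and ns = Gamma_c_onD(1)[OF n]
  note ss = sec_star_sections[OF ns]
  show "conv G L n (sec_star G L n) \<in> sections G L"
    using conv_sections[OF ns ss] Gamma_c_row Gamma_c.base[OF V n] by blast
  fix g assume g: "g \<in> arrows G"
  let ?a = "inv_into V r (r g)"
  have c: "conv G L n (sec_star G L n) g = (if r g \<in> r ` V then lmult L (n ?a) (sec_star G L n (gmult G (ginv G ?a) g)) else lzero L g)"
    by (rule conv_bisection[OF ns ss g V]) (rule Gamma_c_on_zero_outside[OF n])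
  show "cf (conv G L n (sec_star G L n) g) =
      cf (emb (\<lambda>u. if u \<in> r ` V then complex_of_real ((cmod (cf (n (inv_into V r u))))\<^sup>2) else 0) g)"
  proof (cases "r g \<in> r ` V")
    case True
    have a: "?a \<in> V" "r ?a = r g" using True by (auto intro: inv_into_into f_inv_into_f)
    then have aG: "?a \<in> arrows G" using v by auto
    let ?k = "gmult G (ginv G ?a) g"
    have k: "?k \<in> arrows G" "s ?a = r ?k" "gmult G ?a ?k = g"
      using aG a g by (auto simp: gmult_closed ginv_closed src_ginv rng_gmult rng_ginv gmult_inv_left)
    show ?thesis
    proof (cases "g \<in> units G")
      case unit: True
      have "?k = ginv G ?a" using gmult_src[OF ginv_closed[OF aG]] src_ginv[OF aG] a(2) rng_unit[OF unit] by simp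
      then have "conv G L n (sec_star G L n) g = lmult L (lstar L (lstar L (n ?a))) (lstar L (n ?a))"
        using c True aG lstar_lstar[OF aG sectionsD[OF ns aG]] by (simp add: sec_star_def ginv_closed ginv_ginv)
      then show ?thesis
        using cf_lstar_lmult[OF ginv_closed[OF aG] lstar_closed[OF aG sectionsD[OF ns aG]]] True unit g
          cmod_cf_lstar[OF aG sectionsD[OF ns aG]] by (simp add: cf_emb rng_unit)
    next
      case False
      have "ginv G ?k \<notin> V"
      proof
        assume "ginv G ?k \<in> V"
        moreover have "s (ginv G ?k) = s ?a" using k by (simp add: src_ginv)
        ultimately have "ginv G ?k = ?a" using a(1) inj_onD[OF v(3)] by blast
        then have "?k = ginv G ?a" using ginv_ginv[OF k(1)] by simp
        then have "g = r ?a" using k(3) gmult_ginv_right[OF aG] by simp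
        then show False using False rng_in_units[OF aG] by simp
      qed
      then have "n (ginv G ?k) = lzero L (ginv G ?k)"
        using Gamma_c_on_zero_outside[OF n] k(1) ginv_closed by blast
      then have "sec_star G L n ?k = lzero L ?k" using lstar_lzero[OF ginv_closed[OF k(1)]] k(1) by (simp add: sec_star_def ginv_ginv)
      then have "conv G L n (sec_star G L n) g = lzero L g"
        using c True lmult_lzero(1)[OF aG k(1,2) sectionsD[OF ns aG]] k(3) by simp
      then show ?thesis using False g by (simp add: cf_lzero cf_emb)
    qed
  next
    case False
    then show ?thesis using c g by (auto simp: cf_emb cf_lzero rng_unit)
  qed
qed (rule emb_sections)

text \<open>The adjoint is a section on the inverse bisection, whose ranges are the sources of
  \<open>V\<close>, so the formula for the other order applies.\<close>

lemma conv_sec_star_left: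
  assumes V: "open_bisection G V" and n: "n \<in> Gamma_c_on G L V"
  shows "conv G L (sec_star G L n) n =
    emb (\<lambda>u. if u \<in> s ` V then complex_of_real ((cmod (cf (n (inv_into V s u))))\<^sup>2) else 0)"
proof -
  note v = open_bisectionD[OF V] and ns = Gamma_c_onD(1)[OF n]
  note V' = open_bisection_ginv[OF V] and n' = sec_star_Gamma_c_on[OF V n]
  have rs: "r ` ginv G ` V = s ` V" using src_image_eq[OF v(4)] by simp
  have "cmod (cf (sec_star G L n (inv_into (ginv G ` V) r u))) = cmod (cf (n (inv_into V s u)))" if u: "u \<in> s ` V" for u
  proof -
    have a: "inv_into V s u \<in> V" "s (inv_into V s u) = u" using u by (auto intro: inv_into_into f_inv_into_f)
    then have aG: "inv_into V s u \<in> arrows G" using v by auto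
    have "inv_into (ginv G ` V) r (r (ginv G (inv_into V s u))) = ginv G (inv_into V s u)"
      using a(1) by (intro inv_into_f_f open_bisectionD(2)[OF V']) auto
    then have "inv_into (ginv G ` V) r u = ginv G (inv_into V s u)" using a(2) rng_ginv[OF aG] by simp
    then show ?thesis
      using aG cmod_cf_lstar[OF aG sectionsD[OF ns aG]] by (simp add: sec_star_def ginv_closed ginv_ginv)
  qed
  then have "(\<lambda>u. if u \<in> s ` V then complex_of_real ((cmod (cf (sec_star G L n (inv_into (ginv G ` V) r u))))\<^sup>2) else 0) =
      (\<lambda>u. if u \<in> s ` V then complex_of_real ((cmod (cf (n (inv_into V s u))))\<^sup>2) else 0)"
    by (auto simp: fun_eq_iff)
  then show ?thesis
    using conv_sec_star_right[OF V' n'] unfolding sec_star_sec_star[OF ns] rs by simp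
qed

text \<open>A substitute for a partial isometry on \<open>V\<close>: it has modulus one over the
  region where \<open>\<theta>\<close> is 1. It rescales a given continuous section of norm one,
  which is why \<open>V\<close> is taken small in applications.\<close>

lemma ex_isometric_section:
  assumes V: "open_bisection G V"
    and e: "continuous_map (subtopology T V) (total L) e" "\<And>k. k \<in> V \<Longrightarrow> e k \<in> Fb k" "\<And>k. k \<in> V \<Longrightarrow> lnorm L (e k) = 1"
    and \<theta>: "\<theta> \<in> Cp X" "csupp X (r ` V) \<theta>"
  shows "\<exists>n\<in>Gamma_c_on G L V. \<forall>g\<in>V. cmod (cf (n g)) = \<theta> (r g)"
proof -
  note v = open_bisectionD[OF V]
  obtain K where K: "compactin X K" "K \<subseteq> r ` V" "\<And>x. x \<notin> K \<Longrightarrow> \<theta> x = 0" using \<theta>(2) unfolding csupp_def by blast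
  define n where "n = (\<lambda>g\<in>arrows G. if g \<in> V then lscale L (complex_of_real (\<theta> (r g))) (e g) else lzero L g)"
  have ns: "n \<in> sections G L" unfolding n_def by (rule sections_restrict) (auto simp: lscale_fibre e lzero_fibre)
  have "n \<in> Gamma_c_on G L V"
    unfolding Gamma_c_on_def
  proof (intro CollectI conjI ns)
    have "continuous_map T euclideanreal (\<lambda>g. \<theta> (r g))"
      using continuous_map_compose[OF continuous_rng Cp_D(1)[OF \<theta>(1)]] by (simp add: o_def)
    then have "continuous_map (subtopology T V) euclideanreal (\<lambda>g. \<theta> (r g))" by (rule continuous_map_from_subtopology)
    from continuous_map_lscale[OF continuous_map_of_real[OF this] e(1)]
    show "continuous_map (subtopology T V) (total L) n"
      by (rule continuous_map_extensional) (simp add: n_def)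
    have "compactin (subtopology X (r ` V)) K" using K by (simp add: compactin_subtopology)
    then have "compactin (subtopology T V) (inv_into V r ` K)" using continuous_inv_rng[OF V] by (rule image_compactin)
    moreover have "n g = lzero L g" if g: "g \<in> arrows G - inv_into V r ` K" for g
    proof (cases "g \<in> V")
      case True
      then have "g = inv_into V r (r g)" using v(2) by (simp add: inv_into_f_f)
      then have "r g \<notin> K" using g by blast
      then show ?thesis using K(3) g True lscale_0[OF _ e(2)[OF True]] by (simp add: n_def)
    qed (use g in \<open>simp add: n_def\<close>)
    ultimately show "\<exists>K\<subseteq>V. compactin T K \<and> (\<forall>g\<in>arrows G - K. n g = lzero L g)"
      by (intro exI[of _ "inv_into V r ` K"]) (auto simp: compactin_subtopology)
  qed
  moreover have "cmod (cf (n g)) = \<theta> (r g)" if g: "g \<in> V" for g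
  proof -
    have gG: "g \<in> arrows G" using g v by auto
    have "n g = lscale L (complex_of_real (\<theta> (r g))) (e g)" using g gG by (simp add: n_def)
    then show ?thesis
      using cf_lscale[OF gG e(2)[OF g]] lnorm_cf[OF gG e(2)[OF g]] e(3)[OF g] Cp_D(2)[OF \<theta>(1), of "r g"] by (simp add: norm_mult)
  qed
  ultimately show ?thesis by blast
qed

lemma principal_unitI:
  assumes "Defs.principal G" "g \<in> arrows G" "r g = s g"
  shows "g \<in> units G"
proof -
  have "(r g, s g) = (r (r g), s (r g))" using rng_rng[OF assms(2)] src_rng[OF assms(2)] assms(3) by simp
  then have "g = r g"
    using inj_onD[OF assms(1)[unfolded Defs.principal_def], of g "r g"] assms(2) rng_closed[OF assms(2)] by simp
  then show ?thesis using assms(2) by (simp add: units_iff)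
qed

text \<open>Principality makes the units the coincidence set of \<open>r\<close> and
  \<open>s\<close>, two continuous maps into a Hausdorff space.\<close>

lemma principal_closed_units:
  assumes "Defs.principal G"
  shows "closedin T (units G)"
proof -
  have "units G = {g \<in> topspace T. r g = s g}"
    using principal_unitI[OF assms] units_arrows by (auto simp: rng_unit src_unit)
  then show ?thesis
    using closedin_continuous_maps_eq[OF Hausdorff_unit_space continuous_rng continuous_src] by simp
qed

end

section \<open>Invariance of the induced functional and vanishing away from the units\<close>

context groupoid_completion begin

context fixes \<tau> :: "'a \<Rightarrow> complex" assumes \<tau>: "continuous_trace \<tau>" begin

text \<open>Conjugation by \<open>n\<close>, with adjoint written \<open>n'\<close>: over the
  carrier of \<open>k\<close> the section is a partial isometry, so \<open>k = k n n'\<close>,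
  \<open>k n = n k'\<close> and \<open>n' n k' = k'\<close>. Hence
  \<open>\<tau> k = \<tau> (n k' n') = \<tau> (n' n k') = \<tau> k'\<close>.\<close>

lemma restricted_functional_local_invariance:
  assumes V: "open_bisection G V"
    and e: "continuous_map (subtopology T V) (total L) e" "\<And>k. k \<in> V \<Longrightarrow> e k \<in> Fb k" "\<And>k. k \<in> V \<Longrightarrow> lnorm L (e k) = 1"
    and k: "k \<in> Cc X" "csupp X (r ` V) k"
  defines "k' \<equiv> \<lambda>x. if x \<in> s ` V then k (bisection_map G V x) else 0"
  shows "k' \<in> Cc X \<and> restricted_functional \<tau> k = restricted_functional \<tau> k'"
proof -
  note v = open_bisectionD[OF V]
  have k': "k' \<in> Cc X" "csupp X (s ` V) k'"
    unfolding k'_def Cc_iff using transport_csupp[OF V Cc_D(1)[OF k(1)] k(2)] csupp_mono[OF _ subset_UNIV] by blast+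
  obtain K where K: "compactin X K" "K \<subseteq> r ` V" "\<And>x. x \<notin> K \<Longrightarrow> k x = 0" using k(2) unfolding csupp_def by blast
  obtain \<theta> W where \<theta>: "\<theta> \<in> Cp X" "csupp X (r ` V) \<theta>" "K \<subseteq> W" "\<forall>x\<in>W. \<theta> x = 1"
    using units.bump[OF K(1) open_rng[OF v(1)] K(2)] by blast
  obtain n where n: "n \<in> Gamma_c_on G L V" "\<And>g. g\<in>V \<Longrightarrow> cmod (cf (n g)) = \<theta> (r g)"
    using ex_isometric_section[OF V e \<theta>(1,2)] by blast
  have nG: "n \<in> Gamma_c G L" using Gamma_c.base[OF V n(1)] .
  note ns = Gamma_c_sections[OF nG] and sG = sec_star_Gamma_c[OF nG]
  let ?P = "\<lambda>u. if u \<in> r ` V then complex_of_real ((cmod (cf (n (inv_into V r u))))\<^sup>2) else 0"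
  let ?Q = "\<lambda>u. if u \<in> s ` V then complex_of_real ((cmod (cf (n (inv_into V s u))))\<^sup>2) else 0"
  have kth: "k x * complex_of_real (\<theta> x) = k x" for x using K(3) \<theta>(3,4) by (cases "x \<in> K") auto
  have kP: "k x * ?P x = k x" for x
  proof (cases "x \<in> r ` V")
    case True
    then have "cmod (cf (n (inv_into V r x))) = \<theta> x" using n(2)[OF inv_into_into[OF True]] by (simp add: f_inv_into_f)
    then show ?thesis using True kth[of x] by auto
  next
    case False
    then have "x \<notin> K" using K(2) by blast
    then show ?thesis using K(3) by simp
  qed
  have kQ: "k' x * ?Q x = k' x" for x
  proof (cases "x \<in> s ` V")
    case True
    then obtain g where g: "g \<in> V" "x = s g" by blast
    have "inv_into V s x = g" using g v(3) by (simp add: inv_into_f_f)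
    then show ?thesis using True kth[of "r g"] n(2)[OF g(1)] bisection_map_src[OF V g(1)] g(2)
      by (auto simp: k'_def)
  qed (simp add: k'_def)
  have "lact k (conv G L n (sec_star G L n)) = emb k"
    unfolding conv_sec_star_right[OF V n(1)]
    using kP by (intro sections_eqI) (auto simp: lact_sections emb_sections cf_lact cf_emb rng_unit simp del: mult_cancel_left1 mult_cancel_left2)
  then have 1: "j k * (\<iota> n * \<iota> (sec_star G L n)) = j k"
    using j_lact[OF k(1) conv_Gamma_c[OF nG sG]] iota_conv[OF nG sG] by (simp add: j_def)
  have "ract k' (conv G L (sec_star G L n) n) = emb k'"
    unfolding conv_sec_star_left[OF V n(1)]
    using kQ by (intro sections_eqI) (auto simp: ract_sections emb_sections cf_ract cf_emb src_unit simp del: mult_cancel_left1 mult_cancel_left2)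
  then have 2: "(\<iota> (sec_star G L n) * \<iota> n) * j k' = j k'"
    using j_ract[OF k'(1) conv_Gamma_c[OF sG nG]] iota_conv[OF sG nG] by (simp add: j_def)
  have "lact k n = ract k' n"
  proof (rule sections_eqI)
    fix g assume g: "g \<in> arrows G"
    show "cf (lact k n g) = cf (ract k' n g)"
    proof (cases "g \<in> V")
      case True
      then show ?thesis using g bisection_map_src[OF V True] by (simp add: cf_lact cf_ract ns k'_def)
    next
      case False
      then have "n g = lzero L g" using Gamma_c_on_zero_outside[OF n(1)] g by blast
      then show ?thesis using g by (simp add: cf_lact cf_ract ns cf_lzero)
    qed
  qed (auto simp: lact_sections ract_sections ns)
  then have 3: "j k * \<iota> n = \<iota> n * j k'" using j_lact[OF k(1) nG] j_ract[OF k'(1) nG] by simp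
  have "\<tau> (j k) = \<tau> ((\<iota> n * j k') * \<iota> (sec_star G L n))"
    using 1 unfolding 3[symmetric] by (simp add: mult.assoc)
  also have "\<dots> = \<tau> (\<iota> (sec_star G L n) * (\<iota> n * j k'))"
    using iota_in_pedersen[OF nG] iota_in_pedersen[OF sG] pedersen_mult by (intro continuous_traceD(3)[OF \<tau>]) blast+
  also have "\<dots> = \<tau> (j k')" using 2 by (simp add: mult.assoc)
  finally show ?thesis using k'(1) by (simp add: restricted_functional_def)
qed

text \<open>A bisection is covered by open subsets carrying a continuous section of norm one, where
  the local statement applies; for functions carried in the ranges of such a subset, transport along
  it and along \<open>U\<close> agree.\<close>

lemma restricted_functional_invariant: "invariant_radon G (restricted_functional \<tau>)"
  unfolding invariant_radon_def
proof (intro allI impI ballI)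
  fix U f assume U: "open_bisection G U" and f: "f \<in> Cc (subtopology X (r ` U))"
  note u = open_bisectionD[OF U]
  let ?tr = "\<lambda>f x. if x \<in> s ` U then f (bisection_map G U x) else 0"
  obtain K where K: "compactin X K" "K \<subseteq> r ` U" "\<And>x. x \<notin> K \<Longrightarrow> f x = 0"
    using f unfolding Cc_iff csupp_def by (auto simp: compactin_subtopology)
  have "csupp X (r ` U) f" using K by (rule csuppI)
  then have fC: "f \<in> Cc X"
    using continuous_map_extend_zero[OF Hausdorff_unit_space open_rng[OF u(1)]] Cc_D(1)[OF f] csupp_mono
    unfolding Cc_iff by blast
  define \<W> where "\<W> = {r ` V | V. openin T V \<and> V \<subseteq> U \<and> (\<exists>e. continuous_map (subtopology T V) (total L) e \<and>
      (\<forall>k\<in>V. e k \<in> Fb k \<and> lnorm L (e k) = 1))}"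
  \<comment> \<open>Membership of the transported function in \<open>Cc X\<close> is part of the
    induction, because additivity of the functional is known only there.\<close>
  define P where "P k \<longleftrightarrow> ?tr k \<in> Cc X \<and> restricted_functional \<tau> k = restricted_functional \<tau> (?tr k)" for k
  have "P f"
  proof (rule units.Cc_local_induct[OF fC K(3) K(1)])
    show "K \<subseteq> \<Union>\<W>"
    proof
      fix x assume "x \<in> K"
      then obtain g where g: "g \<in> U" "x = r g" using K(2) by blast
      then have "g \<in> arrows G" using u by auto
      then obtain V e where V: "openin T V" "g \<in> V" "continuous_map (subtopology T V) (total L) e"
          "\<forall>k\<in>V. e k \<in> Fb k \<and> lnorm L (e k) = 1"
        using local_unit_section by blast
      have "continuous_map (subtopology T (V \<inter> U)) (total L) e"
        by (rule continuous_map_from_subtopology_mono[OF V(3)]) auto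
      then have "r ` (V \<inter> U) \<in> \<W>" using V u(1) unfolding \<W>_def by blast
      then show "x \<in> \<Union>\<W>" using g V(2) by blast
    qed
    show "openin X W" if "W \<in> \<W>" for W using that open_rng unfolding \<W>_def by blast
    show "P k" if W: "W \<in> \<W>" and k: "k \<in> Cc X" "csupp X W k" for W k
    proof -
      obtain V e where V: "W = r ` V" "openin T V" "V \<subseteq> U" "continuous_map (subtopology T V) (total L) e"
          "\<And>k. k\<in>V \<Longrightarrow> e k \<in> Fb k" "\<And>k. k\<in>V \<Longrightarrow> lnorm L (e k) = 1" using W unfolding \<W>_def by blast
      have VB: "open_bisection G V" by (rule open_bisection_subset[OF U V(2,3)])
      have z: "k x = 0" if "x \<notin> r ` V" for x using k(2) V(1) that unfolding csupp_def by blast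
      have "?tr k = (\<lambda>x. if x \<in> s ` V then k (bisection_map G V x) else 0)"
      proof
        fix x
        show "?tr k x = (if x \<in> s ` V then k (bisection_map G V x) else 0)"
        proof (cases "x \<in> s ` U")
          case True
          then obtain g where g: "g \<in> U" "x = s g" by blast
          show ?thesis
          proof (cases "g \<in> V")
            case True
            then show ?thesis using g bisection_map_src[OF U g(1)] bisection_map_src[OF VB True] by auto
          next
            case False
            then have "x \<notin> s ` V" "r g \<notin> r ` V" using g False inj_on_image_mem_iff[OF u(3) g(1) V(3)] inj_on_image_mem_iff[OF u(2) g(1) V(3)] by auto
            then show ?thesis using g bisection_map_src[OF U g(1)] z by simp
          qed
        qed (use V(3) in auto)
      qed
      then show ?thesis
        unfolding P_def using restricted_functional_local_invariance[OF VB V(4-6) k(1)] k(2) V(1) by simp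
    qed
    have t0: "?tr (\<lambda>x. 0) = (\<lambda>x. 0)" by auto
    show "P (\<lambda>x. 0)" unfolding P_def t0 by (auto simp: Cc_iff csupp_0)
    fix k l assume kl: "k \<in> Cc X" "l \<in> Cc X" "P k" "P l"
    have t: "?tr (\<lambda>x. k x + l x) = (\<lambda>x. ?tr k x + ?tr l x)" by auto
    show "P (\<lambda>x. k x + l x)"
      using kl restricted_functional_linear[OF \<tau>] Cc_add[of "?tr k" X "?tr l"]
      unfolding P_def t Cc_linear_def by simp
  qed
  then show "restricted_functional \<tau> f = restricted_functional \<tau> (?tr f)" by (simp add: P_def)
qed

text \<open>For a set \<open>Y\<close> of arrows whose ranges avoid its sources, a cutoff
  \<open>\<eta>\<close> carried in the ranges can be 1 on the carrier of \<open>k\<close> while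
  vanishing at the sources. So \<open>k f = \<eta> k f\<close>, the trace property turns this into
  \<open>k f \<eta>\<close>, and that section is zero.\<close>

lemma trace_off_diagonal:
  assumes prin: "Defs.principal G" and V: "open_bisection G V" "V \<inter> units G = {}" and f: "f \<in> Gamma_c_on G L V"
  shows "\<tau> (\<iota> f) = 0"
proof -
  note v = open_bisectionD[OF V(1)] and fs = Gamma_c_onD(1)[OF f]
  have fG: "f \<in> Gamma_c G L" using Gamma_c.base[OF V(1) f] .
  obtain K where K: "K \<subseteq> V" "compactin T K" "\<forall>g\<in>arrows G - K. f g = lzero L g" using Gamma_c_onD(3)[OF f] by blast
  have rK: "compactin X (r ` K)" using K(2) continuous_rng by (rule image_compactin)
  obtain \<theta> A where \<theta>: "\<theta> \<in> Cp X" "csupp X (r ` V) \<theta>" "r ` K \<subseteq> A" "\<forall>x\<in>A. \<theta> x = 1"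
    using units.bump[OF rK open_rng[OF v(1)]] K(1) by (metis image_mono)
  obtain D where D: "compactin X D" "D \<subseteq> r ` V" "\<And>x. x \<notin> D \<Longrightarrow> \<theta> x = 0" using \<theta>(2) unfolding csupp_def by blast
  let ?h = "\<lambda>x. complex_of_real (\<theta> x)"
  define \<W> where "\<W> = {r ` W | W. openin T W \<and> W \<subseteq> V \<and> r ` W \<inter> s ` W = {}}"
  note lG = lact_Gamma_c[OF Cc_D(1) fG]
  have zero: "\<tau> (\<iota> h) = 0" if h: "h \<in> Gamma_c G L" "\<And>g. g \<in> arrows G \<Longrightarrow> cf (h g) = 0" for h
  proof -
    have "h = sec_scale G L 0 h"
      using h by (intro sections_eqI) (auto simp: Gamma_c_sections sec_scale_sections cf_sec_scale)
    then have "\<iota> h = 0" using iota_scale[OF h(1), of 0] by (simp add: scaleC_0_left)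
    then show ?thesis using continuous_trace_0[OF \<tau>] pedersen_zero by simp
  qed
  have "\<tau> (\<iota> (lact ?h f)) = 0"
  proof (rule units.Cc_local_induct[where P = "\<lambda>h. \<tau> (\<iota> (lact h f)) = 0", OF Cc_of_real[OF \<theta>(1)] _ D(1)])
    show "complex_of_real (\<theta> x) = 0" if "x \<notin> D" for x using D(3)[OF that] by simp
    show "D \<subseteq> \<Union>\<W>"
    proof
      fix x assume "x \<in> D"
      then obtain g where g: "g \<in> V" "x = r g" using D(2) by blast
      then have gG: "g \<in> arrows G" using v by auto
      \<comment> \<open>An arrow of \<open>V\<close> is not a unit, so principality keeps its range
        and source apart, and the Hausdorff unit space provides disjoint neighbourhoods.\<close>
      have "r g \<noteq> s g" using principal_unitI[OF prin gG] V(2) g(1) by blast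
      moreover have "r g \<in> topspace X" "s g \<in> topspace X"
        using gG by (auto simp: topspace_unit_space rng_in_units src_in_units)
      ultimately obtain A B where AB: "openin X A" "openin X B" "r g \<in> A" "s g \<in> B" "A \<inter> B = {}"
        using Hausdorff_unit_space unfolding Hausdorff_space_def disjnt_def by meson
      let ?W = "V \<inter> ({g \<in> topspace T. r g \<in> A} \<inter> {g \<in> topspace T. s g \<in> B})"
      have "openin T ?W"
        using v(1) openin_continuous_map_preimage[OF continuous_rng AB(1)] openin_continuous_map_preimage[OF continuous_src AB(2)]
        by (intro openin_Int)
      moreover have "r ` ?W \<inter> s ` ?W = {}" using AB(5) by auto
      ultimately have "r ` ?W \<in> \<W>" unfolding \<W>_def by blast
      moreover have "x \<in> r ` ?W" using g gG AB by auto
      ultimately show "x \<in> \<Union>\<W>" by blast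
    qed
    show "openin X W" if "W \<in> \<W>" for W using that open_rng unfolding \<W>_def by blast
    show "\<tau> (\<iota> (lact k f)) = 0" if W: "W \<in> \<W>" and k: "k \<in> Cc X" "csupp X W k" for W k
    proof -
      obtain Y where Y: "W = r ` Y" "openin T Y" "Y \<subseteq> V" "r ` Y \<inter> s ` Y = {}" using W unfolding \<W>_def by blast
      obtain C where C: "compactin X C" "C \<subseteq> r ` Y" "\<And>x. x \<notin> C \<Longrightarrow> k x = 0" using k(2) Y(1) unfolding csupp_def by blast
      obtain \<eta> B where \<eta>: "\<eta> \<in> Cp X" "csupp X (r ` Y) \<eta>" "C \<subseteq> B" "\<forall>x\<in>B. \<eta> x = 1"
        using units.bump[OF C(1) open_rng[OF Y(2)] C(2)] by blast
      let ?e = "\<lambda>x. complex_of_real (\<eta> x)"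
      have e: "?e \<in> Cc X" by (rule Cc_of_real[OF \<eta>(1)])
      note kf = lG[OF k(1)]
      have "lact ?e (lact k f) = lact k f"
      proof (rule sections_eqI)
        fix g assume "g \<in> arrows G"
        then show "cf (lact ?e (lact k f) g) = cf (lact k f g)"
          using C(3)[of "r g"] \<eta>(3,4) by (cases "r g \<in> C") (auto simp: cf_lact lact_sections fs)
      qed (auto simp: lact_sections fs)
      then have "\<tau> (\<iota> (lact k f)) = \<tau> (j ?e * \<iota> (lact k f))" using j_lact[OF e kf] by simp
      also have "\<dots> = \<tau> (\<iota> (lact k f) * j ?e)"
        by (rule continuous_traceD(3)[OF \<tau> j_in_pedersen[OF e] iota_in_pedersen[OF kf]])
      also have "\<dots> = \<tau> (\<iota> (ract ?e (lact k f)))" using j_ract[OF e kf] by simp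
      also have "\<dots> = 0"
      proof (rule zero[OF ract_Gamma_c[OF kf e]])
        fix g assume g: "g \<in> arrows G"
        show "cf (ract ?e (lact k f) g) = 0"
        proof (cases "g \<in> V \<and> r g \<in> C")
          case True
          then obtain y where "y \<in> Y" "r y = r g" using C(2) by (metis (no_types, lifting) imageE subsetD)
          then have "g \<in> Y" using True Y(3) inj_onD[OF v(2)] by blast
          then have "s g \<notin> r ` Y" using Y(4) by blast
          then have "\<eta> (s g) = 0" using \<eta>(2) unfolding csupp_def by blast
          then show ?thesis using g by (simp add: cf_ract cf_lact lact_sections fs)
        next
          case False
          then have "k (r g) = 0 \<or> f g = lzero L g" using C(3) Gamma_c_on_zero_outside[OF f] g by blast
          then show ?thesis using g by (auto simp: cf_ract cf_lact lact_sections fs cf_lzero)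
        qed
      qed
      finally show ?thesis .
    qed
    show "\<tau> (\<iota> (lact (\<lambda>x. 0) f)) = 0"
      by (rule zero[OF lG]) (auto simp: Cc_iff csupp_0 cf_lact fs)
    fix k l assume kl: "k \<in> Cc X" "l \<in> Cc X" "\<tau> (\<iota> (lact k f)) = 0" "\<tau> (\<iota> (lact l f)) = 0"
    have "lact (\<lambda>x. k x + l x) f = sec_add G L (lact k f) (lact l f)"
      by (intro sections_eqI) (auto simp: fs lact_sections sec_add_sections cf_lact cf_sec_add distrib_right)
    then show "\<tau> (\<iota> (lact (\<lambda>x. k x + l x) f)) = 0"
      using kl continuous_traceD(1)[OF \<tau> iota_in_pedersen[OF lG[OF kl(1)]] iota_in_pedersen[OF lG[OF kl(2)]]]
      by (simp add: iota_add lG)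
  qed
  moreover have "lact ?h f = f"
  proof (rule sections_eqI)
    fix g assume g: "g \<in> arrows G"
    show "cf (lact ?h f g) = cf (f g)"
    proof (cases "g \<in> K")
      case True
      then have "\<theta> (r g) = 1" using \<theta>(3,4) by blast
      then show ?thesis using g by (simp add: cf_lact fs)
    next
      case False
      then have "f g = lzero L g" using K(3) g by blast
      then show ?thesis using g by (simp add: cf_lact fs cf_lzero)
    qed
  qed (auto simp: lact_sections fs)
  ultimately show ?thesis by simp
qed

text \<open>The units are closed and open, so \<open>f\<close> splits into its restriction and a
  section on \<open>U\<close> minus the units: closedness gives the restriction a compact carrier
  and makes the second domain open, openness gives the second part a compact carrier.\<close>

lemma trace_eq_restricted_functional:
  assumes prin: "Defs.principal G" and U: "open_bisection G U" and f: "f \<in> Gamma_c_on G L U"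
  shows "restrict_units G L f \<in> Cc X" "\<tau> (\<iota> f) = restricted_functional \<tau> (restrict_units G L f)"
proof -
  note u = open_bisectionD[OF U] and fs = Gamma_c_onD(1)[OF f]
  note clos = principal_closed_units[OF prin]
  have fG: "f \<in> Gamma_c G L" using Gamma_c.base[OF U f] .
  obtain K where K: "K \<subseteq> U" "compactin T K" "\<forall>g\<in>arrows G - K. f g = lzero L g" using Gamma_c_onD(3)[OF f] by blast
  let ?h = "restrict_units G L f"
  have "compactin T (units G \<inter> K)" by (rule closed_Int_compactin[OF clos K(2)])
  then have cK: "compactin X (units G \<inter> K)" by (simp add: compactin_unit_space)
  have "?h x = 0" if "x \<notin> units G \<inter> K" for x
    using that K(3) units_arrows by (auto simp: restrict_units_eq_cf[OF fs] cf_lzero subset_iff)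
  then have s: "csupp X (U \<inter> units G) ?h" using cK K(1) by (intro csuppI[of X "units G \<inter> K"]) auto
  have p: "compact_piece X (U \<inter> units G) ?h" by (rule restrict_units_piece[OF U f])
  have "continuous_map X euclidean ?h"
    using p s Hausdorff_unit_space unfolding compact_piece_def by (intro continuous_map_extend_zero[of X "U \<inter> units G"]) auto
  then show h: "?h \<in> Cc X" unfolding Cc_iff using csupp_mono[OF s] by blast
  define f1 where "f1 = (\<lambda>g\<in>arrows G. if g \<in> units G then lzero L g else f g)"
  let ?V = "U - units G"
  have V: "open_bisection G ?V" "?V \<inter> units G = {}"
    using open_bisection_subset[OF U openin_diff[OF u(1) clos]] by auto
  have "f1 \<in> Gamma_c_on G L ?V"
    unfolding Gamma_c_on_def
  proof (intro CollectI conjI)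
    show "f1 \<in> sections G L" unfolding f1_def by (rule sections_restrict) (auto simp: lzero_fibre sectionsD[OF fs])
    have "continuous_map (subtopology T ?V) (total L) f"
      by (rule continuous_map_from_subtopology_mono[OF Gamma_c_onD(2)[OF f]]) auto
    then show "continuous_map (subtopology T ?V) (total L) f1"
      by (rule continuous_map_extensional) (simp add: f1_def)
    have "closedin T (topspace T - units G)" using open_units by blast
    then have "compactin T ((topspace T - units G) \<inter> K)" using K(2) by (rule closed_Int_compactin)
    moreover have "f1 g = lzero L g" if "g \<in> arrows G - (topspace T - units G) \<inter> K" for g
      using that K(3) by (auto simp: f1_def)
    ultimately show "\<exists>K\<subseteq>?V. compactin T K \<and> (\<forall>g\<in>arrows G - K. f1 g = lzero L g)"
      using K(1) by (intro exI[of _ "(topspace T - units G) \<inter> K"]) auto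
  qed
  note f1 = this
  have f1G: "f1 \<in> Gamma_c G L" using Gamma_c.base[OF V(1) f1] .
  have "f = sec_add G L (emb ?h) f1"
  proof (rule sections_eqI)
    fix g assume g: "g \<in> arrows G"
    have "cf (sec_add G L (emb ?h) f1 g) = cf (emb ?h g) + cf (f1 g)"
      by (rule cf_sec_add[OF emb_sections Gamma_c_sections[OF f1G] g])
    then show "cf (f g) = cf (sec_add G L (emb ?h) f1 g)"
      using g by (simp add: cf_emb f1_def cf_lzero restrict_units_eq_cf[OF fs])
  qed (auto simp: fs sec_add_sections emb_sections Gamma_c_sections f1G)
  then have "\<iota> f = j ?h + \<iota> f1" using iota_add[OF emb_Gamma_c[OF h] f1G] by (simp add: j_def)
  then show "\<tau> (\<iota> f) = restricted_functional \<tau> ?h"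
    using continuous_traceD(1)[OF \<tau> j_in_pedersen[OF h] iota_in_pedersen[OF f1G]] trace_off_diagonal[OF prin V f1]
    by (simp add: restricted_functional_def)
qed

text \<open>The formula is known for sections on a single bisection; expressing it through
  \<open>tr\<close> for one fixed pair of measures lets linearity carry it to all of
  \<open>Gamma_c\<close>.\<close>

lemma principal_trace_induced:
  assumes prin: "Defs.principal G" and real: "real_radon X (restricted_functional \<tau>)"
  shows "trace_induced_by G L \<iota> (restricted_functional \<tau>) \<tau>"
proof -
  obtain M N where M: "radon_borel_measure X M" and N: "radon_borel_measure X N"
      and eq: "\<And>h. h \<in> Cc X \<Longrightarrow> restricted_functional \<tau> h = (\<integral>x. h x \<partial>M) - (\<integral>x. h x \<partial>N)"
    using units.real_radon_representation[OF real] by blast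
  have "\<tau> (\<iota> f) = tr M N f" if "f \<in> Gamma_c G L" for f
    using that
  proof (induction rule: Gamma_c.induct)
    case (base U f)
    then show ?case
      using trace_eq_restricted_functional[OF prin base] eq by (simp add: tr_def)
  next
    case (add f h)
    then show ?case
      using continuous_traceD(1)[OF \<tau> iota_in_pedersen iota_in_pedersen] by (simp add: iota_add tr_add[OF M N])
  next
    case (scale f c)
    then show ?case
      using continuous_traceD(2)[OF \<tau> iota_in_pedersen] by (simp add: iota_scale tr_scale[OF M N])
  qed
  then show ?thesis using trace_induced_by_iff[OF M N eq] by blast
qed

end

end

section \<open>The main theorem\<close>

theorem corollary7p5:
  fixes G :: "'g groupoid"
    and L :: "('g, 'l) fell_bundle"
    and \<pi> :: "('g \<Rightarrow> 'l) \<Rightarrow> 'h::complex_hilbert \<Rightarrow> 'h"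
    and \<iota> :: "('g \<Rightarrow> 'l) \<Rightarrow> 'a::cstar_algebra"
  assumes "twisted_etale_groupoid G L"
    and "star_representation G L \<pi>"
    and "weakly_contains_regular G L \<pi>"
    and "cstar_completion G L \<pi> \<iota>"
  shows "\<iota> ` Gamma_c G L \<subseteq> pedersen_ideal
    \<and> (\<forall>\<mu>. real_radon (unit_space G) \<mu> \<and> invariant_radon G \<mu> \<longrightarrow>
         (\<exists>\<tau>. continuous_trace \<tau> \<and> selfadjoint_on_pedersen \<tau> \<and> trace_induced_by G L \<iota> \<mu> \<tau> \<and>
            (\<forall>\<tau>'. continuous_trace \<tau>' \<and> trace_induced_by G L \<iota> \<mu> \<tau>' \<longrightarrow>
               (\<forall>x\<in>pedersen_ideal. \<tau>' x = \<tau> x))))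
    \<and> (\<forall>\<mu>. positive_radon (unit_space G) \<mu> \<and> invariant_radon G \<mu> \<longrightarrow>
         (\<exists>\<tau>. continuous_trace \<tau> \<and> positive_on_pedersen \<tau> \<and> trace_induced_by G L \<iota> \<mu> \<tau> \<and>
            (\<forall>\<tau>'. continuous_trace \<tau>' \<and> trace_induced_by G L \<iota> \<mu> \<tau>' \<longrightarrow>
               (\<forall>x\<in>pedersen_ideal. \<tau>' x = \<tau> x))))
    \<and> (principal G \<longrightarrow>
         (\<forall>\<tau>. continuous_trace \<tau> \<and> selfadjoint_on_pedersen \<tau> \<longrightarrow>
            (\<exists>\<mu>. real_radon (unit_space G) \<mu> \<and> invariant_radon G \<mu> \<and> trace_induced_by G L \<iota> \<mu> \<tau>)) \<and>
         (\<forall>\<tau>. continuous_trace \<tau> \<and> positive_on_pedersen \<tau> \<longrightarrow>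
            (\<exists>\<mu>. positive_radon (unit_space G) \<mu> \<and> invariant_radon G \<mu> \<and> trace_induced_by G L \<iota> \<mu> \<tau>)))"
proof -
  interpret groupoid_completion G L \<pi> \<iota>
    using assms by (intro groupoid_completion.intro groupoid_completion_axioms.intro)
  show ?thesis
  proof (intro conjI impI allI)
    show "\<iota> ` Gamma_c G L \<subseteq> pedersen_ideal" using iota_in_pedersen by blast
  next
    fix \<mu> assume "real_radon (unit_space G) \<mu> \<and> invariant_radon G \<mu>"
    then show "\<exists>\<tau>. continuous_trace \<tau> \<and> selfadjoint_on_pedersen \<tau> \<and> trace_induced_by G L \<iota> \<mu> \<tau> \<and>
        (\<forall>\<tau>'. continuous_trace \<tau>' \<and> trace_induced_by G L \<iota> \<mu> \<tau>' \<longrightarrow> (\<forall>x\<in>pedersen_ideal. \<tau>' x = \<tau> x))"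
      using real_trace_exists_unique by blast
  next
    fix \<mu> assume "positive_radon (unit_space G) \<mu> \<and> invariant_radon G \<mu>"
    then show "\<exists>\<tau>. continuous_trace \<tau> \<and> positive_on_pedersen \<tau> \<and> trace_induced_by G L \<iota> \<mu> \<tau> \<and>
        (\<forall>\<tau>'. continuous_trace \<tau>' \<and> trace_induced_by G L \<iota> \<mu> \<tau>' \<longrightarrow> (\<forall>x\<in>pedersen_ideal. \<tau>' x = \<tau> x))"
      using positive_trace_exists_unique by blast
  next
    fix \<tau> :: "'a \<Rightarrow> complex" assume prin: "principal G" and \<tau>: "continuous_trace \<tau> \<and> selfadjoint_on_pedersen \<tau>"
    then have t: "continuous_trace \<tau>" and real: "real_radon (unit_space G) (restricted_functional \<tau>)"
      using restricted_functional_real by auto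
    show "\<exists>\<mu>. real_radon (unit_space G) \<mu> \<and> invariant_radon G \<mu> \<and> trace_induced_by G L \<iota> \<mu> \<tau>"
      using real restricted_functional_invariant[OF t] principal_trace_induced[OF t prin real] by blast
  next
    fix \<tau> :: "'a \<Rightarrow> complex" assume prin: "principal G" and \<tau>: "continuous_trace \<tau> \<and> positive_on_pedersen \<tau>"
    then have t: "continuous_trace \<tau>" and pos: "positive_radon (unit_space G) (restricted_functional \<tau>)"
      using restricted_functional_positive_radon by auto
    then have real: "real_radon (unit_space G) (restricted_functional \<tau>)" by (simp add: positive_radon_def)
    show "\<exists>\<mu>. positive_radon (unit_space G) \<mu> \<and> invariant_radon G \<mu> \<and> trace_induced_by G L \<iota> \<mu> \<tau>"
      using pos restricted_functional_invariant[OF t] principal_trace_induced[OF t prin real] by blast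
  qed
qed

end
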